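(* Let $M$ be a compact locally projectively flat manifold of dimension $n$ without boundary. The following statements are equivalent: (1) $M$ admits an oriented tautological bundle $\tau$, and there is a negative section $u$ of the dual bundle $\tau^*$ whose Hessian matrix $(u_{ij})$ is positive definite, the derivatives being taken with respect to some inhomogeneous $\mathbb{RP}^n$ coordinates near each point. (2) $M$ is projectively equivalent to $\Omega/\Gamma$, where $\Omega$ is a convex domain that is bounded (relatively compact) in an affine $\mathbb{R}^n\subset\mathbb{RP}^n$, and $\Gamma\subset\mathbf{PGL}(n+1,\mathbb{R})$ acts discretely and properly discontinuously on $\Omega$.
   Context: A locally projectively flat manifold is a manifold with an atlas of charts in $\mathbb{RP}^n$ whose transition maps are restrictions of elements of $\mathbf{PGL}(n+1,\mathbb{R})$, i.e. an $(\mathbb{RP}^n,\mathbf{PGL}(n+1,\mathbb{R}))$-structure. Two such manifolds are projectively equivalent if there is a diffeomorphism between them that is an isomorphism of these structures. Tautological bundle. Let $\mathbf{SL}^{\pm}(n+1)$ be the group of real $(n+1)\times(n+1)$ matrices of determinant $\pm1$. $M$ admits a tautological bundle if the transition maps of $M$ can be lifted consistently from $\mathbf{PGL}(n+1,\mathbb{R})$ to $\mathbf{SL}^{\pm}(n+1)$. The lifted maps then patch together restrictions of the tautological line bundle of $\mathbb{RP}^n$ to give a real line bundle $\tau\to M$, called a tautological bundle of $M$. "Oriented" means that $\tau$ is oriented as a line bundle. Admitting an oriented $\tau$ is equivalent to lifting the structure of $M$ to an $(\mathbb{S}^n,\mathbf{GL}(n+1,\mathbb{R})/\mathbb{R}^+)$-structure,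 where $\mathbb{S}^n=(\mathbb{R}^{n+1}\setminus 0)/\mathbb{R}^+$. Local description of sections. In inhomogeneous projective coordinates $t=(t^1,\dots,t^n)$, identified with $(t^1,\dots,t^n,1)\in\mathbb{R}^{n+1}$, a section of $\tau$ is represented by a function $s(t)$, corresponding to the point $s(t)(t^1,\dots,t^n,1)\in\mathbb{R}^{n+1}$ (a radial graph). Under a change of coordinates induced by $A\in\mathbf{SL}^{\pm}(n+1)$, $s$ becomes the function $\tilde s$ with $A\big(s(t)(t,1)\big)=\tilde s(\tilde t)(\tilde t,1)$. The local frame of $\tau$ given by $(t,1)$ is taken to be positively oriented. A section $u$ of $\tau^*$ is represented by a function $u(t)$ in the dual frame, so $1/u$ transforms as a section of $\tau$; $u$ is negative if its pairing with positive elements of $\tau$ is negative. Sections are smooth. $u_{ij}=\partial^2u/\partial t^i\partial t^j$. The expression $-\frac1u u_{ij}\,dt^i dt^j$ transforms as a symmetric $(0,2)$ tensor under projective coordinate changes, so positive definiteness of $(u_{ij})$ does not depend on the coordinates chosen.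
   Formalization: M is assumed connected and nonempty: two disjoint copies of a compact Ω/Γ satisfy (1) but not (2), as Ω/Γ is connected. The dimension n is at least 1, and the action of Γ on Ω is taken to be free, as is needed for Ω/Γ to be a manifold. *)

theory Defs
  imports "HOL-Analysis.Analysis"
begin

section \<open>Quotient topologies\<close>

definition quotient_topology :: "'a topology \<Rightarrow> ('a \<Rightarrow> 'b) \<Rightarrow> 'b topology" where
  "quotient_topology X f =
     topology (\<lambda>U. U \<subseteq> f ` topspace X \<and> openin X {x \<in> topspace X. f x \<in> U})"

lemma openin_quotient_topology:
  "openin (quotient_topology X f) U \<longleftrightarrow>
     U \<subseteq> f ` topspace X \<and> openin X {x \<in> topspace X. f x \<in> U}"
proof -
  have "istopology (\<lambda>U. U \<subseteq> f ` topspace X \<and> openin X {x \<in> topspace X. f x \<in> U})"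
    unfolding istopology_def
  proof (intro conjI allI impI)
    fix S T
    assume *: "S \<subseteq> f ` topspace X \<and> openin X {x \<in> topspace X. f x \<in> S}"
      "T \<subseteq> f ` topspace X \<and> openin X {x \<in> topspace X. f x \<in> T}"
    have "{x \<in> topspace X. f x \<in> S \<inter> T} =
        {x \<in> topspace X. f x \<in> S} \<inter> {x \<in> topspace X. f x \<in> T}" by auto
    with * show "openin X {x \<in> topspace X. f x \<in> S \<inter> T}" by auto
    from * show "S \<inter> T \<subseteq> f ` topspace X" by auto
  next
    fix K
    assume *: "\<forall>S\<in>K. S \<subseteq> f ` topspace X \<and> openin X {x \<in> topspace X. f x \<in> S}"
    have "{x \<in> topspace X. f x \<in> \<Union>K} = (\<Union>S\<in>K. {x \<in> topspace X. f x \<in> S})" by auto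
    with * show "openin X {x \<in> topspace X. f x \<in> \<Union>K}" by auto
    from * show "\<Union>K \<subseteq> f ` topspace X" by auto
  qed
  then show ?thesis
    by (simp add: quotient_topology_def)
qed


section \<open>Real projective space and its projective group\<close>

text \<open>
  For a finite type \<open>'n\<close> of cardinality \<open>n\<close>, the space \<open>\<real>\<close> to the power \<open>n + 1\<close> is
  \<open>real ^ 'n option\<close>; the index \<open>None\<close> is the last homogeneous coordinate.
  Points of projective space are the lines through the origin.
\<close>

typedef (overloaded) ('n::finite) rp =
  "{L :: (real ^ 'n option) set. subspace L \<and> dim L = 1}"
  morphisms line_of Abs_rp
proof -
  have "axis None (1::real) \<noteq> (0 :: real ^ 'n option)"
    by (simp add: axis_eq_0_iff)
  then have "dim (span {axis None (1::real) :: real ^ 'n option}) = 1"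
    by (simp add: dim_span)
  then show ?thesis
    using subspace_span by blast
qed

definition proj_pt :: "real ^ 'n option \<Rightarrow> 'n::finite rp" where
  "proj_pt v = Abs_rp (span {v})"

instantiation rp :: (finite) topological_space
begin

definition open_rp :: "'a rp set \<Rightarrow> bool" where
  "open_rp U \<longleftrightarrow> open {v. v \<noteq> 0 \<and> proj_pt v \<in> U}"

instance
proof
  have "{v :: real ^ 'a option. v \<noteq> 0 \<and> proj_pt v \<in> UNIV} = - {0}" by auto
  then show "open (UNIV :: 'a rp set)"
    by (simp add: open_rp_def open_Compl)
next
  fix S T :: "'a rp set"
  assume "open S" "open T"
  moreover have "{v. v \<noteq> 0 \<and> proj_pt v \<in> S \<inter> T} =
      {v. v \<noteq> 0 \<and> proj_pt v \<in> S} \<inter> {v. v \<noteq> 0 \<and> proj_pt v \<in> T}" by auto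
  ultimately show "open (S \<inter> T)"
    by (simp add: open_rp_def open_Int)
next
  fix K :: "'a rp set set"
  assume "\<forall>S\<in>K. open S"
  moreover have "{v. v \<noteq> 0 \<and> proj_pt v \<in> \<Union>K} = (\<Union>S\<in>K. {v. v \<noteq> 0 \<and> proj_pt v \<in> S})" by auto
  ultimately show "open (\<Union>K)"
    by (simp add: open_rp_def open_UN)
qed

end

definition proj_map :: "real ^ 'n option ^ 'n option \<Rightarrow> 'n::finite rp \<Rightarrow> 'n rp" where
  "proj_map A p = Abs_rp ((\<lambda>v. A *v v) ` line_of p)"

text \<open>
  The projective linear group is represented by its (faithful) action on projective space, and
  carries the quotient topology of the general linear group.
\<close>

definition PGL :: "('n::finite rp \<Rightarrow> 'n rp) set" where
  "PGL = proj_map ` {A. det A \<noteq> 0}"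

definition PGL_topology :: "('n::finite rp \<Rightarrow> 'n rp) topology" where
  "PGL_topology = quotient_topology (top_of_set {A. det A \<noteq> 0}) proj_map"

definition SLpm :: "(real ^ 'm ^ 'm::finite) set" where
  "SLpm = {A. det A = 1 \<or> det A = -1}"

definition hom_vec :: "real ^ 'n \<Rightarrow> real ^ 'n::finite option" where
  "hom_vec t = (\<chi> k. case k of Some i \<Rightarrow> t $ i | None \<Rightarrow> 1)"

text \<open>
  The inhomogeneous coordinate system attached to \<open>B\<close>, as a parametrisation of an affine part
  of projective space.
\<close>

definition affine_pt :: "real ^ 'n option ^ 'n option \<Rightarrow> real ^ 'n \<Rightarrow> 'n::finite rp" where
  "affine_pt B t = proj_pt (B *v hom_vec t)"


section \<open>Locally projectively flat manifolds\<close>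

type_synonym ('a, 'n) chart = "'a set \<times> ('a \<Rightarrow> 'n rp)"
type_synonym ('a, 'n) atlas = "('a, 'n) chart set"

definition proj_chart :: "'a topology \<Rightarrow> ('a, 'n::finite) chart \<Rightarrow> bool" where
  "proj_chart M c \<longleftrightarrow>
     openin M (fst c) \<and> open (snd c ` fst c) \<and>
     homeomorphic_map (subtopology M (fst c)) (top_of_set (snd c ` fst c)) (snd c)"

text \<open>The projective map may vary between the components of an overlap.\<close>

definition proj_compatible ::
  "'a topology \<Rightarrow> ('a, 'n::finite) chart \<Rightarrow> ('a, 'n) chart \<Rightarrow> bool" where
  "proj_compatible M c c' \<longleftrightarrow>
     (\<forall>p \<in> fst c \<inter> fst c'. \<exists>\<gamma> \<in> PGL. \<exists>W. openin M W \<and> p \<in> W \<and> W \<subseteq> fst c \<inter> fst c' \<and>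
        (\<forall>q\<in>W. snd c' q = \<gamma> (snd c q)))"

definition proj_flat_manifold :: "'a topology \<Rightarrow> ('a, 'n::finite) atlas \<Rightarrow> bool" where
  "proj_flat_manifold M \<A> \<longleftrightarrow>
     Hausdorff_space M \<and> second_countable M \<and>
     (\<forall>c\<in>\<A>. proj_chart M c) \<and>
     topspace M = (\<Union>c\<in>\<A>. fst c) \<and>
     (\<forall>c\<in>\<A>. \<forall>c'\<in>\<A>. proj_compatible M c c')"

definition same_structure ::
  "'a topology \<Rightarrow> ('a, 'n::finite) atlas \<Rightarrow> ('a, 'n) atlas \<Rightarrow> bool" where
  "same_structure M \<A> \<B> \<longleftrightarrow>
     proj_flat_manifold M \<A> \<and> proj_flat_manifold M \<B> \<and>
     (\<forall>c\<in>\<A>. \<forall>c'\<in>\<B>. proj_compatible M c c')"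

text \<open>
  Isomorphism of structures. A homeomorphism that is locally projective in charts is
  automatically a diffeomorphism.
\<close>

definition proj_equivalent ::
  "'a topology \<Rightarrow> ('a, 'n::finite) atlas \<Rightarrow> 'b topology \<Rightarrow> ('b, 'n) atlas \<Rightarrow> bool" where
  "proj_equivalent M \<A> N \<B> \<longleftrightarrow>
     (\<exists>f. homeomorphic_map M N f \<and>
        (\<forall>c\<in>\<A>. \<forall>d\<in>\<B>. \<forall>p \<in> fst c. f p \<in> fst d \<longrightarrow>
           (\<exists>\<gamma> \<in> PGL. \<exists>W. openin M W \<and> p \<in> W \<and> W \<subseteq> fst c \<and> f ` W \<subseteq> fst d \<and>
              (\<forall>q\<in>W. snd d (f q) = \<gamma> (snd c q)))))"


section \<open>Tautological bundles\<close>

text \<open>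
  A lift to \<open>SLpm\<close> of the transition maps of an atlas: \<open>g c c' p\<close> lifts the germ at \<open>p\<close> of the
  transition map from \<open>c\<close> to \<open>c'\<close>, is locally constant in \<open>p\<close>, and satisfies the cocycle condition.
\<close>

type_synonym ('a, 'n) lift =
  "('a, 'n) chart \<Rightarrow> ('a, 'n) chart \<Rightarrow> 'a \<Rightarrow> real ^ 'n option ^ 'n option"

definition transition_lift ::
  "'a topology \<Rightarrow> ('a, 'n::finite) atlas \<Rightarrow> ('a, 'n) lift \<Rightarrow> bool" where
  "transition_lift M \<B> g \<longleftrightarrow>
     (\<forall>c\<in>\<B>. \<forall>c'\<in>\<B>. \<forall>p \<in> fst c \<inter> fst c'.
        g c c' p \<in> SLpm \<and>
        (\<exists>W. openin M W \<and> p \<in> W \<and> W \<subseteq> fst c \<inter> fst c' \<and>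
           (\<forall>q\<in>W. g c c' q = g c c' p \<and> snd c' q = proj_map (g c c' p) (snd c q)))) \<and>
     (\<forall>c\<in>\<B>. \<forall>c'\<in>\<B>. \<forall>c''\<in>\<B>. \<forall>p \<in> fst c \<inter> fst c' \<inter> fst c''.
        g c' c'' p ** g c c' p = g c c'' p)"

text \<open>
  The fibre at \<open>p\<close> of the bundle glued from the pulled back tautological bundles: an element
  assigns to every chart around \<open>p\<close> a vector on the line \<open>snd c p\<close>, compatibly with the lifted
  transition maps. The value 0 at the other charts is only a normalisation.
\<close>

type_synonym ('a, 'n) taut_vec = "('a, 'n) chart \<Rightarrow> real ^ 'n option"

definition taut_fibre ::
  "('a, 'n::finite) atlas \<Rightarrow> ('a, 'n) lift \<Rightarrow> 'a \<Rightarrow> ('a, 'n) taut_vec set" where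
  "taut_fibre \<B> g p =
     {w. (\<forall>c\<in>\<B>. p \<in> fst c \<longrightarrow> w c \<in> line_of (snd c p)) \<and>
         (\<forall>c\<in>\<B>. \<forall>c'\<in>\<B>. p \<in> fst c \<inter> fst c' \<longrightarrow> w c' = g c c' p *v w c) \<and>
         (\<forall>c. c \<notin> \<B> \<or> p \<notin> fst c \<longrightarrow> w c = 0)}"

text \<open>
  An orientation: a continuous choice of an open half-line \<open>P p\<close> of positive vectors in every
  fibre.
\<close>

definition taut_orientation ::
  "'a topology \<Rightarrow> ('a, 'n::finite) atlas \<Rightarrow> ('a, 'n) lift \<Rightarrow> ('a \<Rightarrow> ('a, 'n) taut_vec set) \<Rightarrow> bool"
  where
  "taut_orientation M \<B> g P \<longleftrightarrow>
     (\<forall>p \<in> topspace M.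
        (\<exists>w \<in> taut_fibre \<B> g p. w \<noteq> (\<lambda>c. 0) \<and> P p = {(\<lambda>c. r *\<^sub>R w c) |r. r > 0}) \<and>
        (\<exists>W \<sigma>. openin M W \<and> p \<in> W \<and> (\<forall>q\<in>W. \<sigma> q \<in> P q) \<and>
           (\<forall>c\<in>\<B>. continuous_map (subtopology M (W \<inter> fst c)) euclidean (\<lambda>q. \<sigma> q c))))"

text \<open>The element of the fibre at \<open>p\<close> whose component in the chart \<open>c\<close> is \<open>x\<close>.\<close>

definition taut_elem ::
  "('a, 'n::finite) atlas \<Rightarrow> ('a, 'n) lift \<Rightarrow> 'a \<Rightarrow> ('a, 'n) chart \<Rightarrow> real ^ 'n option
     \<Rightarrow> ('a, 'n) taut_vec" where
  "taut_elem \<B> g p c x = (\<lambda>c'. if c' \<in> \<B> \<and> p \<in> fst c' then g c c' p *v x else 0)"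

text \<open>
  Inhomogeneous coordinates on the domain of a chart \<open>c\<close>, obtained from \<open>c\<close> by the change of
  homogeneous coordinates \<open>B \<in> SLpm\<close>: the parameter domain, the point with coordinates \<open>t\<close>, and the
  frame \<open>(t, 1)\<close> of the tautological bundle at that point.
\<close>

definition coord_dom ::
  "('a, 'n::finite) chart \<Rightarrow> real ^ 'n option ^ 'n option \<Rightarrow> (real ^ 'n) set" where
  "coord_dom c B = {t. affine_pt B t \<in> snd c ` fst c}"

definition coord_pt ::
  "('a, 'n::finite) chart \<Rightarrow> real ^ 'n option ^ 'n option \<Rightarrow> real ^ 'n \<Rightarrow> 'a" where
  "coord_pt c B t = inv_into (fst c) (snd c) (affine_pt B t)"

definition coord_frame ::
  "('a, 'n::finite) atlas \<Rightarrow> ('a, 'n) lift \<Rightarrow> ('a, 'n) chart \<Rightarrow> real ^ 'n option ^ 'n option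
     \<Rightarrow> real ^ 'n \<Rightarrow> ('a, 'n) taut_vec" where
  "coord_frame \<B> g c B t = taut_elem \<B> g (coord_pt c B t) c (B *v hom_vec t)"


section \<open>Sections of the dual bundle\<close>

definition partial :: "'n \<Rightarrow> (real ^ 'n \<Rightarrow> real) \<Rightarrow> real ^ 'n::finite \<Rightarrow> real" where
  "partial i f t = frechet_derivative f (at t) (axis i 1)"

primrec Ck_on :: "nat \<Rightarrow> (real ^ 'n::finite) set \<Rightarrow> (real ^ 'n \<Rightarrow> real) \<Rightarrow> bool" where
  "Ck_on 0 S f \<longleftrightarrow> continuous_on S f"
| "Ck_on (Suc k) S f \<longleftrightarrow> (\<forall>t\<in>S. f differentiable (at t)) \<and> (\<forall>i. Ck_on k S (partial i f))"

text \<open>Meant for open sets \<open>S\<close> only.\<close>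

definition smooth_on :: "(real ^ 'n::finite) set \<Rightarrow> (real ^ 'n \<Rightarrow> real) \<Rightarrow> bool" where
  "smooth_on S f \<longleftrightarrow> (\<forall>k. Ck_on k S f)"

definition hessian :: "(real ^ 'n \<Rightarrow> real) \<Rightarrow> real ^ 'n::finite \<Rightarrow> real ^ 'n ^ 'n" where
  "hessian f t = (\<chi> i j. partial i (partial j f) t)"

definition positive_definite :: "real ^ 'n ^ 'n::finite \<Rightarrow> bool" where
  "positive_definite H \<longleftrightarrow> transpose H = H \<and> (\<forall>v. v \<noteq> 0 \<longrightarrow> v \<bullet> (H *v v) > 0)"

text \<open>The function representing \<open>u\<close> in the frame dual to \<open>(t, 1)\<close>.\<close>

definition local_rep ::
  "('a, 'n::finite) atlas \<Rightarrow> ('a, 'n) lift \<Rightarrow> ('a \<Rightarrow> ('a, 'n) taut_vec \<Rightarrow> real)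
     \<Rightarrow> ('a, 'n) chart \<Rightarrow> real ^ 'n option ^ 'n option \<Rightarrow> real ^ 'n \<Rightarrow> real" where
  "local_rep \<B> g u c B t = u (coord_pt c B t) (coord_frame \<B> g c B t)"

definition dual_section ::
  "'a topology \<Rightarrow> ('a, 'n::finite) atlas \<Rightarrow> ('a, 'n) lift
     \<Rightarrow> ('a \<Rightarrow> ('a, 'n) taut_vec \<Rightarrow> real) \<Rightarrow> bool" where
  "dual_section M \<B> g u \<longleftrightarrow>
     (\<forall>p \<in> topspace M. \<forall>w \<in> taut_fibre \<B> g p. \<forall>w' \<in> taut_fibre \<B> g p. \<forall>a b.
        u p (\<lambda>c. a *\<^sub>R w c + b *\<^sub>R w' c) = a * u p w + b * u p w') \<and>
     (\<forall>c\<in>\<B>. \<forall>B\<in>SLpm. smooth_on (coord_dom c B) (local_rep \<B> g u c B))"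

definition negative_section ::
  "'a topology \<Rightarrow> ('a \<Rightarrow> ('a, 'n::finite) taut_vec set) \<Rightarrow> ('a \<Rightarrow> ('a, 'n) taut_vec \<Rightarrow> real) \<Rightarrow> bool"
  where
  "negative_section M P u \<longleftrightarrow> (\<forall>p \<in> topspace M. \<forall>w \<in> P p. u p w < 0)"

definition hessian_positive ::
  "'a topology \<Rightarrow> ('a, 'n::finite) atlas \<Rightarrow> ('a, 'n) lift \<Rightarrow> ('a \<Rightarrow> ('a, 'n) taut_vec set)
     \<Rightarrow> ('a \<Rightarrow> ('a, 'n) taut_vec \<Rightarrow> real) \<Rightarrow> bool" where
  "hessian_positive M \<B> g P u \<longleftrightarrow>
     (\<forall>p \<in> topspace M. \<exists>c\<in>\<B>. \<exists>B\<in>SLpm. \<exists>T. open T \<and> T \<subseteq> coord_dom c B \<and> p \<in> coord_pt c B ` T \<and>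
        (\<forall>t\<in>T. coord_frame \<B> g c B t \<in> P (coord_pt c B t) \<and>
                positive_definite (hessian (local_rep \<B> g u c B) t)))"


section \<open>Quotients of convex domains\<close>

definition bounded_convex_domain :: "'n::finite rp set \<Rightarrow> bool" where
  "bounded_convex_domain \<Omega> \<longleftrightarrow>
     (\<exists>B D. det B \<noteq> 0 \<and> open D \<and> convex D \<and> bounded D \<and> D \<noteq> {} \<and> \<Omega> = affine_pt B ` D)"

definition discrete_subgroup_PGL :: "('n::finite rp \<Rightarrow> 'n rp) set \<Rightarrow> bool" where
  "discrete_subgroup_PGL \<Gamma> \<longleftrightarrow>
     \<Gamma> \<subseteq> PGL \<and> id \<in> \<Gamma> \<and> (\<forall>\<gamma>\<in>\<Gamma>. \<forall>\<delta>\<in>\<Gamma>. \<gamma> \<circ> \<delta> \<in> \<Gamma>) \<and> (\<forall>\<gamma>\<in>\<Gamma>. inv \<gamma> \<in> \<Gamma>) \<and>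
     subtopology PGL_topology \<Gamma> = discrete_topology \<Gamma>"

text \<open>
  Freeness is what makes the quotient by a properly discontinuous action a locally projectively
  flat manifold (and not merely an orbifold).
\<close>

definition acts_properly_discontinuously ::
  "('n::finite rp \<Rightarrow> 'n rp) set \<Rightarrow> 'n rp set \<Rightarrow> bool" where
  "acts_properly_discontinuously \<Gamma> \<Omega> \<longleftrightarrow>
     (\<forall>\<gamma>\<in>\<Gamma>. \<gamma> ` \<Omega> = \<Omega>) \<and>
     (\<forall>K. compact K \<and> K \<subseteq> \<Omega> \<longrightarrow> finite {\<gamma>\<in>\<Gamma>. \<gamma> ` K \<inter> K \<noteq> {}}) \<and>
     (\<forall>\<gamma>\<in>\<Gamma>. \<forall>x\<in>\<Omega>. \<gamma> x = x \<longrightarrow> \<gamma> = id)"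

definition orbit_map :: "('n::finite rp \<Rightarrow> 'n rp) set \<Rightarrow> 'n rp \<Rightarrow> 'n rp set" where
  "orbit_map \<Gamma> x = (\<lambda>\<gamma>. \<gamma> x) ` \<Gamma>"

definition orbit_space :: "'n::finite rp set \<Rightarrow> ('n rp \<Rightarrow> 'n rp) set \<Rightarrow> 'n rp set topology" where
  "orbit_space \<Omega> \<Gamma> = quotient_topology (top_of_set \<Omega>) (orbit_map \<Gamma>)"

text \<open>The charts are the local inverses of the orbit projection.\<close>

definition orbit_atlas :: "'n::finite rp set \<Rightarrow> ('n rp \<Rightarrow> 'n rp) set \<Rightarrow> ('n rp set, 'n) atlas" where
  "orbit_atlas \<Omega> \<Gamma> =
     {(orbit_map \<Gamma> ` V, inv_into V (orbit_map \<Gamma>)) |V.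
        open V \<and> V \<subseteq> \<Omega> \<and> inj_on (orbit_map \<Gamma>) V}"

end

theory Submission
  imports Defs
begin

text \<open>
  From (1) to (2): the positive half of \<open>\<tau>\<close> is a manifold with an action of the positive reals and
  with charts in open cones of \<open>\<real>\<^sup>n\<^sup>+\<^sup>1\<close> that change by linear maps, and \<open>u\<close> is a negative function on it,
  homogeneous of degree one, whose Hessian condition says that it is convex along straight segments, strictly so
  in transversal directions. Continue a chart along the straight segments that start at a base point.
  The points that can be reached this way form an open star-shaped cone \<open>E\<close>. Because \<open>M\<close> is compact,
  \<open>u\<close> varies by a uniform fraction of itself across suitable plaques, while a bounded convex function of
  one variable has limits; so continuation can stop along a segment only where \<open>u\<close> tends to \<open>0\<close>.
  A homotopy of segments then shows that \<open>E\<close> is convex, and a negative convex function on a whole line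
  would be constant, which strictness forbids; hence \<open>E\<close> is a proper cone, its projectivization is a bounded convex
  domain \<open>\<Omega>\<close>, and any two preimages of a point differ by a linear automorphism of \<open>E\<close>. No simply connected
  cover is needed.

  From (2) to (1): the Koszul--Vinberg characteristic function \<open>\<Phi> x = (\<integral>\<xi>. exp (- (x \<bullet> \<xi>)))\<close>, integrated over the
  dual cone, is invariant under the unimodular automorphisms of the cone over \<open>\<Omega>\<close> and homogeneous of degree
  \<open>-(n+1)\<close>. So \<open>u = - \<Phi> powr (-1/(n+1))\<close> is an invariant section of the dual bundle, and its Hessian is positive
  definite transversally to the radial direction by the Cauchy--Schwarz inequality for the second moments.
\<close>

section \<open>Convex functions of one variable\<close>

text \<open>The continued map \<open>F\<close> runs from the vector space to the manifold, opposite
  to a developing map. Injectivity of a development therefore never has to be proved; its place is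
  taken by the fact that two points of \<open>E\<close> with the same image are exchanged by a
  linear symmetry. The obstacle to continuation is that only \<open>M\<close> is compact, not the
  half-line bundle over it, so plaques have no uniform size in \<open>E\<close>. The scale that
  compactness respects is \<open>u\<close> itself, and every estimate is relative to the size of
  \<open>u\<close>. In one prescribed direction \<open>u\<close> may return to its old value; strict
  convexity and homogeneity only exclude that this happens both ways, whence the two-sided
  alternatives. In the converse direction the transition maps of the given atlas come without
  consistent lifts. The atlas is replaced by charts whose transition maps lie in the group: each
  group element has exactly one lift in \<open>SLpm\<close> that preserves the cone instead of
  exchanging it with its negative, and this uniqueness yields the cocycle identity. The exponent of
  the characteristic function is the one that makes the degree equal to one, as a pairing with
  vectors of a line requires.\<close>

lemma convex_on_local_midpoint:
  fixes g :: "real \<Rightarrow> real"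
  assumes cont: "continuous_on {a..b} g"
    and mid: "\<And>t. a < t \<Longrightarrow> t < b \<Longrightarrow> \<exists>d>0. \<forall>h. 0 < h \<and> h < d \<longrightarrow> 2 * g t \<le> g (t - h) + g (t + h)"
  shows "convex_on {a..b} g"
proof (rule convex_on_linorderI)
  fix \<mu> x y :: real
  assume \<mu>: "0 < \<mu>" "\<mu> < 1" and xy: "x \<in> {a..b}" "y \<in> {a..b}" "x < y"
  define k where "k = (g y - g x) / (y - x)"
  define f where "f t = g t - g x - k * (t - x)" for t
  have fy: "f x = 0" "f y = 0" using xy by (simp_all add: f_def k_def)
  have contf: "continuous_on {x..y} f"
    unfolding f_def using xy by (intro continuous_intros continuous_on_subset[OF cont]) auto
  obtain m where m: "m \<in> {x..y}" "\<And>t. t \<in> {x..y} \<Longrightarrow> f t \<le> f m"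
    using continuous_attains_sup[of "{x..y}" f] contf xy by auto
  have "f m \<le> 0"
  proof (rule ccontr)
    assume pos: "\<not> f m \<le> 0"
    \<comment> \<open>Maximum principle: \<open>f\<close> is \<open>g\<close> minus its chord. At
      the leftmost point of a positive maximum the midpoint inequality would make
      \<open>c - h\<close> a maximum point too, further to the left.\<close>
    define K where "K = {x..y} \<inter> f -` {f m}"
    have "closed K" unfolding K_def by (rule continuous_closed_preimage[OF contf]) auto
    moreover have "bounded K" unfolding K_def by (rule bounded_subset[of "{x..y}"]) auto
    ultimately have "compact K" using compact_eq_bounded_closed by blast
    moreover have "K \<noteq> {}" using m K_def by auto
    ultimately obtain c where c: "c \<in> K" "\<And>t. t \<in> K \<Longrightarrow> c \<le> t"
      using compact_attains_inf[of K] by blast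
    have cm: "f c = f m" "c \<in> {x..y}" using c K_def by auto
    have cx: "x < c" "c < y" using cm pos fy by (cases "c = x"; cases "c = y"; force)+
    then obtain d where d: "d > 0" "\<And>h. 0 < h \<Longrightarrow> h < d \<Longrightarrow> 2 * g c \<le> g (c - h) + g (c + h)"
      using mid[of c] xy by force
    define h where "h = min (d/2) (min (c - x) (y - c))"
    have h: "0 < h" "h < d" "c - h \<in> {x..y}" "c + h \<in> {x..y}" using d cx by (auto simp: h_def)
    have "2 * f c \<le> f (c - h) + f (c + h)"
      using d(2)[OF h(1,2)] by (simp add: f_def algebra_simps)
    moreover have "f (c + h) \<le> f c" "f (c - h) \<le> f c" using m(2) h cm by auto
    ultimately have "f (c - h) = f m" using cm by linarith
    then have "c - h \<in> K" using h K_def by auto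
    then show False using c(2)[of "c-h"] h by auto
  qed
  moreover have in_xy: "(1 - \<mu>) * x + \<mu> * y \<in> {x..y}"
  proof -
    have "(1 - \<mu>) * x + \<mu> * y = x + \<mu> * (y - x)" by (simp add: algebra_simps)
    moreover have "\<mu> * (y - x) \<le> 1 * (y - x)" using \<mu> xy by (intro mult_right_mono) auto
    moreover have "0 \<le> \<mu> * (y - x)" using \<mu> xy by auto
    ultimately show ?thesis by auto
  qed
  ultimately have "f ((1 - \<mu>) * x + \<mu> * y) \<le> 0" using m(2) by force
  moreover have "k * (((1 - \<mu>) * x + \<mu> * y) - x) = \<mu> * (g y - g x)"
  proof -
    have "((1 - \<mu>) * x + \<mu> * y) - x = \<mu> * (y - x)" by (simp add: algebra_simps)
    then show ?thesis using xy unfolding k_def by (simp add: field_simps)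
  qed
  ultimately show "g ((1 - \<mu>) *\<^sub>R x + \<mu> *\<^sub>R y) \<le> (1 - \<mu>) * g x + \<mu> * g y"
    unfolding f_def by (simp add: algebra_simps)
qed auto

text \<open>Slopes of a convex function increase, so after one rise it cannot fall again.\<close>

lemma convex_slope_pos:
  fixes g :: "real \<Rightarrow> real"
  assumes g: "convex_on S g" and "p \<in> S" "r \<in> S" "p < q" "q \<le> r" "g p < g q"
  shows "g q \<le> g r"
proof (cases "q = r")
  case False
  define \<mu> where "\<mu> = (q - p) / (r - p)"
  have l: "0 < \<mu>" "\<mu> < 1" using assms False by (auto simp: \<mu>_def)
  have "\<mu> * (r - p) = q - p" using assms by (simp add: \<mu>_def)
  then have "q = (1 - \<mu>) * p + \<mu> * r" by (simp add: algebra_simps)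
  then have "g q \<le> (1 - \<mu>) * g p + \<mu> * g r"
    using convex_onD[OF g, of \<mu> p r] l assms by auto
  also have "... \<le> (1 - \<mu>) * g q + \<mu> * g r"
    using l assms by (intro add_right_mono mult_left_mono) auto
  finally have "\<mu> * g q \<le> \<mu> * g r" by (simp add: algebra_simps)
  then show ?thesis using l by simp
qed auto

text \<open>A limit at the open end \<open>1\<close>, in Cauchy form. Either \<open>g\<close> rises
  somewhere, and is monotone and bounded by \<open>b\<close> from there on, or it never rises, and
  then convexity supplies the missing lower bound.\<close>

lemma convex_bounded_above_Cauchy:
  fixes g :: "real \<Rightarrow> real"
  assumes g: "convex_on {0..<1} g" and bd: "\<And>t. t \<in> {0..<1} \<Longrightarrow> g t \<le> b" and "e > 0"
  shows "\<exists>d\<in>{0..<1}. \<forall>s\<in>{d..<1}. \<forall>t\<in>{d..<1}. \<bar>g s - g t\<bar> < e"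
proof (cases "\<exists>s t. 0 \<le> s \<and> s < t \<and> t < 1 \<and> g s < g t")
  case True
  then obtain s t where st: "0 \<le> s" "s < t" "t < 1" "g s < g t" by blast
  have mono: "g p \<le> g q" if "t \<le> p" "p \<le> q" "q < 1" for p q
  proof -
    have "g t \<le> g p" using convex_slope_pos[OF g, of s p t] st that by auto
    then show ?thesis using convex_slope_pos[OF g, of s q p] st that by auto
  qed
  have bda: "bdd_above (g ` {t..<1})" using bd st by (intro bdd_aboveI[of _ b]) auto
  have "\<exists>d\<in>{t..<1}. Sup (g ` {t..<1}) - e < g d"
    using less_cSup_iff[of "g ` {t..<1}" "Sup (g ` {t..<1}) - e"] bda st assms(3) by auto
  then obtain d where d: "d \<in> {t..<1}" "Sup (g ` {t..<1}) - e < g d" by auto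
  have "g d \<le> g p \<and> g p \<le> Sup (g ` {t..<1})" if "p \<in> {d..<1}" for p
    using mono[of d p] that d cSup_upper[OF _ bda, of "g p"] by auto
  then have "\<forall>s\<in>{d..<1}. \<forall>t\<in>{d..<1}. \<bar>g s - g t\<bar> < e" using d(2) by (smt (verit))
  then show ?thesis using d st by (intro bexI[of _ d]) auto
next
  case False
  have mono: "g q \<le> g p" if "0 \<le> p" "p \<le> q" "q < 1" for p q
    using False that by (cases "p = q") (force simp: not_less)+
  have low: "- 2 * \<bar>g 0\<bar> - 2 * \<bar>g (1/2)\<bar> \<le> g p" if "p \<in> {0..<1}" for p
  proof (cases "p \<le> 1/2")
    case True then show ?thesis using mono[of p "1/2"] that by auto
  next
    case False
    \<comment> \<open>\<open>1/2\<close> is a convex combination of \<open>0\<close> and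
      \<open>p\<close> with weight at least one half on \<open>p\<close>, so a very negative
      \<open>g p\<close> would pull \<open>g (1/2)\<close> down.\<close>
    define \<mu> where "\<mu> = 1 / (2 * p)"
    have l: "1/2 < \<mu>" "\<mu> < 1" using False that by (auto simp: \<mu>_def field_simps)
    have "1/2 = (1 - \<mu>) * 0 + \<mu> * p" using False by (simp add: \<mu>_def)
    then have "g (1/2) \<le> (1 - \<mu>) * g 0 + \<mu> * g p"
      using convex_onD[OF g, of \<mu> 0 p] l that by (metis atLeastLessThan_iff less_eq_real_def order_less_le_trans real_scaleR_def zero_less_one half_gt_zero order.refl add_0 order.strict_trans1 zero_le_one)
    moreover have "(1 - \<mu>) * g 0 \<le> (1-\<mu>) * \<bar>g 0\<bar>" using l by (intro mult_left_mono) auto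
    moreover have "(1-\<mu>) * \<bar>g 0\<bar> \<le> (1/2) * \<bar>g 0\<bar>" using l by (intro mult_right_mono) auto
    ultimately have "\<mu> * g p \<ge> - \<bar>g (1/2)\<bar> - \<bar>g 0\<bar> / 2" by linarith
    moreover have "g p \<ge> 2 * (\<mu> * g p) \<or> g p \<ge> 0"
      using l mult_right_mono_neg[of 1 "2*\<mu>" "g p"] by (cases "g p \<ge> 0") auto
    ultimately show ?thesis by linarith
  qed
  have bda: "bdd_below (g ` {0..<1})" using low by (intro bdd_belowI[of _ "- 2 * \<bar>g 0\<bar> - 2 * \<bar>g (1/2)\<bar>"]) auto
  have "\<exists>d\<in>{0..<1}. g d < Inf (g ` {0..<1}) + e"
    using cInf_less_iff[of "g ` {0..<1}" "Inf (g ` {0..<1}) + e"] bda assms(3) by auto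
  then obtain d where d: "d \<in> {0..<1}" "g d < Inf (g ` {0..<1}) + e" by auto
  have "g p \<le> g d \<and> Inf (g ` {0..<1}) \<le> g p" if "p \<in> {d..<1}" for p
    using mono[of d p] that d cInf_lower[OF _ bda, of "g p"] by auto
  then have "\<forall>s\<in>{d..<1}. \<forall>t\<in>{d..<1}. \<bar>g s - g t\<bar> < e" using d(2) by (smt (verit))
  then show ?thesis using d by (intro bexI[of _ d]) auto
qed

lemma convex_bounded_above_UNIV_const:
  fixes g :: "real \<Rightarrow> real"
  assumes g: "convex_on UNIV g" and bd: "\<And>t. g t \<le> b"
  shows "g s = g t"
proof -
  have main: "\<not> f p < f q" if "convex_on UNIV f" "\<And>t. f t \<le> b" "p < q" for f :: "real \<Rightarrow> real" and p q
  proof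
    assume lt: "f p < f q"
    \<comment> \<open>Chosen so that the chord through \<open>p\<close> and \<open>q\<close>,
      prolonged to \<open>r\<close>, reaches \<open>b + (f q - f p)\<close>, which exceeds the
      bound.\<close>
    define n where "n = (b - f p) / (f q - f p) + 1"
    have n: "n \<ge> 1" using lt that(2)[of p] by (simp add: n_def)
    define r where "r = p + n * (q - p)"
    have "q = (1 - 1/n) * p + (1/n) * r" using n by (simp add: r_def field_simps)
    then have "f q \<le> (1 - 1/n) * f p + (1/n) * f r"
      using convex_onD[OF that(1), of "1/n" p r] n by auto
    then have "n * (f q - f p) \<le> f r - f p" using n by (simp add: field_simps)
    moreover have "n * (f q - f p) = b - f p + (f q - f p)" using lt by (simp add: n_def field_simps)
    ultimately show False using that(2)[of r] lt by linarith
  qed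
  \<comment> \<open>Reflection turns a decrease of \<open>g\<close> into an increase, so the same
    extrapolation excludes both.\<close>
  have "convex_on UNIV (\<lambda>t. g (- t))"
  proof (rule convex_onI)
    fix t x y :: real assume "0 < t" "t < 1"
    then show "g (- ((1 - t) *\<^sub>R x + t *\<^sub>R y)) \<le> (1 - t) * g (- x) + t * g (- y)"
      using convex_onD[OF g, of t "-x" "-y"] by (simp add: algebra_simps)
  qed auto
  note neg = main[OF this]
  have "\<not> g p < g q" if "p < q" for p q using main[OF g bd that] .
  moreover have "\<not> g q < g p" if "p < q" for p q using neg[of "-q" "-p"] bd that by simp
  ultimately show ?thesis by (metis linorder_cases)
qed

text \<open>A linear map is determined by its germ at any point. This rigidity makes agreement of
  two locally linear maps a closed condition as well as an open one.\<close>

lemma linear_eq_of_eventually: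
  fixes A B :: "'v::real_normed_vector \<Rightarrow> 'w::real_vector"
  assumes A: "linear A" and B: "linear B" and ev: "eventually (\<lambda>y. A y = B y) (nhds z)"
  shows "A = B"
proof
  fix v
  have "((\<lambda>t. z + t *\<^sub>R v) \<longlongrightarrow> z + 0 *\<^sub>R v) (at (0::real))" by (intro tendsto_intros)
  then have "((\<lambda>t. z + t *\<^sub>R v) \<longlongrightarrow> z) (at (0::real))" by simp
  then have "eventually (\<lambda>t. A (z + t *\<^sub>R v) = B (z + t *\<^sub>R v)) (at (0::real))"
    using ev eventually_compose_filterlim by blast
  moreover have "eventually (\<lambda>t. t \<noteq> 0) (at (0::real))" by (simp add: eventually_at_filter)
  ultimately have "eventually (\<lambda>t. t \<noteq> 0 \<and> A (z + t *\<^sub>R v) = B (z + t *\<^sub>R v)) (at (0::real))"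
    by eventually_elim auto
  then obtain t where t: "t \<noteq> 0" "A (z + t *\<^sub>R v) = B (z + t *\<^sub>R v)"
    using eventually_happens'[OF at_neq_bot] by blast
  have "A z = B z" using ev eventually_nhds_x_imp_x by fast
  then show "A v = B v" using t linear_add[OF A] linear_add[OF B] linear_scale[OF A] linear_scale[OF B] by simp
qed

section \<open>Locally linear maps, their germs and unique continuation\<close>

section \<open>Radiant affine manifolds\<close>

text \<open>An abstract model of the positive half \<open>L\<close> of the tautological bundle: \<open>\<phi> i\<close> is the inverse of the
  chart with values in the cone \<open>V i\<close>, and \<open>\<sigma>\<close> is the action of the positive reals.
  Compactness and connectedness are those of \<open>M\<close>, the quotient of \<open>L\<close> by \<open>\<sigma>\<close>.\<close>

locale radiant =
  fixes I :: "'i set" and V :: "'i \<Rightarrow> 'v::euclidean_space set" and \<phi> :: "'i \<Rightarrow> 'v \<Rightarrow> 'l"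
    and L :: "'l set" and \<sigma> :: "real \<Rightarrow> 'l \<Rightarrow> 'l" and u :: "'l \<Rightarrow> real"
  assumes V_open: "i \<in> I \<Longrightarrow> open (V i)"
    and V_cone: "i \<in> I \<Longrightarrow> x \<in> V i \<Longrightarrow> r > 0 \<Longrightarrow> r *\<^sub>R x \<in> V i"
    and V_0: "i \<in> I \<Longrightarrow> 0 \<notin> V i"
    and L_cover: "L = (\<Union>i\<in>I. \<phi> i ` V i)"
    and L_nonempty: "L \<noteq> {}"
    and \<phi>_inj: "i \<in> I \<Longrightarrow> inj_on (\<phi> i) (V i)"
    and \<phi>_scale: "i \<in> I \<Longrightarrow> x \<in> V i \<Longrightarrow> r > 0 \<Longrightarrow> \<phi> i (r *\<^sub>R x) = \<sigma> r (\<phi> i x)"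
    and transition: "i \<in> I \<Longrightarrow> j \<in> I \<Longrightarrow> x \<in> V i \<Longrightarrow> y \<in> V j \<Longrightarrow> \<phi> i x = \<phi> j y \<Longrightarrow>
      \<exists>A W. linear A \<and> bij A \<and> open W \<and> x \<in> W \<and> W \<subseteq> V i \<and> A ` W \<subseteq> V j \<and> (\<forall>z\<in>W. \<phi> i z = \<phi> j (A z))"
    and hausdorff: "i \<in> I \<Longrightarrow> j \<in> I \<Longrightarrow> x \<in> V i \<Longrightarrow> y \<in> V j \<Longrightarrow>
      (\<And>k::nat. X k \<in> V i) \<Longrightarrow> (\<And>k. Y k \<in> V j) \<Longrightarrow> (\<And>k. \<phi> i (X k) = \<phi> j (Y k)) \<Longrightarrow>
      X \<longlonglongrightarrow> x \<Longrightarrow> Y \<longlonglongrightarrow> y \<Longrightarrow> \<phi> i x = \<phi> j y"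
    and u_neg: "z \<in> L \<Longrightarrow> u z < 0"
    and u_cont: "i \<in> I \<Longrightarrow> continuous_on (V i) (\<lambda>x. u (\<phi> i x))"
    and u_scale: "z \<in> L \<Longrightarrow> r > 0 \<Longrightarrow> u (\<sigma> r z) = r * u z"
    and u_convex: "z \<in> L \<Longrightarrow> \<exists>i\<in>I. \<exists>C. open C \<and> convex C \<and> C \<subseteq> V i \<and> z \<in> \<phi> i ` C \<and>
      (\<forall>x\<in>C. \<forall>y\<in>C. u (\<phi> i (x + y)) \<le> u (\<phi> i x) + u (\<phi> i y) \<and>
        ((\<nexists>r. y = r *\<^sub>R x) \<longrightarrow> u (\<phi> i (x + y)) < u (\<phi> i x) + u (\<phi> i y)))"
    and compactness: "(\<And>i T. (i, T) \<in> \<O> \<Longrightarrow> i \<in> I \<and> open T \<and> T \<subseteq> V i) \<Longrightarrow>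
      (\<And>z. z \<in> L \<Longrightarrow> \<exists>(i, T)\<in>\<O>. z \<in> \<phi> i ` T) \<Longrightarrow>
      \<exists>\<O>'\<subseteq>\<O>. finite \<O>' \<and> (\<forall>z\<in>L. \<exists>(i, T)\<in>\<O>'. \<exists>r>0. \<exists>x\<in>T. z = \<sigma> r (\<phi> i x))"
    and connectedness: "Z \<subseteq> L \<Longrightarrow> Z \<noteq> {} \<Longrightarrow> (\<And>z r. z \<in> Z \<Longrightarrow> r > 0 \<Longrightarrow> \<sigma> r z \<in> Z) \<Longrightarrow>
      (\<And>i. i \<in> I \<Longrightarrow> open {x \<in> V i. \<phi> i x \<in> Z}) \<Longrightarrow>
      (\<And>i. i \<in> I \<Longrightarrow> open {x \<in> V i. \<phi> i x \<notin> Z}) \<Longrightarrow> Z = L"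
begin

text \<open>Local isomorphisms for the linear structure: read in a suitable chart of the target,
  \<open>G\<close> is an invertible linear map near each point. Such maps go into \<open>L\<close>,
  like local inverses of a developing map.\<close>

definition loclin :: "('v \<Rightarrow> 'l) \<Rightarrow> 'v set \<Rightarrow> bool" where
  "loclin G S \<longleftrightarrow> (\<forall>x\<in>S. \<exists>i\<in>I. \<exists>A W. linear A \<and> bij A \<and> open W \<and> x \<in> W \<and> W \<subseteq> S \<and>
     A ` W \<subseteq> V i \<and> (\<forall>y\<in>W. G y = \<phi> i (A y)))"

text \<open>Equality of germs; equality at a single point would not propagate.\<close>

definition agree :: "('v \<Rightarrow> 'l) \<Rightarrow> ('v \<Rightarrow> 'l) \<Rightarrow> 'v \<Rightarrow> bool" where
  "agree G H x \<longleftrightarrow> eventually (\<lambda>y. G y = H y) (nhds x)"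

lemma loclinE:
  assumes "loclin G S" "x \<in> S"
  obtains i A W where "i \<in> I" "linear A" "bij A" "open W" "x \<in> W" "W \<subseteq> S"
     "A ` W \<subseteq> V i" "\<And>y. y \<in> W \<Longrightarrow> G y = \<phi> i (A y)"
proof -
  from assms(1)[unfolded loclin_def, THEN bspec, OF assms(2)]
  obtain i A W where *: "i \<in> I" "linear A \<and> bij A \<and> open W \<and> x \<in> W \<and> W \<subseteq> S \<and>
     A ` W \<subseteq> V i \<and> (\<forall>y\<in>W. G y = \<phi> i (A y))"
    by (elim bexE exE)
  show thesis by (rule that[of i A W]) (use * in simp_all)
qed

lemma loclin_open: "loclin G S \<Longrightarrow> open S"
  unfolding loclin_def by (subst open_subopen) blast

lemma loclin_L: "loclin G S \<Longrightarrow> x \<in> S \<Longrightarrow> G x \<in> L"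
  unfolding L_cover by (erule (1) loclinE) (auto simp: image_subset_iff)

lemma loclin_0: "loclin G S \<Longrightarrow> 0 \<notin> S"
proof
  assume G: "loclin G S" "0 \<in> S"
  obtain i A W where "i \<in> I" "linear A" "bij A" "open W" "0 \<in> W" "W \<subseteq> S"
     "A ` W \<subseteq> V i" "\<And>y. y \<in> W \<Longrightarrow> G y = \<phi> i (A y)"
    using loclinE[OF G] by metis
  then have "A 0 \<in> V i" "A 0 = 0" by (auto simp: linear_0)
  then show False using V_0 \<open>i \<in> I\<close> by simp
qed

lemma loclin_subset: "loclin G S \<Longrightarrow> open T \<Longrightarrow> T \<subseteq> S \<Longrightarrow> loclin G T"
  unfolding loclin_def
  apply (intro ballI)
  subgoal for x
    apply (drule bspec[of S _ x], blast)
    apply (elim bexE exE conjE)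
    subgoal for i A W
      by (intro bexI[of _ i] exI[of _ A] exI[of _ "W \<inter> T"]) auto
    done
  done

lemma loclin_Un:
  assumes "loclin G S" "loclin G T" shows "loclin G (S \<union> T)"
  unfolding loclin_def
proof
  fix x assume "x \<in> S \<union> T"
  then show "\<exists>i\<in>I. \<exists>A W. linear A \<and> bij A \<and> open W \<and> x \<in> W \<and> W \<subseteq> S \<union> T \<and>
     A ` W \<subseteq> V i \<and> (\<forall>y\<in>W. G y = \<phi> i (A y))"
  proof
    assume "x \<in> S" then show ?thesis
      using assms(1) unfolding loclin_def by (meson le_supI1)
  next
    assume "x \<in> T" then show ?thesis
      using assms(2) unfolding loclin_def by (meson le_supI2)
  qed
qed

lemma loclin_cong:
  assumes "loclin G S" "\<And>x. x \<in> S \<Longrightarrow> G x = H x" shows "loclin H S"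
  unfolding loclin_def
proof
  fix x assume "x \<in> S"
  then obtain i A W where "i \<in> I" "linear A" "bij A" "open W" "x \<in> W" "W \<subseteq> S"
     "A ` W \<subseteq> V i" "\<And>y. y \<in> W \<Longrightarrow> G y = \<phi> i (A y)"
    using loclinE[OF assms(1)] by metis
  then show "\<exists>i\<in>I. \<exists>A W. linear A \<and> bij A \<and> open W \<and> x \<in> W \<and> W \<subseteq> S \<and>
     A ` W \<subseteq> V i \<and> (\<forall>y\<in>W. H y = \<phi> i (A y))"
    using assms(2) by (intro bexI[of _ i] exI[of _ A] exI[of _ W]) (auto simp: subset_iff)
qed

lemma loclin_plaque:
  assumes "i \<in> I" "linear A" "bij A" "open S" "A ` S \<subseteq> V i"
  shows "loclin (\<lambda>x. \<phi> i (A x)) S"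
  unfolding loclin_def using assms by blast

lemma loclin_compose:
  assumes G: "loclin G S" and A: "linear A" "bij A"
  shows "loclin (\<lambda>x. G (A x)) (A -` S)"
  unfolding loclin_def
proof
  fix x assume "x \<in> A -` S"
  then obtain i B W where *: "i \<in> I" "linear B" "bij B" "open W" "A x \<in> W" "W \<subseteq> S"
     "B ` W \<subseteq> V i" "\<And>y. y \<in> W \<Longrightarrow> G y = \<phi> i (B y)"
    using loclinE[OF G] by (metis vimageE)
  have "open (A -` W)" using A * by (simp add: linear_continuous_on open_vimage linear_conv_bounded_linear)
  then show "\<exists>i\<in>I. \<exists>B W. linear B \<and> bij B \<and> open W \<and> x \<in> W \<and> W \<subseteq> A -` S \<and>
     B ` W \<subseteq> V i \<and> (\<forall>y\<in>W. G (A y) = \<phi> i (B y))"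
    using * A by (intro bexI[of _ i] exI[of _ "B \<circ> A"] exI[of _ "A -` W"])
      (auto simp: linear_compose bij_comp)
qed

text \<open>The chart of the target may be prescribed: the local expression is composed with a
  linear transition, and injectivity of \<open>\<phi> j\<close> identifies the image of
  \<open>x\<close>.\<close>

lemma loclin_chart:
  assumes G: "loclin G S" "x \<in> S" and j: "j \<in> I" "y \<in> V j" "G x = \<phi> j y"
  obtains A W where "linear A" "bij A" "open W" "x \<in> W" "W \<subseteq> S"
     "A ` W \<subseteq> V j" "\<And>z. z \<in> W \<Longrightarrow> G z = \<phi> j (A z)" "A x = y"
proof -
  obtain i A W where 1: "i \<in> I" "linear A" "bij A" "open W" "x \<in> W" "W \<subseteq> S"
     "A ` W \<subseteq> V i" "\<And>y. y \<in> W \<Longrightarrow> G y = \<phi> i (A y)"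
    using loclinE[OF G] by metis
  have "\<phi> i (A x) = \<phi> j y" using 1 j by auto
  then obtain B W' where 2: "linear B" "bij B" "open W'" "A x \<in> W'" "W' \<subseteq> V i" "B ` W' \<subseteq> V j"
     "\<And>z. z \<in> W' \<Longrightarrow> \<phi> i z = \<phi> j (B z)"
    using transition[OF 1(1) j(1) _ j(2), of "A x"] 1(5,7) by (metis image_subset_iff)
  have op: "open (A -` W')" using 1 2 by (simp add: linear_continuous_on open_vimage linear_conv_bounded_linear)
  have "\<phi> j (B (A x)) = \<phi> j y" using 1 2 j by metis
  moreover have "B (A x) \<in> V j" using 2 by blast
  ultimately have "B (A x) = y" using \<phi>_inj[OF j(1)] j by (meson inj_onD)
  then show ?thesis
    using 1 2 op by (intro that[of "B \<circ> A" "W \<inter> A -` W'"]) (auto simp: linear_compose bij_comp image_subset_iff)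
qed

text \<open>Hausdorffness of the target, carried from chart vectors to arbitrary locally linear
  maps.\<close>

lemma loclin_limit:
  assumes G: "loclin G S" and H: "loclin H T" and x: "x \<in> S" and y: "y \<in> T"
    and X: "X \<longlonglongrightarrow> x" and Y: "Y \<longlonglongrightarrow> y"
    and eq: "\<And>k::nat. G (X k) = H (Y k)"
  shows "G x = H y"
proof -
  obtain i A W where 1: "i \<in> I" "linear A" "bij A" "open W" "x \<in> W" "W \<subseteq> S"
     "A ` W \<subseteq> V i" "\<And>y. y \<in> W \<Longrightarrow> G y = \<phi> i (A y)"
    using loclinE[OF G x] by metis
  obtain j B W' where 2: "j \<in> I" "linear B" "bij B" "open W'" "y \<in> W'" "W' \<subseteq> T"
     "B ` W' \<subseteq> V j" "\<And>y. y \<in> W' \<Longrightarrow> H y = \<phi> j (B y)"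
    using loclinE[OF H y] by metis
  have "eventually (\<lambda>k. X k \<in> W) sequentially" "eventually (\<lambda>k. Y k \<in> W') sequentially"
    using X Y 1 2 by (auto intro: topological_tendstoD)
  then have "eventually (\<lambda>k. X k \<in> W \<and> Y k \<in> W') sequentially" by (rule eventually_conj)
  then obtain N where N: "\<And>k. k \<ge> N \<Longrightarrow> X k \<in> W \<and> Y k \<in> W'" unfolding eventually_sequentially by blast
  \<comment> \<open>Passing to tails puts every term into the charts, as the separation axiom of the
    locale demands for all indices.\<close>
  define X' Y' where "X' k = X (k + N)" and "Y' k = Y (k + N)" for k
  have X': "X' k \<in> W" "Y' k \<in> W'" "X' \<longlonglongrightarrow> x" "Y' \<longlonglongrightarrow> y" for k
    using N[of "k + N"] LIMSEQ_ignore_initial_segment[OF X, of N] LIMSEQ_ignore_initial_segment[OF Y, of N]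
    by (auto simp: X'_def[abs_def] Y'_def[abs_def])
  have lim: "(\<lambda>k. A (X' k)) \<longlonglongrightarrow> A x" "(\<lambda>k. B (Y' k)) \<longlonglongrightarrow> B y"
    using bounded_linear.tendsto[OF linear_conv_bounded_linear[THEN iffD1] X'(3)]
      bounded_linear.tendsto[OF linear_conv_bounded_linear[THEN iffD1] X'(4)] 1 2 by blast+
  have "\<phi> i (A x) = \<phi> j (B y)"
  proof (rule hausdorff[where X = "\<lambda>k. A (X' k)" and Y = "\<lambda>k. B (Y' k)"])
    show "\<phi> i (A (X' k)) = \<phi> j (B (Y' k))" for k
      using X'(1,2)[of k] 1(8) 2(8) eq[of "k + N"] by (auto simp: X'_def Y'_def)
  qed (use 1 2 X' lim in auto)
  then show ?thesis using 1 2 by auto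
qed

lemma agree_open: "open {x. agree G H x}"
  unfolding agree_def
proof (subst open_subopen, intro ballI)
  fix x assume "x \<in> {x. \<forall>\<^sub>F y in nhds x. G y = H y}"
  then obtain T where "open T" "x \<in> T" "\<forall>y\<in>T. G y = H y" by (auto simp: eventually_nhds)
  then show "\<exists>T. open T \<and> x \<in> T \<and> T \<subseteq> {x. \<forall>\<^sub>F y in nhds x. G y = H y}"
    by (intro exI[of _ T]) (auto simp: eventually_nhds)
qed

text \<open>Hausdorffness gives equality at the limit point, so near it both maps are linear into
  one common chart. They agree on an open set near some \<open>X k\<close>, hence the two linear
  maps coincide.\<close>

lemma agree_closed:
  assumes G: "loclin G S" and H: "loclin H S" and x: "x \<in> S" and cl: "x \<in> closure {x\<in>S. agree G H x}"
  shows "agree G H x"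
proof -
  obtain X where X: "\<And>k::nat. X k \<in> {x\<in>S. agree G H x}" "X \<longlonglongrightarrow> x"
    using cl closure_sequential by blast
  have "G (X k) = H (X k)" for k
    using X(1)[of k] eventually_nhds_x_imp_x unfolding agree_def by fastforce
  then have eq: "G x = H x" using loclin_limit[OF G H x x X(2) X(2)] by auto
  obtain i A W where 1: "i \<in> I" "linear A" "bij A" "open W" "x \<in> W" "W \<subseteq> S"
     "A ` W \<subseteq> V i" "\<And>y. y \<in> W \<Longrightarrow> G y = \<phi> i (A y)"
    using loclinE[OF G x] by metis
  obtain B W' where 2: "linear B" "bij B" "open W'" "x \<in> W'" "W' \<subseteq> S"
     "B ` W' \<subseteq> V i" "\<And>y. y \<in> W' \<Longrightarrow> H y = \<phi> i (B y)"
    using loclin_chart[OF H x, of i "A x"] 1 eq by (metis image_subset_iff)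
  have "eventually (\<lambda>k. X k \<in> W \<inter> W') sequentially"
    using X(2) 1 2 by (intro topological_tendstoD) auto
  then obtain k where k: "X k \<in> W \<inter> W'" unfolding eventually_sequentially by blast
  have "eventually (\<lambda>y. y \<in> W \<inter> W') (nhds (X k))"
    using k 1 2 by (intro eventually_nhds_in_open) auto
  moreover have "eventually (\<lambda>y. G y = H y) (nhds (X k))" using X(1)[of k] by (simp add: agree_def)
  ultimately have "eventually (\<lambda>y. A y = B y) (nhds (X k))"
  proof eventually_elim
    case (elim y)
    then have "\<phi> i (A y) = \<phi> i (B y)" using 1 2 by auto
    then show ?case using \<phi>_inj[OF 1(1)] 1(7) 2(6) elim by (auto simp: inj_on_def image_subset_iff)
  qed
  then have "A = B" using linear_eq_of_eventually 1 2 by blast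
  then have "\<And>y. y \<in> W \<inter> W' \<Longrightarrow> G y = H y" using 1 2 by auto
  then show ?thesis unfolding agree_def eventually_nhds using 1 2 by (intro exI[of _ "W \<inter> W'"]) auto
qed

text \<open>Agreement of germs is open by definition and closed by \<open>agree_closed\<close>, so
  it spreads over connected sets.\<close>

lemma unique_continuation:
  assumes G: "loclin G S" and H: "loclin H S" and C: "connected C" "C \<subseteq> S"
    and x: "x \<in> C" "agree G H x" and y: "y \<in> C"
  shows "agree G H y"
proof (rule ccontr)
  assume ny: "\<not> agree G H y"
  define T where "T = {x \<in> S. agree G H x}"
  have oT: "open T" using agree_open[of G H] loclin_open[OF G] unfolding T_def
    by (metis Collect_conj_eq Collect_mem_eq open_Int)
  have "S - closure T = {x \<in> S. \<not> agree G H x}"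
    using agree_closed[OF G H] closure_subset[of T] by (auto simp: T_def)
  moreover have "open (S - closure T)" using loclin_open[OF G] by (simp add: open_Diff)
  ultimately have oT': "open {x \<in> S. \<not> agree G H x}" by simp
  have "T \<inter> C = {} \<or> {x \<in> S. \<not> agree G H x} \<inter> C = {}"
    by (rule connectedD[OF C(1) oT oT']) (use C in \<open>auto simp: T_def\<close>)
  then show False using x y ny C by (auto simp: T_def)
qed

lemma agree_imp_eq: "agree G H x \<Longrightarrow> G x = H x"
  unfolding agree_def using eventually_nhds_x_imp_x by fast

lemma agree_sym: "agree G H x \<Longrightarrow> agree H G x"
  unfolding agree_def by (simp add: eq_commute)

lemma agree_trans: "agree G H x \<Longrightarrow> agree H K x \<Longrightarrow> agree G K x"
  unfolding agree_def by (auto elim: eventually_elim2)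

lemma agreeI: "open W \<Longrightarrow> x \<in> W \<Longrightarrow> (\<And>y. y \<in> W \<Longrightarrow> G y = H y) \<Longrightarrow> agree G H x"
  unfolding agree_def by (rule eventually_nhds[THEN iffD2]) (intro exI[of _ W], simp)

end

section \<open>Convex sheets around a base point and the map they define\<close>

section \<open>Cones, and continuation along rays\<close>

text \<open>Only strictly positive factors are allowed, so that open cones can avoid the
  origin.\<close>

definition pcone :: "'v::real_vector set \<Rightarrow> 'v set" where
  "pcone S = {r *\<^sub>R x | r x. r > 0 \<and> x \<in> S}"

definition is_pcone :: "'v::real_vector set \<Rightarrow> bool" where
  "is_pcone S \<longleftrightarrow> (\<forall>x\<in>S. \<forall>r>0. r *\<^sub>R x \<in> S)"

lemma is_pconeD: "is_pcone S \<Longrightarrow> x \<in> S \<Longrightarrow> r > 0 \<Longrightarrow> r *\<^sub>R x \<in> S"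
  by (simp add: is_pcone_def)

lemma pconeI: "r > 0 \<Longrightarrow> x \<in> S \<Longrightarrow> r *\<^sub>R x \<in> pcone S"
  by (auto simp: pcone_def)

lemma is_pcone_pcone: "is_pcone (pcone S)"
  unfolding is_pcone_def pcone_def
proof (clarify)
  fix r s :: real and x assume "0 < r" "0 < s" "x \<in> S"
  then show "\<exists>t y. s *\<^sub>R r *\<^sub>R x = t *\<^sub>R y \<and> 0 < t \<and> y \<in> S"
    by (intro exI[of _ "s * r"] exI[of _ x]) simp
qed

lemma subset_pcone: "S \<subseteq> pcone S"
proof
  fix x assume "x \<in> S" then show "x \<in> pcone S" using pconeI[of 1 x S] by simp
qed

lemma pcone_subset: "is_pcone T \<Longrightarrow> S \<subseteq> T \<Longrightarrow> pcone S \<subseteq> T"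
  by (auto simp: pcone_def is_pcone_def)

lemma pcone_Un: "pcone (S \<union> T) = pcone S \<union> pcone T"
  by (auto simp: pcone_def)

lemma open_pcone:
  fixes S :: "'v::real_normed_vector set"
  assumes "open S" shows "open (pcone S)"
proof -
  have "pcone S = (\<Union>r\<in>{0<..}. (\<lambda>x. r *\<^sub>R x) ` S)" by (auto simp: pcone_def)
  then show ?thesis using assms by (auto intro!: open_UN open_scaling)
qed

lemma convex_pcone:
  assumes "convex S" shows "convex (pcone S)"
proof (rule convexI)
  fix x y and a b :: real assume xy: "x \<in> pcone S" "y \<in> pcone S" "0 \<le> a" "0 \<le> b" "a + b = 1"
  obtain r p where r: "r > 0" "p \<in> S" "x = r *\<^sub>R p" using xy by (auto simp: pcone_def)
  obtain s q where s: "s > 0" "q \<in> S" "y = s *\<^sub>R q" using xy by (auto simp: pcone_def)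
  \<comment> \<open>The total weight: \<open>a *\<^sub>R x + b *\<^sub>R y\<close> is
    \<open>m\<close> times a convex combination of \<open>p\<close> and \<open>q\<close>.\<close>
  define m where "m = a * r + b * s"
  have m: "m > 0"
  proof (cases "a = 0")
    case True then show ?thesis using xy s by (simp add: m_def)
  next
    case False
    then have "a * r > 0" "b * s \<ge> 0" using xy r s by auto
    then show ?thesis by (simp add: m_def)
  qed
  have "(a * r / m) *\<^sub>R p + (b * s / m) *\<^sub>R q \<in> S"
    using m xy r s by (intro convexD[OF assms]) (auto simp: m_def add_divide_distrib[symmetric])
  then have "m *\<^sub>R ((a * r / m) *\<^sub>R p + (b * s / m) *\<^sub>R q) \<in> pcone S" using m by (rule pconeI[rotated])
  then show "a *\<^sub>R x + b *\<^sub>R y \<in> pcone S" using m r s by (simp add: scaleR_add_right)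
qed

text \<open>The minimum of finitely many admissible constants; it extracts one oscillation constant
  from a finite cover.\<close>

lemma finite_uniform_pos:
  assumes "finite S" "\<And>s. s \<in> S \<Longrightarrow> \<exists>e>0::real. P s e"
    "\<And>s e d. P s e \<Longrightarrow> 0 < d \<Longrightarrow> d \<le> e \<Longrightarrow> P s d"
  shows "\<exists>e>0. \<forall>s\<in>S. P s e"
  using assms(1,2)
proof (induction S)
  case empty then show ?case by (intro exI[of _ 1]) auto
next
  case (insert s S)
  obtain e where e: "e > 0" "\<forall>s\<in>S. P s e" using insert by blast
  obtain d where d: "d > 0" "P s d" using insert by blast
  show ?case
    using e d assms(3) by (intro exI[of _ "min d e"]) auto
qed

lemma convex_on_real_intervalI:
  fixes g :: "real \<Rightarrow> real"
  assumes "convex S" "\<And>a b. a \<in> S \<Longrightarrow> b \<in> S \<Longrightarrow> a < b \<Longrightarrow> convex_on {a..b} g"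
  shows "convex_on S g"
proof (rule convex_on_linorderI)
  fix t x y :: real assume "0 < t" "t < 1" "x \<in> S" "y \<in> S" "x < y"
  then show "g ((1 - t) *\<^sub>R x + t *\<^sub>R y) \<le> (1 - t) * g x + t * g y"
    using convex_onD[OF assms(2)[of x y], of t x y] by auto
qed (rule assms)

lemma linear_vimage_open:
  fixes A :: "'v::euclidean_space \<Rightarrow> 'v"
  shows "linear A \<Longrightarrow> open S \<Longrightarrow> open (A -` S)"
  by (simp add: linear_continuous_on linear_conv_bounded_linear open_vimage)

lemma linear_vimage_pcone: "linear A \<Longrightarrow> is_pcone S \<Longrightarrow> is_pcone (A -` S)"
  by (simp add: is_pcone_def linear_scale)

lemma linear_bij_inv:
  fixes A :: "'v::euclidean_space \<Rightarrow> 'v"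
  assumes "linear A" "bij A" shows "linear (inv A)" "bij (inv A)"
  using assms by (auto simp: bij_imp_bij_inv bij_is_inj intro: inj_linear_imp_inv_linear)

lemma bij_scaleR: "r \<noteq> 0 \<Longrightarrow> bij (\<lambda>x::'v::real_vector. r *\<^sub>R x)"
  by (rule bij_betw_byWitness[where f' = "\<lambda>x. (1/r) *\<^sub>R x"]) auto

locale radiant_base = radiant I V \<phi> L \<sigma> u
  for I :: "'i set" and V :: "'i \<Rightarrow> 'v::euclidean_space set" and \<phi> :: "'i \<Rightarrow> 'v \<Rightarrow> 'l"
    and L :: "'l set" and \<sigma> :: "real \<Rightarrow> 'l \<Rightarrow> 'l" and u :: "'l \<Rightarrow> real" +
  fixes i0 :: 'i and x0 :: 'v
  assumes i0: "i0 \<in> I" and x0: "x0 \<in> V i0"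
begin

text \<open>A continuation of the base chart over a convex cone. Two convex cones through
  \<open>x0\<close> meet in a connected set, so sheets agree on overlaps and no monodromy can
  arise.\<close>

definition sheet where
  "sheet S G \<longleftrightarrow> convex S \<and> is_pcone S \<and> x0 \<in> S \<and> loclin G S \<and> agree G (\<phi> i0) x0"

definition E where "E = \<Union>{S. \<exists>G. sheet S G}"

text \<open>Independent of the sheet by \<open>F_eq\<close>; outside \<open>E\<close> the value is
  arbitrary.\<close>

definition F where "F x = (SOME z. \<exists>S G. sheet S G \<and> x \<in> S \<and> z = G x)"

definition U where "U x = u (F x)"

lemma sheet_agree:
  assumes S: "sheet S G" and T: "sheet T H" and x: "x \<in> S" "x \<in> T"
  shows "agree G H x"
proof (rule unique_continuation[where C = "S \<inter> T" and S = "S \<inter> T"])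
  have o: "open (S \<inter> T)" using S T loclin_open by (auto simp: sheet_def)
  show "loclin G (S \<inter> T)" "loclin H (S \<inter> T)"
    using S T o by (auto simp: sheet_def intro: loclin_subset)
  show "connected (S \<inter> T)" using S T by (auto simp: sheet_def intro: convex_connected convex_Int)
  show "x0 \<in> S \<inter> T" "agree G H x0" using S T by (auto simp: sheet_def intro: agree_trans agree_sym)
qed (use x in auto)

lemma F_eq:
  assumes "sheet S G" "x \<in> S" shows "F x = G x"
proof -
  have "\<exists>S' G'. sheet S' G' \<and> x \<in> S' \<and> F x = G' x"
    unfolding F_def by (rule someI_ex) (use assms in blast)
  then obtain S' G' where "sheet S' G'" "x \<in> S'" "F x = G' x" by blast
  then show ?thesis using sheet_agree[OF assms(1)] assms(2) agree_imp_eq by metis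
qed

lemma E_I: "sheet S G \<Longrightarrow> x \<in> S \<Longrightarrow> x \<in> E"
  unfolding E_def by blast

lemma E_E: assumes "x \<in> E" obtains S G where "sheet S G" "x \<in> S" "S \<subseteq> E"
  using assms unfolding E_def by blast

lemma loclin_F: "loclin F E"
  unfolding loclin_def
proof
  fix x assume "x \<in> E"
  then obtain S G where S: "sheet S G" "x \<in> S" "S \<subseteq> E" using E_E by blast
  have "loclin F S" using S(1) F_eq[OF S(1)] by (auto simp: sheet_def intro: loclin_cong)
  then obtain i A W where "i \<in> I" "linear A" "bij A" "open W" "x \<in> W" "W \<subseteq> S"
     "A ` W \<subseteq> V i" "\<And>y. y \<in> W \<Longrightarrow> F y = \<phi> i (A y)"
    using loclinE S(2) by metis
  then show "\<exists>i\<in>I. \<exists>A W. linear A \<and> bij A \<and> open W \<and> x \<in> W \<and> W \<subseteq> E \<and>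
     A ` W \<subseteq> V i \<and> (\<forall>y\<in>W. F y = \<phi> i (A y))"
    using S(3) by (intro bexI[of _ i] exI[of _ A] exI[of _ W]) auto
qed

lemma E_open: "open E" using loclin_F loclin_open by blast

lemma E_0: "0 \<notin> E" using loclin_F loclin_0 by blast

lemma E_cone: "is_pcone E"
  unfolding is_pcone_def
proof (intro ballI allI impI)
  fix x and r :: real assume "x \<in> E" "r > 0"
  then obtain S G where S: "sheet S G" "x \<in> S" "S \<subseteq> E" using E_E by blast
  then show "r *\<^sub>R x \<in> E" using \<open>r > 0\<close> by (auto simp: sheet_def is_pcone_def)
qed

lemma V_pcone: "i \<in> I \<Longrightarrow> is_pcone (V i)"
  using V_cone by (auto simp: is_pcone_def)

lemma base_sheet: "\<exists>S. sheet S (\<phi> i0) \<and> S \<subseteq> V i0"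
proof -
  obtain e where e: "e > 0" "ball x0 e \<subseteq> V i0"
    using V_open[OF i0] x0 open_contains_ball by blast
  define S where "S = pcone (ball x0 e)"
  have sub: "S \<subseteq> V i0" unfolding S_def by (rule pcone_subset[OF V_pcone[OF i0] e(2)])
  have "loclin (\<lambda>x. \<phi> i0 (id x)) S"
    using sub i0 by (intro loclin_plaque) (auto simp: linear_ident bij_id[unfolded id_def] S_def open_pcone)
  then have "loclin (\<phi> i0) S" by simp
  moreover have "x0 \<in> S" using e subset_pcone[of "ball x0 e"] by (auto simp: S_def)
  ultimately have "sheet S (\<phi> i0)"
    unfolding sheet_def S_def using e by (auto simp: convex_pcone is_pcone_pcone agree_def)
  then show ?thesis using sub by blast
qed

lemma x0_E: "x0 \<in> E"
  using base_sheet E_I unfolding sheet_def by blast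

lemma F_base: "agree F (\<phi> i0) x0"
proof -
  obtain S where S: "sheet S (\<phi> i0)" using base_sheet by blast
  show ?thesis
    by (rule agreeI[of S]) (use S F_eq[OF S] loclin_open in \<open>auto simp: sheet_def\<close>)
qed

lemma E_star: assumes "x \<in> E" shows "closed_segment x0 x \<subseteq> E"
proof -
  obtain S G where S: "sheet S G" "x \<in> S" "S \<subseteq> E" using E_E assms by blast
  then show ?thesis using closed_segment_subset[of x0 S x] by (auto simp: sheet_def)
qed

lemma E_connected: "connected E"
  using E_star x0_E by (intro starlike_imp_connected) (auto simp: starlike_def)

lemma loclin_scale:
  assumes G: "loclin G S" and r: "r > 0" shows "loclin (\<lambda>x. \<sigma> r (G x)) S"
  unfolding loclin_def
proof
  fix x assume "x \<in> S"
  then obtain i A W where *: "i \<in> I" "linear A" "bij A" "open W" "x \<in> W" "W \<subseteq> S"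
     "A ` W \<subseteq> V i" "\<And>y. y \<in> W \<Longrightarrow> G y = \<phi> i (A y)"
    using loclinE[OF G] by metis
  have "bij (\<lambda>x. r *\<^sub>R A x)"
    using bij_comp[OF \<open>bij A\<close> bij_scaleR[of r]] r by (simp add: comp_def)
  moreover have "linear (\<lambda>x. r *\<^sub>R A x)" using * by (simp add: linear_compose_scale_right)
  ultimately show "\<exists>i\<in>I. \<exists>A W. linear A \<and> bij A \<and> open W \<and> x \<in> W \<and> W \<subseteq> S \<and>
     A ` W \<subseteq> V i \<and> (\<forall>y\<in>W. \<sigma> r (G y) = \<phi> i (A y))"
    using * r by (intro bexI[of _ i] exI[of _ "\<lambda>x. r *\<^sub>R A x"] exI[of _ W])
       (auto simp: \<phi>_scale V_cone image_subset_iff)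
qed

text \<open>Both sides continue the same germ at \<open>x0\<close> over the connected set
  \<open>E\<close>.\<close>

lemma F_scale:
  assumes x: "x \<in> E" and r: "r > 0" shows "F (r *\<^sub>R x) = \<sigma> r (F x)"
proof -
  have lin: "linear (\<lambda>x::'v. r *\<^sub>R x)" by (simp add: linear_iff scaleR_add_right)
  have bij: "bij (\<lambda>x::'v. r *\<^sub>R x)" by (rule bij_scaleR) (use r in auto)
  have vE: "(\<lambda>x. r *\<^sub>R x) -` E = E"
  proof -
    have "y \<in> E" if "r *\<^sub>R y \<in> E" for y
      using is_pconeD[OF E_cone that, of "1/r"] r by simp
    then show ?thesis using is_pconeD[OF E_cone] r by auto
  qed
  have G: "loclin (\<lambda>x. F (r *\<^sub>R x)) E"
    using loclin_compose[OF loclin_F lin bij] vE by simp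
  have H: "loclin (\<lambda>x. \<sigma> r (F x)) E" using loclin_scale[OF loclin_F r] .
  obtain S where S: "sheet S (\<phi> i0)" "S \<subseteq> V i0" using base_sheet by blast
  have "agree (\<lambda>x. F (r *\<^sub>R x)) (\<lambda>x. \<sigma> r (F x)) x0"
  proof (rule agreeI[of S])
    show "open S" "x0 \<in> S" using S loclin_open by (auto simp: sheet_def)
    fix y assume y: "y \<in> S"
    then have "r *\<^sub>R y \<in> S" using S r by (auto simp: sheet_def is_pcone_def)
    then show "F (r *\<^sub>R y) = \<sigma> r (F y)"
      using y F_eq[OF S(1)] S(2) \<phi>_scale[OF i0 _ r] by auto
  qed
  then have "agree (\<lambda>x. F (r *\<^sub>R x)) (\<lambda>x. \<sigma> r (F x)) x"
    using unique_continuation[OF G H E_connected order_refl x0_E _ x] by blast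
  then show ?thesis using agree_imp_eq by blast
qed

text \<open>Continuation of \<open>F\<close> along a ray: a thin cone around the segment from \<open>x0\<close> to \<open>w\<close> is a
  union of two convex pieces that overlap in a convex set, so the two local maps fit together.\<close>

lemma extend:
  assumes x: "x \<in> E" "x \<in> B" "x \<in> closed_segment x0 w" and w: "w \<in> B"
    and B: "convex B" "is_pcone B" "loclin G B" and ag: "agree F G x"
  shows "w \<in> E"
proof -
  have oB: "open B" using B loclin_open by blast
  have sub1: "closed_segment x0 x \<subseteq> E" using E_star x by blast
  have sub2: "closed_segment x w \<subseteq> B" using B x w closed_segment_subset by blast
  obtain d1 where d1: "d1 > 0" "(\<Union>y\<in>closed_segment x0 x. ball y d1) \<subseteq> E"
    using compact_subset_open_imp_ball_epsilon_subset[OF compact_segment E_open sub1] by metis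
  obtain d2 where d2: "d2 > 0" "(\<Union>y\<in>closed_segment x w. ball y d2) \<subseteq> B"
    using compact_subset_open_imp_ball_epsilon_subset[OF compact_segment oB sub2] by metis
  define d where "d = min d1 d2"
  have d: "d > 0" "d \<le> d1" "d \<le> d2" using d1 d2 by (auto simp: d_def)
  \<comment> \<open>The Minkowski sum of \<open>S\<close> with a ball, hence convex together with
    \<open>S\<close>.\<close>
  define tube where "tube S = (\<Union>y\<in>S. ball y d)" for S :: "'v set"
  have tube_eq: "tube S = (\<Union>a\<in>S. \<Union>b\<in>ball 0 d. {a + b})" for S
  proof (intro set_eqI iffI)
    fix z assume "z \<in> tube S"
    then obtain a where "a \<in> S" "z - a \<in> ball 0 d"
      by (auto simp: tube_def dist_norm norm_minus_commute)
    then show "z \<in> (\<Union>a\<in>S. \<Union>b\<in>ball 0 d. {a + b})"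
      by (intro UN_I[of a] UN_I[of "z - a"]) auto
  next
    fix z assume "z \<in> (\<Union>a\<in>S. \<Union>b\<in>ball 0 d. {a + b})"
    then obtain a b where "a \<in> S" "norm b < d" "z = a + b" by auto
    then show "z \<in> tube S" unfolding tube_def by (intro UN_I[of a]) (auto simp: dist_norm)
  qed
  have tube_convex: "convex (tube S)" if "convex S" for S
    unfolding tube_eq by (intro convex_sums that convex_ball)
  have tube_open: "open (tube S)" for S by (auto simp: tube_def)
  have in_tube: "y \<in> tube S" if "y \<in> S" for y S unfolding tube_def using that d by (intro UN_I[of y]) auto
  define N1 N2 where "N1 = pcone (tube (closed_segment x0 x))" and "N2 = pcone (tube (closed_segment x w))"
  \<comment> \<open>The union is the cone over a tube around the whole segment. This is why it is
    convex, although unions of convex sets usually are not.\<close>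
  have N12: "N1 \<union> N2 = pcone (tube (closed_segment x0 w))"
  proof -
    have "closed_segment x0 w = closed_segment x0 x \<union> closed_segment x w"
      using x(3) Un_closed_segment by blast
    then show ?thesis by (simp add: N1_def N2_def tube_def pcone_Un)
  qed
  have conv: "convex N1" "convex N2" "convex (N1 \<union> N2)"
    unfolding N12 by (auto simp: N1_def N2_def intro: convex_pcone tube_convex)
  have op: "open N1" "open N2" by (auto simp: N1_def N2_def open_pcone tube_open)
  have sub: "N1 \<subseteq> E" "N2 \<subseteq> B"
  proof -
    have "tube (closed_segment x0 x) \<subseteq> (\<Union>y\<in>closed_segment x0 x. ball y d1)"
      unfolding tube_def by (rule UN_mono[OF order_refl subset_ball]) (rule d)
    moreover have "tube (closed_segment x w) \<subseteq> (\<Union>y\<in>closed_segment x w. ball y d2)"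
      unfolding tube_def by (rule UN_mono[OF order_refl subset_ball]) (rule d)
    ultimately show "N1 \<subseteq> E" "N2 \<subseteq> B"
      unfolding N1_def N2_def using d1(2) d2(2) by (meson pcone_subset E_cone B(2) order_trans)+
  qed
  have xN: "x \<in> N1 \<inter> N2" "x0 \<in> N1" "w \<in> N2"
    using subset_pcone in_tube unfolding N1_def N2_def by (meson IntI ends_in_segment subset_iff)+
  have N: "agree F G y" if "y \<in> N1 \<inter> N2" for y
  proof (rule unique_continuation[where S = "N1 \<inter> N2" and C = "N1 \<inter> N2"])
    show "loclin F (N1 \<inter> N2)" using loclin_subset[OF loclin_F] op sub by blast
    show "loclin G (N1 \<inter> N2)" using loclin_subset[OF B(3)] op sub by blast
    show "connected (N1 \<inter> N2)" using conv by (intro convex_connected convex_Int)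
  qed (use xN ag that in auto)
  \<comment> \<open>\<open>F\<close> and \<open>G\<close> agree on the convex overlap, so the glued
    map is locally linear on both pieces and the union is a sheet that contains
    \<open>w\<close>.\<close>
  define H where "H y = (if y \<in> N1 then F y else G y)" for y
  have H1: "loclin H N1" using loclin_subset[OF loclin_F op(1) sub(1)] by (rule loclin_cong) (simp add: H_def)
  have H2: "loclin H N2" using loclin_subset[OF B(3) op(2) sub(2)]
  proof (rule loclin_cong)
    fix y assume "y \<in> N2" then show "G y = H y"
      using N[of y] agree_imp_eq[of F G y] by (auto simp: H_def)
  qed
  have "agree H F x0" by (rule agreeI[of N1]) (use op xN in \<open>auto simp: H_def\<close>)
  then have "agree H (\<phi> i0) x0" using F_base agree_trans by blast
  moreover have "is_pcone (N1 \<union> N2)" unfolding N12 by (rule is_pcone_pcone)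
  ultimately have "sheet (N1 \<union> N2) H"
    using conv xN loclin_Un[OF H1 H2] by (auto simp: sheet_def)
  then show ?thesis using E_I xN by blast
qed

end

section \<open>Relative variation of a homogeneous convex function\<close>

section \<open>Oscillation on plaques\<close>

context radiant_base
begin

lemma F_L: "x \<in> E \<Longrightarrow> F x \<in> L"
  using loclin_L[OF loclin_F] .

lemma U_neg: "x \<in> E \<Longrightarrow> U x < 0"
  unfolding U_def using u_neg F_L by blast

lemma U_scale: "x \<in> E \<Longrightarrow> r > 0 \<Longrightarrow> U (r *\<^sub>R x) = r * U x"
  unfolding U_def by (simp add: F_scale u_scale F_L)

lemma loclin_u_cont:
  assumes G: "loclin G S" shows "continuous_on S (\<lambda>x. u (G x))"
proof (rule continuous_at_imp_continuous_on, rule ballI)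
  fix x assume "x \<in> S"
  then obtain i A W where *: "i \<in> I" "linear A" "bij A" "open W" "x \<in> W" "W \<subseteq> S"
     "A ` W \<subseteq> V i" "\<And>y. y \<in> W \<Longrightarrow> G y = \<phi> i (A y)"
    using loclinE[OF G] by metis
  have "continuous_on W (\<lambda>y. u (\<phi> i (A y)))"
    using continuous_on_compose2[OF u_cont[OF *(1)], of W A] * linear_continuous_on[of A W]
    by (auto simp: linear_conv_bounded_linear)
  then have "continuous_on W (\<lambda>y. u (G y))" using * by (simp cong: continuous_on_cong)
  then show "isCont (\<lambda>x. u (G x)) x" using * continuous_on_eq_continuous_at by blast
qed

lemma U_cont: "continuous_on E U"
  unfolding U_def using loclin_u_cont[OF loclin_F] .

text \<open>The convexity axiom transported to \<open>E\<close> by a linear chart. The points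
  \<open>x - v\<close> and \<open>x + v\<close> add up to \<open>2 *\<^sub>R x\<close>, where
  homogeneity evaluates \<open>U\<close>; this is the midpoint form that
  \<open>convex_on_local_midpoint\<close> asks for.\<close>

lemma U_local:
  assumes x: "x \<in> E"
  shows "\<exists>d>0. \<forall>v. norm v < d \<longrightarrow> x - v \<in> E \<and> x + v \<in> E \<and> 2 * U x \<le> U (x - v) + U (x + v) \<and>
     ((\<nexists>r. v = r *\<^sub>R x) \<longrightarrow> 2 * U x < U (x - v) + U (x + v))"
proof -
  obtain i C where C: "i \<in> I" "open C" "convex C" "C \<subseteq> V i" "F x \<in> \<phi> i ` C"
    and sub: "\<And>a b. a \<in> C \<Longrightarrow> b \<in> C \<Longrightarrow> u (\<phi> i (a + b)) \<le> u (\<phi> i a) + u (\<phi> i b) \<and>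
        ((\<nexists>r. b = r *\<^sub>R a) \<longrightarrow> u (\<phi> i (a + b)) < u (\<phi> i a) + u (\<phi> i b))"
    using u_convex[OF F_L[OF x]] by metis
  obtain c where c: "c \<in> C" "F x = \<phi> i c" using C by blast
  obtain A W where A: "linear A" "bij A" "open W" "x \<in> W" "W \<subseteq> E"
     "A ` W \<subseteq> V i" "\<And>z. z \<in> W \<Longrightarrow> F z = \<phi> i (A z)" "A x = c"
    using loclin_chart[OF loclin_F x C(1) subsetD[OF C(4) c(1)] c(2)] by metis
  have "open (W \<inter> A -` C)" using A C linear_vimage_open by blast
  moreover have "x \<in> W \<inter> A -` C" using A c by auto
  ultimately obtain d where d: "d > 0" "ball x d \<subseteq> W \<inter> A -` C" using open_contains_ball by blast
  have x0: "x \<noteq> 0" using E_0 x by auto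
  show ?thesis
  proof (intro exI[of _ d] conjI d allI impI)
    fix v :: 'v assume v: "norm v < d"
    have m: "x - v \<in> W \<inter> A -` C" "x + v \<in> W \<inter> A -` C"
      using d v by (auto simp: dist_norm subset_iff)
    then show "x - v \<in> E" "x + v \<in> E" using A by auto
    have U: "U (x - v) = u (\<phi> i (A (x - v)))" "U (x + v) = u (\<phi> i (A (x + v)))"
      using m A by (auto simp: U_def)
    have "A (x - v) + A (x + v) = 2 *\<^sub>R A x" using A(1) by (simp add: linear_add linear_diff scaleR_2)
    then have U2: "u (\<phi> i (A (x - v) + A (x + v))) = 2 * U x"
      using C A c \<phi>_scale[OF C(1) subsetD[OF C(4) c(1)], of 2] u_scale[OF F_L[OF x], of 2] by (simp add: U_def)
    show "2 * U x \<le> U (x - v) + U (x + v)"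
      using sub[of "A (x - v)" "A (x + v)"] m U U2 by auto
    assume nr: "\<nexists>r. v = r *\<^sub>R x"
    \<comment> \<open>Proportional end points would give
      \<open>(1 + r) *\<^sub>R v = (r - 1) *\<^sub>R x\<close>; then \<open>v\<close> is radial, or
      \<open>r = -1\<close> and \<open>x\<close> vanishes.\<close>
    have "\<nexists>r. A (x + v) = r *\<^sub>R A (x - v)"
    proof
      assume "\<exists>r. A (x + v) = r *\<^sub>R A (x - v)"
      then obtain r where "A (x + v) = A (r *\<^sub>R (x - v))" using linear_scale[OF A(1)] by metis
      then have "x + v = r *\<^sub>R (x - v)" using A(2) by (metis bij_pointE)
      moreover have "(1 + r) *\<^sub>R v - (r - 1) *\<^sub>R x = (x + v) - r *\<^sub>R (x - v)" by (simp add: algebra_simps)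
      ultimately have eq: "(1 + r) *\<^sub>R v = (r - 1) *\<^sub>R x" by simp
      show False
      proof (cases "1 + r = 0")
        case True then show False using eq x0 by auto
      next
        case False
        then have "v = ((r - 1) / (1 + r)) *\<^sub>R x"
          using arg_cong[OF eq, of "\<lambda>z. (1 / (1 + r)) *\<^sub>R z"] by simp
        then show False using nr by blast
      qed
    qed
    then show "2 * U x < U (x - v) + U (x + v)"
      using sub[of "A (x - v)" "A (x + v)"] m U U2 by auto
  qed
qed

lemma U_line_convex:
  assumes "convex S" and E: "\<And>t. t \<in> S \<Longrightarrow> x + t *\<^sub>R v \<in> E"
  shows "convex_on S (\<lambda>t. U (x + t *\<^sub>R v))"
proof (rule convex_on_real_intervalI[OF assms(1)])
  fix a b :: real assume ab: "a \<in> S" "b \<in> S" "a < b"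
  have in_S: "t \<in> S" if "t \<in> {a..b}" for t
    using assms(1) ab that mem_is_interval_1_I[of S a b t] by (auto simp: is_interval_convex_1)
  show "convex_on {a..b} (\<lambda>t. U (x + t *\<^sub>R v))"
  proof (rule convex_on_local_midpoint)
    show "continuous_on {a..b} (\<lambda>t. U (x + t *\<^sub>R v))"
      by (rule continuous_on_compose2[OF U_cont]) (auto intro!: continuous_intros E in_S)
    fix t assume t: "a < t" "t < b"
    then have "x + t *\<^sub>R v \<in> E" using E in_S by auto
    then obtain d where d: "d > 0" "\<And>w. norm w < d \<Longrightarrow>
       2 * U (x + t *\<^sub>R v) \<le> U (x + t *\<^sub>R v - w) + U (x + t *\<^sub>R v + w)"
      using U_local by blast
    show "\<exists>d>0. \<forall>h. 0 < h \<and> h < d \<longrightarrow> 2 * U (x + t *\<^sub>R v) \<le> U (x + (t - h) *\<^sub>R v) + U (x + (t + h) *\<^sub>R v)"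
    \<comment> \<open>The summand \<open>1\<close> in the denominator covers
      \<open>v = 0\<close>.\<close>
    proof (intro exI[of _ "d / (norm v + 1)"] conjI allI impI)
      fix h assume h: "0 < h \<and> h < d / (norm v + 1)"
      have "norm (h *\<^sub>R v) \<le> h * (norm v + 1)" using h by (simp add: mult_left_mono)
      also have "\<dots> < d" using h by (simp add: pos_less_divide_eq add_nonneg_pos)
      finally show "2 * U (x + t *\<^sub>R v) \<le> U (x + (t - h) *\<^sub>R v) + U (x + (t + h) *\<^sub>R v)"
        using d(2)[of "h *\<^sub>R v"] by (simp add: scaleR_add_left scaleR_diff_left algebra_simps)
    qed (use d in \<open>simp add: add_nonneg_pos\<close>)
  qed
qed

text \<open>A negative function that is strictly subadditive and homogeneous cannot be constant to first
  order in any direction: transversally because of strictness, radially because of homogeneity.\<close>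

lemma chart_oscillation:
  assumes i: "i \<in> I" and C: "C \<subseteq> V i" "cball c (3 * \<rho>) \<subseteq> C" "\<rho> > 0"
    and sub: "\<And>a b. a \<in> C \<Longrightarrow> b \<in> C \<Longrightarrow> (\<nexists>r. b = r *\<^sub>R a) \<Longrightarrow> u (\<phi> i (a + b)) < u (\<phi> i a) + u (\<phi> i b)"
  shows "\<exists>\<eta>>0. \<forall>y\<in>cball c \<rho>. \<forall>w. norm w = \<rho> \<longrightarrow>
    \<eta> * \<bar>u (\<phi> i y)\<bar> \<le> \<bar>u (\<phi> i (y + w)) - u (\<phi> i y)\<bar> \<or> \<eta> * \<bar>u (\<phi> i y)\<bar> \<le> \<bar>u (\<phi> i (y - w)) - u (\<phi> i y)\<bar>"
proof -
  define f where "f y = u (\<phi> i y)" for y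
  have contf: "continuous_on (V i) f" unfolding f_def using u_cont[OF i] .
  have L: "\<phi> i y \<in> L" if "y \<in> V i" for y using that i L_cover by auto
  have in_C: "y + w \<in> C" "y - w \<in> C" "y \<in> C" if "dist c y \<le> \<rho>" "norm w = \<rho>" for y w
  proof -
    have "dist c (y + w) \<le> dist c y + norm w"
      using dist_triangle[of c "y + w" y] by (simp add: dist_norm)
    moreover have "dist c (y - w) \<le> dist c y + norm w"
      using dist_triangle[of c "y - w" y] by (simp add: dist_norm)
    ultimately show "y + w \<in> C" "y - w \<in> C" "y \<in> C" using C that by (auto simp: subset_iff)
  qed
  \<comment> \<open>The relative change, with the better of the two opposite directions. It is
    continuous on a compact set, so its positive minimum is the constant sought.\<close>
  define q where "q = (\<lambda>(y, w). max \<bar>f (y + w) - f y\<bar> \<bar>f (y - w) - f y\<bar> / \<bar>f y\<bar>)"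
  define K where "K = cball c \<rho> \<times> sphere (0::'v) \<rho>"
  have neg: "f y < 0" if "y \<in> C" for y using u_neg L C that by (auto simp: f_def)
  have KC: "fst p + snd p \<in> C" "fst p - snd p \<in> C" "fst p \<in> C" if "p \<in> K" for p
    using in_C[of "fst p" "snd p"] that by (auto simp: K_def)
  have contK: "continuous_on K (\<lambda>p. f (fst p + snd p))" "continuous_on K (\<lambda>p. f (fst p - snd p))"
    "continuous_on K (\<lambda>p. f (fst p))"
    using KC C by (auto intro!: continuous_on_compose2[OF contf] continuous_intros)
  have nz: "\<bar>f (fst p)\<bar> \<noteq> 0" if "p \<in> K" for p using neg[OF KC(3)[OF that]] by simp
  have contq: "continuous_on K q"
    unfolding q_def case_prod_beta
    by (intro continuous_on_divide continuous_on_max continuous_on_rabs continuous_on_diff contK ballI nz)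
  have posq: "q p > 0" if p: "p \<in> K" for p
  proof -
    obtain y w where yw: "p = (y, w)" "dist c y \<le> \<rho>" "norm w = \<rho>" using p by (auto simp: K_def)
    note m = in_C[OF yw(2,3)]
    have y0: "y \<noteq> 0" "w \<noteq> 0" using m(3) C V_0[OF i] yw(3) by auto
    have scale: "f (r *\<^sub>R y) = r * f y" if "r > 0" for r
      using \<phi>_scale[OF i _ that, of y] u_scale[OF L that, of y] m C by (auto simp: f_def)
    have "f (y + w) \<noteq> f y \<or> f (y - w) \<noteq> f y"
    proof (cases "\<exists>r. w = r *\<^sub>R y")
      \<comment> \<open>Radial direction: one of \<open>1 + r\<close> and \<open>1 - r\<close> is
        greater than \<open>1\<close>, and homogeneity changes the value by that factor.\<close>
      case True
      then obtain r where r: "w = r *\<^sub>R y" by blast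
      then have "r \<noteq> 0" using y0 by auto
      have "y + w = (1 + r) *\<^sub>R y" "y - w = (1 - r) *\<^sub>R y" using r by (auto simp: algebra_simps)
      then show ?thesis
        using scale[of "1 + r"] scale[of "1 - r"] neg[OF m(3)] \<open>r \<noteq> 0\<close> by (cases "r > 0") auto
    next
      case False
      have "\<nexists>r. y - w = r *\<^sub>R (y + w)"
      proof
        assume "\<exists>r. y - w = r *\<^sub>R (y + w)"
        then obtain r where "y - w = r *\<^sub>R (y + w)" by blast
        moreover have "(1 + r) *\<^sub>R w - (1 - r) *\<^sub>R y = r *\<^sub>R (y + w) - (y - w)" by (simp add: algebra_simps)
        ultimately have eq: "(1 + r) *\<^sub>R w = (1 - r) *\<^sub>R y" by simp
        show False
        proof (cases "1 + r = 0")
          case True then show False using eq y0 by auto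
        next
          case nz: False
          then have "w = ((1 - r) / (1 + r)) *\<^sub>R y"
            using arg_cong[OF eq, of "\<lambda>z. (1 / (1 + r)) *\<^sub>R z"] by simp
          then show False using False by blast
        qed
      qed
      \<comment> \<open>If both \<open>f (y + w)\<close> and \<open>f (y - w)\<close> were equal to
        \<open>f y\<close>, this would read \<open>2 * f y < 2 * f y\<close>.\<close>
      then have "f ((y + w) + (y - w)) < f (y + w) + f (y - w)" unfolding f_def by (rule sub[OF m(1,2)])
      moreover have "(y + w) + (y - w) = 2 *\<^sub>R y" by (simp add: scaleR_2)
      ultimately show ?thesis using scale[of 2] by auto
    qed
    then have "max \<bar>f (y + w) - f y\<bar> \<bar>f (y - w) - f y\<bar> > 0" by (auto simp: less_max_iff_disj)
    moreover have "\<bar>f y\<bar> > 0" using neg[OF m(3)] by simp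
    ultimately show ?thesis unfolding q_def yw(1) by (simp only: case_prod_conv divide_pos_pos)
  qed
  have "compact K" unfolding K_def by (intro compact_Times) auto
  moreover have "K \<noteq> {}"
  proof -
    obtain w :: 'v where "norm w = \<rho>" using vector_choose_size[of \<rho>] C by auto
    then show ?thesis using C by (auto simp: K_def)
  qed
  ultimately obtain p where p: "p \<in> K" "\<And>p'. p' \<in> K \<Longrightarrow> q p \<le> q p'"
    using continuous_attains_inf[OF _ _ contq] by blast
  have "q p * \<bar>f y\<bar> \<le> max \<bar>f (y + w) - f y\<bar> \<bar>f (y - w) - f y\<bar>" if "y \<in> cball c \<rho>" "norm w = \<rho>" for y w
  proof -
    have "q p \<le> q (y, w)" using p(2) that by (auto simp: K_def)
    then have "q p * \<bar>f y\<bar> \<le> q (y, w) * \<bar>f y\<bar>" by (rule mult_right_mono) auto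
    moreover have "f y \<noteq> 0" using neg[OF in_C(3)] that by fastforce
    ultimately show ?thesis by (simp add: q_def)
  qed
  then show ?thesis using posq[OF p(1)] unfolding f_def le_max_iff_disj by blast
qed

text \<open>One \<open>\<eta>\<close> serves all points and directions: finitely many chart balls
  cover everything up to scaling, and scaling does not alter the relative change of
  \<open>u\<close>. The step length \<open>l\<close> is not uniform; it is whatever the plaque
  \<open>B\<close> through \<open>x\<close> permits in the direction \<open>v\<close>.\<close>

lemma oscillation:
  "\<exists>\<eta>>0. \<forall>x\<in>E. \<forall>v. v \<noteq> 0 \<longrightarrow> (\<exists>l>0. \<exists>B G. convex B \<and> is_pcone B \<and> loclin G B \<and> agree F G x \<and>
     x \<in> B \<and> x + l *\<^sub>R v \<in> B \<and> x - l *\<^sub>R v \<in> B \<and>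
     (\<eta> * \<bar>U x\<bar> \<le> \<bar>u (G (x + l *\<^sub>R v)) - U x\<bar> \<or> \<eta> * \<bar>U x\<bar> \<le> \<bar>u (G (x - l *\<^sub>R v)) - U x\<bar>))"
proof -
  \<comment> \<open>The factor \<open>3\<close> leaves room for balls of radius
    \<open>2 * \<rho>\<close> around all points of the inner ball.\<close>
  define good where "good i c \<rho> \<eta> \<longleftrightarrow> cball c (3 * \<rho>) \<subseteq> V i \<and> (\<forall>y\<in>cball c \<rho>. \<forall>w. norm w = \<rho> \<longrightarrow>
    \<eta> * \<bar>u (\<phi> i y)\<bar> \<le> \<bar>u (\<phi> i (y + w)) - u (\<phi> i y)\<bar> \<or> \<eta> * \<bar>u (\<phi> i y)\<bar> \<le> \<bar>u (\<phi> i (y - w)) - u (\<phi> i y)\<bar>)"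
    for i c \<rho> \<eta>
  define \<O> where "\<O> = {(i, T). i \<in> I \<and> (\<exists>c \<rho> \<eta>. \<rho> > 0 \<and> \<eta> > 0 \<and> T = ball c \<rho> \<and> good i c \<rho> \<eta>)}"
  have "\<exists>\<O>'\<subseteq>\<O>. finite \<O>' \<and> (\<forall>z\<in>L. \<exists>(i, T)\<in>\<O>'. \<exists>r>0. \<exists>x\<in>T. z = \<sigma> r (\<phi> i x))"
  proof (rule compactness)
    fix i T assume "(i, T) \<in> \<O>"
    then obtain c \<rho> \<eta> where "i \<in> I" "\<rho> > 0" "T = ball c \<rho>" "cball c (3 * \<rho>) \<subseteq> V i"
      by (auto simp: \<O>_def good_def)
    moreover have "ball c \<rho> \<subseteq> cball c (3 * \<rho>)" using \<open>\<rho> > 0\<close> by auto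
    ultimately show "i \<in> I \<and> open T \<and> T \<subseteq> V i" by auto
  next
    fix z assume "z \<in> L"
    then obtain i C where C: "i \<in> I" "open C" "convex C" "C \<subseteq> V i" "z \<in> \<phi> i ` C"
      and sub: "\<And>a b. a \<in> C \<Longrightarrow> b \<in> C \<Longrightarrow> (\<nexists>r. b = r *\<^sub>R a) \<Longrightarrow> u (\<phi> i (a + b)) < u (\<phi> i a) + u (\<phi> i b)"
      using u_convex by metis
    obtain c where c: "c \<in> C" "z = \<phi> i c" using C by blast
    obtain e where e: "e > 0" "cball c e \<subseteq> C" using C c open_contains_cball by blast
    have "cball c (3 * (e/3)) \<subseteq> C" "e/3 > 0" using e by auto
    from chart_oscillation[OF C(1) C(4) this sub]
    obtain \<eta> where "\<eta> > 0" "good i c (e/3) \<eta>" unfolding good_def using e C by auto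
    then have "\<exists>c' \<rho> \<eta>. \<rho> > 0 \<and> \<eta> > 0 \<and> ball c (e/3) = ball c' \<rho> \<and> good i c' \<rho> \<eta>"
      using e by (intro exI[of _ c] exI[of _ "e/3"] exI[of _ \<eta>]) auto
    then have "(i, ball c (e/3)) \<in> \<O>" "z \<in> \<phi> i ` ball c (e/3)" using C c e by (auto simp: \<O>_def)
    then show "\<exists>(i, T)\<in>\<O>. z \<in> \<phi> i ` T" by blast
  qed
  then obtain \<O>' where O': "\<O>' \<subseteq> \<O>" "finite \<O>'"
    "\<And>z. z \<in> L \<Longrightarrow> \<exists>(i, T)\<in>\<O>'. \<exists>r>0. \<exists>x\<in>T. z = \<sigma> r (\<phi> i x)" by blast
  have "\<exists>\<eta>>0. \<forall>p\<in>\<O>'. fst p \<in> I \<and> (\<exists>c \<rho>. \<rho> > 0 \<and> snd p = ball c \<rho> \<and> good (fst p) c \<rho> \<eta>)"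
  proof (rule finite_uniform_pos[OF O'(2)])
    fix p assume "p \<in> \<O>'"
    then show "\<exists>\<eta>>0. fst p \<in> I \<and> (\<exists>c \<rho>. \<rho> > 0 \<and> snd p = ball c \<rho> \<and> good (fst p) c \<rho> \<eta>)"
    proof (cases p)
      case (Pair i T)
      then have "(i, T) \<in> \<O>" using \<open>p \<in> \<O>'\<close> O'(1) by auto
      then obtain c \<rho> \<eta> where "i \<in> I" "\<rho> > 0" "\<eta> > 0" "T = ball c \<rho>" "good i c \<rho> \<eta>"
        unfolding \<O>_def by blast
      then show ?thesis unfolding Pair fst_conv snd_conv by blast
    qed
  next
    fix p and e d :: real assume "fst p \<in> I \<and> (\<exists>c \<rho>. \<rho> > 0 \<and> snd p = ball c \<rho> \<and> good (fst p) c \<rho> e)"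
      and d: "0 < d" "d \<le> e"
    then obtain c \<rho> where c: "fst p \<in> I" "\<rho> > 0" "snd p = ball c \<rho>" "good (fst p) c \<rho> e" by blast
    have "d * \<bar>a\<bar> \<le> e * \<bar>a\<bar>" for a :: real using d by (intro mult_right_mono) auto
    then have "good (fst p) c \<rho> d" using c(4) unfolding good_def by (meson order_trans)
    then show "fst p \<in> I \<and> (\<exists>c \<rho>. \<rho> > 0 \<and> snd p = ball c \<rho> \<and> good (fst p) c \<rho> d)" using c by blast
  qed
  then obtain \<eta> where \<eta>: "\<eta> > 0"
    "\<And>p. p \<in> \<O>' \<Longrightarrow> fst p \<in> I \<and> (\<exists>c \<rho>. \<rho> > 0 \<and> snd p = ball c \<rho> \<and> good (fst p) c \<rho> \<eta>)" by blast
  show ?thesis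
  proof (rule exI[of _ \<eta>], intro conjI \<eta>(1) ballI allI impI)
    fix x v :: 'v assume x: "x \<in> E" and v: "v \<noteq> 0"
    obtain i T r y where iT: "(i, T) \<in> \<O>'" "r > 0" "y \<in> T" "F x = \<sigma> r (\<phi> i y)"
      using O'(3)[OF F_L[OF x]] by auto
    obtain c \<rho> where c: "i \<in> I" "\<rho> > 0" "T = ball c \<rho>" and g: "good i c \<rho> \<eta>"
      using \<eta>(2)[OF iT(1)] by auto
    have sub: "ball y (2 * \<rho>) \<subseteq> V i"
    proof
      fix z assume "z \<in> ball y (2 * \<rho>)"
      then have "dist c z \<le> 3 * \<rho>" using iT(3) c(3) dist_triangle[of c z y] by simp
      then show "z \<in> V i" using g by (auto simp: good_def)
    qed
    have yV: "y \<in> V i" using sub c by auto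
    have Fx: "F x = \<phi> i (r *\<^sub>R y)" using iT c \<phi>_scale[OF c(1) yV] by simp
    obtain A W where A: "linear A" "bij A" "open W" "x \<in> W" "W \<subseteq> E"
      "A ` W \<subseteq> V i" "\<And>z. z \<in> W \<Longrightarrow> F z = \<phi> i (A z)" "A x = r *\<^sub>R y"
      using loclin_chart[OF loclin_F x c(1) V_cone[OF c(1) yV iT(2)] Fx] by metis
    have "A v \<noteq> A 0" using A(2) v by (metis bij_pointE)
    then have Av: "A v \<noteq> 0" using linear_0[OF A(1)] by simp
    \<comment> \<open>The length for which the chart carries \<open>x + l *\<^sub>R v\<close> to
      \<open>r *\<^sub>R (y + w)\<close> with \<open>norm w = \<rho>\<close>, where
      \<open>A x = r *\<^sub>R y\<close>.\<close>
    define l where "l = \<rho> * r / norm (A v)"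
    define w where "w = (\<rho> / norm (A v)) *\<^sub>R A v"
    have nw: "norm w = \<rho>" using Av c by (simp add: w_def)
    have lA: "l *\<^sub>R A v = r *\<^sub>R w" by (simp add: l_def w_def)
    have Axl: "A (x + l *\<^sub>R v) = r *\<^sub>R (y + w)" "A (x - l *\<^sub>R v) = r *\<^sub>R (y - w)"
      using A(1,8) lA by (auto simp: linear_add linear_diff linear_scale scaleR_add_right scaleR_diff_right)
    \<comment> \<open>The plaque is the whole cone over the ball, pulled back to \<open>E\<close>,
      because \<open>extend\<close> continues along cones.\<close>
    define B where "B = A -` pcone (ball y (2 * \<rho>))"
    have yw: "y + w \<in> ball y (2*\<rho>)" "y - w \<in> ball y (2*\<rho>)" using nw c by (auto simp: dist_norm)
    have "convex B" unfolding B_def using A by (intro convex_linear_vimage convex_pcone convex_ball)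
    moreover have "is_pcone B" unfolding B_def using A by (intro linear_vimage_pcone is_pcone_pcone)
    moreover have "loclin (\<lambda>z. \<phi> i (A z)) B"
      unfolding B_def using A c pcone_subset[OF V_pcone[OF c(1)] sub]
      by (intro loclin_plaque linear_vimage_open open_pcone) auto
    moreover have "agree F (\<lambda>z. \<phi> i (A z)) x" using A by (intro agreeI[of W])
    moreover have "x \<in> B" "x + l *\<^sub>R v \<in> B" "x - l *\<^sub>R v \<in> B"
      unfolding B_def vimage_eq Axl A(8) using yw iT(2) c(2) by (auto intro!: pconeI)
    moreover have "\<eta> * \<bar>U x\<bar> \<le> \<bar>u (\<phi> i (A (x + l *\<^sub>R v))) - U x\<bar> \<or> \<eta> * \<bar>U x\<bar> \<le> \<bar>u (\<phi> i (A (x - l *\<^sub>R v))) - U x\<bar>"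
    proof -
      have yv: "y + w \<in> V i" "y - w \<in> V i" using yw sub by auto
      have L: "\<phi> i z \<in> L" if "z \<in> V i" for z using that c(1) L_cover by auto
      have eqs: "u (\<phi> i (A (x + l *\<^sub>R v))) = r * u (\<phi> i (y + w))"
        "u (\<phi> i (A (x - l *\<^sub>R v))) = r * u (\<phi> i (y - w))" "U x = r * u (\<phi> i y)"
        unfolding Axl U_def Fx using yv yV iT(2) c(1) L by (simp_all add: \<phi>_scale u_scale)
      have "\<eta> * \<bar>u (\<phi> i y)\<bar> \<le> \<bar>u (\<phi> i (y + w)) - u (\<phi> i y)\<bar> \<or> \<eta> * \<bar>u (\<phi> i y)\<bar> \<le> \<bar>u (\<phi> i (y - w)) - u (\<phi> i y)\<bar>"
        using g nw iT(3) c(3) unfolding good_def by auto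
      then have "r * (\<eta> * \<bar>u (\<phi> i y)\<bar>) \<le> r * \<bar>u (\<phi> i (y + w)) - u (\<phi> i y)\<bar> \<or> r * (\<eta> * \<bar>u (\<phi> i y)\<bar>) \<le> r * \<bar>u (\<phi> i (y - w)) - u (\<phi> i y)\<bar>"
        using iT(2) by simp
      moreover have "r * \<bar>a - b\<bar> = \<bar>r * a - r * b\<bar>" for a b using iT(2) by (simp add: abs_mult right_diff_distrib[symmetric])
      moreover have "r * (\<eta> * \<bar>u (\<phi> i y)\<bar>) = \<eta> * \<bar>r * u (\<phi> i y)\<bar>" using iT(2) by (simp add: abs_mult)
      ultimately show ?thesis unfolding eqs by simp
    qed
    moreover have "l > 0" using c iT Av by (simp add: l_def)
    ultimately show "\<exists>l>0. \<exists>B G. convex B \<and> is_pcone B \<and> loclin G B \<and> agree F G x \<and>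
     x \<in> B \<and> x + l *\<^sub>R v \<in> B \<and> x - l *\<^sub>R v \<in> B \<and>
     (\<eta> * \<bar>U x\<bar> \<le> \<bar>u (G (x + l *\<^sub>R v)) - U x\<bar> \<or> \<eta> * \<bar>U x\<bar> \<le> \<bar>u (G (x - l *\<^sub>R v)) - U x\<bar>)"
      by (intro exI[of _ l] conjI exI[of _ B] exI[of _ "\<lambda>z. \<phi> i (A z)"])
  qed
qed

end

section \<open>Convexity of the domain, covering property and deck group\<close>

section \<open>Convexity of the domain of continuation\<close>

context radiant_base
begin

text \<open>Near a missing end point the plaques of uniform size would have to become short compared with
  the remaining distance; then the convex, bounded and hence convergent function \<open>U\<close> would
  keep oscillating by a fixed amount.\<close>

lemma closing:
  assumes a: "a > 0" and P: "\<And>t. 0 \<le> t \<Longrightarrow> t < 1 \<Longrightarrow> x0 + t *\<^sub>R (w - x0) \<in> E \<and> U (x0 + t *\<^sub>R (w - x0)) \<le> - a"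
  shows "w \<in> E"
proof (rule ccontr)
  assume w: "w \<notin> E"
  define v where "v = w - x0"
  have v: "v \<noteq> 0" using w x0_E by (auto simp: v_def)
  define g where "g t = U (x0 + t *\<^sub>R v)" for t
  have E: "x0 + t *\<^sub>R v \<in> E" "g t \<le> - a" if "t \<in> {0..<1}" for t
    using P[of t] that by (auto simp: g_def v_def)
  have conv: "convex_on {0..<1} g" unfolding g_def using E by (intro U_line_convex) auto
  obtain \<eta> where \<eta>: "\<eta> > 0" and osc: "\<And>x v. x \<in> E \<Longrightarrow> v \<noteq> 0 \<Longrightarrow> (\<exists>l>0. \<exists>B G. convex B \<and> is_pcone B \<and> loclin G B \<and> agree F G x \<and>
     x \<in> B \<and> x + l *\<^sub>R v \<in> B \<and> x - l *\<^sub>R v \<in> B \<and>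
     (\<eta> * \<bar>U x\<bar> \<le> \<bar>u (G (x + l *\<^sub>R v)) - U x\<bar> \<or> \<eta> * \<bar>U x\<bar> \<le> \<bar>u (G (x - l *\<^sub>R v)) - U x\<bar>))"
    using oscillation by blast
  obtain d where d: "d \<in> {0..<1}" "\<And>s t. s \<in> {d..<1} \<Longrightarrow> t \<in> {d..<1} \<Longrightarrow> \<bar>g s - g t\<bar> < \<eta> * a"
    using convex_bounded_above_Cauchy[OF conv E(2), of "\<eta> * a"] \<eta> a by auto
  \<comment> \<open>Midway between \<open>d\<close> and \<open>1\<close>: a step shorter than
    \<open>1 - t\<close> then stays inside the interval of small variation on both sides.\<close>
  define t where "t = (1 + d) / 2"
  have t: "t \<in> {0..<1}" "d < t" "1 - t = t - d" using d(1) by (auto simp: t_def field_simps)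
  define x where "x = x0 + t *\<^sub>R v"
  have x: "x \<in> E" using E t by (simp add: x_def)
  obtain l B G where l: "l > 0" and B: "convex B" "is_pcone B" "loclin G B" "agree F G x"
     "x \<in> B" "x + l *\<^sub>R v \<in> B" "x - l *\<^sub>R v \<in> B" and
     os: "\<eta> * \<bar>U x\<bar> \<le> \<bar>u (G (x + l *\<^sub>R v)) - U x\<bar> \<or> \<eta> * \<bar>U x\<bar> \<le> \<bar>u (G (x - l *\<^sub>R v)) - U x\<bar>"
    using osc[OF x v] by metis
  have Ux: "U x = g t" "\<bar>U x\<bar> \<ge> a" using E[OF t(1)] a by (auto simp: g_def x_def)
  have xl: "x + s *\<^sub>R v = x0 + (t + s) *\<^sub>R v" for s by (simp add: x_def scaleR_add_left)
  show False
  proof (cases "l < 1 - t")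
    \<comment> \<open>The plaque ends before \<open>w\<close>. Continuation identifies
      \<open>G\<close> with \<open>F\<close> on the two-sided step, and the oscillation
      \<open>\<eta> * a\<close> contradicts the Cauchy property.\<close>
    case True
    have seg: "x + s *\<^sub>R v \<in> E \<inter> B" if "\<bar>s\<bar> \<le> l" for s
    proof
      show "x + s *\<^sub>R v \<in> E" unfolding xl using that True t d(1) by (intro E) auto
      define m where "m = (l + s) / (2 * l)"
      have m: "0 \<le> m" "m \<le> 1" "(2 * m - 1) * l = s" using that l by (auto simp: m_def field_simps)
      have "(1 - m) *\<^sub>R (x - l *\<^sub>R v) + m *\<^sub>R (x + l *\<^sub>R v) = x + ((2 * m - 1) * l) *\<^sub>R v"
        by (simp add: algebra_simps) (simp add: scaleR_add_left[symmetric])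
      then show "x + s *\<^sub>R v \<in> B" using B(1,6,7) m convexD_alt[of B "x - l *\<^sub>R v" "x + l *\<^sub>R v" m] by simp
    qed
    define C where "C = (\<lambda>s. x + s *\<^sub>R v) ` {-l..l}"
    have "connected C" unfolding C_def
      by (intro connected_continuous_image continuous_intros) auto
    moreover have "C \<subseteq> E \<inter> B" using seg by (auto simp: C_def)
    moreover have o: "open (E \<inter> B)" using E_open B loclin_open by blast
    moreover have lF: "loclin F (E \<inter> B)" using loclin_subset[OF loclin_F o] by auto
    moreover have lG: "loclin G (E \<inter> B)" using loclin_subset[OF B(3) o] by auto
    moreover have "x \<in> C" using l by (auto simp: C_def intro!: image_eqI[of _ _ 0])
    ultimately have ag: "agree F G y" if "y \<in> C" for y
      using unique_continuation[of F "E \<inter> B" G C x y] B(4) that by blast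
    have inC: "x + l *\<^sub>R v \<in> C" "x + (-l) *\<^sub>R v \<in> C" unfolding C_def using l by (intro imageI; simp)+
    have eq: "u (G (x + s *\<^sub>R v)) = g (t + s)" if "x + s *\<^sub>R v \<in> C" for s
      using agree_imp_eq[OF ag[OF that]] by (simp add: g_def U_def xl[symmetric])
    have "\<bar>g (t + l) - g t\<bar> < \<eta> * a" "\<bar>g (t + (-l)) - g t\<bar> < \<eta> * a"
      using d t True l by (auto intro!: d(2))
    moreover have "\<eta> * \<bar>U x\<bar> \<ge> \<eta> * a" using \<eta> Ux by simp
    ultimately show False using os eq[OF inC(1)] eq[OF inC(2)] Ux(1) by auto
  next
    \<comment> \<open>The plaque reaches as far as \<open>w\<close>, so \<open>extend\<close>
      applies.\<close>
    case False
    have w_eq: "w = x + (1 - t) *\<^sub>R v" by (simp add: x_def v_def algebra_simps)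
    define m where "m = (1 - t) / l"
    have m: "0 \<le> m" "m \<le> 1" using False l t by (auto simp: m_def)
    have "(1 - m) *\<^sub>R x + m *\<^sub>R (x + l *\<^sub>R v) = x + (m * l) *\<^sub>R v" by (simp add: algebra_simps)
    then have wB: "w \<in> B" using B(1,5,6) m convexD_alt[of B x "x + l *\<^sub>R v" m] w_eq l by (simp add: m_def)
    have "x = (1 - t) *\<^sub>R x0 + t *\<^sub>R w" by (simp add: x_def v_def algebra_simps)
    then have "x \<in> closed_segment x0 w" using t(1) unfolding closed_segment_def by auto
    then show False using extend[OF x B(5) _ wB B(1,2,3,4)] w by blast
  qed
qed

text \<open>The segment from \<open>y\<close> to \<open>z\<close> is shrunk towards
  \<open>x0\<close>, and \<open>J\<close> collects the parameters at which it lies in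
  \<open>E\<close>. Openness of \<open>J\<close> is compactness of the segment. At the supremum,
  convexity of \<open>U\<close> along the shrunk segments bounds \<open>U\<close> by its values on
  the two fixed sides \<open>x0 y\<close> and \<open>x0 z\<close>, where it stays away from
  \<open>0\<close>; hence \<open>closing\<close> applies.\<close>

lemma E_convex: "convex E"
proof (rule convexI)
  fix y z and \<alpha> \<beta> :: real
  assume yz: "y \<in> E" "z \<in> E" and ab: "0 \<le> \<alpha>" "0 \<le> \<beta>" "\<alpha> + \<beta> = 1"
  define T where "T m s = x0 + s *\<^sub>R (((1 - m) *\<^sub>R y + m *\<^sub>R z) - x0)" for m s
  define J where "J = {s \<in> {0..1}. \<forall>m\<in>{0..1}. T m s \<in> E}"
  have T_shrink: "T m s' = x0 + (s' / s) *\<^sub>R (T m s - x0)" if "s \<noteq> 0" for m s s'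
    using that by (simp add: T_def)
  have down: "s' \<in> J" if "s \<in> J" "0 \<le> s'" "s' \<le> s" for s s'
  proof (cases "s' = s")
    case False
    then have s: "s > 0" using that by simp
    have "T m s' \<in> E" if m: "m \<in> {0..1}" for m
    proof -
      have "T m s \<in> E" using \<open>s \<in> J\<close> m by (auto simp: J_def)
      then have "closed_segment x0 (T m s) \<subseteq> E" using E_star by blast
      moreover have "T m s' = (1 - s'/s) *\<^sub>R x0 + (s'/s) *\<^sub>R T m s"
        using T_shrink[of s m s'] s by (simp add: algebra_simps)
      ultimately show ?thesis using s \<open>0 \<le> s'\<close> \<open>s' \<le> s\<close> unfolding closed_segment_def by fastforce
    qed
    then show ?thesis using that by (auto simp: J_def)
  qed (use that in simp)
  have opn: "\<exists>e>0. \<forall>s'\<in>{0..1}. \<bar>s' - s\<bar> < e \<longrightarrow> s' \<in> J" if "s \<in> J" for s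
  proof -
    define K where "K = (\<lambda>m. T m s) ` {0..1}"
    have cont: "continuous_on {0..1} (\<lambda>m. T m s)" unfolding T_def by (intro continuous_intros)
    then have "compact K" unfolding K_def by (intro compact_continuous_image) auto
    moreover have "K \<subseteq> E" using that by (auto simp: K_def J_def)
    ultimately obtain e where e: "e > 0" "(\<Union>x\<in>K. ball x e) \<subseteq> E"
      using compact_subset_open_imp_ball_epsilon_subset[OF _ E_open] by metis
    define M where "M = norm (y - x0) + norm (z - x0) + 1"
    have M: "M > 0" by (simp add: M_def add_nonneg_pos)
    have bd: "norm (((1 - m) *\<^sub>R y + m *\<^sub>R z) - x0) < M" if "m \<in> {0..1}" for m
    proof -
      have "((1 - m) *\<^sub>R y + m *\<^sub>R z) - x0 = (1 - m) *\<^sub>R (y - x0) + m *\<^sub>R (z - x0)" by (simp add: algebra_simps)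
      then have "norm (((1 - m) *\<^sub>R y + m *\<^sub>R z) - x0) \<le> (1 - m) * norm (y - x0) + m * norm (z - x0)"
        using norm_triangle_ineq[of "(1 - m) *\<^sub>R (y - x0)" "m *\<^sub>R (z - x0)"] that by simp
      moreover have "(1 - m) * norm (y - x0) \<le> 1 * norm (y - x0)" "m * norm (z - x0) \<le> 1 * norm (z - x0)"
        using that by (simp_all add: mult_left_le_one_le)
      ultimately show ?thesis by (simp add: M_def)
    qed
    show ?thesis
    proof (rule exI[of _ "e / M"], intro conjI ballI impI)
      show "e / M > 0" using e M by simp
      fix s' :: real assume s': "s' \<in> {0..1}" "\<bar>s' - s\<bar> < e / M"
      have "T m s' \<in> E" if m: "m \<in> {0..1}" for m
      proof -
        have "T m s - T m s' = (s - s') *\<^sub>R (((1 - m) *\<^sub>R y + m *\<^sub>R z) - x0)" by (simp add: T_def algebra_simps)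
        then have "dist (T m s) (T m s') = \<bar>s' - s\<bar> * norm (((1 - m) *\<^sub>R y + m *\<^sub>R z) - x0)"
          by (simp add: dist_norm abs_minus_commute)
        also have "\<dots> \<le> \<bar>s' - s\<bar> * M" using bd[OF m] by (intro mult_left_mono) auto
        also have "\<dots> < e" using s' M by (simp add: pos_less_divide_eq)
        finally have "T m s' \<in> ball (T m s) e" by simp
        moreover have "T m s \<in> K" using m by (auto simp: K_def)
        ultimately show ?thesis using e(2) by blast
      qed
      then show "s' \<in> J" using s' by (auto simp: J_def)
    qed
  qed
  have J0: "0 \<in> J" using x0_E by (auto simp: J_def T_def)
  have Jsub: "J \<subseteq> {0..1}" by (auto simp: J_def)
  have bdd: "bdd_above J" using Jsub by (meson bdd_above_Icc bdd_above_mono)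
  define S where "S = Sup J"
  have S01: "S \<in> {0..1}" using J0 Jsub bdd by (auto simp: S_def intro!: cSup_upper cSup_least)
  have below: "s \<in> J" if "0 \<le> s" "s < S" for s
  proof -
    have "\<exists>s'\<in>J. s < s'" using less_cSup_iff[of J s] J0 bdd that unfolding S_def by blast
    then obtain s' where "s' \<in> J" "s < s'" by blast
    then show ?thesis using down that by auto
  qed
  \<comment> \<open>The sides from \<open>x0\<close> are compact subsets of \<open>E\<close>, so
    \<open>U\<close> has a negative maximum there.\<close>
  have U_end: "\<exists>a>0. \<forall>s\<in>{0..1}. U (x0 + s *\<^sub>R (p - x0)) \<le> - a" if p: "p \<in> E" for p
  proof -
    have E: "x0 + s *\<^sub>R (p - x0) \<in> E" if "s \<in> {0..1}" for s
    proof -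
      have "x0 + s *\<^sub>R (p - x0) = (1 - s) *\<^sub>R x0 + s *\<^sub>R p" by (simp add: algebra_simps)
      then have "x0 + s *\<^sub>R (p - x0) \<in> closed_segment x0 p" using that by (auto simp: closed_segment_def)
      then show ?thesis using E_star p by blast
    qed
    have "continuous_on {0..1} (\<lambda>s. U (x0 + s *\<^sub>R (p - x0)))"
      by (rule continuous_on_compose2[OF U_cont]) (auto intro!: continuous_intros E)
    then have "\<exists>m\<in>{0..1}. \<forall>s\<in>{0..1}. U (x0 + s *\<^sub>R (p - x0)) \<le> U (x0 + m *\<^sub>R (p - x0))"
      using continuous_attains_sup[OF compact_Icc, of 0 1] by simp
    then obtain m where "m \<in> {0..1}" "\<And>s. s \<in> {0..1} \<Longrightarrow> U (x0 + s *\<^sub>R (p - x0)) \<le> U (x0 + m *\<^sub>R (p - x0))"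
      by blast
    then show ?thesis using U_neg[OF E] by (intro exI[of _ "- U (x0 + m *\<^sub>R (p - x0))"]) auto
  qed
  obtain a1 where a1: "a1 > 0" "\<And>s. s \<in> {0..1} \<Longrightarrow> U (x0 + s *\<^sub>R (y - x0)) \<le> - a1" using U_end[OF yz(1)] by auto
  obtain a2 where a2: "a2 > 0" "\<And>s. s \<in> {0..1} \<Longrightarrow> U (x0 + s *\<^sub>R (z - x0)) \<le> - a2" using U_end[OF yz(2)] by auto
  define a where "a = min a1 a2"
  \<comment> \<open>The end points of the shrunk segment slide along the two fixed sides, and
    convexity carries their bound to the interior, with \<open>a\<close> independent of
    \<open>s\<close> and \<open>m\<close>.\<close>
  have UT: "U (T m s) \<le> - a" if s: "s \<in> J" and m: "m \<in> {0..1}" for m s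
  proof -
    have T_eq: "T m s = T 0 s + m *\<^sub>R (T 1 s - T 0 s)" for m by (simp add: T_def algebra_simps)
    have "convex_on {0..1} (\<lambda>m. U (T 0 s + m *\<^sub>R (T 1 s - T 0 s)))"
      by (rule U_line_convex) (use s in \<open>auto simp: J_def T_eq[symmetric]\<close>)
    from convex_onD[OF this, of m 0 1] m
    have "U (T m s) \<le> (1 - m) * U (T 0 s) + m * U (T 1 s)" using T_eq[of m] by simp
    moreover have "U (T 0 s) \<le> - a" "U (T 1 s) \<le> - a"
      using a1(2)[of s] a2(2)[of s] s by (auto simp: T_def a_def J_def)
    then have "(1 - m) * U (T 0 s) \<le> (1 - m) * - a" "m * U (T 1 s) \<le> m * - a"
      using m by (intro mult_left_mono; simp)+
    ultimately show ?thesis by (simp add: algebra_simps)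
  qed
  have "S \<in> J"
  proof -
    have "T m S \<in> E" if m: "m \<in> {0..1}" for m
    proof (cases "S = 0")
      case True then show ?thesis using x0_E by (simp add: T_def)
    next
      \<comment> \<open>The ray from \<open>x0\<close> to \<open>T m S\<close> consists of points
        \<open>T m (t * S)\<close>, which belong to smaller parameters and hence to
        \<open>E\<close>.\<close>
      case False
      show ?thesis
      proof (rule closing)
        show "a > 0" using a1 a2 by (simp add: a_def)
        fix t :: real assume t: "0 \<le> t" "t < 1"
        have "t * S < S" using t S01 False by (simp add: less_le)
        then have "t * S \<in> J" using t S01 by (intro below) auto
        moreover have "x0 + t *\<^sub>R (T m S - x0) = T m (t * S)" by (simp add: T_def)
        ultimately show "x0 + t *\<^sub>R (T m S - x0) \<in> E \<and> U (x0 + t *\<^sub>R (T m S - x0)) \<le> - a"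
          using UT m by (auto simp: J_def)
      qed
    qed
    then show ?thesis using S01 by (auto simp: J_def)
  qed
  have "S = 1"
  proof (rule ccontr)
    assume "S \<noteq> 1"
    then have S1: "S < 1" using S01 by auto
    obtain e where e: "e > 0" "\<And>s'. s' \<in> {0..1} \<Longrightarrow> \<bar>s' - S\<bar> < e \<Longrightarrow> s' \<in> J" using opn[OF \<open>S \<in> J\<close>] by blast
    define s where "s = min 1 (S + e/2)"
    have "s \<in> J" using e S01 by (intro e(2)) (auto simp: s_def)
    then have "s \<le> S" using cSup_upper bdd by (auto simp: S_def)
    then show False using S1 e by (auto simp: s_def)
  qed
  then have "T \<beta> 1 \<in> E" using \<open>S \<in> J\<close> ab by (auto simp: J_def)
  moreover have "T \<beta> 1 = \<alpha> *\<^sub>R y + \<beta> *\<^sub>R z"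
  proof -
    have "1 - \<beta> = \<alpha>" using ab by simp
    then show ?thesis by (simp add: T_def)
  qed
  ultimately show "\<alpha> *\<^sub>R y + \<beta> *\<^sub>R z \<in> E" by simp
qed

lemma no_line:
  assumes v: "v \<noteq> 0" and E: "\<And>t. x + t *\<^sub>R v \<in> E"
  shows False
proof -
  have conv: "convex_on UNIV (\<lambda>t. U (x + t *\<^sub>R v))" using E by (intro U_line_convex) auto
  have const: "U (x + s *\<^sub>R v) = U (x + t *\<^sub>R v)" for s t
    using convex_bounded_above_UNIV_const[OF conv, of 0 s t] U_neg[OF E] less_imp_le by blast
  have x: "x \<in> E" using E[of 0] by simp
  \<comment> \<open>Strictness holds only transversally to the radial direction; a radial line would
    pass through the origin, which is not in \<open>E\<close>.\<close>
  have nr: "\<nexists>r. v = r *\<^sub>R x"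
  proof
    assume "\<exists>r. v = r *\<^sub>R x"
    then obtain r where r: "v = r *\<^sub>R x" by blast
    then have "r \<noteq> 0" using v by auto
    then have "x + (-1/r) *\<^sub>R v = 0" using r by simp
    then show False using E[of "-1/r"] E_0 by simp
  qed
  obtain d where d: "d > 0" "\<And>w. norm w < d \<Longrightarrow> (\<nexists>r. w = r *\<^sub>R x) \<Longrightarrow> 2 * U x < U (x - w) + U (x + w)"
    using U_local[OF x] by blast
  define h where "h = d / (2 * norm v)"
  have h: "h > 0" "norm (h *\<^sub>R v) < d" using d v by (auto simp: h_def)
  have "\<nexists>r. h *\<^sub>R v = r *\<^sub>R x"
  proof
    assume "\<exists>r. h *\<^sub>R v = r *\<^sub>R x"
    then obtain r where "h *\<^sub>R v = r *\<^sub>R x" by blast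
    from arg_cong[OF this, of "\<lambda>z. (1/h) *\<^sub>R z"] h(1) have "v = (r / h) *\<^sub>R x" by simp
    then show False using nr by blast
  qed
  then have "2 * U x < U (x - h *\<^sub>R v) + U (x + h *\<^sub>R v)" using d(2)[OF h(2)] by blast
  moreover have "U (x - h *\<^sub>R v) = U x" "U (x + h *\<^sub>R v) = U x" using const[of "-h" 0] const[of h 0] by auto
  ultimately show False by simp
qed

text \<open>A point of \<open>B\<close> in the closure of the convex set \<open>E\<close> is the end
  of a segment from \<open>x0\<close> that otherwise lies in \<open>E\<close>;
  \<open>extend\<close>, applied just before the end, takes the point into \<open>E\<close>. So
  \<open>E\<close> is relatively closed in the connected set \<open>B\<close>. Equality of the maps
  is unique continuation on the convex set \<open>B \<inter> E\<close>.\<close>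

lemma maximal:
  assumes B: "convex B" "is_pcone B" "loclin G B" and x: "x \<in> B" "x \<in> E" and ag: "agree F G x"
  shows "B \<subseteq> E" and "y \<in> B \<Longrightarrow> F y = G y"
proof -
  have o: "open B" "open (B \<inter> E)" using B loclin_open E_open by blast+
  have lF: "loclin F (B \<inter> E)" using loclin_subset[OF loclin_F o(2)] by auto
  have lG: "loclin G (B \<inter> E)" using loclin_subset[OF B(3) o(2)] by auto
  have conn: "connected (B \<inter> E)" using B E_convex by (intro convex_connected convex_Int)
  have agr: "agree F G y" if "y \<in> B \<inter> E" for y
    using unique_continuation[OF lF lG conn order_refl _ ag that] x by blast
  have clo: "w \<in> E" if w: "w \<in> B" "w \<in> closure E" for w
  proof (rule ccontr)
    assume nw: "w \<notin> E"
    have seg: "open_segment x0 w \<subseteq> E"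
      using in_interior_closure_convex_segment[OF E_convex, of x0 w] x0_E w E_open by (simp add: interior_open)
    obtain e where e: "e > 0" "ball w e \<subseteq> B" using o w open_contains_ball by blast
    define t where "t = min (1/2) (e / (2 * norm (x0 - w)))"
    have ne: "x0 \<noteq> w" using nw x0_E by auto
    have t: "0 < t" "t < 1" using e ne by (auto simp: t_def)
    define y where "y = w + t *\<^sub>R (x0 - w)"
    have "t * norm (x0 - w) \<le> (e / (2 * norm (x0 - w))) * norm (x0 - w)"
      by (intro mult_right_mono) (auto simp: t_def)
    also have "\<dots> < e" using e ne by simp
    finally have "y \<in> ball w e" using t by (simp add: y_def dist_norm)
    then have yB: "y \<in> B" using e by blast
    have y_eq: "y = (1 - (1 - t)) *\<^sub>R x0 + (1 - t) *\<^sub>R w" by (simp add: y_def algebra_simps)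
    then have "y \<in> open_segment x0 w" using t ne unfolding in_segment by (intro conjI exI[of _ "1 - t"]) auto
    then have yE: "y \<in> E" "y \<in> closed_segment x0 w" using seg open_closed_segment by auto
    show False using extend[OF yE(1) yB yE(2) w(1) B agr] yE yB nw by blast
  qed
  have "B \<inter> (- closure E) = {} \<or> E \<inter> B = {}"
  proof -
    have "(- closure E) \<inter> B = {} \<or> E \<inter> B = {}"
    proof (rule connectedD[OF convex_connected[OF B(1)]])
      show "open (- closure E)" "open E" using E_open by auto
      show "- closure E \<inter> E \<inter> B = {}" using closure_subset by blast
      show "B \<subseteq> - closure E \<union> E" using clo by blast
    qed
    then show ?thesis by blast
  qed
  then show BE: "B \<subseteq> E" using x clo by blast
  show "F y = G y" if "y \<in> B" using agr[of y] BE that agree_imp_eq by blast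
qed

text \<open>Even covering: through any preimage of one of its points, a convex conical plaque lifts
  as a whole.\<close>

lemma cover_plaque:
  assumes i: "i \<in> I" and C: "open C" "convex C" "is_pcone C" "C \<subseteq> V i" and y: "y \<in> C"
    and x: "x \<in> E" "F x = \<phi> i y"
  obtains A where "linear A" "bij A" "A x = y" "A -` C \<subseteq> E" "\<And>z. A z \<in> C \<Longrightarrow> F z = \<phi> i (A z)"
proof -
  obtain A W where A: "linear A" "bij A" "open W" "x \<in> W" "W \<subseteq> E"
      "A ` W \<subseteq> V i" "\<And>z. z \<in> W \<Longrightarrow> F z = \<phi> i (A z)" "A x = y"
    using loclin_chart[OF loclin_F x(1) i subsetD[OF C(4) y] x(2)] by metis
  have 1: "convex (A -` C)" using A C by (intro convex_linear_vimage)
  have 2: "is_pcone (A -` C)" using A C by (intro linear_vimage_pcone)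
  have 3: "loclin (\<lambda>z. \<phi> i (A z)) (A -` C)" using A C i by (intro loclin_plaque linear_vimage_open) auto
  have 4: "agree F (\<lambda>z. \<phi> i (A z)) x" using A by (intro agreeI[of W])
  have 5: "x \<in> A -` C" using A y by simp
  show ?thesis
    using that[OF A(1,2,8) maximal(1)[OF 1 2 3 5 x(1) 4]] maximal(2)[OF 1 2 3 5 x(1) 4] by auto
qed

lemma chart_cone:
  assumes "i \<in> I" "y \<in> V i"
  obtains C where "open C" "convex C" "is_pcone C" "C \<subseteq> V i" "y \<in> C"
proof -
  obtain e where e: "e > 0" "ball y e \<subseteq> V i" using assms V_open open_contains_ball by blast
  have "y \<in> pcone (ball y e)" using subset_pcone[of "ball y e"] e by auto
  then show ?thesis
    using that[of "pcone (ball y e)"] pcone_subset[OF V_pcone[OF assms(1)] e(2)]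
    by (auto simp: open_pcone convex_pcone is_pcone_pcone)
qed

text \<open>By \<open>cover_plaque\<close> a convex conical plaque lies in the image as soon as one
  of its points does, so both the image and its complement are open.\<close>

lemma F_surj: "F ` E = L"
proof (rule connectedness)
  show "F ` E \<subseteq> L" using F_L by blast
  show "F ` E \<noteq> {}" using x0_E by blast
  show "\<sigma> r z \<in> F ` E" if z: "z \<in> F ` E" and r: "r > 0" for r z
  proof -
    obtain x where "x \<in> E" "z = F x" using z by blast
    then show ?thesis using F_scale[of x r] is_pconeD[OF E_cone, of x r] r by (metis imageI)
  qed
  have key: "C \<subseteq> {y \<in> V i. \<phi> i y \<in> F ` E}"
    if i: "i \<in> I" and C: "open C" "convex C" "is_pcone C" "C \<subseteq> V i" and y: "y \<in> C" "\<phi> i y \<in> F ` E" for i C y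
  proof
    fix z assume z: "z \<in> C"
    obtain x where x: "x \<in> E" "F x = \<phi> i y" using y by force
    obtain A where A: "linear A" "bij A" "A x = y" "A -` C \<subseteq> E" "\<And>z. A z \<in> C \<Longrightarrow> F z = \<phi> i (A z)"
      using cover_plaque[OF i C y(1) x] by metis
    obtain q where "A q = z" using A(2) by (metis bij_pointE)
    then have "q \<in> E" "F q = \<phi> i z" using A z by auto
    then show "z \<in> {y \<in> V i. \<phi> i y \<in> F ` E}" using z C by (auto intro: image_eqI[of _ _ q])
  qed
  fix i assume i: "i \<in> I"
  show "open {x \<in> V i. \<phi> i x \<in> F ` E}"
  proof (subst open_subopen, intro ballI)
    fix y assume y: "y \<in> {x \<in> V i. \<phi> i x \<in> F ` E}"
    obtain C where "open C" "convex C" "is_pcone C" "C \<subseteq> V i" "y \<in> C"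
      using chart_cone[OF i, of y] y by blast
    then show "\<exists>T. open T \<and> y \<in> T \<and> T \<subseteq> {x \<in> V i. \<phi> i x \<in> F ` E}"
      using key[OF i, of "C" y] y by blast
  qed
  show "open {x \<in> V i. \<phi> i x \<notin> F ` E}"
  proof (subst open_subopen, intro ballI)
    fix y assume y: "y \<in> {x \<in> V i. \<phi> i x \<notin> F ` E}"
    obtain C where e: "open C" "convex C" "is_pcone C" "C \<subseteq> V i" "y \<in> C"
      using chart_cone[OF i, of y] y by blast
    have "C \<subseteq> {x \<in> V i. \<phi> i x \<notin> F ` E}"
    proof
      fix z assume z: "z \<in> C"
      show "z \<in> {x \<in> V i. \<phi> i x \<notin> F ` E}"
        using key[OF i e(1-4) z] e(4,5) y z by auto
    qed
    then show "\<exists>T. open T \<and> y \<in> T \<and> T \<subseteq> {x \<in> V i. \<phi> i x \<notin> F ` E}" using e by blast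
  qed
qed

text \<open>Covering transformations, taken as linear maps of the whole space so that they induce
  projective maps.\<close>

definition Deck :: "('v \<Rightarrow> 'v) set" where
  "Deck = {h. linear h \<and> bij h \<and> h ` E = E \<and> (\<forall>x\<in>E. F (h x) = F x)}"

text \<open>The covering is regular. In one chart around the common image, \<open>F\<close> is given
  by \<open>A\<close> near \<open>x\<close> and by \<open>B\<close> near \<open>y\<close>, so
  \<open>inv B \<circ> A\<close> preserves \<open>F\<close> near \<open>x\<close>; by
  \<open>maximal\<close> this germ of a symmetry is global.\<close>

lemma deck_exists:
  assumes x: "x \<in> E" and y: "y \<in> E" and eq: "F x = F y"
  obtains h where "h \<in> Deck" "h x = y"
proof -
  obtain i A W where A: "i \<in> I" "linear A" "bij A" "open W" "x \<in> W" "W \<subseteq> E"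
     "A ` W \<subseteq> V i" "\<And>y. y \<in> W \<Longrightarrow> F y = \<phi> i (A y)"
    using loclinE[OF loclin_F x] by metis
  have Ax: "A x \<in> V i" "F y = \<phi> i (A x)" using A eq by auto
  obtain B W' where B: "linear B" "bij B" "open W'" "y \<in> W'" "W' \<subseteq> E"
      "B ` W' \<subseteq> V i" "\<And>z. z \<in> W' \<Longrightarrow> F z = \<phi> i (B z)" "B y = A x"
    using loclin_chart[OF loclin_F y A(1) Ax] by metis
  define h k where "h = inv B \<circ> A" and "k = inv A \<circ> B"
  have lin: "linear h" "bij h" "linear k" "bij k"
    unfolding h_def k_def
    using linear_bij_inv[OF A(2,3)] linear_bij_inv[OF B(1,2)] A(2,3) B(1,2)
    by (metis linear_compose bij_comp)+
  have hk: "h (k z) = z" "k (h z) = z" "B (h z) = A z" "A (k z) = B z" for z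
    using A(3) B(2) by (simp_all add: h_def k_def bij_is_surj bij_is_inj surj_f_inv_f inv_f_f)
  have hx: "h x = y" "k y = x" using B(8) A(3) B(2) by (auto simp: h_def k_def bij_is_inj inv_f_eq)
  have sub: "q -` E \<subseteq> E \<and> (\<forall>z\<in>q -` E. F z = F (q z))"
    if q: "linear q" "bij q" and z: "z \<in> E" "q z \<in> E" and N: "open N" "z \<in> N" "\<And>p. p \<in> N \<Longrightarrow> F p = F (q p)" for q z N
  proof -
    have 1: "convex (q -` E)" using q E_convex by (intro convex_linear_vimage)
    have 2: "is_pcone (q -` E)" using q E_cone by (intro linear_vimage_pcone)
    have 3: "loclin (\<lambda>z. F (q z)) (q -` E)" using loclin_compose[OF loclin_F q] .
    have 4: "agree F (\<lambda>z. F (q z)) z" using N by (intro agreeI[of N])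
    have 5: "z \<in> q -` E" using z by simp
    show ?thesis using maximal[OF 1 2 3 5 z(1) 4] by blast
  qed
  have h: "h -` E \<subseteq> E \<and> (\<forall>z\<in>h -` E. F z = F (h z))"
  proof (rule sub[of h x "W \<inter> h -` W'"])
    show "open (W \<inter> h -` W')" using A B lin linear_vimage_open by blast
    show "F p = F (h p)" if "p \<in> W \<inter> h -` W'" for p using that A B hk by auto
  qed (use lin x y hx A B in auto)
  have k: "k -` E \<subseteq> E \<and> (\<forall>z\<in>k -` E. F z = F (k z))"
  proof (rule sub[of k y "W' \<inter> k -` W"])
    show "open (W' \<inter> k -` W)" using A B lin linear_vimage_open by blast
    show "F p = F (k p)" if "p \<in> W' \<inter> k -` W" for p using that A B hk by auto
  qed (use lin x y hx A B in auto)
  have hE: "h z \<in> E" if "z \<in> E" for z using k hk(2)[of z] that by auto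
  have kE: "k z \<in> E" if "z \<in> E" for z using h hk(1)[of z] that by auto
  have "h ` E = E"
  proof (intro equalityI subsetI)
    fix z assume "z \<in> E" then show "z \<in> h ` E" using kE[of z] hk(1)[of z] by (metis imageI)
  qed (use hE in auto)
  then have "h \<in> Deck" using lin h hE by (auto simp: Deck_def)
  then show ?thesis using that hx by blast
qed

lemma deck_id: "id \<in> Deck"
  by (simp add: Deck_def linear_id)

lemma deck_comp: "h \<in> Deck \<Longrightarrow> k \<in> Deck \<Longrightarrow> h \<circ> k \<in> Deck"
proof -
  assume h: "h \<in> Deck" and k: "k \<in> Deck"
  have "(h \<circ> k) ` E = E" using h k by (simp only: image_comp[symmetric] Deck_def mem_Collect_eq)
  moreover have "F ((h \<circ> k) x) = F x" if "x \<in> E" for x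
  proof -
    have "k x \<in> E" "F (k x) = F x" using k that by (auto simp: Deck_def)
    then show ?thesis using h by (auto simp: Deck_def)
  qed
  ultimately show ?thesis using h k by (auto simp: Deck_def linear_compose bij_comp simp del: comp_apply)
qed

lemma deck_E: "h \<in> Deck \<Longrightarrow> x \<in> E \<Longrightarrow> h x \<in> E"
  unfolding Deck_def by blast

lemma deck_F: "h \<in> Deck \<Longrightarrow> x \<in> E \<Longrightarrow> F (h x) = F x"
  unfolding Deck_def by blast

lemma deck_inv:
  assumes h: "h \<in> Deck" shows "inv h \<in> Deck"
proof -
  have b: "linear h" "bij h" "h ` E = E" "\<And>x. x \<in> E \<Longrightarrow> F (h x) = F x" using h by (auto simp: Deck_def)
  have inE: "inv h z \<in> E" if z: "z \<in> E" for z
  proof -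
    obtain y where "y \<in> E" "z = h y" using b(3) z by blast
    then show ?thesis using b(2) by (simp add: bij_is_inj inv_f_f)
  qed
  have "inv h ` E = E"
  proof (intro equalityI subsetI)
    fix z assume "z \<in> E"
    then have "h z \<in> E" "z = inv h (h z)" using deck_E[OF h] b(2) by (auto simp: bij_is_inj inv_f_f)
    then show "z \<in> inv h ` E" by (metis imageI)
  qed (use inE in auto)
  moreover have "F (inv h z) = F z" if "z \<in> E" for z
    using b(4)[OF inE[OF that]] b(2) by (simp add: bij_is_surj surj_f_inv_f)
  ultimately show ?thesis unfolding Deck_def using linear_bij_inv[OF b(1,2)] by blast
qed

lemma F_locally_inj:
  assumes x: "x \<in> E" obtains W where "open W" "x \<in> W" "W \<subseteq> E" "inj_on F W"
proof -
  obtain i A W where A: "i \<in> I" "linear A" "bij A" "open W" "x \<in> W" "W \<subseteq> E"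
     "A ` W \<subseteq> V i" "\<And>y. y \<in> W \<Longrightarrow> F y = \<phi> i (A y)"
    using loclinE[OF loclin_F x] by metis
  have "inj_on F W"
  proof (rule inj_onI)
    fix a b assume ab: "a \<in> W" "b \<in> W" "F a = F b"
    then have "\<phi> i (A a) = \<phi> i (A b)" using A by auto
    then have "A a = A b" using \<phi>_inj[OF A(1)] A(7) ab by (auto simp: inj_on_def image_subset_iff)
    then show "a = b" using A(3) by (metis bij_pointE)
  qed
  then show ?thesis using that A by blast
qed

text \<open>Freeness on rays, as the projective action needs. \<open>E\<close> contains no opposite
  vectors, so \<open>r\<close> is positive; \<open>U\<close> is invariant and of degree one, so
  \<open>r = 1\<close>; near the fixed point \<open>F\<close> is injective, so \<open>h\<close> is
  the identity there.\<close>

lemma deck_free: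
  assumes h: "h \<in> Deck" and x: "x \<in> E" and eq: "h x = r *\<^sub>R x"
  shows "h = id"
proof -
  have b: "linear h" "bij h" using h by (auto simp: Deck_def)
  have hx: "r *\<^sub>R x \<in> E" using deck_E[OF h x] eq by simp
  have "r > 0"
  proof (rule ccontr)
    assume r: "\<not> r > 0"
    then have "r \<noteq> 0" using hx E_0 by auto
    then have "(-1/r) *\<^sub>R r *\<^sub>R x \<in> E" using is_pconeD[OF E_cone hx, of "-1/r"] r by (simp add: divide_pos_neg)
    then have "- x \<in> E" using \<open>r \<noteq> 0\<close> by simp
    then have "(1/2) *\<^sub>R x + (1/2) *\<^sub>R (- x) \<in> E" using x by (intro convexD[OF E_convex]) auto
    then show False using E_0 by simp
  qed
  then have "U (h x) = r * U x" using eq U_scale x by simp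
  moreover have "U (h x) = U x" using deck_F[OF h x] by (simp add: U_def)
  ultimately have "r = 1" using U_neg[OF x] by simp
  then have hx: "h x = x" using eq by simp
  obtain W where W: "open W" "x \<in> W" "W \<subseteq> E" "inj_on F W" using F_locally_inj[OF x] by metis
  have "open (W \<inter> h -` W)" using W b linear_vimage_open by blast
  moreover have "x \<in> W \<inter> h -` W" using W hx by simp
  ultimately have "eventually (\<lambda>y. y \<in> W \<inter> h -` W) (nhds x)" by (rule eventually_nhds_in_open)
  then have "eventually (\<lambda>y. h y = id y) (nhds x)"
  proof eventually_elim
    case (elim y)
    then have "F (h y) = F y" using deck_F[OF h] W by auto
    then show ?case using W elim by (auto simp: inj_on_def)
  qed
  then show ?thesis using linear_eq_of_eventually[OF b(1) linear_id] by blast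
qed

text \<open>The limits have the same image, so some \<open>g\<close> carries \<open>x\<close> to
  \<open>y\<close>. Eventually \<open>inv g \<circ> h k\<close> moves \<open>X k\<close> only within
  a set on which \<open>F\<close> is injective, hence fixes it, and \<open>deck_free\<close>
  applies.\<close>

lemma deck_discontinuous:
  assumes h: "\<And>k::nat. h k \<in> Deck" and X: "\<And>k. X k \<in> E" "X \<longlonglongrightarrow> x" "x \<in> E"
    and Y: "(\<lambda>k. h k (X k)) \<longlonglongrightarrow> y" "y \<in> E"
  obtains g where "g \<in> Deck" "eventually (\<lambda>k. h k = g) sequentially"
proof -
  have "F x = F y"
    by (rule loclin_limit[OF loclin_F loclin_F X(3) Y(2) X(2) Y(1)]) (use deck_F h X in auto)
  then obtain g where g: "g \<in> Deck" "g x = y" using deck_exists X Y by metis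
  have gi: "inv g \<in> Deck" "linear (inv g)" "inv g (g z) = z" "g (inv g z) = z" for z
    using deck_inv[OF g(1)] g by (auto simp: Deck_def bij_is_inj bij_is_surj surj_f_inv_f)
  obtain W where W: "open W" "x \<in> W" "W \<subseteq> E" "inj_on F W" using F_locally_inj[OF X(3)] by metis
  have "(\<lambda>k. inv g (h k (X k))) \<longlonglongrightarrow> inv g y"
    using bounded_linear.tendsto[OF linear_conv_bounded_linear[THEN iffD1, OF gi(2)] Y(1)] .
  moreover have "inv g y = x" using gi(3)[of x] g(2) by simp
  ultimately have "eventually (\<lambda>k. inv g (h k (X k)) \<in> W) sequentially"
    using W by (intro topological_tendstoD) auto
  moreover have "eventually (\<lambda>k. X k \<in> W) sequentially" using X(2) W by (intro topological_tendstoD)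
  ultimately have "eventually (\<lambda>k. h k = g) sequentially"
  proof eventually_elim
    case (elim k)
    have "F (inv g (h k (X k))) = F (X k)"
      using deck_F[OF gi(1) deck_E[OF h X(1)]] deck_F[OF h X(1)] by simp
    then have eq: "inv g (h k (X k)) = X k" using W elim by (auto simp: inj_on_def)
    have "(inv g \<circ> h k) \<in> Deck" using deck_comp[OF gi(1) h] .
    then have "inv g \<circ> h k = id" using deck_free[of "inv g \<circ> h k" "X k" 1] X(1) eq by simp
    then have "inv g (h k z) = z" for z by (metis comp_apply id_apply)
    then have "h k z = g z" for z using gi(4) by metis
    then show ?case by blast
  qed
  then show ?thesis using that g by blast
qed

end

section \<open>Homogeneous coordinates, projective maps and affine charts\<close>

section \<open>Matrices and projective maps\<close>

lemma line_of_proj_pt: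
  fixes v :: "real ^ 'n::finite option"
  assumes "v \<noteq> 0" shows "line_of (proj_pt v) = span {v}"
proof -
  have "dim (span {v}) = 1" using assms by (simp add: dim_span dim_insert)
  then show ?thesis unfolding proj_pt_def by (subst Abs_rp_inverse) (auto simp: subspace_span)
qed

lemma mem_line_proj_pt:
  fixes v :: "real ^ 'n::finite option"
  assumes "v \<noteq> 0" shows "w \<in> line_of (proj_pt v) \<longleftrightarrow> (\<exists>r. w = r *\<^sub>R v)"
  using assms by (auto simp: line_of_proj_pt span_singleton)

lemma proj_pt_scale: "r \<noteq> 0 \<Longrightarrow> proj_pt (r *\<^sub>R v) = proj_pt (v :: real ^ 'n::finite option)"
proof -
  assume r: "r \<noteq> 0"
  have "span {r *\<^sub>R v} = span {v}"
    using r span_image_scale[of "{v}" "\<lambda>_. r"] by simp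
  then show ?thesis by (simp add: proj_pt_def)
qed

lemma line_of_subspace: "subspace (line_of p)" "dim (line_of p) = 1"
  using line_of[of p] by auto

lemma rp_obtain:
  fixes p :: "'n::finite rp"
  obtains v where "v \<noteq> 0" "p = proj_pt v"
proof -
  obtain B where B: "B \<subseteq> line_of p" "independent B" "line_of p \<subseteq> span B" "card B = dim (line_of p)"
    using basis_exists by blast
  then obtain v where v: "B = {v}" using line_of_subspace(2)[of p] card_1_singletonE by metis
  have "line_of p = span {v}" using B v line_of_subspace(1)[of p] span_minimal[of B "line_of p"] by auto
  moreover have "v \<noteq> 0" using B(2) v dependent_zero by blast
  ultimately have "p = proj_pt v" unfolding proj_pt_def by (metis line_of_inverse)
  then show ?thesis using that \<open>v \<noteq> 0\<close> by blast
qed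

lemma proj_pt_mem_line:
  assumes "x \<in> line_of p" "x \<noteq> 0" shows "p = proj_pt x"
proof -
  obtain v where v: "v \<noteq> 0" "p = proj_pt v" using rp_obtain by blast
  then obtain r where "x = r *\<^sub>R v" using assms mem_line_proj_pt by blast
  then show ?thesis using v assms proj_pt_scale[of r v] by auto
qed

lemma proj_pt_eq_iff:
  fixes v w :: "real ^ 'n::finite option"
  assumes "v \<noteq> 0" "w \<noteq> 0" shows "proj_pt v = proj_pt w \<longleftrightarrow> (\<exists>r. w = r *\<^sub>R v)"
proof
  assume eq: "proj_pt v = proj_pt w"
  have "w \<in> line_of (proj_pt w)" using assms mem_line_proj_pt[of w w] by (metis scaleR_one)
  then show "\<exists>r. w = r *\<^sub>R v" using assms eq mem_line_proj_pt[of v w] by simp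
next
  assume "\<exists>r. w = r *\<^sub>R v"
  then obtain r where "w = r *\<^sub>R v" by blast
  then show "proj_pt v = proj_pt w" using assms proj_pt_scale[of r v] by auto
qed

lemma det_nz_mult_zero:
  fixes A :: "real ^ 'm ^ 'm::finite"
  assumes "det A \<noteq> 0" shows "A *v v = 0 \<longleftrightarrow> v = 0"
proof -
  have "inj ((*v) A)" using assms by (simp add: inj_matrix_vector_mult invertible_det_nz)
  then show ?thesis by (metis injD matrix_vector_mult_0_right)
qed

lemma proj_map_pt:
  fixes A :: "real ^ 'n::finite option ^ 'n option"
  assumes "det A \<noteq> 0" "v \<noteq> 0" shows "proj_map A (proj_pt v) = proj_pt (A *v v)"
proof -
  have "(\<lambda>x. A *v x) ` span {v} = span {A *v v}"
    using linear_span_image[OF matrix_vector_mul_linear[of A], of "{v}"] by simp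
  then show ?thesis by (simp add: proj_map_def line_of_proj_pt assms(2)) (simp add: proj_pt_def)
qed

lemma line_of_proj_map:
  fixes A :: "real ^ 'n::finite option ^ 'n option"
  assumes "det A \<noteq> 0" "x \<in> line_of p" shows "A *v x \<in> line_of (proj_map A p)"
proof -
  obtain v where v: "v \<noteq> 0" "p = proj_pt v" using rp_obtain by blast
  then obtain r where r: "x = r *\<^sub>R v" using assms mem_line_proj_pt by blast
  have "A *v x = r *\<^sub>R (A *v v)" using r by (simp add: scaleR_matrix_vector_assoc matrix_vector_mult_scaleR)
  then show ?thesis using v assms by (auto simp: proj_map_pt mem_line_proj_pt det_nz_mult_zero)
qed

lemma proj_map_comp:
  fixes A B :: "real ^ 'n::finite option ^ 'n option"
  assumes "det A \<noteq> 0" "det B \<noteq> 0" shows "proj_map A (proj_map B p) = proj_map (A ** B) p"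
proof -
  obtain v where v: "v \<noteq> 0" "p = proj_pt v" using rp_obtain by blast
  then show ?thesis using assms
    by (simp add: proj_map_pt det_nz_mult_zero det_mul matrix_vector_mul_assoc)
qed

lemma proj_map_mat1: "proj_map (mat 1) = (id :: 'n::finite rp \<Rightarrow> 'n rp)"
proof
  fix p :: "'n rp"
  obtain v where "v \<noteq> 0" "p = proj_pt v" using rp_obtain by blast
  then show "proj_map (mat 1) p = id p" by (simp add: proj_map_pt)
qed

lemma det_inv_matrix:
  fixes A :: "real ^ 'm ^ 'm::finite"
  assumes "det A \<noteq> 0"
  shows "matrix_inv A ** A = mat 1" "A ** matrix_inv A = mat 1" "det (matrix_inv A) \<noteq> 0"
    "matrix_inv A *v (A *v x) = x" "A *v (matrix_inv A *v x) = x"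
proof -
  have "\<exists>A'. A ** A' = mat 1 \<and> A' ** A = mat 1"
    using assms invertible_det_nz[of A] unfolding invertible_def by blast
  then have "A ** matrix_inv A = mat 1 \<and> matrix_inv A ** A = mat 1"
    unfolding matrix_inv_def by (rule someI_ex)
  then show *: "matrix_inv A ** A = mat 1" "A ** matrix_inv A = mat 1" by blast+
  have "det (matrix_inv A) * det A = 1" using * det_mul[of "matrix_inv A" A] by (simp add: det_I)
  then show "det (matrix_inv A) \<noteq> 0" by auto
  show "matrix_inv A *v (A *v x) = x" "A *v (matrix_inv A *v x) = x"
    using * by (simp_all add: matrix_vector_mul_assoc)
qed

lemma proj_map_inv:
  fixes A :: "real ^ 'n::finite option ^ 'n option"
  assumes "det A \<noteq> 0"
  shows "proj_map (matrix_inv A) (proj_map A p) = p" "proj_map A (proj_map (matrix_inv A) p) = p"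
  using det_inv_matrix[OF assms] assms by (simp_all add: proj_map_comp proj_map_mat1)

lemma inv_proj_map:
  fixes A :: "real ^ 'n::finite option ^ 'n option"
  assumes "det A \<noteq> 0"
  shows "bij (proj_map A)" "inv (proj_map A) = proj_map (matrix_inv A)"
proof -
  show b: "bij (proj_map A)"
    by (rule bij_betw_byWitness[where f' = "proj_map (matrix_inv A)"]) (auto simp: proj_map_inv assms)
  show "inv (proj_map A) = proj_map (matrix_inv A)"
    by (rule inv_equality) (auto simp: proj_map_inv assms)
qed

lemma PGL_E: assumes "\<gamma> \<in> PGL" obtains A where "det A \<noteq> 0" "\<gamma> = proj_map A"
  using assms unfolding PGL_def by auto

lemma PGL_I: "det A \<noteq> 0 \<Longrightarrow> proj_map A \<in> PGL"
  unfolding PGL_def by auto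

lemma PGL_group:
  "id \<in> PGL" "\<gamma> \<in> PGL \<Longrightarrow> \<delta> \<in> PGL \<Longrightarrow> \<gamma> \<circ> \<delta> \<in> PGL" "\<gamma> \<in> PGL \<Longrightarrow> inv \<gamma> \<in> PGL" "\<gamma> \<in> PGL \<Longrightarrow> bij \<gamma>"
proof -
  show "id \<in> PGL" using PGL_I[of "mat 1"] by (simp add: proj_map_mat1)
  show "\<gamma> \<circ> \<delta> \<in> PGL" if "\<gamma> \<in> PGL" "\<delta> \<in> PGL"
  proof -
    obtain A B where AB: "det A \<noteq> 0" "\<gamma> = proj_map A" "det B \<noteq> 0" "\<delta> = proj_map B"
      using \<open>\<gamma> \<in> PGL\<close> \<open>\<delta> \<in> PGL\<close> PGL_E by metis
    then have "\<gamma> \<circ> \<delta> = proj_map (A ** B)" by (auto simp: proj_map_comp)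
    then show ?thesis using AB PGL_I[of "A ** B"] by (simp add: det_mul)
  qed
  show "inv \<gamma> \<in> PGL" if "\<gamma> \<in> PGL"
    using that inv_proj_map det_inv_matrix(3) PGL_I PGL_E by metis
  show "bij \<gamma>" if "\<gamma> \<in> PGL" using that inv_proj_map PGL_E by metis
qed

text \<open>A matrix for which every vector is an eigenvector is scalar.\<close>

lemma proj_map_eq_iff:
  fixes A B :: "real ^ 'n::finite option ^ 'n option"
  assumes A: "det A \<noteq> 0" and B: "det B \<noteq> 0"
  shows "proj_map A = proj_map B \<longleftrightarrow> (\<exists>c. c \<noteq> 0 \<and> (\<forall>v. B *v v = c *\<^sub>R (A *v v)))"
proof
  assume eq: "proj_map A = proj_map B"
  have ex: "\<exists>r. B *v v = r *\<^sub>R (A *v v)" if "v \<noteq> 0" for v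
  proof -
    have "proj_pt (A *v v) = proj_pt (B *v v)" using eq that A B by (metis proj_map_pt)
    then show ?thesis using that A B by (simp add: proj_pt_eq_iff det_nz_mult_zero)
  qed
  then obtain r where r: "\<And>v. v \<noteq> 0 \<Longrightarrow> B *v v = r v *\<^sub>R (A *v v)" by metis
  have inj: "A *v v = A *v w \<Longrightarrow> v = w" for v w using det_inv_matrix(4)[OF A] by metis
  \<comment> \<open>Eigenvalues at dependent vectors agree by linearity; at independent ones they
    are compared through \<open>v + w\<close>.\<close>
  have same: "r v = r w" if vw: "v \<noteq> 0" "w \<noteq> 0" for v w
  proof (cases "\<exists>s. w = s *\<^sub>R v")
    case True
    then obtain s where s: "w = s *\<^sub>R v" "s \<noteq> 0" using vw by auto
    have "r w *\<^sub>R (A *v w) = r v *\<^sub>R (A *v w)"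
      using r[OF vw(2)] r[OF vw(1)] s by (auto simp: matrix_vector_mult_scaleR)
    then have "r w = r v \<or> A *v w = 0" by (metis scaleR_cancel_right)
    then show ?thesis using vw A by (simp add: det_nz_mult_zero)
  next
    case False
    have nz: "v + w \<noteq> 0"
    proof
      assume "v + w = 0" then have "w = (-1) *\<^sub>R v" by (simp add: eq_neg_iff_add_eq_0 add.commute)
      then show False using False by blast
    qed
    have "r (v + w) *\<^sub>R (A *v v) + r (v + w) *\<^sub>R (A *v w) = r v *\<^sub>R (A *v v) + r w *\<^sub>R (A *v w)"
      using r[OF nz] r[OF vw(1)] r[OF vw(2)] by (simp add: matrix_vector_right_distrib scaleR_add_right)
    then have "(r (v + w) - r w) *\<^sub>R (A *v w) = (r v - r (v + w)) *\<^sub>R (A *v v)" by (simp add: algebra_simps)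
    then have "A *v ((r (v + w) - r w) *\<^sub>R w) = A *v ((r v - r (v + w)) *\<^sub>R v)"
      by (simp add: matrix_vector_mult_scaleR)
    then have e: "(r (v + w) - r w) *\<^sub>R w = (r v - r (v + w)) *\<^sub>R v" by (rule inj)
    have z: "r (v + w) - r w = 0"
    proof (rule ccontr)
      assume n: "r (v + w) - r w \<noteq> 0"
      have "w = ((r v - r (v + w)) / (r (v + w) - r w)) *\<^sub>R v"
        using arg_cong[OF e, of "\<lambda>x. (1 / (r (v + w) - r w)) *\<^sub>R x"] n by simp
      then show False using False by blast
    qed
    then show ?thesis using e vw by simp
  qed
  obtain e :: "real ^ 'n option" where e: "e \<noteq> 0" using vector_choose_size[of 1] by (metis norm_zero zero_neq_one zero_le_one)
  have "B *v v = r e *\<^sub>R (A *v v)" for v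
    using r[of v] same[of v e] e by (cases "v = 0") auto
  moreover have "r e \<noteq> 0" using r[OF e] e B by (metis det_nz_mult_zero scaleR_zero_left)
  ultimately show "\<exists>c. c \<noteq> 0 \<and> (\<forall>v. B *v v = c *\<^sub>R (A *v v))" by blast
next
  assume "\<exists>c. c \<noteq> 0 \<and> (\<forall>v. B *v v = c *\<^sub>R (A *v v))"
  then obtain c where c: "c \<noteq> 0" "\<And>v. B *v v = c *\<^sub>R (A *v v)" by blast
  show "proj_map A = proj_map B"
  proof
    fix p :: "'n rp"
    obtain v where "v \<noteq> 0" "p = proj_pt v" using rp_obtain by blast
    then show "proj_map A p = proj_map B p" using c A B by (simp add: proj_map_pt proj_pt_scale)
  qed
qed

lemma SLpm_nz: "A \<in> SLpm \<Longrightarrow> det A \<noteq> 0"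
  by (auto simp: SLpm_def)

lemma open_rp_iff: "open U \<longleftrightarrow> open {v. v \<noteq> 0 \<and> proj_pt v \<in> U}"
  by (simp add: open_rp_def)

text \<open>The saturation of \<open>S\<close> is the union of its nonzero scalings, all of them
  open.\<close>

lemma open_proj_pt_image:
  fixes S :: "(real ^ 'n::finite option) set"
  assumes S: "open S" "0 \<notin> S" shows "open (proj_pt ` S)"
proof -
  have "{v. v \<noteq> 0 \<and> proj_pt v \<in> proj_pt ` S} = (\<Union>r\<in>-{0}. (\<lambda>x. r *\<^sub>R x) ` S)" (is "?L = ?R")
  proof (intro set_eqI iffI)
    fix v assume "v \<in> ?L"
    then obtain x where x: "v \<noteq> 0" "x \<in> S" "proj_pt v = proj_pt x" by auto
    then have "x \<noteq> 0" using S by auto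
    then obtain r where r: "v = r *\<^sub>R x" using x proj_pt_eq_iff[of x v] by metis
    then show "v \<in> ?R" using x by auto
  next
    fix v assume "v \<in> ?R"
    then obtain r x where "r \<noteq> 0" "x \<in> S" "v = r *\<^sub>R x" by auto
    then show "v \<in> ?L" using S by (auto simp: proj_pt_scale)
  qed
  moreover have "open ?R" using S by (auto intro!: open_UN open_scaling)
  ultimately show ?thesis by (simp add: open_rp_iff)
qed

lemma continuous_on_proj_pt: "continuous_on (- {0}) (proj_pt :: real ^ 'n::finite option \<Rightarrow> _)"
proof (subst continuous_on_open_vimage)
  show "open (- {0 :: real ^ 'n option})" by auto
  show "\<forall>B. open B \<longrightarrow> open (proj_pt -` B \<inter> - {0 :: real ^ 'n option})"
  proof (intro allI impI)
    fix B :: "'n rp set" assume "open B"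
    moreover have "proj_pt -` B \<inter> - {0} = {v. v \<noteq> 0 \<and> proj_pt v \<in> B}" by auto
    ultimately show "open (proj_pt -` B \<inter> - {0 :: real ^ 'n option})" by (simp add: open_rp_iff)
  qed
qed

lemma continuous_on_proj_map:
  fixes A :: "real ^ 'n::finite option ^ 'n option"
  assumes A: "det A \<noteq> 0" shows "continuous_on S (proj_map A)"
proof -
  have "open (proj_map A -` U)" if U: "open U" for U
  proof -
    have "{v. v \<noteq> 0 \<and> proj_pt v \<in> proj_map A -` U} = (\<lambda>v. A *v v) -` {v. v \<noteq> 0 \<and> proj_pt v \<in> U}"
      using A by (auto simp: proj_map_pt det_nz_mult_zero)
    moreover have "open \<dots>" using U unfolding open_rp_iff[of U]
      by (intro linear_vimage_open matrix_vector_mul_linear)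
    ultimately show ?thesis by (simp add: open_rp_iff)
  qed
  then have "continuous_on UNIV (proj_map A)" by (simp add: continuous_on_open_vimage)
  then show ?thesis using continuous_on_subset by blast
qed

lemma open_PGL_image:
  assumes "\<gamma> \<in> PGL" "open U" shows "open (\<gamma> ` U)" "open (\<gamma> -` U)"
proof -
  have vi: "open (\<delta> -` U)" if "\<delta> \<in> PGL" "open U" for \<delta> :: "'n::finite rp \<Rightarrow> 'n rp" and U
    using that continuous_on_proj_map by (metis PGL_E open_vimage)
  show "open (\<gamma> -` U)" using vi assms by blast
  have "bij \<gamma>" using PGL_group(4)[OF assms(1)] .
  then have "inv \<gamma> -` U = \<gamma> ` U"
    using bij_vimage_eq_inv_image[OF bij_imp_bij_inv, of \<gamma> U] by (simp add: inv_inv_eq)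
  then show "open (\<gamma> ` U)" using vi PGL_group(3) assms by metis
qed

lemma hom_vec_nth [simp]: "hom_vec t $ None = 1" "hom_vec t $ Some i = t $ i"
  by (simp_all add: hom_vec_def)

lemma hom_vec_nz: "hom_vec t \<noteq> 0"
proof
  assume "hom_vec t = 0" then have "hom_vec t $ None = 0" by simp then show False by simp
qed

lemma B_hom_vec_nz: "det B \<noteq> 0 \<Longrightarrow> B *v hom_vec t \<noteq> 0"
  by (simp add: det_nz_mult_zero hom_vec_nz)

lemma continuous_on_hom_vec: "continuous_on S (hom_vec :: real ^ 'n::finite \<Rightarrow> _)"
proof -
  have "continuous_on S (\<lambda>t. case k of Some i \<Rightarrow> t $ i | None \<Rightarrow> (1 :: real))" for k :: "'n option"
    by (cases k) (auto intro!: continuous_intros)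
  then show ?thesis unfolding hom_vec_def by (intro continuous_on_vec_lambda)
qed

text \<open>Inverse of \<open>hom_vec\<close> up to scale, meaningful where the last coordinate is
  nonzero.\<close>

definition inhom :: "real ^ 'n option \<Rightarrow> real ^ 'n::finite" where
  "inhom x = (\<chi> i. x $ Some i / x $ None)"

lemma hom_vec_inhom: "x $ None \<noteq> 0 \<Longrightarrow> x = (x $ None) *\<^sub>R hom_vec (inhom x)"
  by (auto simp: vec_eq_iff inhom_def hom_vec_def split: option.split)

lemma inhom_hom_vec: "r \<noteq> 0 \<Longrightarrow> inhom (r *\<^sub>R hom_vec t) = t"
  by (simp add: inhom_def vec_eq_iff)

lemma continuous_on_inhom: "continuous_on {x. x $ None \<noteq> 0} inhom"
  unfolding inhom_def by (auto intro!: continuous_intros)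

lemma affine_pt_inj: "det B \<noteq> 0 \<Longrightarrow> inj_on (affine_pt B) D"
proof (rule inj_onI)
  fix s t assume B: "det B \<noteq> 0" and "affine_pt B s = affine_pt B t"
  then obtain r where "B *v hom_vec t = r *\<^sub>R (B *v hom_vec s)"
    using B_hom_vec_nz proj_pt_eq_iff unfolding affine_pt_def by metis
  then have "hom_vec t = r *\<^sub>R hom_vec s" using det_inv_matrix(4)[OF B] by (metis matrix_vector_mult_scaleR)
  then have t: "hom_vec t = r *\<^sub>R hom_vec s" .
  have "r = 1" using arg_cong[OF t, of "\<lambda>x. x $ None"] by simp
  then show "s = t" using t inhom_hom_vec[of 1] by (metis scaleR_one zero_neq_one)
qed

text \<open>In the coordinates of \<open>B\<close> the cone is a condition on the sign of the last
  coordinate and on the quotients by it. This form gives openness, and later the exclusion of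
  opposite vectors.\<close>

lemma pcone_affine:
  fixes B :: "real ^ 'n::finite option ^ 'n option"
  assumes B: "det B \<noteq> 0"
  shows "pcone ((\<lambda>t. B *v hom_vec t) ` D) =
    {x. (matrix_inv B *v x) $ None > 0 \<and> inhom (matrix_inv B *v x) \<in> D}" (is "?L = ?R")
proof (intro set_eqI iffI)
  fix x assume "x \<in> ?L"
  then obtain r t where "r > 0" "t \<in> D" "x = r *\<^sub>R (B *v hom_vec t)" by (auto simp: pcone_def)
  then have "matrix_inv B *v x = r *\<^sub>R hom_vec t" "r > 0" "t \<in> D"
    using det_inv_matrix(4)[OF B] by (simp_all add: matrix_vector_mult_scaleR)
  then show "x \<in> ?R" by (simp add: inhom_hom_vec)
next
  fix x assume x: "x \<in> ?R"
  define y where "y = matrix_inv B *v x"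
  have "B *v y = x" using det_inv_matrix(5)[OF B] by (simp add: y_def)
  moreover have "y = (y $ None) *\<^sub>R hom_vec (inhom y)" using x by (intro hom_vec_inhom) (simp add: y_def)
  ultimately have "x = (y $ None) *\<^sub>R (B *v hom_vec (inhom y))" by (metis matrix_vector_mult_scaleR)
  then show "x \<in> ?L" using x by (auto simp: pcone_def y_def)
qed

lemma open_pcone_affine:
  fixes B :: "real ^ 'n::finite option ^ 'n option"
  assumes B: "det B \<noteq> 0" and D: "open D"
  shows "open (pcone ((\<lambda>t. B *v hom_vec t) ` D))"
proof -
  define T where "T = {y :: real ^ 'n option. y $ None > 0}"
  have oT: "open T" unfolding T_def by (intro open_Collect_less continuous_intros)
  have "continuous_on T inhom" by (rule continuous_on_subset[OF continuous_on_inhom]) (auto simp: T_def)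
  then have "open (T \<inter> inhom -` D)" using continuous_open_preimage oT D by blast
  then have "open ((\<lambda>x. matrix_inv B *v x) -` (T \<inter> inhom -` D))"
    by (intro linear_vimage_open matrix_vector_mul_linear)
  moreover have "(\<lambda>x. matrix_inv B *v x) -` (T \<inter> inhom -` D) = pcone ((\<lambda>t. B *v hom_vec t) ` D)"
    unfolding pcone_affine[OF B] by (auto simp: T_def)
  ultimately show ?thesis by simp
qed

lemma convex_affine_image:
  assumes "convex D" shows "convex ((\<lambda>t. B *v hom_vec t) ` D)"
proof (rule convexI)
  fix x y and a b :: real assume xy: "x \<in> (\<lambda>t. B *v hom_vec t) ` D" "y \<in> (\<lambda>t. B *v hom_vec t) ` D"
    and ab: "0 \<le> a" "0 \<le> b" "a + b = 1"
  obtain s t where st: "s \<in> D" "t \<in> D" "x = B *v hom_vec s" "y = B *v hom_vec t" using xy by auto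
  have "a *\<^sub>R hom_vec s + b *\<^sub>R hom_vec t = hom_vec (a *\<^sub>R s + b *\<^sub>R t)"
    using ab by (auto simp: vec_eq_iff hom_vec_def split: option.split)
  then have "a *\<^sub>R x + b *\<^sub>R y = B *v hom_vec (a *\<^sub>R s + b *\<^sub>R t)"
    unfolding st by (metis matrix_vector_mult_scaleR matrix_vector_right_distrib)
  then show "a *\<^sub>R x + b *\<^sub>R y \<in> (\<lambda>t. B *v hom_vec t) ` D" using convexD[OF assms st(1,2) ab] by blast
qed

lemma proj_pt_pcone:
  fixes S :: "(real ^ 'n::finite option) set"
  shows "proj_pt ` pcone S = proj_pt ` S"
proof (intro set_eqI iffI)
  fix p :: "'n rp" assume "p \<in> proj_pt ` pcone S" then show "p \<in> proj_pt ` S" by (auto simp: pcone_def proj_pt_scale)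
next
  fix p :: "'n rp" assume "p \<in> proj_pt ` S" then show "p \<in> proj_pt ` pcone S" using subset_pcone by blast
qed

lemma affine_pt_image: "affine_pt B ` D = proj_pt ` pcone ((\<lambda>t. B *v hom_vec t) ` D)"
  by (simp add: proj_pt_pcone affine_pt_def image_image)

lemma pcone_affine_0: "det B \<noteq> 0 \<Longrightarrow> 0 \<notin> pcone ((\<lambda>t. B *v hom_vec t) ` D)"
  by (auto simp: pcone_def B_hom_vec_nz)

lemma open_affine_pt_image: "det B \<noteq> 0 \<Longrightarrow> open D \<Longrightarrow> open (affine_pt B ` D)"
  unfolding affine_pt_image by (intro open_proj_pt_image open_pcone_affine pcone_affine_0)

lemma continuous_on_affine_pt: "det B \<noteq> 0 \<Longrightarrow> continuous_on D (affine_pt B)"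
  unfolding affine_pt_def
  by (rule continuous_on_compose2[OF continuous_on_proj_pt])
    (auto intro!: continuous_on_compose2[OF matrix_vector_mult_linear_continuous_on continuous_on_hom_vec] simp: B_hom_vec_nz)

lemma affine_pt_homeomorphism:
  assumes "det B \<noteq> 0" "open D"
  obtains g where "homeomorphism D (affine_pt B ` D) (affine_pt B) g"
proof (rule homeomorphism_injective_open_map[OF continuous_on_affine_pt[OF assms(1)] refl affine_pt_inj[OF assms(1)]])
  fix U assume "openin (top_of_set D) U"
  then have "open U" "U \<subseteq> D" using assms(2) openin_open_eq by auto
  then show "openin (top_of_set (affine_pt B ` D)) (affine_pt B ` U)"
    using open_affine_pt_image[OF assms(1)] assms(2) by (subst openin_open_eq) auto
qed

section \<open>Strict convexity from the Hessian\<close>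

section \<open>Smooth functions with positive definite Hessian\<close>

lemma smooth_onD:
  assumes "smooth_on S f"
  shows "t \<in> S \<Longrightarrow> f differentiable (at t)" "smooth_on S (partial i f)" "continuous_on S f"
proof -
  have *: "Ck_on (Suc k) S f" for k using assms by (auto simp: smooth_on_def simp del: Ck_on.simps)
  show "t \<in> S \<Longrightarrow> f differentiable (at t)" "smooth_on S (partial i f)" using * by (auto simp: smooth_on_def)
  show "continuous_on S f" using assms Ck_on.simps(1) unfolding smooth_on_def by blast
qed

lemma smooth_on_subset: "smooth_on S f \<Longrightarrow> T \<subseteq> S \<Longrightarrow> smooth_on T f"
proof -
  have "Ck_on k S f \<Longrightarrow> T \<subseteq> S \<Longrightarrow> Ck_on k T f" for k f
    by (induction k arbitrary: f) (auto intro: continuous_on_subset)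
  then show "smooth_on S f \<Longrightarrow> T \<subseteq> S \<Longrightarrow> smooth_on T f" by (auto simp: smooth_on_def)
qed

lemma frechet_derivative_partial:
  fixes f :: "real ^ 'n::finite \<Rightarrow> real"
  assumes "f differentiable (at t)"
  shows "frechet_derivative f (at t) v = (\<Sum>i\<in>UNIV. v $ i * partial i f t)"
proof -
  have lin: "linear (frechet_derivative f (at t))" using assms by (rule linear_frechet_derivative)
  have "v = (\<Sum>i\<in>UNIV. v $ i *\<^sub>R axis i 1)" using basis_expansion[of v] by (simp add: scalar_mult_eq_scaleR)
  then have "frechet_derivative f (at t) v = frechet_derivative f (at t) (\<Sum>i\<in>UNIV. v $ i *\<^sub>R axis i 1)" by simp
  also have "\<dots> = (\<Sum>i\<in>UNIV. v $ i * partial i f t)"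
    by (simp add: linear_sum[OF lin] linear_scale[OF lin] partial_def)
  finally show ?thesis .
qed

lemma DERIV_along_line:
  fixes f :: "real ^ 'n::finite \<Rightarrow> real"
  assumes "f differentiable (at (s + r *\<^sub>R v))"
  shows "((\<lambda>r. f (s + r *\<^sub>R v)) has_real_derivative (\<Sum>i\<in>UNIV. v $ i * partial i f (s + r *\<^sub>R v))) (at r)"
proof -
  have "(f has_derivative frechet_derivative f (at (s + r *\<^sub>R v))) (at (s + r *\<^sub>R v))"
    using assms frechet_derivative_works by blast
  moreover have "((\<lambda>r. s + r *\<^sub>R v) has_derivative (\<lambda>h. h *\<^sub>R v)) (at r)"
    by (auto intro!: derivative_eq_intros)
  ultimately have "((\<lambda>r. f (s + r *\<^sub>R v)) has_derivative (\<lambda>h. frechet_derivative f (at (s + r *\<^sub>R v)) (h *\<^sub>R v))) (at r)"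
    using diff_chain_at[of "\<lambda>r. s + r *\<^sub>R v" _ r f] by (simp add: o_def)
  moreover have "frechet_derivative f (at (s + r *\<^sub>R v)) (h *\<^sub>R v) = (\<Sum>i\<in>UNIV. v $ i * partial i f (s + r *\<^sub>R v)) * h" for h
    unfolding frechet_derivative_partial[OF assms] by (simp add: sum_distrib_left mult_ac)
  ultimately show ?thesis by (simp add: has_field_derivative_def)
qed

text \<open>Along the segment the second derivative is the quadratic form of the Hessian, so the
  first derivative increases strictly; two mean values, one on each side of \<open>b\<close>,
  compare the slopes of the chords.\<close>

lemma hessian_strict_convex:
  fixes f :: "real ^ 'n::finite \<Rightarrow> real"
  assumes sm: "smooth_on T f" and T: "convex T" and pd: "\<And>t. t \<in> T \<Longrightarrow> positive_definite (hessian f t)"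
    and st: "s \<in> T" "t \<in> T" "s \<noteq> t" and ab: "0 < a" "0 < b" "a + b = (1::real)"
  shows "f (a *\<^sub>R s + b *\<^sub>R t) < a * f s + b * f t"
proof -
  define v where "v = t - s"
  have v: "v \<noteq> 0" using st by (simp add: v_def)
  have inT: "s + r *\<^sub>R v \<in> T" if "0 \<le> r" "r \<le> 1" for r
  proof -
    have "s + r *\<^sub>R v = (1 - r) *\<^sub>R s + r *\<^sub>R t" by (simp add: v_def algebra_simps)
    then show ?thesis using convexD[OF T st(1,2), of "1 - r" r] that by simp
  qed
  define g g1 g2 where "g r = f (s + r *\<^sub>R v)"
    and "g1 r = (\<Sum>i\<in>UNIV. v $ i * partial i f (s + r *\<^sub>R v))"
    and "g2 r = (\<Sum>i\<in>UNIV. v $ i * (\<Sum>j\<in>UNIV. v $ j * partial j (partial i f) (s + r *\<^sub>R v)))" for r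
  have d1: "(g has_real_derivative g1 r) (at r)" if "0 \<le> r" "r \<le> 1" for r
    unfolding g_def g1_def using smooth_onD(1)[OF sm inT[OF that]] by (rule DERIV_along_line)
  have d2: "(g1 has_real_derivative g2 r) (at r)" if "0 \<le> r" "r \<le> 1" for r
    unfolding g1_def g2_def
    by (intro DERIV_sum DERIV_cmult DERIV_along_line smooth_onD(1)[OF smooth_onD(2)[OF sm] inT[OF that]])
  have pos: "g2 r > 0" if "0 \<le> r" "r \<le> 1" for r
  proof -
    have "v \<bullet> (hessian f (s + r *\<^sub>R v) *v v) > 0" using pd[OF inT[OF that]] v by (simp add: positive_definite_def)
    also have "v \<bullet> (hessian f (s + r *\<^sub>R v) *v v)
      = (\<Sum>i\<in>UNIV. \<Sum>j\<in>UNIV. v $ i * (partial i (partial j f) (s + r *\<^sub>R v) * v $ j))"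
      by (simp add: inner_vec_def matrix_vector_mult_def hessian_def sum_distrib_left)
    \<comment> \<open>The outer derivative carries the first index of \<open>hessian\<close> but the
      inner summation index of \<open>g2\<close>.\<close>
    also have "\<dots> = g2 r" unfolding g2_def sum_distrib_left by (subst sum.swap) (simp add: mult_ac)
    finally show ?thesis .
  qed
  have b1: "b < 1" using ab by simp
  obtain x1 where x1: "0 < x1" "x1 < b" "g b - g 0 = (b - 0) * g1 x1"
    using MVT2[of 0 b g g1] ab b1 d1 by auto
  obtain x2 where x2: "b < x2" "x2 < 1" "g 1 - g b = (1 - b) * g1 x2"
    using MVT2[of b 1 g g1] ab b1 d1 by auto
  have "g1 x1 < g1 x2"
  proof (rule DERIV_pos_imp_increasing[of x1 x2 g1])
    fix r assume "x1 \<le> r" "r \<le> x2"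
    then have "0 \<le> r" "r \<le> 1" using x1 x2 by auto
    then show "\<exists>y. (g1 has_real_derivative y) (at r) \<and> 0 < y" using d2 pos by blast
  qed (use x1 x2 in simp)
  then have "a * (b * g1 x1) < a * (b * g1 x2)" using ab by simp
  moreover have "a = 1 - b" using ab by simp
  ultimately have "a * (g b - g 0) < b * (g 1 - g b)" using x1 x2 by (simp add: mult_ac)
  moreover have "a * g b + b * g b = g b" using ab by (metis distrib_right mult_1)
  ultimately have "g b < a * g 0 + b * g 1" by (simp add: algebra_simps)
  moreover have "s + b *\<^sub>R v = a *\<^sub>R s + b *\<^sub>R t" unfolding \<open>a = 1 - b\<close> by (simp add: v_def algebra_simps)
  ultimately show ?thesis by (simp add: g_def v_def)
qed

text \<open>An orthogonal map turns \<open>x\<close> onto the last axis, and orthogonal matrices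
  have determinant \<open>1\<close> or \<open>-1\<close>. Smoothness of a section is given in such
  unimodular coordinates only.\<close>

lemma SLpm_positive_coordinate:
  fixes x :: "real ^ 'n::finite option"
  assumes "x \<noteq> 0" obtains B where "B \<in> SLpm" "(matrix_inv B *v x) $ None > 0"
proof -
  obtain f where f: "orthogonal_transformation f" "f x = norm x *\<^sub>R (axis None 1 :: real ^ 'n option)"
    using orthogonal_transformation_exists[of x "norm x *\<^sub>R (axis None 1 :: real ^ 'n option)"] by (auto simp: norm_axis_1)
  define A where "A = matrix f"
  have "orthogonal_matrix A" using f(1) orthogonal_transformation_matrix[of f] by (simp add: A_def)
  then have d: "det A = 1 \<or> det A = -1" by (rule det_orthogonal_matrix)
  then have nz: "det A \<noteq> 0" by auto
  have Ax: "A *v x = norm x *\<^sub>R axis None 1"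
    using f matrix_works[of f x] by (simp add: A_def orthogonal_transformation_linear)
  define B where "B = matrix_inv A"
  have "det B * det A = 1" using det_inv_matrix(1)[OF nz] det_mul[of B A] by (simp add: det_I B_def)
  then have "det B = 1 \<or> det B = -1" using d by auto
  moreover have "matrix_inv B *v x = A *v x"
    using det_inv_matrix(4)[OF det_inv_matrix(3)[OF nz], of "A *v x"] det_inv_matrix(4)[OF nz, of x] by (simp add: B_def)
  ultimately show ?thesis using that[of B] Ax assms by (simp add: SLpm_def axis_def)
qed

section \<open>Homogeneous charts of the half-line bundle of positive vectors\<close>

section \<open>The space of positive vectors\<close>

locale lifted_atlas =
  fixes M :: "'a topology" and \<B> :: "('a, 'n::finite) atlas" and g :: "('a, 'n) lift"
  assumes mfd: "proj_flat_manifold M \<B>" and lift: "transition_lift M \<B> g"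
begin

lemma chart:
  assumes "c \<in> \<B>"
  shows "openin M (fst c)" "open (snd c ` fst c)" "fst c \<subseteq> topspace M"
    "homeomorphic_map (subtopology M (fst c)) (top_of_set (snd c ` fst c)) (snd c)"
  using assms mfd by (auto simp: proj_flat_manifold_def proj_chart_def)

lemma topspace_charts: "p \<in> topspace M \<Longrightarrow> \<exists>c\<in>\<B>. p \<in> fst c"
  using mfd unfolding proj_flat_manifold_def by blast

lemma chart_inj: "c \<in> \<B> \<Longrightarrow> inj_on (snd c) (fst c)"
  using homeomorphic_imp_injective_map[OF chart(4)] chart(3) by (metis inf.absorb_iff2 topspace_subtopology)

lemma chart_open_image:
  assumes c: "c \<in> \<B>" and W: "openin M W" "W \<subseteq> fst c" shows "open (snd c ` W)"
proof -
  have "openin (subtopology M (fst c)) W" using W by (metis inf.absorb_iff2 inf_commute openin_subtopology)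
  moreover have "W \<subseteq> topspace (subtopology M (fst c))" using W chart(3)[OF c] by auto
  ultimately have "openin (top_of_set (snd c ` fst c)) (snd c ` W)"
    using homeomorphic_map_openness[OF chart(4)[OF c]] by blast
  then show ?thesis using chart(2)[OF c] openin_open_eq by blast
qed

lemma chart_preimage:
  assumes c: "c \<in> \<B>" and T: "open T" shows "openin M {p \<in> fst c. snd c p \<in> T}"
proof -
  have "continuous_map (subtopology M (fst c)) (top_of_set (snd c ` fst c)) (snd c)"
    using chart(4)[OF c] homeomorphic_imp_continuous_map by blast
  moreover have "openin (top_of_set (snd c ` fst c)) (T \<inter> snd c ` fst c)" using T by (metis inf_commute openin_open_Int)
  ultimately have "openin (subtopology M (fst c)) {p \<in> topspace (subtopology M (fst c)). snd c p \<in> T \<inter> snd c ` fst c}"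
    using openin_continuous_map_preimage by blast
  moreover have "{p \<in> topspace (subtopology M (fst c)). snd c p \<in> T \<inter> snd c ` fst c} = {p \<in> fst c. snd c p \<in> T}"
    using chart(3)[OF c] by auto
  ultimately show ?thesis using openin_trans_full chart(1)[OF c] by (metis (no_types, lifting))
qed

definition pt where "pt c x = inv_into (fst c) (snd c) (proj_pt x)"

text \<open>Whole punctured lines over the image of the chart; \<open>V\<close> will select the
  positive half of each.\<close>

definition dom where "dom c = {x. x \<noteq> 0 \<and> proj_pt x \<in> snd c ` fst c}"

lemma pt_in: "x \<in> dom c \<Longrightarrow> pt c x \<in> fst c" "x \<in> dom c \<Longrightarrow> snd c (pt c x) = proj_pt x"
  unfolding pt_def dom_def by (auto simp: inv_into_into f_inv_into_f)

lemma pt_unique: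
  assumes "c \<in> \<B>" "p \<in> fst c" "snd c p = proj_pt x" "x \<noteq> 0" shows "x \<in> dom c" "pt c x = p"
proof -
  show "x \<in> dom c" using assms unfolding dom_def by (metis (mono_tags) imageI mem_Collect_eq)
  show "pt c x = p" using assms chart_inj unfolding pt_def by (metis inv_into_f_f)
qed

lemma dom_scale: "x \<in> dom c \<Longrightarrow> r \<noteq> 0 \<Longrightarrow> r *\<^sub>R x \<in> dom c" "r \<noteq> 0 \<Longrightarrow> pt c (r *\<^sub>R x) = pt c x"
  by (auto simp: dom_def pt_def proj_pt_scale)

lemma pt_preimage_open:
  assumes "c \<in> \<B>" "openin M W" shows "open {x \<in> dom c. pt c x \<in> W}"
proof -
  have "{x \<in> dom c. pt c x \<in> W} = {x. x \<noteq> 0 \<and> proj_pt x \<in> snd c ` (W \<inter> fst c)}"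
  proof (intro set_eqI iffI)
    fix x assume x: "x \<in> {x \<in> dom c. pt c x \<in> W}"
    then have "pt c x \<in> W \<inter> fst c" "snd c (pt c x) = proj_pt x" using pt_in[of x c] by auto
    then have "proj_pt x \<in> snd c ` (W \<inter> fst c)" by (metis imageI)
    then show "x \<in> {x. x \<noteq> 0 \<and> proj_pt x \<in> snd c ` (W \<inter> fst c)}" using x by (auto simp: dom_def)
  next
    fix x assume "x \<in> {x. x \<noteq> 0 \<and> proj_pt x \<in> snd c ` (W \<inter> fst c)}"
    then obtain p where "p \<in> W" "p \<in> fst c" "snd c p = proj_pt x" "x \<noteq> 0" by auto
    then show "x \<in> {x \<in> dom c. pt c x \<in> W}" using pt_unique[OF assms(1)] by auto
  qed
  moreover have "open (snd c ` (W \<inter> fst c))" using assms chart(1)[OF assms(1)] by (intro chart_open_image openin_Int) auto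
  ultimately show ?thesis by (simp add: open_rp_iff)
qed

lemma pt_image_open:
  assumes c: "c \<in> \<B>" and O: "open T" "T \<subseteq> dom c" shows "openin M (pt c ` T)"
proof -
  have "pt c ` T = {p \<in> fst c. snd c p \<in> proj_pt ` T}"
  proof (intro set_eqI iffI)
    fix p assume "p \<in> pt c ` T" then show "p \<in> {p \<in> fst c. snd c p \<in> proj_pt ` T}"
      using O pt_in[where c = c] by (auto simp: subset_iff)
  next
    fix p assume "p \<in> {p \<in> fst c. snd c p \<in> proj_pt ` T}"
    then obtain x where x: "p \<in> fst c" "x \<in> T" "snd c p = proj_pt x" by auto
    then have "x \<noteq> 0" using O by (auto simp: dom_def)
    then show "p \<in> pt c ` T" using pt_unique[OF c] x by blast
  qed
  moreover have "open (proj_pt ` T)" using O by (intro open_proj_pt_image) (auto simp: dom_def)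
  ultimately show ?thesis using chart_preimage[OF c] by simp
qed

lemma pt_continuous:
  assumes "c \<in> \<B>" "T \<subseteq> dom c" shows "continuous_map (top_of_set T) M (pt c)"
  unfolding continuous_map_def
proof (intro conjI allI impI)
  show "pt c \<in> topspace (top_of_set T) \<rightarrow> topspace M"
    using assms pt_in(1)[of _ c] chart(3)[OF assms(1)] by (auto simp: subset_iff)
  fix W assume "openin M W"
  then have "open {x \<in> dom c. pt c x \<in> W}" using pt_preimage_open assms by blast
  moreover have "{x \<in> topspace (top_of_set T). pt c x \<in> W} = T \<inter> {x \<in> dom c. pt c x \<in> W}" using assms by auto
  ultimately show "openin (top_of_set T) {x \<in> topspace (top_of_set T). pt c x \<in> W}" by (simp add: openin_open_Int)
qed

lemma g_local:
  assumes "c \<in> \<B>" "c' \<in> \<B>" "p \<in> fst c" "p \<in> fst c'"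
  obtains W where "openin M W" "p \<in> W" "W \<subseteq> fst c \<inter> fst c'"
    "\<And>q. q \<in> W \<Longrightarrow> g c c' q = g c c' p" "\<And>q. q \<in> W \<Longrightarrow> snd c' q = proj_map (g c c' p) (snd c q)"
proof -
  have "\<forall>c\<in>\<B>. \<forall>c'\<in>\<B>. \<forall>p \<in> fst c \<inter> fst c'. \<exists>W. openin M W \<and> p \<in> W \<and> W \<subseteq> fst c \<inter> fst c' \<and>
           (\<forall>q\<in>W. g c c' q = g c c' p \<and> snd c' q = proj_map (g c c' p) (snd c q))"
    using lift unfolding transition_lift_def by blast
  then have "\<exists>W. openin M W \<and> p \<in> W \<and> W \<subseteq> fst c \<inter> fst c' \<and>
           (\<forall>q\<in>W. g c c' q = g c c' p \<and> snd c' q = proj_map (g c c' p) (snd c q))" using assms by simp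
  then obtain W where W: "openin M W \<and> p \<in> W \<and> W \<subseteq> fst c \<inter> fst c' \<and>
           (\<forall>q\<in>W. g c c' q = g c c' p \<and> snd c' q = proj_map (g c c' p) (snd c q))" ..
  show ?thesis
  proof (rule that[of W])
    show "openin M W" "p \<in> W" "W \<subseteq> fst c \<inter> fst c'" using W by blast+
    show "g c c' q = g c c' p" "snd c' q = proj_map (g c c' p) (snd c q)" if "q \<in> W" for q using W that by blast+
  qed
qed

lemma g_SLpm: "c \<in> \<B> \<Longrightarrow> c' \<in> \<B> \<Longrightarrow> p \<in> fst c \<Longrightarrow> p \<in> fst c' \<Longrightarrow> g c c' p \<in> SLpm"
  using lift unfolding transition_lift_def by simp

lemma g_nz: "c \<in> \<B> \<Longrightarrow> c' \<in> \<B> \<Longrightarrow> p \<in> fst c \<Longrightarrow> p \<in> fst c' \<Longrightarrow> det (g c c' p) \<noteq> 0"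
  using g_SLpm SLpm_nz by blast

lemma g_proj: "c \<in> \<B> \<Longrightarrow> c' \<in> \<B> \<Longrightarrow> p \<in> fst c \<Longrightarrow> p \<in> fst c' \<Longrightarrow> snd c' p = proj_map (g c c' p) (snd c p)"
  using g_local by metis

lemma g_cocycle:
  assumes "c \<in> \<B>" "c' \<in> \<B>" "c'' \<in> \<B>" "p \<in> fst c" "p \<in> fst c'" "p \<in> fst c''"
  shows "g c' c'' p *v (g c c' p *v x) = g c c'' p *v x"
proof -
  have "g c' c'' p ** g c c' p = g c c'' p" using lift assms unfolding transition_lift_def by blast
  then show ?thesis by (simp add: matrix_vector_mul_assoc)
qed

text \<open>The cocycle identity makes \<open>g c c p\<close> idempotent, and it is
  invertible.\<close>

lemma g_refl:
  assumes "c \<in> \<B>" "p \<in> fst c" shows "g c c p *v x = x"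
  using g_cocycle[OF assms(1,1,1) assms(2,2,2), of x] det_inv_matrix(4)[OF g_nz[OF assms(1,1) assms(2,2)]] by metis

abbreviation "fibre \<equiv> taut_fibre \<B> g"

abbreviation "elem \<equiv> taut_elem \<B> g"

lemma elem_fibre:
  assumes c: "c \<in> \<B>" "p \<in> fst c" "x \<in> line_of (snd c p)" shows "elem p c x \<in> fibre p"
  unfolding taut_fibre_def
proof (intro CollectI conjI ballI impI allI)
  fix d assume d: "d \<in> \<B>" "p \<in> fst d"
  then have "g c d p *v x \<in> line_of (proj_map (g c d p) (snd c p))" using c by (intro line_of_proj_map g_nz)
  then show "elem p c x d \<in> line_of (snd d p)" using d c g_proj[of c d p] by (simp add: taut_elem_def)
next
  fix d d' assume d: "d \<in> \<B>" "d' \<in> \<B>" "p \<in> fst d \<inter> fst d'"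
  then show "elem p c x d' = g d d' p *v elem p c x d" using c g_cocycle[of c d d' p x] by (simp add: taut_elem_def)
next
  fix d assume "d \<notin> \<B> \<or> p \<notin> fst d"
  then show "elem p c x d = 0" unfolding taut_elem_def by auto
qed

lemma elem_self: "c \<in> \<B> \<Longrightarrow> p \<in> fst c \<Longrightarrow> elem p c x c = x"
  by (simp add: taut_elem_def g_refl)

lemma fibreD:
  assumes "w \<in> fibre p"
  shows "c \<in> \<B> \<Longrightarrow> p \<in> fst c \<Longrightarrow> w c \<in> line_of (snd c p)"
    "c \<in> \<B> \<Longrightarrow> c' \<in> \<B> \<Longrightarrow> p \<in> fst c \<Longrightarrow> p \<in> fst c' \<Longrightarrow> w c' = g c c' p *v w c"
    "c \<notin> \<B> \<or> p \<notin> fst c \<Longrightarrow> w c = 0"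
  using assms unfolding taut_fibre_def by blast+

lemma fibre_elem:
  assumes "w \<in> fibre p" "c \<in> \<B>" "p \<in> fst c" shows "elem p c (w c) = w"
proof
  fix d show "elem p c (w c) d = w d"
  proof (cases "d \<in> \<B> \<and> p \<in> fst d")
    case True then show ?thesis using fibreD(2)[OF assms(1), of c d] assms by (simp add: taut_elem_def)
  next
    case False
    then have "w d = 0" using fibreD(3)[OF assms(1), of d] by blast
    then show ?thesis using False by (auto simp: taut_elem_def simp del: split_paired_All)
  qed
qed

lemma fibre_line: "w \<in> fibre p \<Longrightarrow> c \<in> \<B> \<Longrightarrow> p \<in> fst c \<Longrightarrow> w c \<in> line_of (snd c p)"
  by (rule fibreD(1))

lemma elem_change:
  assumes "c \<in> \<B>" "c' \<in> \<B>" "p \<in> fst c" "p \<in> fst c'"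
  shows "elem p c' (g c c' p *v x) = elem p c x"
proof
  fix d show "elem p c' (g c c' p *v x) d = elem p c x d"
    using assms g_cocycle[of c c' d p x] by (simp add: taut_elem_def)
qed

lemma elem_scale: "elem p c (r *\<^sub>R x) = (\<lambda>d. r *\<^sub>R elem p c x d)"
  by (auto simp: taut_elem_def matrix_vector_mult_scaleR)

lemma fibre_scale: "w \<in> fibre p \<Longrightarrow> (\<lambda>c. r *\<^sub>R w c) \<in> fibre p"
proof -
  assume w: "w \<in> fibre p"
  show ?thesis unfolding taut_fibre_def
  proof (intro CollectI conjI ballI impI allI)
    fix c assume "c \<in> \<B>" "p \<in> fst c"
    then show "r *\<^sub>R w c \<in> line_of (snd c p)" by (intro subspace_scale line_of_subspace(1) fibreD(1)[OF w])
  next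
    fix c c' assume "c \<in> \<B>" "c' \<in> \<B>" "p \<in> fst c \<inter> fst c'"
    then show "r *\<^sub>R w c' = g c c' p *v (r *\<^sub>R w c)" using fibreD(2)[OF w, of c c'] by (simp add: matrix_vector_mult_scaleR)
  next
    fix c assume "c \<notin> \<B> \<or> p \<notin> fst c"
    then show "r *\<^sub>R w c = 0" using fibreD(3)[OF w, of c] by simp
  qed
qed

end

locale taut_data = lifted_atlas M \<B> g
  for M :: "'a topology" and \<B> :: "('a, 'n::finite) atlas" and g :: "('a, 'n) lift" +
  fixes P :: "'a \<Rightarrow> ('a, 'n) taut_vec set" and u :: "'a \<Rightarrow> ('a, 'n) taut_vec \<Rightarrow> real"
  assumes ori: "taut_orientation M \<B> g P" and dual: "dual_section M \<B> g u"
    and neg: "negative_section M P u" and hess: "hessian_positive M \<B> g P u"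
    and comp: "compact_space M" and conn: "connected_space M" and ne: "topspace M \<noteq> {}"
begin

lemma P_ray:
  assumes "p \<in> topspace M"
  obtains w0 where "w0 \<in> fibre p" "w0 \<noteq> (\<lambda>c. 0)" "P p = {(\<lambda>c. r *\<^sub>R w0 c) |r. r > 0}"
proof -
  have "\<exists>w \<in> fibre p. w \<noteq> (\<lambda>c. 0) \<and> P p = {(\<lambda>c. r *\<^sub>R w c) |r. r > 0}"
    using ori assms unfolding taut_orientation_def by blast
  then obtain w where "w \<in> fibre p" "w \<noteq> (\<lambda>c. 0) \<and> P p = {(\<lambda>c. r *\<^sub>R w c) |r. r > 0}" ..
  then show ?thesis using that[of w] by simp
qed

lemma P_fibre: assumes "p \<in> topspace M" "w \<in> P p" shows "w \<in> fibre p"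
proof -
  obtain w0 where w0: "w0 \<in> fibre p" "w0 \<noteq> (\<lambda>c. 0)" "P p = {(\<lambda>c. r *\<^sub>R w0 c) |r. r > 0}" by (rule P_ray[OF assms(1)])
  then obtain r where "w = (\<lambda>c. r *\<^sub>R w0 c)" using assms(2) by auto
  then show ?thesis using fibre_scale[OF w0(1), of r] by simp
qed

lemma P_nonempty: assumes "p \<in> topspace M" obtains w where "w \<in> P p"
proof -
  obtain w0 where w0: "w0 \<in> fibre p" "w0 \<noteq> (\<lambda>c. 0)" "P p = {(\<lambda>c. r *\<^sub>R w0 c) |r. r > 0}" by (rule P_ray[OF assms])
  have "(\<lambda>c. 1 *\<^sub>R w0 c) \<in> P p" unfolding w0(3) using zero_less_one by blast
  then show ?thesis using that by blast
qed

lemma P_nz: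
  assumes p: "p \<in> topspace M" "w \<in> P p" and c: "c \<in> \<B>" "p \<in> fst c" shows "w c \<noteq> 0"
proof
  assume z: "w c = 0"
  obtain w0 where w0: "w0 \<in> fibre p" "w0 \<noteq> (\<lambda>c. 0)" "P p = {(\<lambda>c. r *\<^sub>R w0 c) |r. r > 0}" by (rule P_ray[OF p(1)])
  then obtain r where "r > 0" "w = (\<lambda>c. r *\<^sub>R w0 c)" using p by auto
  then have "w0 c = 0" using z by simp
  then have "w0 = elem p c 0" using fibre_elem[OF w0(1) c] by simp
  moreover have "elem p c 0 = (\<lambda>d. 0)" by (auto simp: taut_elem_def)
  ultimately show False using w0 by simp
qed

lemma P_scale:
  assumes p: "p \<in> topspace M" "w \<in> P p" and r: "r > 0" shows "(\<lambda>c. r *\<^sub>R w c) \<in> P p"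
proof -
  obtain w0 where w0: "w0 \<in> fibre p" "w0 \<noteq> (\<lambda>c. 0)" "P p = {(\<lambda>c. r *\<^sub>R w0 c) |r. r > 0}" by (rule P_ray[OF p(1)])
  then obtain s where s: "s > 0" "w = (\<lambda>c. s *\<^sub>R w0 c)" using p by auto
  then have "(\<lambda>c. r *\<^sub>R w c) = (\<lambda>c. (r * s) *\<^sub>R w0 c)" "r * s > 0" using r by auto
  then show ?thesis unfolding w0(3) by blast
qed

lemma P_multiple:
  assumes p: "p \<in> topspace M" "w \<in> P p" "w' \<in> P p" obtains r where "r > 0" "w' = (\<lambda>c. r *\<^sub>R w c)"
proof -
  obtain w0 where w0: "w0 \<in> fibre p" "w0 \<noteq> (\<lambda>c. 0)" "P p = {(\<lambda>c. r *\<^sub>R w0 c) |r. r > 0}" by (rule P_ray[OF p(1)])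
  then obtain s s' where s: "s > 0" "w = (\<lambda>c. s *\<^sub>R w0 c)" "s' > 0" "w' = (\<lambda>c. s' *\<^sub>R w0 c)" using p by auto
  then have "w' = (\<lambda>c. (s' / s) *\<^sub>R w c)" "s' / s > 0" by auto
  then show ?thesis using that by blast
qed

text \<open>\<open>L\<close> is the total space of the bundle of positive half-lines,
  \<open>V c\<close> is the part of it over \<open>c\<close> in homogeneous coordinates, and
  \<open>\<phi> c\<close> is the parametrization.\<close>

definition V where "V c = {x \<in> dom c. elem (pt c x) c x \<in> P (pt c x)}"

definition \<phi> where "\<phi> c x = (pt c x, elem (pt c x) c x)"

definition L where "L = {(p, w). p \<in> topspace M \<and> w \<in> P p}"

definition \<sigma> :: "real \<Rightarrow> 'a \<times> ('a, 'n) taut_vec \<Rightarrow> 'a \<times> ('a, 'n) taut_vec"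
  where "\<sigma> r z = (fst z, \<lambda>c. r *\<^sub>R snd z c)"

definition uu where "uu z = u (fst z) (snd z)"

lemma pt_top: "c \<in> \<B> \<Longrightarrow> x \<in> dom c \<Longrightarrow> pt c x \<in> topspace M"
  using pt_in(1) chart(3) by blast

lemma V_dom: "V c \<subseteq> dom c" by (auto simp: V_def)

lemma \<phi>_self: "c \<in> \<B> \<Longrightarrow> x \<in> dom c \<Longrightarrow> snd (\<phi> c x) c = x"
  using pt_in(1)[of x c] by (simp add: \<phi>_def elem_self)

lemma \<phi>_scale: "r \<noteq> 0 \<Longrightarrow> \<phi> c (r *\<^sub>R x) = \<sigma> r (\<phi> c x)"
  by (simp add: \<phi>_def \<sigma>_def dom_scale elem_scale)

lemma L_chart:
  assumes z: "(p, w) \<in> L" and c: "c \<in> \<B>" "p \<in> fst c" shows "w c \<in> V c" "\<phi> c (w c) = (p, w)"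
proof -
  have p: "p \<in> topspace M" "w \<in> P p" using z by (auto simp: L_def)
  have "w c \<in> line_of (snd c p)" "w c \<noteq> 0" using P_fibre[OF p] fibre_line c P_nz[OF p c] by auto
  then have "snd c p = proj_pt (w c)" using proj_pt_mem_line by blast
  then have "w c \<in> dom c" "pt c (w c) = p" using pt_unique[OF c] \<open>w c \<noteq> 0\<close> by auto
  then show "w c \<in> V c" "\<phi> c (w c) = (p, w)"
    using fibre_elem[OF P_fibre[OF p] c] p by (auto simp: V_def \<phi>_def)
qed

lemma \<phi>_L: "c \<in> \<B> \<Longrightarrow> x \<in> V c \<Longrightarrow> \<phi> c x \<in> L"
  using pt_top V_dom[of c] by (auto simp: \<phi>_def V_def L_def)

lemma V_scale: "c \<in> \<B> \<Longrightarrow> x \<in> V c \<Longrightarrow> r > 0 \<Longrightarrow> r *\<^sub>R x \<in> V c"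
  unfolding V_def by (auto simp: dom_scale elem_scale intro!: P_scale pt_top)

text \<open>The orientation provides a continuous positive section \<open>s\<close> near the base
  point. Since \<open>y\<close> and \<open>s\<close> lie on one line, \<open>y\<close> is positive
  exactly when its inner product with \<open>s\<close> is, which is an open condition.\<close>

lemma V_open_aux:
  assumes c: "c \<in> \<B>" and x: "x \<in> V c" shows "\<exists>T. open T \<and> x \<in> T \<and> T \<subseteq> V c"
proof -
  have p: "pt c x \<in> topspace M" "pt c x \<in> fst c" using c x V_dom[of c] pt_top[OF c] pt_in[of x c] by auto
  obtain W s where W: "openin M W" "pt c x \<in> W" "\<And>q. q \<in> W \<Longrightarrow> s q \<in> P q"
    "\<And>c. c\<in>\<B> \<Longrightarrow> continuous_map (subtopology M (W \<inter> fst c)) euclidean (\<lambda>q. s q c)"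
  proof -
    have "\<exists>W \<sigma>. openin M W \<and> pt c x \<in> W \<and> (\<forall>q\<in>W. \<sigma> q \<in> P q) \<and>
           (\<forall>c\<in>\<B>. continuous_map (subtopology M (W \<inter> fst c)) euclidean (\<lambda>q. \<sigma> q c))"
      using ori p unfolding taut_orientation_def by blast
    then obtain W \<sigma> where "openin M W \<and> pt c x \<in> W \<and> (\<forall>q\<in>W. \<sigma> q \<in> P q) \<and>
           (\<forall>c\<in>\<B>. continuous_map (subtopology M (W \<inter> fst c)) euclidean (\<lambda>q. \<sigma> q c))" by (elim exE)
    then show ?thesis by (intro that[of W \<sigma>]) blast+
  qed
  define Q where "Q = {y \<in> dom c. pt c y \<in> W}"
  have oQ: "open Q" unfolding Q_def using pt_preimage_open c W by blast
  have "continuous_map (top_of_set Q) (subtopology M (W \<inter> fst c)) (pt c)"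
    unfolding continuous_map_in_subtopology
    using pt_continuous[OF c, of Q] pt_in(1)[of _ c] by (auto simp: Q_def)
  then have "continuous_map (top_of_set Q) euclidean ((\<lambda>q. s q c) \<circ> pt c)"
    using continuous_map_compose W(4)[OF c] by blast
  then have "continuous_on Q (\<lambda>y. s (pt c y) c)" by (simp add: o_def)
  then have "continuous_on Q (\<lambda>y. y \<bullet> s (pt c y) c)" by (intro continuous_intros)
  then have "open (Q \<inter> (\<lambda>y. y \<bullet> s (pt c y) c) -` {0<..})"
    by (rule continuous_open_preimage[OF _ oQ open_greaterThan])
  moreover have key: "y \<in> V c \<longleftrightarrow> y \<bullet> s (pt c y) c > 0" if y: "y \<in> Q" for y
  proof -
    have yd: "y \<in> dom c" "pt c y \<in> W" "y \<noteq> 0" using y by (auto simp: Q_def dom_def)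
    have q: "pt c y \<in> topspace M" "pt c y \<in> fst c" "snd c (pt c y) = proj_pt y" using yd pt_top[OF c] pt_in[of y c] by auto
    have sP: "s (pt c y) \<in> P (pt c y)" using W yd by blast
    then have "s (pt c y) c \<in> line_of (proj_pt y)" "s (pt c y) c \<noteq> 0"
      using fibre_line[OF P_fibre[OF q(1) sP] c q(2)] P_nz[OF q(1) sP c q(2)] q(3) by auto
    then obtain a where a: "s (pt c y) c = a *\<^sub>R y" "a \<noteq> 0" using mem_line_proj_pt[OF yd(3)] by force
    have sa: "s (pt c y) = (\<lambda>d. a *\<^sub>R elem (pt c y) c y d)"
    proof -
      have "s (pt c y) = elem (pt c y) c (s (pt c y) c)" using fibre_elem[OF P_fibre[OF q(1) sP] c q(2)] by simp
      then show ?thesis unfolding a(1) elem_scale .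
    qed
    have "y \<in> V c \<longleftrightarrow> a > 0"
    proof
      assume "y \<in> V c"
      then have eP: "elem (pt c y) c y \<in> P (pt c y)" by (simp add: V_def)
      obtain r where r: "r > 0" "s (pt c y) = (\<lambda>d. r *\<^sub>R elem (pt c y) c y d)" by (rule P_multiple[OF q(1) eP sP])
      have "s (pt c y) c = r *\<^sub>R elem (pt c y) c y c" using r(2) by simp
      then have "r *\<^sub>R y = a *\<^sub>R y" using a(1) elem_self[OF c q(2)] by auto
      then show "a > 0" using r yd by simp
    next
      assume "a > 0"
      then have "(\<lambda>d. (1/a) *\<^sub>R s (pt c y) d) \<in> P (pt c y)" using P_scale[OF q(1) sP] by simp
      then show "y \<in> V c" using sa \<open>a > 0\<close> yd by (simp add: V_def)
    qed
    moreover have "y \<bullet> s (pt c y) c = a * (y \<bullet> y)" using a by simp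
    moreover have yy: "y \<bullet> y > 0" using yd by simp
    have "a * (y \<bullet> y) > 0 \<longleftrightarrow> a > 0" using zero_less_mult_pos2[OF _ yy] mult_pos_pos[OF _ yy] by blast
    ultimately show ?thesis by simp
  qed
  moreover have "x \<in> Q" using x W V_dom[of c] by (auto simp: Q_def)
  ultimately show ?thesis using x
    by (intro exI[of _ "Q \<inter> (\<lambda>y. y \<bullet> s (pt c y) c) -` {0<..}"]) auto
qed

lemma V_open: "c \<in> \<B> \<Longrightarrow> open (V c)"
  using V_open_aux open_subopen by metis

text \<open>Near the base point the lifted transition is one constant matrix, and the element of the
  fibre, hence its positivity, is the same in both charts.\<close>

lemma transition:
  assumes "c \<in> \<B>" "c' \<in> \<B>" "x \<in> V c" "y \<in> V c'" and eq: "\<phi> c x = \<phi> c' y"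
  shows "\<exists>A W. linear A \<and> bij A \<and> open W \<and> x \<in> W \<and> W \<subseteq> V c \<and> A ` W \<subseteq> V c' \<and> (\<forall>z\<in>W. \<phi> c z = \<phi> c' (A z))"
proof -
  define p where "p = pt c x"
  have p: "p \<in> fst c" "p \<in> fst c'" using assms V_dom[of c] V_dom[of c'] pt_in(1)[of x c] pt_in(1)[of y c'] eq by (auto simp: p_def \<phi>_def)
  obtain W where W: "openin M W" "p \<in> W" "W \<subseteq> fst c \<inter> fst c'"
    "\<And>q. q \<in> W \<Longrightarrow> g c c' q = g c c' p" "\<And>q. q \<in> W \<Longrightarrow> snd c' q = proj_map (g c c' p) (snd c q)"
    using g_local[OF assms(1,2) p] by metis
  define A where "A z = g c c' p *v z" for z
  have nz: "det (g c c' p) \<noteq> 0" using g_nz assms p by blast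
  define T where "T = V c \<inter> {z \<in> dom c. pt c z \<in> W}"
  have A: "linear A" unfolding A_def by (rule matrix_vector_mul_linear)
  moreover have "bij A" using nz det_inv_matrix(4,5)[OF nz] unfolding A_def
    by (intro bij_betw_byWitness[where f' = "\<lambda>z. matrix_inv (g c c' p) *v z"]) auto
  moreover have "open T" unfolding T_def using V_open pt_preimage_open assms W by blast
  moreover have "x \<in> T" using assms(3) W(2) V_dom[of c] by (auto simp: T_def p_def)
  moreover have key: "A z \<in> V c' \<and> \<phi> c z = \<phi> c' (A z)" if z: "z \<in> T" for z
  proof -
    have zz: "z \<in> dom c" "z \<noteq> 0" "pt c z \<in> W" "z \<in> V c" using z by (auto simp: T_def dom_def)
    have in': "pt c z \<in> fst c" "pt c z \<in> fst c'" using W(3) zz(3) by auto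
    have "snd c' (pt c z) = proj_pt (A z)"
      using W(5)[OF zz(3)] pt_in(2)[OF zz(1)] nz zz(2) by (simp add: A_def proj_map_pt)
    moreover have "A z \<noteq> 0" using nz zz by (simp add: A_def det_nz_mult_zero)
    ultimately have pz: "A z \<in> dom c'" "pt c' (A z) = pt c z" using pt_unique[OF assms(2) in'(2)] by auto
    have "elem (pt c z) c' (A z) = elem (pt c z) c z"
      using elem_change[OF assms(1,2) in'] W(4)[OF zz(3)] by (simp add: A_def)
    then show ?thesis using pz zz by (simp add: \<phi>_def V_def)
  qed
  ultimately show ?thesis by (intro exI[of _ A] exI[of _ T]) (auto simp: T_def)
qed

text \<open>The base points have a common limit because \<open>M\<close> is Hausdorff. Around it the
  lifted transition is a fixed matrix, which carries the limit of \<open>X\<close> to the limit of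
  \<open>Y\<close>.\<close>

lemma hausdorff_seq:
  assumes c: "c \<in> \<B>" "c' \<in> \<B>" "x \<in> V c" "y \<in> V c'"
    and X1: "\<And>k::nat. X k \<in> V c" and Y1: "\<And>k. Y k \<in> V c'"
    and eq: "\<And>k. \<phi> c (X k) = \<phi> c' (Y k)" and X2: "X \<longlonglongrightarrow> x" and Y2: "Y \<longlonglongrightarrow> y"
  shows "\<phi> c x = \<phi> c' y"
proof -
  note X = X1 X2 and Y = Y1 Y2
  have d: "x \<in> dom c" "y \<in> dom c'" "\<And>k. X k \<in> dom c" "\<And>k. Y k \<in> dom c'" using V_dom[of c] V_dom[of c'] c(3,4) X(1) Y(1) by auto
  have pq: "pt c (X k) = pt c' (Y k)" for k using eq[of k] by (simp add: \<phi>_def)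
  have ev: "eventually (\<lambda>k. pt c (X k) \<in> W) sequentially" if "openin M W" "pt c x \<in> W" for W
  proof -
    have "eventually (\<lambda>k. X k \<in> {z \<in> dom c. pt c z \<in> W}) sequentially"
      using that d(1) by (intro topological_tendstoD[OF X(2)] pt_preimage_open c) auto
    then show ?thesis by eventually_elim auto
  qed
  have ev': "eventually (\<lambda>k. pt c' (Y k) \<in> W) sequentially" if "openin M W" "pt c' y \<in> W" for W
  proof -
    have "eventually (\<lambda>k. Y k \<in> {z \<in> dom c'. pt c' z \<in> W}) sequentially"
      using that d(2) by (intro topological_tendstoD[OF Y(2)] pt_preimage_open c) auto
    then show ?thesis by eventually_elim auto
  qed
  have pt_eq: "pt c x = pt c' y"
  proof (rule ccontr)
    assume ne: "pt c x \<noteq> pt c' y"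
    have "Hausdorff_space M" using mfd by (simp add: proj_flat_manifold_def)
    obtain W W' where W: "openin M W" "openin M W'" "pt c x \<in> W" "pt c' y \<in> W'" "disjnt W W'"
    proof -
      have "\<exists>W W'. openin M W \<and> openin M W' \<and> pt c x \<in> W \<and> pt c' y \<in> W' \<and> disjnt W W'"
        using \<open>Hausdorff_space M\<close> ne pt_top[OF c(1) d(1)] pt_top[OF c(2) d(2)]
        unfolding Hausdorff_space_def by simp
      then show ?thesis by (elim exE conjE) (rule that)
    qed
    have "eventually (\<lambda>k. pt c (X k) \<in> W \<and> pt c' (Y k) \<in> W') sequentially"
      using ev[OF W(1,3)] ev'[OF W(2,4)] by (rule eventually_conj)
    then obtain k where "pt c (X k) \<in> W \<and> pt c' (Y k) \<in> W'" unfolding eventually_sequentially by blast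
    then show False using W pq by (auto simp: disjnt_iff)
  qed
  define p where "p = pt c x"
  have p: "p \<in> fst c" "p \<in> fst c'" using d pt_in(1)[of x c] pt_in(1)[of y c'] pt_eq by (auto simp: p_def)
  obtain W where W: "openin M W" "p \<in> W" "W \<subseteq> fst c \<inter> fst c'"
    "\<And>q. q \<in> W \<Longrightarrow> g c c' q = g c c' p" "\<And>q. q \<in> W \<Longrightarrow> snd c' q = proj_map (g c c' p) (snd c q)"
    using g_local[OF c(1,2) p] by metis
  have "eventually (\<lambda>k. pt c (X k) \<in> W) sequentially" using ev[OF W(1)] W(2) by (simp add: p_def)
  then have "eventually (\<lambda>k. Y k = g c c' p *v X k) sequentially"
  proof eventually_elim
    case (elim k)
    have "Y k = snd (\<phi> c' (Y k)) c'" using \<phi>_self[OF c(2) d(4)] by simp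
    also have "\<dots> = snd (\<phi> c (X k)) c'" using eq by simp
    also have "\<dots> = g c c' (pt c (X k)) *v X k" using W(3) elim c by (auto simp: \<phi>_def taut_elem_def)
    finally show ?case using W(4)[OF elim] by simp
  qed
  moreover have "(\<lambda>k. g c c' p *v X k) \<longlonglongrightarrow> g c c' p *v x"
    by (intro tendsto_intros X(2) bounded_linear.tendsto[OF matrix_vector_mul_bounded_linear])
  ultimately have "Y \<longlonglongrightarrow> g c c' p *v x" using tendsto_cong[of Y "\<lambda>k. g c c' p *v X k" sequentially] by simp
  then have "y = g c c' p *v x" using LIMSEQ_unique[OF Y(2)] by simp
  then show ?thesis using elem_change[OF c(1,2) p, of x] pt_eq by (simp add: \<phi>_def p_def)
qed

lemma u_linear: "p \<in> topspace M \<Longrightarrow> w \<in> fibre p \<Longrightarrow> u p (\<lambda>c. a *\<^sub>R w c) = a * u p w"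
proof -
  assume p: "p \<in> topspace M" "w \<in> fibre p"
  have "\<forall>w'\<in>fibre p. \<forall>w''\<in>fibre p. \<forall>a b. u p (\<lambda>c. a *\<^sub>R w' c + b *\<^sub>R w'' c) = a * u p w' + b * u p w''"
    using dual p(1) unfolding dual_section_def by (elim conjE bspec)
  then have "u p (\<lambda>c. a *\<^sub>R w c + 0 *\<^sub>R w c) = a * u p w + 0 * u p w"
    using p(2) by blast
  then show ?thesis by simp
qed

lemma dom_elem_fibre: "c \<in> \<B> \<Longrightarrow> x \<in> dom c \<Longrightarrow> elem (pt c x) c x \<in> fibre (pt c x)"
proof (rule elem_fibre)
  assume x: "x \<in> dom c"
  then have "x \<noteq> 0" by (simp add: dom_def)
  then have "x \<in> line_of (proj_pt x)" by (subst mem_line_proj_pt) (auto intro: exI[of _ 1])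
  then show "x \<in> line_of (snd c (pt c x))" unfolding pt_in(2)[OF x] .
  show "pt c x \<in> fst c" using pt_in(1)[OF x] .
qed

text \<open>Dictionary between a homogeneous vector and its inhomogeneous coordinates: the scale
  \<open>s\<close> passes through \<open>uu\<close> because a section of the dual bundle is linear
  on fibres.\<close>

lemma coord:
  assumes c: "c \<in> \<B>" and B: "B \<in> SLpm" and x: "x = s *\<^sub>R (B *v hom_vec t)" and s: "s > 0"
  shows "x \<in> dom c \<longleftrightarrow> t \<in> coord_dom c B" "pt c x = coord_pt c B t"
    "t \<in> coord_dom c B \<Longrightarrow> uu (\<phi> c x) = s * local_rep \<B> g u c B t"
    "t \<in> coord_dom c B \<Longrightarrow> x \<in> V c \<longleftrightarrow> coord_frame \<B> g c B t \<in> P (coord_pt c B t)"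
proof -
  have pp: "proj_pt x = affine_pt B t" using x s by (simp add: affine_pt_def proj_pt_scale)
  have x0: "x \<noteq> 0" using x s B_hom_vec_nz[OF SLpm_nz[OF B]] by simp
  show dm: "x \<in> dom c \<longleftrightarrow> t \<in> coord_dom c B" using pp x0 by (simp add: dom_def coord_dom_def)
  show pe: "pt c x = coord_pt c B t" using pp by (simp add: pt_def coord_pt_def)
  have el: "elem (pt c x) c x = (\<lambda>d. s *\<^sub>R coord_frame \<B> g c B t d)"
    unfolding coord_frame_def pe[symmetric] x by (simp add: elem_scale)
  have el': "coord_frame \<B> g c B t = (\<lambda>d. (1/s) *\<^sub>R elem (pt c x) c x d)" using el s by auto
  assume t: "t \<in> coord_dom c B"
  then have xd: "x \<in> dom c" using dm by simp
  have "u (pt c x) (coord_frame \<B> g c B t) = (1/s) * u (pt c x) (elem (pt c x) c x)"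
    unfolding el' by (rule u_linear[OF pt_top[OF c xd] dom_elem_fibre[OF c xd]])
  then show "uu (\<phi> c x) = s * local_rep \<B> g u c B t" using s by (simp add: uu_def \<phi>_def local_rep_def pe)
  show "x \<in> V c \<longleftrightarrow> coord_frame \<B> g c B t \<in> P (coord_pt c B t)"
  proof
    assume "x \<in> V c"
    then have "elem (pt c x) c x \<in> P (pt c x)" by (simp add: V_def)
    from P_scale[OF pt_top[OF c xd] this, of "1/s"] show "coord_frame \<B> g c B t \<in> P (coord_pt c B t)"
      using s el' pe by simp
  next
    assume "coord_frame \<B> g c B t \<in> P (coord_pt c B t)"
    then have "coord_frame \<B> g c B t \<in> P (pt c x)" using pe by simp
    from P_scale[OF pt_top[OF c xd] this s] show "x \<in> V c" using xd el by (simp add: V_def)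
  qed
qed

lemma uu_continuous:
  assumes c: "c \<in> \<B>" shows "continuous_on (V c) (\<lambda>x. uu (\<phi> c x))"
proof (rule continuous_at_imp_continuous_on, rule ballI)
  fix x assume x: "x \<in> V c"
  then have "x \<noteq> 0" using V_dom[of c] by (auto simp: dom_def)
  \<comment> \<open>Inhomogeneous coordinates around \<open>x\<close> must be chosen so that
    \<open>x\<close> has positive height, since the dictionary needs \<open>s > 0\<close>.\<close>
  then obtain B where B: "B \<in> SLpm" "(matrix_inv B *v x) $ None > 0" using SLpm_positive_coordinate by blast
  note nz = SLpm_nz[OF B(1)]
  define s where "s y = (matrix_inv B *v y) $ None" for y
  define T where "T = V c \<inter> {y. s y > 0}"
  have cs: "continuous_on S s" for S unfolding s_def by (intro continuous_intros)
  have oT: "open T" unfolding T_def using V_open[OF c] by (intro open_Int open_Collect_less continuous_intros cs)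
  have dec: "y = s y *\<^sub>R (B *v hom_vec (inhom (matrix_inv B *v y)))" if "y \<in> T" for y
  proof -
    have "matrix_inv B *v y = s y *\<^sub>R hom_vec (inhom (matrix_inv B *v y))"
      using hom_vec_inhom[of "matrix_inv B *v y"] that by (simp add: T_def s_def)
    then have "B *v (matrix_inv B *v y) = s y *\<^sub>R (B *v hom_vec (inhom (matrix_inv B *v y)))"
      by (metis matrix_vector_mult_scaleR)
    then show ?thesis using det_inv_matrix(5)[OF nz] by simp
  qed
  have Tc: "inhom (matrix_inv B *v y) \<in> coord_dom c B" if "y \<in> T" for y
    using coord(1)[OF c B(1) dec[OF that]] that V_dom[of c] by (auto simp: T_def)
  have eq: "uu (\<phi> c y) = s y * local_rep \<B> g u c B (inhom (matrix_inv B *v y))" if "y \<in> T" for y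
    using coord(3)[OF c B(1) dec[OF that] _ Tc[OF that]] that by (simp add: T_def)
  have "smooth_on (coord_dom c B) (local_rep \<B> g u c B)" using dual c B unfolding dual_section_def by blast
  then have cl: "continuous_on (coord_dom c B) (local_rep \<B> g u c B)" by (rule smooth_onD(3))
  have ci: "continuous_on T (\<lambda>y. inhom (matrix_inv B *v y))"
    by (rule continuous_on_compose2[OF continuous_on_inhom]) (auto intro!: continuous_intros simp: T_def s_def)
  have "continuous_on T (\<lambda>y. s y * local_rep \<B> g u c B (inhom (matrix_inv B *v y)))"
    by (intro continuous_on_mult cs continuous_on_compose2[OF cl ci]) (use Tc in auto)
  then have "continuous_on T (\<lambda>y. uu (\<phi> c y))" using eq by (simp cong: continuous_on_cong)
  moreover have "x \<in> T" using x B by (simp add: T_def s_def)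
  ultimately show "isCont (\<lambda>x. uu (\<phi> c x)) x" using oT continuous_on_eq_continuous_at by blast
qed

text \<open>In a cone over a coordinate ball, \<open>uu\<close> is the perspective of the local
  representative: \<open>s\<close> times its value at \<open>t\<close>. Subadditivity of a
  perspective is convexity with weights \<open>s / m\<close> and \<open>s' / m\<close>; it is strict
  unless both vectors lie over the same \<open>t\<close>, that is, on one ray.\<close>

lemma uu_subadditive:
  assumes z: "z \<in> L"
  shows "\<exists>c\<in>\<B>. \<exists>C. open C \<and> convex C \<and> C \<subseteq> V c \<and> z \<in> \<phi> c ` C \<and>
      (\<forall>x\<in>C. \<forall>y\<in>C. uu (\<phi> c (x + y)) \<le> uu (\<phi> c x) + uu (\<phi> c y) \<and>
        ((\<nexists>r. y = r *\<^sub>R x) \<longrightarrow> uu (\<phi> c (x + y)) < uu (\<phi> c x) + uu (\<phi> c y)))"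
proof -
  obtain p w where pw: "z = (p, w)" "p \<in> topspace M" "w \<in> P p" using z by (auto simp: L_def)
  obtain c B T where c: "c \<in> \<B>" "B \<in> SLpm" "open T" "T \<subseteq> coord_dom c B" "p \<in> coord_pt c B ` T"
    and T: "\<And>t. t \<in> T \<Longrightarrow> coord_frame \<B> g c B t \<in> P (coord_pt c B t) \<and> positive_definite (hessian (local_rep \<B> g u c B) t)"
  proof -
    have "\<exists>c\<in>\<B>. \<exists>B\<in>SLpm. \<exists>T. open T \<and> T \<subseteq> coord_dom c B \<and> p \<in> coord_pt c B ` T \<and>
        (\<forall>t\<in>T. coord_frame \<B> g c B t \<in> P (coord_pt c B t) \<and> positive_definite (hessian (local_rep \<B> g u c B) t))"
      using hess pw(2) unfolding hessian_positive_def by blast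
    then obtain c B T where "c \<in> \<B>" "B \<in> SLpm" "open T \<and> T \<subseteq> coord_dom c B \<and> p \<in> coord_pt c B ` T \<and>
        (\<forall>t\<in>T. coord_frame \<B> g c B t \<in> P (coord_pt c B t) \<and> positive_definite (hessian (local_rep \<B> g u c B) t))"
      by (elim bexE exE)
    then show ?thesis by (intro that[of c B T]) blast+
  qed
  note nz = SLpm_nz[OF c(2)]
  obtain t0 where t0: "t0 \<in> T" "p = coord_pt c B t0" using c by blast
  obtain e where e: "e > 0" "ball t0 e \<subseteq> T" using c t0 open_contains_ball by blast
  define f where "f = local_rep \<B> g u c B"
  have "smooth_on (coord_dom c B) f" unfolding f_def using dual c unfolding dual_section_def by blast
  then have sm: "smooth_on (ball t0 e) f" using smooth_on_subset e c by blast
  define C where "C = pcone ((\<lambda>t. B *v hom_vec t) ` ball t0 e)"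
  have elem: "\<exists>s t. s > 0 \<and> t \<in> ball t0 e \<and> x = s *\<^sub>R (B *v hom_vec t)" if x: "x \<in> C" for x
  proof -
    obtain s q where "s > 0" "q \<in> (\<lambda>t. B *v hom_vec t) ` ball t0 e" "x = s *\<^sub>R q"
      using x unfolding C_def pcone_def by blast
    then show ?thesis by blast
  qed
  have sub: "C \<subseteq> V c"
  proof
    fix x assume "x \<in> C"
    then obtain s t where st: "s > 0" "t \<in> ball t0 e" "x = s *\<^sub>R (B *v hom_vec t)" using elem by blast
    then have "t \<in> T" using e by blast
    then show "x \<in> V c" using coord(4)[OF c(1,2) st(3,1)] T c by blast
  qed
  have val: "uu (\<phi> c (s *\<^sub>R (B *v hom_vec t))) = s * f t" if "s > 0" "t \<in> ball t0 e" for s t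
    unfolding f_def using coord(3)[OF c(1,2) refl that(1)] that e c by blast
  have "z \<in> \<phi> c ` C"
  proof -
    have td: "t0 \<in> coord_dom c B" using t0 c by blast
    have fr: "coord_frame \<B> g c B t0 \<in> P p" using T t0 by blast
    obtain r where r: "r > 0" "w = (\<lambda>d. r *\<^sub>R coord_frame \<B> g c B t0 d)" by (rule P_multiple[OF pw(2) fr pw(3)])
    define x where "x = r *\<^sub>R (B *v hom_vec t0)"
    have px: "pt c x = p" using coord(2)[OF c(1,2) x_def r(1)] t0 by simp
    have "\<phi> c x = (p, w)" unfolding \<phi>_def px using r px t0 by (simp add: x_def elem_scale coord_frame_def)
    moreover have "x \<in> C" unfolding C_def x_def using r(1) e by (auto intro!: pconeI imageI)
    ultimately show ?thesis using pw(1) by (metis imageI)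
  qed
  moreover have "uu (\<phi> c (x + y)) \<le> uu (\<phi> c x) + uu (\<phi> c y) \<and>
        ((\<nexists>r. y = r *\<^sub>R x) \<longrightarrow> uu (\<phi> c (x + y)) < uu (\<phi> c x) + uu (\<phi> c y))" if xy: "x \<in> C" "y \<in> C" for x y
  proof -
    obtain s t where st: "s > 0" "t \<in> ball t0 e" "x = s *\<^sub>R (B *v hom_vec t)" using elem[OF xy(1)] by blast
    obtain s' t' where st': "s' > 0" "t' \<in> ball t0 e" "y = s' *\<^sub>R (B *v hom_vec t')" using elem[OF xy(2)] by blast
    define m where "m = s + s'"
    have m: "m > 0" using st st' by (simp add: m_def)
    have ab: "s / m + s' / m = 1" "0 < s / m" "0 < s' / m" using m st st' by (auto simp: m_def add_divide_distrib[symmetric])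
    define q where "q = (s / m) *\<^sub>R t + (s' / m) *\<^sub>R t'"
    have q: "q \<in> ball t0 e" unfolding q_def using ab st st' by (intro convexD[OF convex_ball]) auto
    have "(s / m) *\<^sub>R hom_vec t + (s' / m) *\<^sub>R hom_vec t' = hom_vec q"
      using ab(1) by (auto simp: vec_eq_iff hom_vec_def q_def split: option.split)
    then have "m *\<^sub>R hom_vec q = s *\<^sub>R hom_vec t + s' *\<^sub>R hom_vec t'"
      using m by (simp add: scaleR_add_right flip: \<open>_ = hom_vec q\<close>)
    then have xy_eq: "x + y = m *\<^sub>R (B *v hom_vec q)"
      unfolding st st' by (metis matrix_vector_mult_scaleR matrix_vector_right_distrib)
    have vals: "uu (\<phi> c (x + y)) = m * f q" "uu (\<phi> c x) = s * f t" "uu (\<phi> c y) = s' * f t'"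
      unfolding xy_eq using val[OF m q] val[OF st(1,2)] val[OF st'(1,2)] st st' by auto
    show ?thesis
    proof (cases "t = t'")
      case True
      have "q = (s / m + s' / m) *\<^sub>R t" using True by (simp add: q_def scaleR_add_left)
      then have "q = t" using ab by simp
      moreover have "y = (s' / s) *\<^sub>R x" using st st' True by simp
      ultimately show ?thesis unfolding vals using True by (auto simp: m_def algebra_simps)
    next
      case False
      have "f q < (s / m) * f t + (s' / m) * f t'"
        unfolding q_def
        by (rule hessian_strict_convex[OF sm convex_ball _ st(2) st'(2) False ab(2,3,1)]) (use T e in \<open>auto simp: f_def\<close>)
      then have "m * f q < m * ((s / m) * f t + (s' / m) * f t')" using m by simp
      also have "\<dots> = s * f t + s' * f t'" using m by (simp add: field_simps)
      finally show ?thesis unfolding vals by auto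
    qed
  qed
  moreover have "open C" "convex C" unfolding C_def
    using nz by (auto intro!: open_pcone_affine convex_pcone convex_affine_image)
  ultimately show ?thesis using c(1) sub by (intro bexI[of _ c] exI[of _ C]) auto
qed

text \<open>The sets are projected to \<open>M\<close>, where a finite subcover exists. Over one
  base point all positive vectors are multiples of each other, so the chosen sets recover
  \<open>L\<close> up to scaling.\<close>

lemma L_compact:
  assumes O: "\<And>c T. (c, T) \<in> \<O> \<Longrightarrow> c \<in> \<B> \<and> open T \<and> T \<subseteq> V c"
    and cov: "\<And>z. z \<in> L \<Longrightarrow> \<exists>(c, T)\<in>\<O>. z \<in> \<phi> c ` T"
  shows "\<exists>\<O>'\<subseteq>\<O>. finite \<O>' \<and> (\<forall>z\<in>L. \<exists>(c, T)\<in>\<O>'. \<exists>r>0. \<exists>x\<in>T. z = \<sigma> r (\<phi> c x))"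
proof -
  define im :: "('a, 'n) chart \<times> (real ^ 'n option) set \<Rightarrow> 'a set" where "im p = pt (fst p) ` snd p" for p
  have "\<forall>U\<in>im ` \<O>. openin M U"
  proof
    fix U assume "U \<in> im ` \<O>"
    then obtain c T where cT: "(c, T) \<in> \<O>" "U = pt c ` T" by (auto simp: im_def)
    then have "c \<in> \<B>" "open T" "T \<subseteq> dom c" using O[OF cT(1)] V_dom[of c] by auto
    then show "openin M U" using pt_image_open cT(2) by simp
  qed
  moreover have "topspace M \<subseteq> \<Union>(im ` \<O>)"
  proof
    fix p assume p: "p \<in> topspace M"
    then obtain w where "w \<in> P p" using P_nonempty by blast
    then have "(p, w) \<in> L" using p by (simp add: L_def)
    then obtain c T where "(c, T) \<in> \<O>" "(p, w) \<in> \<phi> c ` T" using cov by blast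
    then show "p \<in> \<Union>(im ` \<O>)" by (force simp: im_def \<phi>_def)
  qed
  ultimately obtain \<F> where F: "finite \<F>" "\<F> \<subseteq> im ` \<O>" "topspace M \<subseteq> \<Union>\<F>"
    using comp unfolding compact_space_alt by meson
  then obtain \<O>' where O': "\<O>' \<subseteq> \<O>" "finite \<O>'" "\<F> = im ` \<O>'" using finite_subset_image by metis
  have "\<exists>(c, T)\<in>\<O>'. \<exists>r>0. \<exists>x\<in>T. z = \<sigma> r (\<phi> c x)" if z: "z \<in> L" for z
  proof -
    obtain p w where pw: "z = (p, w)" "p \<in> topspace M" "w \<in> P p" using z by (auto simp: L_def)
    then obtain c T where cT: "(c, T) \<in> \<O>'" "p \<in> pt c ` T" using F O' by (force simp: im_def)
    then obtain x where x: "x \<in> T" "pt c x = p" by blast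
    have "x \<in> V c" using cT x O' O by blast
    then have eP: "elem p c x \<in> P p" using x by (simp add: V_def)
    obtain r where "r > 0" "w = (\<lambda>d. r *\<^sub>R elem p c x d)" by (rule P_multiple[OF pw(2) eP pw(3)])
    then have "r > 0 \<and> z = \<sigma> r (\<phi> c x)" using pw x by (simp add: \<sigma>_def \<phi>_def)
    then show ?thesis using cT x by blast
  qed
  then show ?thesis using O' by blast
qed

text \<open>A scaling-invariant \<open>Z\<close> contains all or none of the positive vectors over a
  point, so it is determined by its projection, which is clopen in \<open>M\<close>.\<close>

lemma L_connected:
  assumes Z: "Z \<subseteq> L" "Z \<noteq> {}" and sc: "\<And>z r. z \<in> Z \<Longrightarrow> r > 0 \<Longrightarrow> \<sigma> r z \<in> Z"
    and o1: "\<And>c. c \<in> \<B> \<Longrightarrow> open {x \<in> V c. \<phi> c x \<in> Z}" and o2: "\<And>c. c \<in> \<B> \<Longrightarrow> open {x \<in> V c. \<phi> c x \<notin> Z}"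
  shows "Z = L"
proof -
  have all: "(p, w') \<in> Z" if pw: "(p, w) \<in> Z" "w' \<in> P p" for p w w'
  proof -
    have pL: "p \<in> topspace M" "w \<in> P p" using pw Z by (auto simp: L_def)
    obtain r where "r > 0" "w' = (\<lambda>c. r *\<^sub>R w c)" by (rule P_multiple[OF pL pw(2)])
    then show ?thesis using sc[OF pw(1), of r] by (simp add: \<sigma>_def)
  qed
  define N where "N = fst ` Z"
  have sub: "N \<subseteq> topspace M" using Z by (auto simp: N_def L_def)
  have "openin M N"
  proof (subst openin_subopen, intro ballI)
    fix p assume "p \<in> N"
    then obtain w where w: "(p, w) \<in> Z" by (auto simp: N_def)
    then have pL: "(p, w) \<in> L" using Z by auto
    have "p \<in> topspace M" using pL by (simp add: L_def)
    then obtain c where c: "c \<in> \<B>" "p \<in> fst c" using topspace_charts by blast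
    note wc = L_chart[OF pL c]
    define T where "T = {x \<in> V c. \<phi> c x \<in> Z}"
    have "openin M (pt c ` T)" using o1[OF c(1)] V_dom[of c] by (intro pt_image_open c) (auto simp: T_def)
    moreover have "p \<in> pt c ` T" using wc w by (auto simp: T_def \<phi>_def intro!: image_eqI[of _ _ "w c"])
    moreover have "pt c ` T \<subseteq> N" by (force simp: T_def N_def \<phi>_def)
    ultimately show "\<exists>T. openin M T \<and> p \<in> T \<and> T \<subseteq> N" by blast
  qed
  moreover have "openin M (topspace M - N)"
  proof (subst openin_subopen, intro ballI)
    fix p assume p: "p \<in> topspace M - N"
    then obtain w where w: "w \<in> P p" using P_nonempty by blast
    then have pL: "(p, w) \<in> L" using p by (auto simp: L_def)
    have "p \<in> topspace M" using p by simp
    then obtain c where c: "c \<in> \<B>" "p \<in> fst c" using topspace_charts by blast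
    note wc = L_chart[OF pL c]
    define T where "T = {x \<in> V c. \<phi> c x \<notin> Z}"
    have "openin M (pt c ` T)" using o2[OF c(1)] V_dom[of c] by (intro pt_image_open c) (auto simp: T_def)
    moreover have "(p, w) \<notin> Z" using p by (force simp: N_def)
    then have "p \<in> pt c ` T" using wc by (auto simp: T_def \<phi>_def intro!: image_eqI[of _ _ "w c"])
    moreover have "pt c ` T \<subseteq> topspace M - N"
    proof
      fix q assume "q \<in> pt c ` T"
      then obtain x where x: "x \<in> V c" "\<phi> c x \<notin> Z" "q = pt c x" by (auto simp: T_def)
      have "q \<notin> N"
      proof
        assume "q \<in> N"
        then obtain w' where "(q, w') \<in> Z" by (auto simp: N_def)
        then have "\<phi> c x \<in> Z" using all[of q w'] x by (simp add: \<phi>_def V_def)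
        then show False using x by blast
      qed
      then show "q \<in> topspace M - N" using x pt_top[OF c(1)] V_dom[of c] by auto
    qed
    ultimately show "\<exists>T. openin M T \<and> p \<in> T \<and> T \<subseteq> topspace M - N" by blast
  qed
  then have "closedin M N" using sub by (simp add: closedin_def)
  ultimately have "N = {} \<or> N = topspace M" using conn unfolding connected_space_clopen_in by blast
  then have "N = topspace M" using Z by (auto simp: N_def)
  then have "L \<subseteq> Z" using all by (force simp: L_def N_def)
  then show ?thesis using Z by blast
qed

sublocale radiant \<B> V \<phi> L \<sigma> uu
proof
  obtain p where p: "p \<in> topspace M" using ne by blast
  then obtain w where "w \<in> P p" using P_nonempty by blast
  then have "(p, w) \<in> L" using p by (simp add: L_def)
  then show "L \<noteq> {}" by blast
  show "L = (\<Union>c\<in>\<B>. \<phi> c ` V c)"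
  proof (intro equalityI subsetI)
    fix z assume z: "z \<in> L"
    then obtain p w where pw: "z = (p, w)" "p \<in> topspace M" by (auto simp: L_def)
    then obtain c where c: "c \<in> \<B>" "p \<in> fst c" using topspace_charts by blast
    have "(p, w) \<in> L" using z pw by simp
    note wc = L_chart[OF this c]
    have "z \<in> \<phi> c ` V c" using wc pw(1) by (intro image_eqI[of _ _ "w c"]) simp_all
    then show "z \<in> (\<Union>c\<in>\<B>. \<phi> c ` V c)" using c(1) by (rule UN_I[rotated])
  next
    fix z assume "z \<in> (\<Union>c\<in>\<B>. \<phi> c ` V c)"
    then obtain c x where "c \<in> \<B>" "x \<in> V c" "z = \<phi> c x" by (elim UN_E imageE)
    then show "z \<in> L" using \<phi>_L by simp
  qed
  fix c assume c: "c \<in> \<B>"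
  show "open (V c)" using V_open c .
  show "0 \<notin> V c" by (auto simp: V_def dom_def)
  show "inj_on (\<phi> c) (V c)"
  proof (rule inj_onI)
    fix x y assume "x \<in> V c" "y \<in> V c" "\<phi> c x = \<phi> c y"
    then show "x = y" using \<phi>_self[OF c, of x] \<phi>_self[OF c, of y] V_dom[of c] by auto
  qed
  show "continuous_on (V c) (\<lambda>x. uu (\<phi> c x))" using uu_continuous c .
next
  fix z assume z: "z \<in> L"
  show "uu z < 0" using z neg by (auto simp: L_def uu_def negative_section_def)
  show "uu (\<sigma> r z) = r * uu z" if "r > 0" for r
    using z u_linear P_fibre by (auto simp: L_def uu_def \<sigma>_def)
next
  show "r *\<^sub>R x \<in> V c" if "c \<in> \<B>" "x \<in> V c" "r > 0" for c x r using V_scale[OF that] .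
  show "\<phi> c (r *\<^sub>R x) = \<sigma> r (\<phi> c x)" if "c \<in> \<B>" "x \<in> V c" "r > 0" for c x r using \<phi>_scale[of r] that by simp
qed (fact transition, fact hausdorff_seq, fact uu_subadditive, fact L_compact, fact L_connected)

end

section \<open>Discreteness in the projective group; proper cones and their bounded slices\<close>

section \<open>Discrete groups of projective maps\<close>

lemma topspace_PGL: "topspace (PGL_topology :: ('n::finite rp \<Rightarrow> 'n rp) topology) = PGL"
proof -
  have "openin (PGL_topology :: ('n rp \<Rightarrow> 'n rp) topology) PGL"
    unfolding PGL_topology_def openin_quotient_topology PGL_def
    by (auto simp: openin_subtopology intro!: exI[of _ UNIV])
  moreover have "U \<subseteq> PGL" if "openin (PGL_topology :: ('n rp \<Rightarrow> 'n rp) topology) U" for U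
    using that unfolding PGL_topology_def openin_quotient_topology PGL_def by auto
  ultimately show ?thesis by (metis openin_subset openin_topspace subset_antisym)
qed

lemma openin_PGL:
  fixes S :: "('n::finite rp \<Rightarrow> 'n rp) set"
  assumes "S \<subseteq> PGL" "open {A. det A \<noteq> 0 \<and> proj_map A \<in> S}"
  shows "openin PGL_topology S"
proof -
  have 1: "{A \<in> topspace (top_of_set {A. det A \<noteq> 0}). proj_map A \<in> S} = {A. det A \<noteq> 0} \<inter> {A. det A \<noteq> 0 \<and> proj_map A \<in> S}"
    by auto
  have 2: "openin (top_of_set {A. det A \<noteq> 0}) ({A. det A \<noteq> 0} \<inter> {A. det A \<noteq> 0 \<and> proj_map A \<in> S})"
    using assms(2) by (rule openin_open_Int)
  have 3: "S \<subseteq> proj_map ` topspace (top_of_set {A. det A \<noteq> 0})" using assms(1) by (simp add: PGL_def)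
  show ?thesis unfolding PGL_topology_def openin_quotient_topology 1 using 2 3 by blast
qed

lemma open_det_nz: "open {A :: real ^ 'm ^ 'm::finite. det A \<noteq> 0}"
proof -
  have "continuous_on UNIV (\<lambda>A :: real ^ 'm ^ 'm. det A)"
    unfolding det_def by (intro continuous_intros)
  then show ?thesis by (intro open_Collect_neq continuous_intros)
qed

lemma open_evaluation:
  fixes N :: "'n::finite rp set"
  assumes "open N" "v \<noteq> 0"
  shows "open {A. det A \<noteq> 0 \<and> proj_map A (proj_pt v) \<in> N}"
proof -
  have "{A. det A \<noteq> 0 \<and> proj_map A (proj_pt v) \<in> N}
      = {A. det A \<noteq> 0} \<inter> (\<lambda>A. A *v v) -` {x. x \<noteq> 0 \<and> proj_pt x \<in> N}"
    using assms(2) by (auto simp: proj_map_pt det_nz_mult_zero)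
  moreover have "continuous_on UNIV (\<lambda>A :: real ^ 'n option ^ 'n option. A *v v)"
    unfolding matrix_vector_mult_def by (intro continuous_intros)
  then have "open ((\<lambda>A :: real ^ 'n option ^ 'n option. A *v v) -` {x. x \<noteq> 0 \<and> proj_pt x \<in> N})"
    using assms(1) unfolding open_rp_iff by (rule open_vimage[rotated])
  ultimately show ?thesis using open_det_nz by auto
qed

text \<open>The matrices that induce \<open>\<delta>\<close> are the nonzero multiples of one
  matrix, and the line they span is closed.\<close>

lemma open_avoid:
  fixes \<delta> :: "'n::finite rp \<Rightarrow> 'n rp"
  assumes "\<delta> \<in> PGL" shows "open {A. det A \<noteq> 0 \<and> proj_map A \<noteq> \<delta>}"
proof -
  obtain D where D: "det D \<noteq> 0" "\<delta> = proj_map D" using assms PGL_E by blast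
  have "{A. det A \<noteq> 0 \<and> proj_map A \<noteq> \<delta>} = {A. det A \<noteq> 0} \<inter> - span {D}"
  proof (intro set_eqI iffI)
    fix A assume A: "A \<in> {A. det A \<noteq> 0 \<and> proj_map A \<noteq> \<delta>}"
    have "A \<notin> span {D}"
    proof
      assume "A \<in> span {D}"
      then obtain c where c: "A = c *\<^sub>R D" by (auto simp: span_singleton)
      have "c \<noteq> 0"
      proof
        assume "c = 0"
        then have "A *v axis None 1 = 0" using c by simp
        then show False using A det_nz_mult_zero[of A "axis None 1"] by (simp add: axis_eq_0_iff)
      qed
      then have "proj_map D = proj_map A"
        using proj_map_eq_iff[OF D(1), of A] A c by (auto simp: scaleR_matrix_vector_assoc[symmetric])
      then show False using A D by simp
    qed
    then show "A \<in> {A. det A \<noteq> 0} \<inter> - span {D}" using A by simp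
  next
    fix A assume A: "A \<in> {A. det A \<noteq> 0} \<inter> - span {D}"
    have "proj_map A \<noteq> \<delta>"
    proof
      assume "proj_map A = \<delta>"
      then obtain c where "\<And>v. A *v v = c *\<^sub>R (D *v v)" using proj_map_eq_iff[OF D(1), of A] A D by auto
      then have "A = c *\<^sub>R D" by (subst matrix_eq) (simp add: scaleR_matrix_vector_assoc)
      then show False using A by (auto simp: span_singleton)
    qed
    then show "A \<in> {A. det A \<noteq> 0 \<and> proj_map A \<noteq> \<delta>}" using A by simp
  qed
  then show ?thesis using open_det_nz by (auto simp: open_Int open_Compl)
qed

text \<open>Evaluation at one point suffices: elements close to \<open>\<gamma>\<close> send
  \<open>x\<close> into a neighbourhood of \<open>\<gamma> x\<close>, only finitely many elements of
  the group do so, and \<open>open_avoid\<close> removes those different from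
  \<open>\<gamma>\<close>.\<close>

lemma discrete_of_properly_discontinuous:
  fixes \<Gamma> :: "('n::finite rp \<Rightarrow> 'n rp) set"
  assumes \<Omega>: "bounded_convex_domain \<Omega>" and \<Gamma>: "\<Gamma> \<subseteq> PGL" and act: "acts_properly_discontinuously \<Gamma> \<Omega>"
  shows "subtopology PGL_topology \<Gamma> = discrete_topology \<Gamma>"
proof -
  obtain B D where B: "det B \<noteq> 0" "open D" "D \<noteq> {}" "\<Omega> = affine_pt B ` D"
    using \<Omega> unfolding bounded_convex_domain_def by blast
  obtain t0 where t0: "t0 \<in> D" using B by blast
  define x where "x = affine_pt B t0"
  have "openin (subtopology PGL_topology \<Gamma>) {\<gamma>}" if \<gamma>: "\<gamma> \<in> \<Gamma>" for \<gamma>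
  proof -
    have "x \<in> \<Omega>" using t0 B by (auto simp: x_def)
    then have "\<gamma> x \<in> \<Omega>" using act \<gamma> unfolding acts_properly_discontinuously_def by blast
    then obtain t1 where t1: "t1 \<in> D" "\<gamma> x = affine_pt B t1" using B by blast
    obtain e where e: "e > 0" "cball t1 e \<subseteq> D" using B t1 open_contains_cball by blast
    \<comment> \<open>\<open>K\<close> contains both \<open>x\<close> and a neighbourhood of
      \<open>\<gamma> x\<close>, so every element that sends \<open>x\<close> into that
      neighbourhood makes \<open>K\<close> meet its own image.\<close>
    define K where "K = affine_pt B ` (insert t0 (cball t1 e))"
    have "compact K" unfolding K_def
      by (intro compact_continuous_image continuous_on_affine_pt B) auto
    moreover have "K \<subseteq> \<Omega>" using e t0 B by (auto simp: K_def)
    ultimately have fin: "finite {\<delta>\<in>\<Gamma>. \<delta> ` K \<inter> K \<noteq> {}}"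
      using act unfolding acts_properly_discontinuously_def by blast
    define N where "N = affine_pt B ` ball t1 e"
    have N: "open N" "\<gamma> x \<in> N" "N \<subseteq> K" unfolding N_def K_def
      using B e t1 by (auto intro!: open_affine_pt_image)
    define Q where "Q = {\<delta>\<in>\<Gamma>. \<delta> ` K \<inter> K \<noteq> {}} - {\<gamma>}"
    have finQ: "finite Q" using fin by (simp add: Q_def)
    define T where "T = {\<delta> \<in> PGL. \<delta> x \<in> N} - Q"
    have "{A. det A \<noteq> 0 \<and> proj_map A \<in> T} = {A. det A \<noteq> 0 \<and> proj_map A x \<in> N} \<inter> (\<Inter>\<delta>\<in>Q. {A. det A \<noteq> 0 \<and> proj_map A \<noteq> \<delta>})"
      by (auto simp: T_def PGL_I)
    moreover have "open {A. det A \<noteq> 0 \<and> proj_map A x \<in> N}"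
      unfolding x_def affine_pt_def using N B by (intro open_evaluation B_hom_vec_nz)
    moreover have "open (\<Inter>\<delta>\<in>Q. {A. det A \<noteq> 0 \<and> proj_map A \<noteq> \<delta>})"
      using finQ \<Gamma> by (intro open_INT ballI open_avoid) (auto simp: Q_def)
    ultimately have "open {A. det A \<noteq> 0 \<and> proj_map A \<in> T}" by auto
    then have "openin PGL_topology T" by (intro openin_PGL) (auto simp: T_def)
    moreover have "T \<inter> \<Gamma> = {\<gamma>}"
    proof (intro set_eqI iffI)
      fix \<delta> assume d: "\<delta> \<in> T \<inter> \<Gamma>"
      then have "\<delta> x \<in> K" "\<delta> \<in> \<Gamma>" "\<delta> \<notin> Q" using N by (auto simp: T_def)
      moreover have "x \<in> K" by (auto simp: K_def x_def)
      ultimately show "\<delta> \<in> {\<gamma>}" by (auto simp: Q_def)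
    next
      fix \<delta> assume "\<delta> \<in> {\<gamma>}" then show "\<delta> \<in> T \<inter> \<Gamma>" using \<gamma> \<Gamma> N by (auto simp: T_def Q_def)
    qed
    ultimately show ?thesis unfolding openin_subtopology by blast
  qed
  moreover have "topspace (subtopology PGL_topology \<Gamma>) = \<Gamma>"
    using \<Gamma> by (auto simp: topspace_PGL)
  ultimately show ?thesis by (metis discrete_topology_unique)
qed

lemma matrix_linear_bij:
  fixes h :: "real ^ 'm::finite \<Rightarrow> real ^ 'm"
  assumes "linear h" "bij h" shows "det (matrix h) \<noteq> 0" "matrix h *v x = h x"
  using assms det_nz_iff_inj[OF assms(1)] by (auto simp: bij_is_inj matrix_works)

text \<open>A line-free open convex cone has a closure without opposite vectors. The convex hull of
  the unit vectors in the closure is then compact and misses the origin, and a separating hyperplane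
  gives a functional that is uniformly positive on unit vectors.\<close>

lemma proper_cone_functional:
  fixes E :: "'v::euclidean_space set"
  assumes E: "convex E" "open E" "is_pcone E" "E \<noteq> {}"
    and noline: "\<And>x v. v \<noteq> 0 \<Longrightarrow> \<not> (\<forall>t::real. x + t *\<^sub>R v \<in> E)"
  obtains a b where "b > 0" "\<And>x. x \<in> E \<Longrightarrow> a \<bullet> x \<ge> b * norm x"
proof -
  define C where "C = closure E"
  have C: "convex C" "closed C" unfolding C_def using E by (auto intro: convex_closure)
  have Cs: "r *\<^sub>R x \<in> C" if "x \<in> C" "r > 0" for x r
  proof -
    have "(\<lambda>x. r *\<^sub>R x) ` closure E = closure ((\<lambda>x. r *\<^sub>R x) ` E)" using closure_scaleR[of r E] by simp
    moreover have "(\<lambda>x. r *\<^sub>R x) ` E \<subseteq> E" using is_pconeD[OF E(3)] that by auto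
    ultimately show ?thesis using that closure_mono unfolding C_def by blast
  qed
  obtain e where e: "e \<in> E" using E by blast
  have pointed: "x = 0" if x: "x \<in> C" "- x \<in> C" for x
  proof (rule ccontr)
    assume nz: "x \<noteq> 0"
    have "e + t *\<^sub>R x \<in> E" for t
    proof (cases "t = 0")
      case False
      define y where "y = t *\<^sub>R x"
      have "y \<in> C"
      proof (cases "t > 0")
        case True then show ?thesis using Cs[OF x(1), of t] by (simp add: y_def)
      next
        case f: False
        then have "(- t) *\<^sub>R (- x) \<in> C" using Cs[OF x(2), of "- t"] False by simp
        then show ?thesis by (simp add: y_def)
      qed
      \<comment> \<open>The midpoint of an interior point and a point of the closure is interior;
        doubling it gives \<open>e + y\<close>. Thus opposite vectors in the closure would produce a
        line in \<open>E\<close>.\<close>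
      have "y - (1/2) *\<^sub>R (y - e) \<in> interior E"
        by (rule mem_interior_closure_convex_shrink[OF E(1)]) (use e E(2) \<open>y \<in> C\<close> in \<open>auto simp: C_def interior_open\<close>)
      then have "y - (1/2) *\<^sub>R (y - e) \<in> E" using interior_subset by blast
      then have "2 *\<^sub>R (y - (1/2) *\<^sub>R (y - e)) \<in> E" using is_pconeD[OF E(3)] by simp
      moreover have "2 *\<^sub>R (y - (1/2) *\<^sub>R (y - e)) = e + y" by (simp add: scaleR_diff_right scaleR_2)
      ultimately show ?thesis by (simp add: y_def)
    qed (use e in simp)
    then show False using noline nz by blast
  qed
  \<comment> \<open>Pointedness means exactly that deleting the origin keeps the cone convex; hence
    the hull of the unit vectors avoids it.\<close>
  have conv: "convex (C - {0})"
  proof (rule convexI)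
    fix x y and p q :: real assume xy: "x \<in> C - {0}" "y \<in> C - {0}" "0 \<le> p" "0 \<le> q" "p + q = 1"
    have "p *\<^sub>R x + q *\<^sub>R y \<in> C" using xy C by (auto intro: convexD)
    moreover have "p *\<^sub>R x + q *\<^sub>R y \<noteq> 0"
    proof
      assume z: "p *\<^sub>R x + q *\<^sub>R y = 0"
      show False
      proof (cases "p = 0 \<or> q = 0")
        case True then show False using z xy by auto
      next
        case False
        then have pq: "p > 0" "q > 0" using xy by auto
        have "q *\<^sub>R y = - (p *\<^sub>R x)" using z by (simp add: eq_neg_iff_add_eq_0 add.commute)
        moreover have "q *\<^sub>R y \<in> C" "p *\<^sub>R x \<in> C" using Cs pq xy by auto
        ultimately have "p *\<^sub>R x = 0" using pointed[of "p *\<^sub>R x"] by simp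
        then show False using pq xy by simp
      qed
    qed
    ultimately show "p *\<^sub>R x + q *\<^sub>R y \<in> C - {0}" by simp
  qed
  define K where "K = C \<inter> sphere 0 1"
  have "compact K" unfolding K_def using C(2) by (simp add: compact_Int_closed Int_commute closed_Int_compact)
  then have "compact (convex hull K)" by (rule compact_convex_hull)
  moreover have "convex hull K \<subseteq> C - {0}" by (rule hull_minimal) (use conv in \<open>auto simp: K_def\<close>)
  ultimately obtain a b where ab: "b > 0" "\<And>x. x \<in> convex hull K \<Longrightarrow> a \<bullet> x > b"
    using separating_hyperplane_closed_0[of "convex hull K"] compact_imp_closed by (metis convex_convex_hull Diff_iff insertI1 subsetD)
  have "a \<bullet> x \<ge> b * norm x" if x: "x \<in> E" for x
  proof (cases "x = 0")
    case False
    have "x \<in> C" using x closure_subset by (auto simp: C_def)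
    then have "(1 / norm x) *\<^sub>R x \<in> K" using Cs[of x "1 / norm x"] False by (simp add: K_def)
    then have "a \<bullet> ((1 / norm x) *\<^sub>R x) > b" using ab hull_inc by metis
    then show ?thesis using False by (simp add: field_simps)
  qed simp
  then show ?thesis using that ab by blast
qed

text \<open>A rotation makes the functional of \<open>proper_cone_functional\<close> the last
  coordinate up to a factor. The slice at height one is bounded because the functional dominates the
  norm.\<close>

lemma proper_cone_bounded_domain:
  fixes E :: "(real ^ 'n::finite option) set"
  assumes E: "convex E" "open E" "is_pcone E" "E \<noteq> {}"
    and noline: "\<And>x v. v \<noteq> 0 \<Longrightarrow> \<not> (\<forall>t::real. x + t *\<^sub>R v \<in> E)"
  obtains B D where "det B \<noteq> 0" "open D" "convex D" "bounded D" "D \<noteq> {}"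
    "E = pcone ((\<lambda>t. B *v hom_vec t) ` D)"
proof -
  obtain a b where ab: "b > 0" "\<And>x. x \<in> E \<Longrightarrow> a \<bullet> x \<ge> b * norm x"
    using proper_cone_functional[OF E noline] by blast
  obtain x0 where x0: "x0 \<in> E" using E by blast
  \<comment> \<open>An open cone that contains the origin is the whole space and contains
    lines.\<close>
  have zE: "0 \<notin> E"
  proof
    assume "0 \<in> E"
    then obtain e where e: "e > 0" "ball 0 e \<subseteq> E" using E(2) open_contains_ball by blast
    obtain v :: "real ^ 'n option" where v: "norm v = 1" using vector_choose_size[of 1] by auto
    have "t *\<^sub>R v \<in> E" for t
    proof (cases "t = 0")
      case False
      have "norm ((e / (2 * \<bar>t\<bar>)) *\<^sub>R (t *\<^sub>R v)) = e / 2" using e v False by (simp add: abs_mult)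
      then have "(e / (2 * \<bar>t\<bar>)) *\<^sub>R (t *\<^sub>R v) \<in> E" using e by (intro subsetD[OF e(2)]) simp
      then have "(2 * \<bar>t\<bar> / e) *\<^sub>R ((e / (2 * \<bar>t\<bar>)) *\<^sub>R (t *\<^sub>R v)) \<in> E"
        by (rule is_pconeD[OF E(3)]) (use e False in auto)
      moreover have "(2 * \<bar>t\<bar> / e) * ((e / (2 * \<bar>t\<bar>)) * t) = t" using e False by (simp add: field_simps)
      ultimately show ?thesis unfolding scaleR_scaleR by simp
    qed (use \<open>0 \<in> E\<close> in simp)
    moreover have "v \<noteq> 0" using v by auto
    ultimately show False using noline[of v 0] by simp
  qed
  have "x0 \<noteq> 0" using x0 zE by auto
  have a0: "a \<noteq> 0"
  proof
    assume "a = 0"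
    then have "b * norm x0 \<le> 0" using ab(2)[OF x0] by simp
    then show False using ab(1) \<open>x0 \<noteq> 0\<close> by (simp add: mult_le_0_iff)
  qed
  obtain f where f: "orthogonal_transformation f" "f a = norm a *\<^sub>R (axis None 1 :: real ^ 'n option)"
    using orthogonal_transformation_exists[of a "norm a *\<^sub>R (axis None 1 :: real ^ 'n option)"] by (auto simp: norm_axis_1)
  have flin: "linear f" "bij f" using f(1) by (auto simp: orthogonal_transformation_linear orthogonal_transformation_bij)
  define A where "A = matrix f"
  have A: "det A \<noteq> 0" "A *v x = f x" for x unfolding A_def using matrix_linear_bij[OF flin] by auto
  have ax: "a \<bullet> x = norm a * (A *v x) $ None" for x
  proof -
    have "a \<bullet> x = f a \<bullet> f x" using f(1) by (simp add: orthogonal_transformation_def)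
    then show ?thesis using f(2) A(2)[of x] by (simp add: inner_axis' )
  qed
  define B where "B = matrix_inv A"
  note Ai = det_inv_matrix[OF A(1)]
  have B: "det B \<noteq> 0" using Ai(3) by (simp add: B_def)
  have Binv: "matrix_inv B *v x = A *v x" for x
    using det_inv_matrix(4)[OF B, of "A *v x"] Ai(4)[of x] by (simp add: B_def)
  have nB: "norm (B *v y) = norm y" for y
  proof -
    have "norm (A *v (B *v y)) = norm (B *v y)" using f(1) A(2) by (simp add: orthogonal_transformation_norm)
    then show ?thesis using Ai(5) by (simp add: B_def)
  qed
  define D where "D = {t. B *v hom_vec t \<in> E}"
  have Eeq: "E = pcone ((\<lambda>t. B *v hom_vec t) ` D)"
  proof (intro set_eqI iffI)
    fix x assume x: "x \<in> E"
    then have "x \<noteq> 0" using zE by auto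
    then have "a \<bullet> x > 0" using ab(1) ab(2)[OF x] by (smt (verit) mult_pos_pos zero_less_norm_iff)
    then have pos: "(A *v x) $ None > 0" using a0 by (simp add: ax zero_less_mult_iff)
    define s t where "s = (A *v x) $ None" and "t = inhom (A *v x)"
    have "A *v x = s *\<^sub>R hom_vec t" using hom_vec_inhom[of "A *v x"] pos by (simp add: s_def t_def)
    then have "B *v (A *v x) = s *\<^sub>R (B *v hom_vec t)" by (simp add: matrix_vector_mult_scaleR)
    then have xs: "x = s *\<^sub>R (B *v hom_vec t)" using Ai(4) by (simp add: B_def)
    have "(1/s) *\<^sub>R x = (1/s) *\<^sub>R (s *\<^sub>R (B *v hom_vec t))" by (rule arg_cong[OF xs])
    also have "\<dots> = B *v hom_vec t" using pos by (simp flip: s_def)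
    finally have "(1/s) *\<^sub>R x = B *v hom_vec t" .
    moreover have "(1/s) *\<^sub>R x \<in> E" using is_pconeD[OF E(3) x, of "1/s"] pos by (simp add: s_def)
    ultimately have "t \<in> D" by (simp add: D_def)
    then have "s *\<^sub>R (B *v hom_vec t) \<in> pcone ((\<lambda>t. B *v hom_vec t) ` D)"
      using pos by (intro pconeI imageI) (simp_all add: s_def)
    then show "x \<in> pcone ((\<lambda>t. B *v hom_vec t) ` D)" by (subst xs)
  next
    fix x assume "x \<in> pcone ((\<lambda>t. B *v hom_vec t) ` D)"
    moreover have "pcone ((\<lambda>t. B *v hom_vec t) ` D) \<subseteq> E" by (rule pcone_subset[OF E(3)]) (auto simp: D_def)
    ultimately show "x \<in> E" by blast
  qed
  have "open D"
  proof -
    have "D = (\<lambda>t. B *v hom_vec t) -` E" by (auto simp: D_def)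
    moreover have "continuous_on UNIV (\<lambda>t. B *v hom_vec t)"
      by (rule continuous_on_compose2[OF matrix_vector_mult_linear_continuous_on continuous_on_hom_vec]) auto
    ultimately show ?thesis using E(2) by (simp add: open_vimage)
  qed
  moreover have "convex D"
  proof (rule convexI)
    fix s t and p q :: real assume st: "s \<in> D" "t \<in> D" "0 \<le> p" "0 \<le> q" "p + q = 1"
    have "p *\<^sub>R hom_vec s + q *\<^sub>R hom_vec t = hom_vec (p *\<^sub>R s + q *\<^sub>R t)"
      using st by (auto simp: vec_eq_iff hom_vec_def split: option.split)
    then have "B *v hom_vec (p *\<^sub>R s + q *\<^sub>R t) = p *\<^sub>R (B *v hom_vec s) + q *\<^sub>R (B *v hom_vec t)"
      by (metis matrix_vector_mult_scaleR matrix_vector_right_distrib)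
    then show "p *\<^sub>R s + q *\<^sub>R t \<in> D" using st convexD[OF E(1)] by (simp add: D_def)
  qed
  moreover have "bounded D"
  proof (rule boundedI)
    fix t assume "t \<in> D"
    then have t: "B *v hom_vec t \<in> E" by (simp add: D_def)
    have "b * norm (hom_vec t) \<le> norm a * (A *v (B *v hom_vec t)) $ None"
      using ab(2)[OF t] nB ax by simp
    also have "\<dots> = norm a" using Ai(5) by (simp add: B_def)
    finally have "norm (hom_vec t) \<le> norm a / b" using ab(1) by (simp add: field_simps)
    moreover have "norm t \<le> norm (hom_vec t)"
    proof -
      have "(\<Sum>i\<in>UNIV. (t $ i)\<^sup>2) \<le> (\<Sum>k\<in>UNIV. (hom_vec t $ k)\<^sup>2)"
        by (simp add: UNIV_option_conv sum.reindex o_def)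
      then show ?thesis by (simp add: norm_vec_def L2_set_def)
    qed
    ultimately show "norm t \<le> norm a / b" by simp
  qed
  moreover have "D \<noteq> {}" using Eeq x0 by (auto simp: pcone_def)
  ultimately show ?thesis using that B Eeq by blast
qed

section \<open>The convex domain, its group and the isomorphism with the quotient\<close>

section \<open>The quotient description\<close>

lemma openin_orbit_space_iff:
  assumes "open \<Omega>"
  shows "openin (orbit_space \<Omega> \<Gamma>) S \<longleftrightarrow> S \<subseteq> orbit_map \<Gamma> ` \<Omega> \<and> open {q \<in> \<Omega>. orbit_map \<Gamma> q \<in> S}"
proof -
  have "openin (top_of_set \<Omega>) {q \<in> \<Omega>. orbit_map \<Gamma> q \<in> S} \<longleftrightarrow> open {q \<in> \<Omega>. orbit_map \<Gamma> q \<in> S}"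
    using openin_open_eq[OF assms] by blast
  then show ?thesis unfolding orbit_space_def openin_quotient_topology by simp
qed

lemma topspace_orbit_space_eq:
  assumes "open \<Omega>" shows "topspace (orbit_space \<Omega> \<Gamma>) = orbit_map \<Gamma> ` \<Omega>"
proof -
  have "{q \<in> \<Omega>. orbit_map \<Gamma> q \<in> orbit_map \<Gamma> ` \<Omega>} = \<Omega>" by auto
  then have "openin (orbit_space \<Omega> \<Gamma>) (orbit_map \<Gamma> ` \<Omega>)" unfolding openin_orbit_space_iff[OF assms] using assms by simp
  then have "orbit_map \<Gamma> ` \<Omega> \<subseteq> topspace (orbit_space \<Omega> \<Gamma>)" by (rule openin_subset)
  moreover have "topspace (orbit_space \<Omega> \<Gamma>) \<subseteq> orbit_map \<Gamma> ` \<Omega>"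
    using openin_topspace[of "orbit_space \<Omega> \<Gamma>"] unfolding openin_orbit_space_iff[OF assms] by (rule conjunct1)
  ultimately show ?thesis by (rule subset_antisym[rotated])
qed

locale taut_base = taut_data M \<B> g P u
  for M :: "'a topology" and \<B> :: "('a, 'n::finite) atlas" and g P u +
  fixes c0 :: "('a, 'n) chart" and x0 :: "real ^ 'n option"
  assumes c0: "c0 \<in> \<B>" and x0: "x0 \<in> V c0"
begin

sublocale radiant_base \<B> V \<phi> L \<sigma> uu c0 x0
  by unfold_locales (fact c0 x0)+

definition Om where "Om = proj_pt ` E"

definition act where "act h = proj_map (matrix h)"

definition Gam where "Gam = act ` Deck"

text \<open>Any vector of \<open>E\<close> on the line will do: it is unique up to positive scale,
  which \<open>fst \<circ> F\<close> ignores.\<close>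

definition rep where "rep q = (SOME x. x \<in> E \<and> proj_pt x = q)"

definition proj where "proj q = fst (F (rep q))"

lemma E_pos:
  assumes "x \<in> E" "r *\<^sub>R x \<in> E" shows "r > 0"
proof (rule ccontr)
  assume r: "\<not> r > 0"
  then have "r \<noteq> 0" using assms E_0 by auto
  then have "(-1/r) *\<^sub>R r *\<^sub>R x \<in> E" using is_pconeD[OF E_cone assms(2), of "-1/r"] r by (simp add: divide_pos_neg)
  then have "- x \<in> E" using \<open>r \<noteq> 0\<close> by simp
  then have "(1/2) *\<^sub>R x + (1/2) *\<^sub>R (- x) \<in> E" using assms by (intro convexD[OF E_convex]) auto
  then show False using E_0 by simp
qed

lemma E_nz: "x \<in> E \<Longrightarrow> x \<noteq> 0" using E_0 by auto

lemma E_line: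
  assumes "x \<in> E" "y \<in> E" "proj_pt x = proj_pt y" obtains r where "r > 0" "y = r *\<^sub>R x"
proof -
  obtain r where "y = r *\<^sub>R x" using assms proj_pt_eq_iff[OF E_nz E_nz] by blast
  then show ?thesis using that E_pos assms by blast
qed

lemma rep: assumes "q \<in> Om" shows "rep q \<in> E" "proj_pt (rep q) = q"
proof -
  have "\<exists>x. x \<in> E \<and> proj_pt x = q" using assms by (auto simp: Om_def)
  then have "rep q \<in> E \<and> proj_pt (rep q) = q" unfolding rep_def by (rule someI_ex)
  then show "rep q \<in> E" "proj_pt (rep q) = q" by auto
qed

lemma proj_F: assumes "x \<in> E" shows "proj (proj_pt x) = fst (F x)"
proof -
  have q: "proj_pt x \<in> Om" using assms by (simp add: Om_def)
  obtain r where "r > 0" "rep (proj_pt x) = r *\<^sub>R x"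
    using E_line[OF assms rep(1)[OF q] rep(2)[OF q, symmetric]] by metis
  then show ?thesis using F_scale[OF assms] by (simp add: proj_def \<sigma>_def)
qed

lemma Om_obtain: assumes "q \<in> Om" obtains x where "x \<in> E" "q = proj_pt x"
  using assms by (auto simp: Om_def)

lemma deck_matrix:
  assumes "h \<in> Deck" shows "det (matrix h) \<noteq> 0" "matrix h *v x = h x"
  using matrix_linear_bij[of h] assms by (auto simp: Deck_def)

lemma act_pt: "h \<in> Deck \<Longrightarrow> x \<noteq> 0 \<Longrightarrow> act h (proj_pt x) = proj_pt (h x)"
  by (simp add: act_def proj_map_pt deck_matrix)

lemma deck_nz: "h \<in> Deck \<Longrightarrow> x \<noteq> 0 \<Longrightarrow> h x \<noteq> 0"
  using deck_matrix det_nz_mult_zero by metis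

lemma act_comp: assumes "h \<in> Deck" "k \<in> Deck" shows "act h \<circ> act k = act (h \<circ> k)"
proof
  fix p :: "'n rp"
  obtain v where v: "v \<noteq> 0" "p = proj_pt v" using rp_obtain by blast
  then show "(act h \<circ> act k) p = act (h \<circ> k) p"
    using act_pt[OF assms(2) v(1)] act_pt[OF assms(1) deck_nz[OF assms(2) v(1)]] act_pt[OF deck_comp[OF assms] v(1)] by simp
qed

lemma act_id: "act id = (id :: 'n rp \<Rightarrow> 'n rp)"
proof
  fix p :: "'n rp"
  obtain v where v: "v \<noteq> 0" "p = proj_pt v" using rp_obtain by blast
  then show "act id p = id p" using act_pt[OF deck_id v(1)] by simp
qed

lemma act_inv: assumes "h \<in> Deck" shows "inv (act h) = act (inv h)"
proof -
  have b: "bij h" using assms by (simp add: Deck_def)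
  have 1: "inv h \<circ> h = id" "h \<circ> inv h = id" using b by (auto simp: bij_is_inj bij_is_surj surj_f_inv_f)
  have "act h \<circ> act (inv h) = id" "act (inv h) \<circ> act h = id"
    using act_comp[OF deck_inv[OF assms] assms] act_comp[OF assms deck_inv[OF assms]] 1 act_id by simp_all
  then show ?thesis by (rule inv_unique_comp)
qed

text \<open>Two positive vectors over one base point differ by a positive factor. After rescaling
  \<open>x\<close>, the two vectors have the same image under \<open>F\<close>, and
  \<open>deck_exists\<close> joins them.\<close>

lemma proj_eq_iff:
  assumes x: "x \<in> E" and y: "y \<in> E"
  shows "fst (F x) = fst (F y) \<longleftrightarrow> (\<exists>h\<in>Deck. proj_pt y = act h (proj_pt x))"
proof
  assume eq: "fst (F x) = fst (F y)"
  define p where "p = fst (F x)"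
  have L: "F x \<in> L" "F y \<in> L" using F_L x y by auto
  then have P: "p \<in> topspace M" "snd (F x) \<in> P p" "snd (F y) \<in> P p" using eq by (auto simp: L_def p_def)
  obtain r where r: "r > 0" "snd (F y) = (\<lambda>c. r *\<^sub>R snd (F x) c)" by (rule P_multiple[OF P])
  then have "F y = F (r *\<^sub>R x)" using F_scale[OF x r(1)] eq by (simp add: \<sigma>_def prod_eq_iff)
  then obtain h where h: "h \<in> Deck" "h (r *\<^sub>R x) = y" using deck_exists[OF is_pconeD[OF E_cone x r(1)] y] by metis
  have "act h (proj_pt (r *\<^sub>R x)) = proj_pt y" using act_pt[OF h(1), of "r *\<^sub>R x"] h E_nz[OF x] r by simp
  then show "\<exists>h\<in>Deck. proj_pt y = act h (proj_pt x)" using h r by (metis proj_pt_scale less_irrefl)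
next
  assume "\<exists>h\<in>Deck. proj_pt y = act h (proj_pt x)"
  then obtain h where h: "h \<in> Deck" "proj_pt y = proj_pt (h x)" using act_pt E_nz[OF x] by metis
  then obtain r where "r > 0" "y = r *\<^sub>R h x" using E_line[OF deck_E[OF h(1) x] y] by metis
  then have "F y = \<sigma> r (F x)" using F_scale deck_E[OF h(1) x] deck_F[OF h(1) x] by simp
  then show "fst (F x) = fst (F y)" by (simp add: \<sigma>_def)
qed

lemma act_Om: "h \<in> Deck \<Longrightarrow> act h ` Om = Om"
proof -
  have sub: "act h ` Om \<subseteq> Om" if "h \<in> Deck" for h
    using that act_pt E_nz deck_E by (auto simp: Om_def)
  assume h: "h \<in> Deck"
  show ?thesis
  proof (intro equalityI sub h subsetI)
    fix q assume q: "q \<in> Om"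
    have "bij h" using h by (simp add: Deck_def)
    then have "h \<circ> inv h = id" by (auto simp: bij_is_surj surj_f_inv_f)
    then have "q = act h (act (inv h) q)" using act_comp[OF h deck_inv[OF h]] act_id by (metis comp_apply id_apply)
    moreover have "act (inv h) q \<in> Om" using sub[OF deck_inv[OF h]] q by blast
    ultimately show "q \<in> act h ` Om" by blast
  qed
qed

lemma domain:
  obtains B D where "det B \<noteq> 0" "open D" "convex D" "bounded D" "D \<noteq> {}"
    "E = pcone ((\<lambda>t. B *v hom_vec t) ` D)" "Om = affine_pt B ` D"
proof -
  have "\<not> (\<forall>t::real. x + t *\<^sub>R v \<in> E)" if "v \<noteq> 0" for x v using no_line that by blast
  then obtain B D where BD: "det B \<noteq> 0" "open D" "convex D" "bounded D" "D \<noteq> {}"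
    "E = pcone ((\<lambda>t. B *v hom_vec t) ` D)"
    using proper_cone_bounded_domain[OF E_convex E_open E_cone] x0_E by (metis empty_iff)
  moreover have "Om = affine_pt B ` D" unfolding Om_def affine_pt_image BD(6)[symmetric] ..
  ultimately show ?thesis using that by blast
qed

lemma Om_domain: "bounded_convex_domain Om"
  using domain unfolding bounded_convex_domain_def by metis

lemma Gam_PGL: "Gam \<subseteq> PGL"
  using deck_matrix(1) PGL_I by (auto simp: Gam_def act_def)

text \<open>The level \<open>U = -1\<close> meets every ray of \<open>E\<close> once, and deck
  transformations preserve \<open>U\<close>. This lifts questions about lines in \<open>Om\<close>
  to vectors without losing the group action.\<close>

lemma normalized_section:
  obtains s where "continuous_on Om s" "\<And>q. q \<in> Om \<Longrightarrow> s q \<in> E" "\<And>q. q \<in> Om \<Longrightarrow> proj_pt (s q) = q"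
    "\<And>q. q \<in> Om \<Longrightarrow> U (s q) = -1"
proof -
  obtain B D where BD: "det B \<noteq> 0" "open D" "E = pcone ((\<lambda>t. B *v hom_vec t) ` D)" "Om = affine_pt B ` D"
    using domain by metis
  obtain k where k: "homeomorphism D Om (affine_pt B) k"
    using affine_pt_homeomorphism[OF BD(1,2)] BD(4) by metis
  define r where "r q = B *v hom_vec (k q)" for q
  have kD: "k q \<in> D" "affine_pt B (k q) = q" if "q \<in> Om" for q using k that by (auto simp: homeomorphism_def)
  have rE: "r q \<in> E" if "q \<in> Om" for q
    unfolding r_def BD(3) using kD(1)[OF that] subset_pcone[of "(\<lambda>t. B *v hom_vec t) ` D"] by blast
  have rp: "proj_pt (r q) = q" if "q \<in> Om" for q using kD(2)[OF that] by (simp add: r_def affine_pt_def)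
  have cr: "continuous_on Om r" unfolding r_def
    using k by (intro continuous_on_compose2[OF matrix_vector_mult_linear_continuous_on
      continuous_on_compose2[OF continuous_on_hom_vec[of UNIV]]]) (auto simp: homeomorphism_def)
  define s where "s q = (- 1 / U (r q)) *\<^sub>R r q" for q
  have pos: "- 1 / U (r q) > 0" if "q \<in> Om" for q using U_neg[OF rE[OF that]] by (simp add: divide_neg_neg)
  have cU: "continuous_on Om (\<lambda>q. U (r q))" using continuous_on_compose2[OF U_cont cr] rE by blast
  have "continuous_on Om s" unfolding s_def
    by (intro continuous_intros cr cU) (use U_neg[OF rE] in force)
  moreover have "s q \<in> E" if "q \<in> Om" for q unfolding s_def using is_pconeD[OF E_cone rE[OF that] pos[OF that]] .
  moreover have "proj_pt (s q) = q" if "q \<in> Om" for q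
    unfolding s_def using proj_pt_scale[of "- 1 / U (r q)" "r q"] pos[OF that] rp[OF that] by simp
  moreover have "U (s q) = -1" if "q \<in> Om" for q
    unfolding s_def using U_scale[OF rE[OF that] pos[OF that]] U_neg[OF rE[OF that]] by simp
  ultimately show ?thesis using that by blast
qed

text \<open>Infinitely many elements would give a sequence of distinct ones. Lifted by the
  normalized section, their points and images stay in a compact set; along a subsequence both
  converge, and \<open>deck_discontinuous\<close> makes the elements eventually constant.\<close>

lemma Gam_finite:
  assumes K: "compact K" "K \<subseteq> Om" shows "finite {\<gamma>\<in>Gam. \<gamma> ` K \<inter> K \<noteq> {}}"
proof (rule ccontr)
  assume "infinite {\<gamma>\<in>Gam. \<gamma> ` K \<inter> K \<noteq> {}}"
  then obtain G :: "nat \<Rightarrow> 'n rp \<Rightarrow> 'n rp" where G: "inj G" "range G \<subseteq> {\<gamma>\<in>Gam. \<gamma> ` K \<inter> K \<noteq> {}}"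
    using infinite_countable_subset by blast
  have "\<exists>h q. h \<in> Deck \<and> G k = act h \<and> q \<in> K \<and> act h q \<in> K" for k
  proof -
    have "G k \<in> Gam" "G k ` K \<inter> K \<noteq> {}" using G(2) by auto
    then show ?thesis unfolding Gam_def by auto
  qed
  then obtain h q where hq: "\<And>k. h k \<in> Deck" "\<And>k. G k = act (h k)" "\<And>k. q k \<in> K" "\<And>k. act (h k) (q k) \<in> K"
    by metis
  obtain s where s: "continuous_on Om s" "\<And>q. q \<in> Om \<Longrightarrow> s q \<in> E" "\<And>q. q \<in> Om \<Longrightarrow> proj_pt (s q) = q"
    "\<And>q. q \<in> Om \<Longrightarrow> U (s q) = -1" using normalized_section by metis
  \<comment> \<open>Both vectors lie on the same ray and on the level \<open>U = -1\<close>, so the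
    section is equivariant.\<close>
  have hs: "h k (s (q k)) = s (act (h k) (q k))" for k
  proof -
    have qO: "q k \<in> Om" "act (h k) (q k) \<in> Om" using hq(3,4)[of k] K by auto
    have 1: "h k (s (q k)) \<in> E" using deck_E hq(1) s(2)[OF qO(1)] by blast
    have "proj_pt (h k (s (q k))) = proj_pt (s (act (h k) (q k)))"
      using act_pt[OF hq(1) E_nz[OF s(2)[OF qO(1)]]] s(3)[OF qO(1)] s(3)[OF qO(2)] by metis
    then obtain r where r: "r > 0" "s (act (h k) (q k)) = r *\<^sub>R h k (s (q k))"
      using E_line[OF 1 s(2)[OF qO(2)]] by metis
    have "U (h k (s (q k))) = -1" using deck_F[OF hq(1) s(2)[OF qO(1)]] s(4)[OF qO(1)] by (simp add: U_def)
    then have "r = 1" using U_scale[OF 1 r(1)] r(2) s(4)[OF qO(2)] by simp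
    then show ?thesis using r by simp
  qed
  define KK where "KK = s ` K"
  have "compact KK" unfolding KK_def using s(1) K by (intro compact_continuous_image) (auto intro: continuous_on_subset)
  then have "compact (KK \<times> KK)" by (intro compact_Times)
  then have sc: "seq_compact (KK \<times> KK)" by (simp add: compact_eq_seq_compact_metric)
  have inKK: "\<forall>k. (s (q k), h k (s (q k))) \<in> KK \<times> KK" using hq hs by (auto simp: KK_def)
  obtain l r where lr: "l \<in> KK \<times> KK" "strict_mono r" "((\<lambda>k. (s (q k), h k (s (q k)))) \<circ> r) \<longlonglongrightarrow> l"
    by (rule seq_compactE[OF sc inKK])
  obtain x y where xy: "l = (x, y)" by (cases l)
  have lim: "(\<lambda>k. s (q (r k))) \<longlonglongrightarrow> x" "(\<lambda>k. h (r k) (s (q (r k)))) \<longlonglongrightarrow> y"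
    using tendsto_fst[OF lr(3)] tendsto_snd[OF lr(3)] by (simp_all add: o_def xy)
  have KE: "KK \<subseteq> E" using s(2) K by (auto simp: KK_def)
  have "x \<in> E" "y \<in> E" using lr(1) xy KE by auto
  moreover have "s (q (r k)) \<in> E" for k using hq(3) K(2) s(2) by blast
  ultimately obtain f where "eventually (\<lambda>k. h (r k) = f) sequentially"
    using deck_discontinuous[of "\<lambda>k. h (r k)" "\<lambda>k. s (q (r k))" x y] hq(1) lim by metis
  then obtain N where "\<And>k. k \<ge> N \<Longrightarrow> h (r k) = f" unfolding eventually_sequentially by blast
  then have "G (r N) = G (r (Suc N))" using hq(2) by simp
  then have "r N = r (Suc N)" using G(1) by (simp add: inj_eq)
  then show False using lr(2) by (metis lessI less_irrefl strict_monoD)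
qed

lemma Gam_properly_discontinuous: "acts_properly_discontinuously Gam Om"
  unfolding acts_properly_discontinuously_def
proof (intro conjI ballI allI impI)
  fix \<gamma> assume "\<gamma> \<in> Gam"
  then show "\<gamma> ` Om = Om" using act_Om by (auto simp: Gam_def)
next
  fix \<gamma> q assume g: "\<gamma> \<in> Gam" "q \<in> Om" "\<gamma> q = q"
  then obtain h where h: "h \<in> Deck" "\<gamma> = act h" by (auto simp: Gam_def)
  obtain x where x: "x \<in> E" "q = proj_pt x" using g Om_obtain by blast
  have "proj_pt x = proj_pt (h x)" using g h x act_pt E_nz by metis
  then obtain r where "h x = r *\<^sub>R x" using E_line[OF x(1) deck_E[OF h(1) x(1)]] by metis
  then have "h = id" using deck_free[OF h(1) x(1)] by blast
  then show "\<gamma> = id" using h act_id by simp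
qed (use Gam_finite in blast)

lemma Gam_discrete: "discrete_subgroup_PGL Gam"
  unfolding discrete_subgroup_PGL_def
proof (intro conjI ballI)
  show "id \<in> Gam" using act_id deck_id by (metis Gam_def imageI)
  show "\<gamma> \<circ> \<delta> \<in> Gam" if gd: "\<gamma> \<in> Gam" "\<delta> \<in> Gam" for \<gamma> \<delta>
  proof -
    obtain h k where "h \<in> Deck" "k \<in> Deck" "\<gamma> = act h" "\<delta> = act k" using gd by (auto simp: Gam_def)
    then show ?thesis using act_comp deck_comp by (auto simp: Gam_def)
  qed
  show "inv \<gamma> \<in> Gam" if "\<gamma> \<in> Gam" for \<gamma>
    using that act_inv deck_inv by (auto simp: Gam_def)
qed (use Gam_PGL discrete_of_properly_discontinuous[OF Om_domain Gam_PGL Gam_properly_discontinuous] in auto)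

lemma orbit_eq: "q \<in> Om \<Longrightarrow> orbit_map Gam q = {q' \<in> Om. proj q' = proj q}"
proof (intro set_eqI iffI)
  fix q' assume q: "q \<in> Om"
  obtain x where x: "x \<in> E" "q = proj_pt x" using q Om_obtain by blast
  { assume "q' \<in> orbit_map Gam q"
    then obtain h where h: "h \<in> Deck" "q' = act h q" by (auto simp: orbit_map_def Gam_def)
    then have "q' \<in> Om" using act_Om q by blast
    then obtain y where y: "y \<in> E" "q' = proj_pt y" using Om_obtain by blast
    then have "fst (F x) = fst (F y)" using proj_eq_iff[OF x(1) y(1)] h x by blast
    then show "q' \<in> {q' \<in> Om. proj q' = proj q}" using proj_F x y \<open>q' \<in> Om\<close> by simp }
  { assume q': "q' \<in> {q' \<in> Om. proj q' = proj q}"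
    then obtain y where y: "y \<in> E" "q' = proj_pt y" using Om_obtain by blast
    then have "fst (F x) = fst (F y)" using q' proj_F x by simp
    then obtain h where "h \<in> Deck" "q' = act h q" using proj_eq_iff[OF x(1) y(1)] x y by blast
    then show "q' \<in> orbit_map Gam q" by (auto simp: orbit_map_def Gam_def) }
qed

lemma proj_image: "proj ` Om = topspace M"
proof (intro equalityI subsetI)
  fix p assume "p \<in> proj ` Om"
  then obtain x where x: "x \<in> E" "p = fst (F x)" using proj_F by (auto simp: Om_def)
  then show "p \<in> topspace M" using F_L[OF x(1)] by (auto simp: L_def case_prod_beta)
next
  fix p assume p: "p \<in> topspace M"
  then obtain w where "w \<in> P p" using P_nonempty by blast
  then have "(p, w) \<in> L" using p by (simp add: L_def)
  then have "(p, w) \<in> F ` E" using F_surj by simp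
  then obtain x where "(p, w) = F x" "x \<in> E" by (rule imageE)
  then have "x \<in> E" "F x = (p, w)" by simp_all
  then show "p \<in> proj ` Om" using proj_F[of x] by (auto simp: Om_def intro!: image_eqI[of _ _ "proj_pt x"])
qed

lemma local_form:
  assumes x: "x \<in> E" and c: "c \<in> \<B>" "fst (F x) \<in> fst c"
  obtains A W where "det A \<noteq> 0" "open W" "x \<in> W" "W \<subseteq> E" "\<And>y. y \<in> W \<Longrightarrow> A *v y \<in> dom c"
    "\<And>y. y \<in> W \<Longrightarrow> fst (F y) = pt c (A *v y)"
proof -
  obtain p w where pw: "F x = (p, w)" by (cases "F x")
  have L: "(p, w) \<in> L" using F_L[OF x] pw by simp
  note wc = L_chart[OF L c(1)]
  have pc: "p \<in> fst c" using c pw by simp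
  have Fx: "F x = \<phi> c (w c)" using wc(2)[OF pc] pw by simp
  obtain h W where h: "linear h" "bij h" "open W" "x \<in> W" "W \<subseteq> E" "h ` W \<subseteq> V c" "\<And>z. z \<in> W \<Longrightarrow> F z = \<phi> c (h z)"
    using loclin_chart[OF loclin_F x c(1) wc(1)[OF pc] Fx] by metis
  note m = matrix_linear_bij[OF h(1,2)]
  show ?thesis
  proof (rule that[of "matrix h" W])
    fix y assume y: "y \<in> W"
    then show "matrix h *v y \<in> dom c" using m h(6) V_dom[of c] by auto
    show "fst (F y) = pt c (matrix h *v y)" using h(7)[OF y] m by (simp add: \<phi>_def)
  qed (use m h in auto)
qed

lemma proj_open:
  assumes S: "open S" "S \<subseteq> Om" shows "openin M (proj ` S)"
proof (subst openin_subopen, intro ballI)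
  fix p assume "p \<in> proj ` S"
  then obtain x where x: "x \<in> E" "proj_pt x \<in> S" "p = fst (F x)" using S proj_F by (force simp: Om_def)
  have "p \<in> topspace M" using F_L[OF x(1)] x by (auto simp: L_def)
  then obtain c where c: "c \<in> \<B>" "p \<in> fst c" using topspace_charts by blast
  obtain A W where A: "det A \<noteq> 0" "open W" "x \<in> W" "W \<subseteq> E" "\<And>y. y \<in> W \<Longrightarrow> A *v y \<in> dom c"
    "\<And>y. y \<in> W \<Longrightarrow> fst (F y) = pt c (A *v y)" using local_form[OF x(1) c(1)] c x by metis
  define T where "T = W \<inter> {y. y \<noteq> 0 \<and> proj_pt y \<in> S}"
  have oT: "open T" using A S by (auto simp: T_def open_rp_iff)
  have "(\<lambda>y. A *v y) ` T = (\<lambda>y. matrix_inv A *v y) -` T"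
  proof (intro set_eqI iffI)
    fix z assume "z \<in> (\<lambda>y. matrix_inv A *v y) -` T"
    then show "z \<in> (\<lambda>y. A *v y) ` T"
      using det_inv_matrix(5)[OF A(1), of z] by (intro image_eqI[of _ _ "matrix_inv A *v z"]) auto
  qed (use det_inv_matrix(4)[OF A(1)] in auto)
  then have "open ((\<lambda>y. A *v y) ` T)" using oT by (simp add: linear_vimage_open)
  then have "openin M (pt c ` (\<lambda>y. A *v y) ` T)" using A by (intro pt_image_open c) (auto simp: T_def)
  moreover have "p \<in> pt c ` (\<lambda>y. A *v y) ` T"
    using x A E_nz by (auto simp: T_def intro!: image_eqI[of _ _ "A *v x"] image_eqI[of _ _ x])
  moreover have "pt c ` (\<lambda>y. A *v y) ` T \<subseteq> proj ` S"
  proof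
    fix q assume "q \<in> pt c ` (\<lambda>y. A *v y) ` T"
    then obtain y where y: "y \<in> T" "q = pt c (A *v y)" by auto
    then have "y \<in> E" "proj_pt y \<in> S" "q = fst (F y)" using A by (auto simp: T_def)
    then show "q \<in> proj ` S" using proj_F[of y] by (metis imageI)
  qed
  ultimately show "\<exists>T. openin M T \<and> p \<in> T \<and> T \<subseteq> proj ` S" by blast
qed

lemma proj_preimage_open:
  assumes T: "openin M T" shows "open {q \<in> Om. proj q \<in> T}"
proof -
  have "open {x \<in> E. fst (F x) \<in> T}"
  proof (subst open_subopen, intro ballI)
    fix x assume x: "x \<in> {x \<in> E. fst (F x) \<in> T}"
    then have "fst (F x) \<in> topspace M" using T openin_subset by blast
    then obtain c where c: "c \<in> \<B>" "fst (F x) \<in> fst c" using topspace_charts by blast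
    have xE: "x \<in> E" using x by simp
    obtain A W where A: "det A \<noteq> 0" "open W" "x \<in> W" "W \<subseteq> E" "\<And>y. y \<in> W \<Longrightarrow> A *v y \<in> dom c"
      "\<And>y. y \<in> W \<Longrightarrow> fst (F y) = pt c (A *v y)" using local_form[OF xE c] by metis
    have "open (W \<inter> (\<lambda>y. A *v y) -` {y \<in> dom c. pt c y \<in> T})"
      using A pt_preimage_open[OF c(1) T] by (intro open_Int linear_vimage_open matrix_vector_mul_linear)
    moreover have "x \<in> W \<inter> (\<lambda>y. A *v y) -` {y \<in> dom c. pt c y \<in> T}" using x A(3) A(5)[OF A(3)] A(6)[OF A(3)] by simp
    moreover have "W \<inter> (\<lambda>y. A *v y) -` {y \<in> dom c. pt c y \<in> T} \<subseteq> {x \<in> E. fst (F x) \<in> T}" using A(4,6) by auto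
    ultimately show "\<exists>S. open S \<and> x \<in> S \<and> S \<subseteq> {x \<in> E. fst (F x) \<in> T}" by blast
  qed
  then have "open (proj_pt ` {x \<in> E. fst (F x) \<in> T})" using E_0 by (intro open_proj_pt_image) auto
  moreover have "proj_pt ` {x \<in> E. fst (F x) \<in> T} = {q \<in> Om. proj q \<in> T}"
  proof (intro set_eqI iffI)
    fix q assume "q \<in> proj_pt ` {x \<in> E. fst (F x) \<in> T}"
    then show "q \<in> {q \<in> Om. proj q \<in> T}" using proj_F by (auto simp: Om_def)
  next
    fix q assume q: "q \<in> {q \<in> Om. proj q \<in> T}"
    then obtain x where "x \<in> E" "q = proj_pt x" using Om_obtain by blast
    then show "q \<in> proj_pt ` {x \<in> E. fst (F x) \<in> T}" using q proj_F[of x] by auto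
  qed
  ultimately show ?thesis by simp
qed

lemma Om_open: "open Om"
  unfolding Om_def using E_open E_0 by (rule open_proj_pt_image)

lemmas openin_orbit_space = openin_orbit_space_iff[OF Om_open]

lemmas topspace_orbit_space = topspace_orbit_space_eq[OF Om_open]

text \<open>The fibre of \<open>proj\<close> over \<open>p\<close>, which is an orbit of
  \<open>Gam\<close>; this is the isomorphism from \<open>M\<close> to the quotient.\<close>

definition dev where "dev p = {q \<in> Om. proj q = p}"

lemma dev_orbit: "q \<in> Om \<Longrightarrow> dev (proj q) = orbit_map Gam q"
  using orbit_eq by (simp add: dev_def)

lemma dev_homeomorphic: "homeomorphic_map M (orbit_space Om Gam) dev"
proof (rule bijective_open_imp_homeomorphic_map)
  show im: "dev ` topspace M = topspace (orbit_space Om Gam)"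
    unfolding topspace_orbit_space proj_image[symmetric] image_image using dev_orbit by auto
  show "continuous_map M (orbit_space Om Gam) dev"
    unfolding continuous_map_def
  proof (intro conjI allI impI)
    show "dev \<in> topspace M \<rightarrow> topspace (orbit_space Om Gam)" using im by blast
    fix S assume S: "openin (orbit_space Om Gam) S"
    have "{p \<in> topspace M. dev p \<in> S} = proj ` {q \<in> Om. orbit_map Gam q \<in> S}"
      unfolding proj_image[symmetric] using dev_orbit by auto
    then show "openin M {p \<in> topspace M. dev p \<in> S}" using S openin_orbit_space proj_open by auto
  qed
  show "open_map M (orbit_space Om Gam) dev"
    unfolding open_map_def
  proof (intro allI impI)
    fix T assume T: "openin M T"
    have "{q \<in> Om. orbit_map Gam q \<in> dev ` T} = {q \<in> Om. proj q \<in> T}"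
    proof (intro set_eqI iffI)
      fix q assume q: "q \<in> {q \<in> Om. orbit_map Gam q \<in> dev ` T}"
      then obtain p where p: "p \<in> T" "dev (proj q) = dev p" using dev_orbit by auto
      have "q \<in> dev (proj q)" using q by (simp add: dev_def)
      then have "q \<in> dev p" unfolding p(2) .
      then have "proj q = p" by (simp add: dev_def)
      then show "q \<in> {q \<in> Om. proj q \<in> T}" using q p by simp
    next
      fix q assume "q \<in> {q \<in> Om. proj q \<in> T}"
      then show "q \<in> {q \<in> Om. orbit_map Gam q \<in> dev ` T}" using dev_orbit[of q] by auto
    qed
    moreover have "dev ` T \<subseteq> orbit_map Gam ` Om" using im T openin_subset[OF T] topspace_orbit_space by blast
    ultimately show "openin (orbit_space Om Gam) (dev ` T)"
      using openin_orbit_space proj_preimage_open[OF T] by simp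
  qed
  show "inj_on dev (topspace M)"
  proof (rule inj_onI)
    fix p p' assume "p \<in> topspace M" "p' \<in> topspace M" and eq: "dev p = dev p'"
    then obtain q where "q \<in> Om" "p = proj q" using proj_image by blast
    then have "q \<in> dev p" by (simp add: dev_def)
    then have "q \<in> dev p'" unfolding eq .
    then show "p = p'" using \<open>p = proj q\<close> by (simp add: dev_def)
  qed
qed

text \<open>In a chart of \<open>\<B>\<close> the map \<open>F\<close> is linear, so
  \<open>dev\<close> is locally the inverse of a projective map there; the common structure of
  \<open>\<A>\<close> and \<open>\<B>\<close> carries this to the charts of
  \<open>\<A>\<close>.\<close>

lemma dev_equivalent:
  assumes A: "same_structure M \<A> \<B>"
  shows "proj_equivalent M \<A> (orbit_space Om Gam) (orbit_atlas Om Gam)"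
  unfolding proj_equivalent_def
proof (intro exI[of _ dev] conjI dev_homeomorphic ballI impI)
  fix c d p assume c: "c \<in> \<A>" and d: "d \<in> orbit_atlas Om Gam" and p: "p \<in> fst c" "dev p \<in> fst d"
  obtain S where S: "d = (orbit_map Gam ` S, inv_into S (orbit_map Gam))" "open S" "S \<subseteq> Om" "inj_on (orbit_map Gam) S"
    using d by (auto simp: orbit_atlas_def)
  have "topspace M = (\<Union>c\<in>\<A>. fst c)" using A by (simp add: same_structure_def proj_flat_manifold_def)
  then have pM: "p \<in> topspace M" using c p(1) by auto
  obtain q where q: "q \<in> S" "dev p = orbit_map Gam q" using p S by auto
  have qO: "q \<in> Om" using q S by blast
  have pq: "proj q = p"
  proof -
    have "q \<in> orbit_map Gam q" using orbit_eq[OF qO] qO by simp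
    then have "q \<in> dev p" using q(2) by simp
    then show ?thesis by (simp add: dev_def)
  qed
  obtain x where x: "x \<in> E" "q = proj_pt x" using Om_obtain[OF qO] by metis
  obtain c2 where c2: "c2 \<in> \<B>" "p \<in> fst c2" using topspace_charts[OF pM] by metis
  have Fx: "fst (F x) = p" using proj_F[OF x(1)] x pq by simp
  obtain B W where B: "det B \<noteq> 0" "open W" "x \<in> W" "W \<subseteq> E" "\<And>y. y \<in> W \<Longrightarrow> B *v y \<in> dom c2"
    "\<And>y. y \<in> W \<Longrightarrow> fst (F y) = pt c2 (B *v y)" using local_form[OF x(1) c2(1)] c2 Fx by metis
  have "proj_compatible M c c2" using A c c2 unfolding same_structure_def by blast
  obtain \<gamma> W1 where W1: "\<gamma> \<in> PGL" "openin M W1" "p \<in> W1" "W1 \<subseteq> fst c \<inter> fst c2" "\<And>q. q \<in> W1 \<Longrightarrow> snd c2 q = \<gamma> (snd c q)"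
  proof -
    have "p \<in> fst c \<inter> fst c2" using p c2 by simp
    with \<open>proj_compatible M c c2\<close> have "\<exists>\<gamma>\<in>PGL. \<exists>W. openin M W \<and> p \<in> W \<and> W \<subseteq> fst c \<inter> fst c2 \<and> (\<forall>q\<in>W. snd c2 q = \<gamma> (snd c q))"
      unfolding proj_compatible_def by (rule bspec)
    then obtain \<gamma> W where gW: "\<gamma> \<in> PGL" "openin M W \<and> p \<in> W \<and> W \<subseteq> fst c \<inter> fst c2 \<and> (\<forall>q\<in>W. snd c2 q = \<gamma> (snd c q))"
      by (elim bexE exE)
    show ?thesis by (rule that[of \<gamma> W]) (use gW in blast)+
  qed
  define T where "T = proj_pt ` W \<inter> S"
  have oT: "open T" unfolding T_def using B S E_0 by (intro open_Int open_proj_pt_image) auto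
  have TO: "T \<subseteq> Om" using S by (auto simp: T_def)
  define N where "N = proj ` T \<inter> W1"
  \<comment> \<open>From \<open>c\<close> to the auxiliary chart \<open>c2\<close> by
    \<open>\<gamma>\<close>, then back to \<open>Om\<close> by the inverse of the matrix of
    \<open>F\<close> in \<open>c2\<close>.\<close>
  define \<delta> where "\<delta> = proj_map (matrix_inv B) \<circ> \<gamma>"
  have "openin M N" unfolding N_def using proj_open[OF oT TO] W1 by auto
  moreover have "p \<in> N" using W1 q x B pq by (auto simp: N_def T_def intro!: image_eqI[of _ _ q])
  moreover have "N \<subseteq> fst c" using W1 by (auto simp: N_def)
  moreover have "\<delta> \<in> PGL" unfolding \<delta>_def
    using W1 det_inv_matrix(3)[OF B(1)] by (intro PGL_group PGL_I)
  moreover have key: "dev r \<in> fst d \<and> snd d (dev r) = \<delta> (snd c r)" if r: "r \<in> N" for r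
  proof -
    obtain q' where q': "q' \<in> T" "r = proj q'" using r by (auto simp: N_def)
    then obtain y where y: "y \<in> W" "q' = proj_pt y" by (auto simp: T_def)
    have yE: "y \<in> E" using y B by blast
    have dv: "dev r = orbit_map Gam q'" using q' TO dev_orbit by auto
    have q'S: "q' \<in> S" using q' by (simp add: T_def)
    have 1: "snd d (dev r) = q'" using S dv q'S by (simp add: inv_into_f_f)
    have "r = pt c2 (B *v y)" using q' y proj_F[OF yE] B(6)[OF y(1)] by simp
    then have "snd c2 r = proj_map B q'" using pt_in(2)[OF B(5)[OF y(1)]] y E_nz[OF yE] B(1) by (simp add: proj_map_pt)
    then have "proj_map (matrix_inv B) (\<gamma> (snd c r)) = q'" using W1(5)[of r] r proj_map_inv(1)[OF B(1), of q'] by (simp add: N_def)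
    then show ?thesis using 1 dv S q'S by (simp add: \<delta>_def)
  qed
  ultimately show "\<exists>\<gamma>\<in>PGL. \<exists>W. openin M W \<and> p \<in> W \<and> W \<subseteq> fst c \<and> dev ` W \<subseteq> fst d \<and> (\<forall>q\<in>W. snd d (dev q) = \<gamma> (snd c q))"
    by (intro bexI[of _ \<delta>] exI[of _ N]) auto
qed

end

theorem convex_quotient_of_section:
  fixes M :: "'a topology" and \<A> \<B> :: "('a, 'n::finite) atlas"
  assumes "same_structure M \<A> \<B>" "transition_lift M \<B> g" "taut_orientation M \<B> g P"
    "dual_section M \<B> g u" "negative_section M P u" "hessian_positive M \<B> g P u"
    "compact_space M" "connected_space M" "topspace M \<noteq> {}"
  shows "\<exists>(\<Omega> :: 'n rp set) \<Gamma>. bounded_convex_domain \<Omega> \<and> discrete_subgroup_PGL \<Gamma> \<and>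
        acts_properly_discontinuously \<Gamma> \<Omega> \<and>
        proj_equivalent M \<A> (orbit_space \<Omega> \<Gamma>) (orbit_atlas \<Omega> \<Gamma>)"
proof -
  interpret td: taut_data M \<B> g P u
    by unfold_locales (use assms in \<open>simp_all add: same_structure_def\<close>)
  obtain c x where cx: "c \<in> \<B>" "x \<in> td.V c"
    using td.L_nonempty td.L_cover by auto
  interpret tb: taut_base M \<B> g P u c x
    by unfold_locales (fact cx)+
  show ?thesis
    using tb.Om_domain tb.Gam_discrete tb.Gam_properly_discontinuous tb.dev_equivalent[OF assms(1)] by blast
qed

section \<open>Transformation of Lebesgue measure by invertible matrices\<close>

section \<open>Linear changes of variables\<close>

text \<open>The Jacobian formula for preimages, with the determinant multiplied out so that extended
  reals are never divided.\<close>

definition scales_lborel :: "real ^ 'm ^ 'm::finite \<Rightarrow> bool" where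
  "scales_lborel A \<longleftrightarrow> (\<forall>S\<in>sets borel. emeasure lborel ((\<lambda>x. A *v x) -` S) * ennreal \<bar>det A\<bar> = emeasure lborel S)"

lemma measurable_mult_vec [measurable]:
  fixes A :: "real ^ 'm ^ 'k::finite"
  shows "(\<lambda>x :: real ^ 'm::finite. A *v x) \<in> borel_measurable borel"
  by (intro borel_measurable_continuous_onI matrix_vector_mult_linear_continuous_on)

lemma scales_lborel_mult:
  assumes "scales_lborel A" "scales_lborel B" shows "scales_lborel (A ** B)"
  unfolding scales_lborel_def
proof
  fix S :: "(real ^ 'a) set" assume S: "S \<in> sets borel"
  have vS: "(\<lambda>x. A *v x) -` S \<in> sets borel" using measurable_sets[OF measurable_mult_vec[of A] S] by simp
  have "(\<lambda>x. (A ** B) *v x) -` S = (\<lambda>x. B *v x) -` (\<lambda>x. A *v x) -` S"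
    by (auto simp: matrix_vector_mul_assoc)
  then have "emeasure lborel ((\<lambda>x. (A ** B) *v x) -` S) * ennreal \<bar>det (A ** B)\<bar>
      = emeasure lborel ((\<lambda>x. B *v x) -` (\<lambda>x. A *v x) -` S) * ennreal \<bar>det B\<bar> * ennreal \<bar>det A\<bar>"
    by (simp add: det_mul abs_mult ennreal_mult mult_ac)
  also have "\<dots> = emeasure lborel S" using assms S vS unfolding scales_lborel_def by simp
  finally show "emeasure lborel ((\<lambda>x. (A ** B) *v x) -` S) * ennreal \<bar>det (A ** B)\<bar> = emeasure lborel S" .
qed

lemma Basis_vec_axis: "(Basis :: (real ^ 'm::finite) set) = range (\<lambda>i. axis i 1)"
  by (auto simp: Basis_vec_def)

lemma prod_Basis_vec: "(\<Prod>b\<in>Basis. f b) = (\<Prod>i\<in>(UNIV :: 'm::finite set). f (axis i (1::real)))"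
proof -
  have "inj (\<lambda>i::'m. axis i (1::real))" by (simp add: inj_on_def axis_eq_axis)
  then show ?thesis unfolding Basis_vec_axis by (simp add: prod.reindex)
qed

lemma sum_Basis_vec: "(\<Sum>b\<in>Basis. f b) = (\<Sum>i\<in>(UNIV :: 'm::finite set). f (axis i (1::real)))"
proof -
  have "inj (\<lambda>i::'m. axis i (1::real))" by (simp add: inj_on_def axis_eq_axis)
  then show ?thesis unfolding Basis_vec_axis by (simp add: sum.reindex)
qed

lemma scales_lborel_diagonal:
  fixes A :: "real ^ 'm ^ 'm::finite"
  assumes A: "\<And>i j. i \<noteq> j \<Longrightarrow> A $ i $ j = 0" and nz: "det A \<noteq> 0" shows "scales_lborel A"
proof -
  have dA: "det A = (\<Prod>i\<in>UNIV. A $ i $ i)" by (rule det_diagonal) (use A in auto)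
  define c where "c b = b \<bullet> (A *v b)" for b :: "real ^ 'm"
  have row: "(\<Sum>j\<in>UNIV. A $ i $ j * x j) = A $ i $ i * x i" for i and x :: "'m \<Rightarrow> real"
    using A by (subst sum.remove[of _ i]) (auto intro!: sum.neutral)
  have Ax: "(A *v x) $ i = A $ i $ i * x $ i" for x i by (simp add: matrix_vector_mult_def row)
  have c: "c (axis i 1) = A $ i $ i" for i
    by (simp add: c_def inner_axis' Ax)
  have T: "(\<lambda>x. A *v x) = (\<lambda>x. 0 + (\<Sum>j\<in>Basis. (c j * (x \<bullet> j)) *\<^sub>R j))"
  proof
    fix x
    have "(0 + (\<Sum>j\<in>Basis. (c j * (x \<bullet> j)) *\<^sub>R j)) $ i = A $ i $ i * x $ i" for i
    proof -
      have "(0 + (\<Sum>j\<in>Basis. (c j * (x \<bullet> j)) *\<^sub>R j)) $ i = (\<Sum>j\<in>UNIV. (A $ j $ j * x $ j) * axis j 1 $ i)"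
        by (simp add: sum_Basis_vec c inner_axis)
      also have "\<dots> = (\<Sum>j\<in>UNIV. if j = i then A $ j $ j * x $ j else 0)"
        by (intro sum.cong) (auto simp: axis_def)
      finally show ?thesis by simp
    qed
    then show "A *v x = 0 + (\<Sum>j\<in>Basis. (c j * (x \<bullet> j)) *\<^sub>R j)" by (simp add: vec_eq_iff Ax)
  qed
  have cnz: "c j \<noteq> 0" if "j \<in> Basis" for j
    using that nz dA c by (auto simp: Basis_vec_axis)
  have "(\<Prod>j\<in>Basis. \<bar>c j\<bar>) = \<bar>det A\<bar>" unfolding dA by (simp add: prod_Basis_vec c abs_prod)
  then have eq: "lborel = density (distr lborel borel (\<lambda>x. A *v x)) (\<lambda>_. \<bar>det A\<bar>)"
    using lborel_affine_euclidean[of c 0] cnz unfolding T by simp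
  show ?thesis unfolding scales_lborel_def
  proof
    fix S :: "(real ^ 'm) set" assume S: "S \<in> sets borel"
    have "emeasure lborel S = emeasure (density (distr lborel borel (\<lambda>x. A *v x)) (\<lambda>_. \<bar>det A\<bar>)) S"
      using eq by simp
    also have "\<dots> = \<bar>det A\<bar> * emeasure lborel ((\<lambda>x. A *v x) -` S)"
      using S by (subst emeasure_density) (auto simp: nn_integral_cmult_indicator emeasure_distr)
    finally show "emeasure lborel ((\<lambda>x. A *v x) -` S) * ennreal \<bar>det A\<bar> = emeasure lborel S"
      by (simp add: mult.commute)
  qed
qed

lemma scales_lborel_swap:
  fixes m n :: "'m::finite"
  assumes "m \<noteq> n"
  shows "scales_lborel ((\<chi> i j. mat 1 $ i $ Transposition.transpose m n j) :: real ^ 'm ^ 'm)" (is "scales_lborel ?A")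
proof -
  define t where "t = Transposition.transpose m n"
  have tt: "t (t i) = i" for i by (simp add: t_def)
  have tinj: "i = t j \<longleftrightarrow> j = t i" for i j using tt by metis
  have bij: "bij t" by (simp add: t_def)
  have Ax: "(?A *v x) $ i = x $ t i" for x i
    by (simp add: matrix_vector_mult_def mat_def t_def[symmetric] tinj if_distrib[of "\<lambda>x. x * _"] cong: if_cong)
  have d: "\<bar>det ?A\<bar> = 1"
  proof -
    have "det ?A = of_int (sign t) * det (mat 1 :: real ^ 'm ^ 'm)"
      unfolding t_def by (rule det_permute_columns) (simp add: permutes_swap_id)
    then show ?thesis by (simp add: det_I sign_def)
  qed
  have "lborel = distr lborel borel (\<lambda>x. ?A *v x)"
  proof (rule lborel_eqI)
    fix l u :: "real ^ 'm" assume le: "\<And>b. b \<in> Basis \<Longrightarrow> l \<bullet> b \<le> u \<bullet> b"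
    have "l $ i \<le> u $ i" for i using le[of "axis i 1"] by (simp add: Basis_vec_axis inner_axis)
    then have le': "(?A *v l) \<bullet> b \<le> (?A *v u) \<bullet> b" if "b \<in> Basis" for b
      using that by (auto simp: Basis_vec_axis inner_axis Ax)
    have all: "(\<forall>i. P (t i)) \<longleftrightarrow> (\<forall>i. P i)" for P using tt by metis
    have "(\<lambda>x. ?A *v x) -` box l u = box (?A *v l) (?A *v u)"
    proof (intro set_eqI iffI)
      fix x assume "x \<in> (\<lambda>x. ?A *v x) -` box l u"
      then have "l $ i < x $ t i \<and> x $ t i < u $ i" for i by (simp add: mem_box_cart Ax)
      then have "l $ t i < x $ i \<and> x $ i < u $ t i" for i using tt by metis
      then show "x \<in> box (?A *v l) (?A *v u)" by (simp add: mem_box_cart Ax)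
    next
      fix x assume "x \<in> box (?A *v l) (?A *v u)"
      then have "l $ t i < x $ i \<and> x $ i < u $ t i" for i by (simp add: mem_box_cart Ax)
      then have "l $ i < x $ t i \<and> x $ t i < u $ i" for i using tt by metis
      then show "x \<in> (\<lambda>x. ?A *v x) -` box l u" by (simp add: mem_box_cart Ax)
    qed
    then have "emeasure (distr lborel borel (\<lambda>x. ?A *v x)) (box l u) = emeasure lborel (box (?A *v l) (?A *v u))"
      by (simp add: emeasure_distr)
    also have "\<dots> = (\<Prod>b\<in>Basis. (?A *v u - ?A *v l) \<bullet> b)" using le' by (rule emeasure_lborel_box)
    also have "(\<Prod>b\<in>Basis. (?A *v u - ?A *v l) \<bullet> b) = (\<Prod>i\<in>UNIV. (u - l) $ t i)"
      by (simp add: prod_Basis_vec inner_axis Ax)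
    also have "\<dots> = (\<Prod>i\<in>UNIV. (u - l) $ i)" by (rule prod.reindex_bij_betw[OF bij])
    also have "\<dots> = (\<Prod>b\<in>Basis. (u - l) \<bullet> b)" by (simp add: prod_Basis_vec inner_axis)
    finally show "emeasure (distr lborel borel (\<lambda>x. ?A *v x)) (box l u) = (\<Prod>b\<in>Basis. (u - l) \<bullet> b)" .
  qed simp
  then have "emeasure lborel S = emeasure (distr lborel borel (\<lambda>x. ?A *v x)) S" for S by simp
  then have "emeasure lborel S = emeasure lborel ((\<lambda>x. ?A *v x) -` S)" if "S \<in> sets borel" for S
    using that by (simp add: emeasure_distr)
  then show ?thesis unfolding scales_lborel_def d by simp
qed

text \<open>On every line parallel to the axis \<open>e\<close> the shear is a translation, so
  Fubini reduces the claim to translation invariance on the real line.\<close>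

lemma scales_lborel_shear:
  fixes m n :: "'m::finite" and c :: real
  assumes mn: "m \<noteq> n"
  shows "scales_lborel ((\<chi> i j. if i = m \<and> j = n then c else of_bool (i = j)) :: real ^ 'm ^ 'm)" (is "scales_lborel ?A")
proof -
  interpret product_sigma_finite "\<lambda>_ :: real ^ 'm. lborel :: real measure" by unfold_locales
  define e where "e = (axis m 1 :: real ^ 'm)"
  have eB: "e \<in> Basis" "axis n 1 \<in> Basis - {e}" using mn by (auto simp: e_def axis_eq_axis)
  have Ax: "?A *v x = x + (c * (x $ n)) *\<^sub>R e" for x
  proof -
    have "(?A *v x) $ i = (x + (c * (x $ n)) *\<^sub>R e) $ i" for i
    proof (cases "i = m")
      case True
      have "(?A *v x) $ m = (\<Sum>j\<in>UNIV. (if j = n then c * x $ j else 0) + (if j = m then x $ j else 0))"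
        unfolding matrix_vector_mult_def using mn by (auto intro!: sum.cong)
      then show ?thesis using True by (simp add: sum.distrib e_def)
    next
      case False
      have "(?A *v x) $ i = (\<Sum>j\<in>UNIV. if j = i then x $ j else 0)"
        unfolding matrix_vector_mult_def using False by (auto intro!: sum.cong)
      then show ?thesis using False by (simp add: e_def axis_def)
    qed
    then show ?thesis by (simp add: vec_eq_iff)
  qed
  have d: "det ?A = 1"
  proof -
    define R where "R = (\<chi> i. if i = m then row m (mat 1 :: real ^ 'm ^ 'm) + c *\<^sub>R row n (mat 1) else row i (mat 1))"
    have "det R = det (mat 1 :: real ^ 'm ^ 'm)" unfolding R_def scalar_mult_eq_scaleR[symmetric]
      by (rule det_row_operation[OF mn])
    moreover have "R = ?A" using mn by (auto simp: R_def vec_eq_iff row_def mat_def)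
    ultimately show ?thesis by (simp add: det_I)
  qed
  have nn: "(\<integral>\<^sup>+x. f (?A *v x) \<partial>lborel) = (\<integral>\<^sup>+x. f x \<partial>lborel)" if f[measurable]: "f \<in> borel_measurable borel"
    for f :: "real ^ 'm \<Rightarrow> ennreal"
  proof -
    define I where "I = Basis - {e}"
    have I: "finite I" "e \<notin> I" "insert e I = Basis" using eB by (auto simp: I_def)
    define s where "s x = (\<Sum>b\<in>Basis. x b *\<^sub>R b)" for x :: "real ^ 'm \<Rightarrow> real"
    have sm[measurable]: "s \<in> borel_measurable (Pi\<^sub>M (insert e I) (\<lambda>_. lborel))"
      unfolding s_def I(3) by measurable
    \<comment> \<open>Splits off the coordinate along \<open>e\<close>; the remaining part, with
      this coordinate set to \<open>0\<close>, is constant in the inner integral.\<close>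
    have upd: "s (x(e := y)) = s (x(e := 0)) + y *\<^sub>R e" for x y
    proof -
      have "s (x(e := y)) = y *\<^sub>R e + (\<Sum>b\<in>I. x b *\<^sub>R b)" for y
        unfolding s_def I(3)[symmetric] using I(1,2) by (subst sum.insert) (auto intro!: sum.cong)
      then show ?thesis by simp
    qed
    have sn: "s x $ n = x (axis n 1)" for x
      by (simp add: s_def sum_Basis_vec axis_def if_distrib[of "\<lambda>x. _ * x"] cong: if_cong)
    have gen: "(\<integral>\<^sup>+x. h x \<partial>lborel) = (\<integral>\<^sup>+x. (\<integral>\<^sup>+y. h (s (x(e := 0)) + y *\<^sub>R e) \<partial>lborel) \<partial>(Pi\<^sub>M I (\<lambda>_. lborel)))"
      if h[measurable]: "h \<in> borel_measurable borel" for h :: "real ^ 'm \<Rightarrow> ennreal"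
    proof -
      have "(\<integral>\<^sup>+x. h x \<partial>lborel) = (\<integral>\<^sup>+x. h (s x) \<partial>(Pi\<^sub>M Basis (\<lambda>_. lborel)))"
        unfolding s_def by (subst lborel_eq, subst nn_integral_distr) auto
      also have "\<dots> = (\<integral>\<^sup>+x. (\<integral>\<^sup>+y. h (s (x(e := y))) \<partial>lborel) \<partial>(Pi\<^sub>M I (\<lambda>_. lborel)))"
        unfolding I(3)[symmetric] by (rule product_nn_integral_insert[OF I(1,2)]) measurable
      also have "\<dots> = (\<integral>\<^sup>+x. (\<integral>\<^sup>+y. h (s (x(e := 0)) + y *\<^sub>R e) \<partial>lborel) \<partial>(Pi\<^sub>M I (\<lambda>_. lborel)))"
        by (intro nn_integral_cong arg_cong[where f = h] upd)
      finally show ?thesis .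
    qed
    have "(\<integral>\<^sup>+y. f (?A *v (s (x(e := 0)) + y *\<^sub>R e)) \<partial>lborel) = (\<integral>\<^sup>+y. f (s (x(e := 0)) + y *\<^sub>R e) \<partial>lborel)" for x
    proof -
      define w where "w = s (x(e := 0))"
      have en: "e $ n = 0" using mn by (simp add: e_def axis_def)
      have "?A *v (w + y *\<^sub>R e) = w + (c * w $ n + y) *\<^sub>R e" for y
        using en by (simp add: Ax algebra_simps)
      then have "(\<integral>\<^sup>+y. f (?A *v (w + y *\<^sub>R e)) \<partial>lborel) = (\<integral>\<^sup>+y. f (w + (c * w $ n + 1 * y) *\<^sub>R e) \<partial>lborel)" by simp
      also have "\<dots> = (\<integral>\<^sup>+y. f (w + y *\<^sub>R e) \<partial>lborel)"
        using nn_integral_real_affine[of "\<lambda>y. f (w + y *\<^sub>R e)" 1 "c * w $ n"] by simp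
      finally show ?thesis by (simp add: w_def)
    qed
    then show ?thesis using gen[of "\<lambda>x. f (?A *v x)"] gen[of f] by simp
  qed
  show ?thesis unfolding scales_lborel_def d
  proof
    fix S :: "(real ^ 'm) set" assume S[measurable]: "S \<in> sets borel"
    have vS: "(\<lambda>x. ?A *v x) -` S \<in> sets borel" using measurable_sets[OF measurable_mult_vec[of ?A] S] by simp
    have "emeasure lborel ((\<lambda>x. ?A *v x) -` S) = (\<integral>\<^sup>+x. indicator ((\<lambda>x. ?A *v x) -` S) x \<partial>lborel)" using vS by simp
    also have "\<dots> = (\<integral>\<^sup>+x. indicator S (?A *v x) \<partial>lborel)" by (simp add: indicator_def)
    also have "\<dots> = (\<integral>\<^sup>+x. indicator S x \<partial>lborel)" by (rule nn) (simp add: S)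
    finally show "emeasure lborel ((\<lambda>x. ?A *v x) -` S) * ennreal \<bar>1\<bar> = emeasure lborel S" using S by simp
  qed
qed

text \<open>Induction over elementary matrices. Carrying invertibility in the predicate makes the
  case of a zero row vacuous, and for products it passes to both factors.\<close>

lemma scales_lborel:
  fixes A :: "real ^ 'm ^ 'm::finite"
  assumes "det A \<noteq> 0" shows "scales_lborel A"
proof -
  have "det A \<noteq> 0 \<longrightarrow> scales_lborel A"
  proof (rule induct_matrix_elementary[of "\<lambda>A. det A \<noteq> 0 \<longrightarrow> scales_lborel A"])
    fix A B :: "real ^ 'm ^ 'm"
    assume "det A \<noteq> 0 \<longrightarrow> scales_lborel A" "det B \<noteq> 0 \<longrightarrow> scales_lborel B"
    then show "det (A ** B) \<noteq> 0 \<longrightarrow> scales_lborel (A ** B)" using scales_lborel_mult by (auto simp: det_mul)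
  next
    fix A :: "real ^ 'm ^ 'm" and i assume "row i A = 0"
    then show "det A \<noteq> 0 \<longrightarrow> scales_lborel A" using det_zero_row by blast
  next
    fix A :: "real ^ 'm ^ 'm" assume "\<And>i j. i \<noteq> j \<Longrightarrow> A $ i $ j = 0"
    then show "det A \<noteq> 0 \<longrightarrow> scales_lborel A" using scales_lborel_diagonal[of A] by simp
  next
    fix m n :: 'm assume "m \<noteq> n"
    then show "det (\<chi> i j. (mat 1 :: real ^ 'm ^ 'm) $ i $ Transposition.transpose m n j) \<noteq> 0 \<longrightarrow>
        scales_lborel (\<chi> i j. (mat 1 :: real ^ 'm ^ 'm) $ i $ Transposition.transpose m n j)"
      using scales_lborel_swap[of m n] by simp
  next
    fix m n :: 'm and c :: real assume "m \<noteq> n"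
    then show "det (\<chi> i j. if i = m \<and> j = n then c else of_bool (i = j)) \<noteq> 0 \<longrightarrow>
        scales_lborel (\<chi> i j. if i = m \<and> j = n then c else of_bool (i = j))"
      using scales_lborel_shear[of m n c] by simp
  qed
  then show ?thesis using assms by blast
qed

lemma integral_linear_change:
  fixes A :: "real ^ 'm ^ 'm::finite" and f :: "real ^ 'm \<Rightarrow> real"
  assumes A: "det A \<noteq> 0" and f[measurable]: "f \<in> borel_measurable borel"
  shows "(\<integral>x. f (A *v x) \<partial>lborel) = (\<integral>x. f x \<partial>lborel) / \<bar>det A\<bar>"
proof -
  have "lborel = density (distr lborel borel (\<lambda>x. A *v x)) (\<lambda>_. ennreal \<bar>det A\<bar>)"
  proof (rule measure_eqI)
    fix S :: "(real ^ 'm) set" assume S: "S \<in> sets lborel"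
    then have S': "S \<in> sets borel" by simp
    have "emeasure (density (distr lborel borel (\<lambda>x. A *v x)) (\<lambda>_. ennreal \<bar>det A\<bar>)) S
       = \<bar>det A\<bar> * emeasure lborel ((\<lambda>x. A *v x) -` S)"
      using S' by (subst emeasure_density) (auto simp: nn_integral_cmult_indicator emeasure_distr)
    then show "emeasure lborel S = emeasure (density (distr lborel borel (\<lambda>x. A *v x)) (\<lambda>_. ennreal \<bar>det A\<bar>)) S"
      using scales_lborel[OF A] S' by (simp add: scales_lborel_def mult.commute)
  qed simp
  then have "(\<integral>x. f x \<partial>lborel) = (\<integral>x. f x \<partial>density (distr lborel borel (\<lambda>x. A *v x)) (\<lambda>_. ennreal \<bar>det A\<bar>))" by simp
  also have "\<dots> = \<bar>det A\<bar> * (\<integral>x. f (A *v x) \<partial>lborel)"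
    by (subst integral_density) (auto simp: integral_distr)
  finally show ?thesis using A by simp
qed

section \<open>Laplace integrals over the dual cone and their derivatives\<close>

section \<open>Exponential integrals over a cone\<close>

lemma power_le_exp:
  fixes t c :: real assumes "t \<ge> 0" "c > 0" shows "t ^ k \<le> (fact k / c ^ k) * exp (c * t)"
proof -
  have "(c * t) ^ k / fact k \<le> exp (c * t)"
  proof -
    have "(c * t) ^ k /\<^sub>R fact k \<le> (\<Sum>n. (c * t) ^ n /\<^sub>R fact n)"
      using sum_le_suminf[OF summable_exp_generic[of "c * t"], of "{k}"] assms by simp
    then show ?thesis by (simp add: exp_def divide_inverse mult.commute)
  qed
  then show ?thesis using assms by (simp add: field_simps)
qed

lemma integrable_exp_abs:
  fixes c :: real assumes c: "c > 0" shows "(\<integral>\<^sup>+y. ennreal (exp (- c * \<bar>y\<bar>)) \<partial>lborel) < \<infinity>"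
proof -
  have half: "(\<integral>\<^sup>+y. ennreal (exp (- c * y)) * indicator {0..} y \<partial>lborel) = ennreal (0 - (- exp (- c * 0) / c))"
  proof (rule nn_integral_FTC_atLeast)
    show "DERIV (\<lambda>y. - exp (- c * y) / c) x :> exp (- c * x)" for x
      using c by (auto intro!: derivative_eq_intros)
    have "((\<lambda>y. exp (- c * y)) \<longlongrightarrow> 0) at_top"
      by (rule filterlim_compose[OF exp_at_bot filterlim_tendsto_neg_mult_at_bot[OF tendsto_const _ filterlim_ident]])
        (use c in simp)
    then have "((\<lambda>y. - exp (- c * y) / c) \<longlongrightarrow> - 0 / c) at_top"
      by (intro tendsto_divide tendsto_minus tendsto_const) (use c in auto)
    then show "((\<lambda>y. - exp (- c * y) / c) \<longlongrightarrow> 0) at_top" by simp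
  qed auto
  have "(\<integral>\<^sup>+y. ennreal (exp (- c * \<bar>y\<bar>)) \<partial>lborel)
      \<le> (\<integral>\<^sup>+y. ennreal (exp (- c * y)) * indicator {0..} y + ennreal (exp (- c * (- y))) * indicator {0..} (- y) \<partial>lborel)"
    by (intro nn_integral_mono) (auto split: split_indicator)
  also have "\<dots> = (\<integral>\<^sup>+y. ennreal (exp (- c * y)) * indicator {0..} y \<partial>lborel) + (\<integral>\<^sup>+y. ennreal (exp (- c * (- y))) * indicator {0..} (- y) \<partial>lborel)"
    by (intro nn_integral_add) auto
  also have "(\<integral>\<^sup>+y. ennreal (exp (- c * (- y))) * indicator {0..} (- y) \<partial>lborel) = (\<integral>\<^sup>+y. ennreal (exp (- c * y)) * indicator {0..} y \<partial>lborel)"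
    using nn_integral_real_affine[of "\<lambda>y. ennreal (exp (- c * y)) * indicator {0..} y" "-1" 0] by simp
  finally have "(\<integral>\<^sup>+y. ennreal (exp (- c * \<bar>y\<bar>)) \<partial>lborel) \<le> ennreal (0 - (- exp (- c * 0) / c)) + ennreal (0 - (- exp (- c * 0) / c))"
    unfolding half .
  also have "\<dots> < \<infinity>" by simp
  finally show ?thesis .
qed

text \<open>The sum of the absolute coordinates is at most \<open>N\<close> times the norm, so a
  product of one-dimensional exponentials dominates the integrand.\<close>

lemma integrable_exp_norm:
  fixes c :: real assumes c: "c > 0"
  shows "integrable lborel (\<lambda>x :: 'v::euclidean_space. exp (- c * norm x))"
proof (rule integrableI_bounded)
  define N where "N = real DIM('v)"
  have N: "N > 0" by (simp add: N_def)
  have le: "exp (- c * norm x) \<le> (\<Prod>b\<in>Basis. exp (- (c / N) * \<bar>x \<bullet> b\<bar>))" for x :: 'v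
  proof -
    have "(\<Sum>b\<in>Basis. \<bar>x \<bullet> b\<bar>) \<le> (\<Sum>b\<in>(Basis :: 'v set). norm x)" by (intro sum_mono Basis_le_norm)
    then have "(c / N) * (\<Sum>b\<in>Basis. \<bar>x \<bullet> b\<bar>) \<le> (c / N) * (N * norm x)"
      using c N by (intro mult_left_mono) (auto simp: N_def)
    then have "(c / N) * (\<Sum>b\<in>Basis. \<bar>x \<bullet> b\<bar>) \<le> c * norm x" using N by simp
    then have "exp (- c * norm x) \<le> exp (- ((c / N) * (\<Sum>b\<in>Basis. \<bar>x \<bullet> b\<bar>)))" by simp
    also have "- ((c / N) * (\<Sum>b\<in>Basis. \<bar>x \<bullet> b\<bar>)) = (\<Sum>b\<in>Basis. - (c / N) * \<bar>x \<bullet> b\<bar>)"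
      by (simp add: sum_distrib_left sum_negf)
    also have "exp \<dots> = (\<Prod>b\<in>Basis. exp (- (c / N) * \<bar>x \<bullet> b\<bar>))" by (rule exp_sum) simp
    finally show ?thesis .
  qed
  have "(\<integral>\<^sup>+x. ennreal (norm (exp (- c * norm x))) \<partial>(lborel :: 'v measure)) \<le> (\<integral>\<^sup>+x. (\<Prod>b\<in>Basis. ennreal (exp (- (c / N) * \<bar>x \<bullet> b\<bar>))) \<partial>(lborel :: 'v measure))"
  proof (rule nn_integral_mono)
    fix x :: 'v
    have "(\<Prod>b\<in>Basis. ennreal (exp (- (c / N) * \<bar>x \<bullet> b\<bar>))) = ennreal (\<Prod>b\<in>Basis. exp (- (c / N) * \<bar>x \<bullet> b\<bar>))"
      by (rule prod_ennreal) simp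
    then show "ennreal (norm (exp (- c * norm x))) \<le> (\<Prod>b\<in>Basis. ennreal (exp (- (c / N) * \<bar>x \<bullet> b\<bar>)))"
      using ennreal_leI[OF le[of x]] by simp
  qed
  also have "\<dots> = (\<Prod>b\<in>(Basis :: 'v set). (\<integral>\<^sup>+y. ennreal (exp (- (c / N) * \<bar>y\<bar>)) \<partial>lborel))"
    by (rule nn_integral_lborel_prod[where f = "\<lambda>_ y. ennreal (exp (- (c / N) * \<bar>y\<bar>))"]) auto
  also have "\<dots> < \<infinity>"
  proof -
    have "(\<integral>\<^sup>+y. ennreal (exp (- (c / N) * \<bar>y\<bar>)) \<partial>lborel) < \<infinity>"
      using integrable_exp_abs[of "c / N"] c N by (simp add: less_top[symmetric])
    then show ?thesis unfolding prod_constant infinity_ennreal_def power_less_top_ennreal by simp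
  qed
  finally show "(\<integral>\<^sup>+x. ennreal (norm (exp (- c * norm x))) \<partial>(lborel :: 'v measure)) < \<infinity>" .
qed simp

lemma has_derivative_of_quadratic_bound:
  fixes f :: "'v::euclidean_space \<Rightarrow> real"
  assumes D: "linear D" and d: "d > 0" and bd: "\<And>v. norm v < d \<Longrightarrow> \<bar>f (x + v) - f x - D v\<bar> \<le> K * (norm v)\<^sup>2"
  shows "(f has_derivative D) (at x)"
  unfolding has_derivative_at
proof
  show "bounded_linear D" using D by (simp add: linear_conv_bounded_linear)
  show "(\<lambda>v. norm (f (x + v) - f x - D v) / norm v) \<midarrow>0\<rightarrow> 0"
  proof (rule Lim_null_comparison)
    have "eventually (\<lambda>v. v \<in> ball 0 d \<and> v \<noteq> 0) (at (0::'v))"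
      using d by (intro eventually_conj eventually_at_in_open') (auto simp: eventually_at_filter)
    then show "eventually (\<lambda>v. norm (norm (f (x + v) - f x - D v) / norm v) \<le> K * norm v) (at 0)"
    proof eventually_elim
      case (elim v)
      then have "\<bar>f (x + v) - f x - D v\<bar> \<le> K * (norm v)\<^sup>2" using bd by auto
      then show ?case using elim by (simp add: field_simps power2_eq_square)
    qed
    have "((\<lambda>v::'v. K * norm v) \<longlongrightarrow> K * norm (0::'v)) (at 0)" by (intro tendsto_intros)
    then show "((\<lambda>v::'v. K * norm v) \<longlongrightarrow> 0) (at 0)" by simp
  qed
qed

lemma exp_quadratic_remainder:
  fixes h :: real shows "\<bar>exp (- h) - 1 + h\<bar> \<le> h\<^sup>2 * exp \<bar>h\<bar>"
proof -
  obtain t where t: "\<bar>t\<bar> \<le> \<bar>- h\<bar>" "exp (- h) = (\<Sum>m<2. (- h) ^ m / fact m) + exp t / fact 2 * (- h)\<^sup>2"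
    using Maclaurin_exp_le[of "- h" 2] by blast
  have "exp (- h) - 1 + h = exp t / 2 * h\<^sup>2" using t(2) by (simp add: numeral_2_eq_2)
  then have "\<bar>exp (- h) - 1 + h\<bar> = exp t / 2 * h\<^sup>2" by (simp only: abs_of_nonneg[of "exp t / 2 * h\<^sup>2"]) simp
  moreover have "exp t \<le> exp \<bar>h\<bar>" using t(1) by simp
  then have "exp t / 2 \<le> exp \<bar>h\<bar>" using exp_gt_zero[of t] by linarith
  then have "exp t / 2 * h\<^sup>2 \<le> exp \<bar>h\<bar> * h\<^sup>2" by (intro mult_right_mono) auto
  ultimately show ?thesis by (simp only: mult.commute)
qed

text \<open>Products of linear forms: the factors that repeated differentiation of
  \<open>exp (- (x \<bullet> \<xi>))\<close> in \<open>x\<close> brings down, up to sign.\<close>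

definition lin_prod :: "'v::real_inner list \<Rightarrow> 'v \<Rightarrow> real" where
  "lin_prod vs \<xi> = prod_list (map (\<lambda>v. v \<bullet> \<xi>) vs)"

lemma lin_prod_simps [simp]: "lin_prod [] \<xi> = 1" "lin_prod (v # vs) \<xi> = (v \<bullet> \<xi>) * lin_prod vs \<xi>"
  by (simp_all add: lin_prod_def)

lemma lin_prod_bound: "\<bar>lin_prod vs \<xi>\<bar> \<le> prod_list (map norm vs) * norm \<xi> ^ length vs"
proof (induction vs)
  case (Cons v vs)
  have "\<bar>lin_prod (v # vs) \<xi>\<bar> \<le> (norm v * norm \<xi>) * (prod_list (map norm vs) * norm \<xi> ^ length vs)"
    unfolding lin_prod_simps abs_mult by (intro mult_mono Cauchy_Schwarz_ineq2 Cons) auto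
  then show ?case by (simp add: mult_ac)
qed simp

lemma lin_prod_measurable [measurable]: "lin_prod vs \<in> borel_measurable (borel :: 'v::euclidean_space measure)"
proof (induction vs)
  case (Cons v vs)
  then have "(\<lambda>\<xi>. (v \<bullet> \<xi>) * lin_prod vs \<xi>) \<in> borel_measurable borel" by measurable
  then show ?case by (simp add: lin_prod_simps(2)[abs_def] fun_eq_iff cong: measurable_cong)
qed (simp add: lin_prod_def[abs_def])

lemma lin_prod_scale: "lin_prod vs (r *\<^sub>R \<xi>) = r ^ length vs * lin_prod vs \<xi>"
  by (induction vs) (simp_all add: mult_ac)

text \<open>The characteristic function of a convex cone (Koszul, Vinberg) and its moments.\<close>

locale dual_cone =
  fixes C :: "'v::euclidean_space set" and a :: 'v and \<rho> :: real
  assumes C_open: "open C" and C_cone: "is_pcone C"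
    and \<rho>: "\<rho> > 0" and proper: "\<And>x. x \<in> C \<Longrightarrow> a \<bullet> x \<ge> \<rho> * norm x"
begin

definition K where "K = {\<xi>. \<forall>x\<in>C. x \<bullet> \<xi> \<ge> 0}"

text \<open>The list of directions makes the family closed under differentiation: a derivative along
  \<open>v\<close> puts \<open>v\<close> in front, with a minus sign. \<open>\<Phi> []\<close> is
  the characteristic function itself.\<close>

definition \<Phi> where "\<Phi> vs x = (\<integral>\<xi>. indicator K \<xi> * (lin_prod vs \<xi> * exp (- (x \<bullet> \<xi>))) \<partial>lborel)"

lemma K_closed: "closed K"
proof -
  have "K = (\<Inter>x\<in>C. {\<xi>. x \<bullet> \<xi> \<ge> 0})" by (auto simp: K_def)
  then show ?thesis by (auto intro!: closed_INT closed_halfspace_ge)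
qed

lemma K_measurable [measurable]: "K \<in> sets borel"
  using K_closed by (rule borel_closed)

text \<open>\<open>x\<close> is interior to \<open>C\<close>, so it can be moved by a fixed length
  against \<open>\<xi>\<close> and still pairs nonnegatively with it. This is the exponential decay
  behind every integral below.\<close>

lemma K_lower:
  assumes x: "x \<in> C" obtains \<delta> where "\<delta> > 0" "\<And>\<xi>. \<xi> \<in> K \<Longrightarrow> x \<bullet> \<xi> \<ge> \<delta> * norm \<xi>"
proof -
  obtain e where e: "e > 0" "ball x e \<subseteq> C" using x C_open open_contains_ball by blast
  have "x \<bullet> \<xi> \<ge> (e / 2) * norm \<xi>" if \<xi>: "\<xi> \<in> K" for \<xi>
  proof (cases "\<xi> = 0")
    case False
    define y where "y = x - (e / (2 * norm \<xi>)) *\<^sub>R \<xi>"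
    have "norm ((e / (2 * norm \<xi>)) *\<^sub>R \<xi>) = e / 2" using e False by simp
    then have "y \<in> ball x e" using e by (simp add: y_def dist_norm)
    then have "y \<bullet> \<xi> \<ge> 0" using e \<xi> by (auto simp: K_def)
    moreover have "y \<bullet> \<xi> = x \<bullet> \<xi> - (e / (2 * norm \<xi>)) * (norm \<xi>)\<^sup>2"
      by (simp add: y_def inner_diff_left power2_norm_eq_inner)
    moreover have "(e / (2 * norm \<xi>)) * (norm \<xi>)\<^sup>2 = (e / 2) * norm \<xi>" using False by (simp add: power2_eq_square)
    ultimately show ?thesis by simp
  qed simp
  then show ?thesis using that[of "e/2"] e by simp
qed

text \<open>Properness of \<open>C\<close> makes the dual cone solid, so positive integrands have
  positive integrals.\<close>

lemma K_ball: "ball a \<rho> \<subseteq> K"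
proof
  fix \<xi> assume \<xi>: "\<xi> \<in> ball a \<rho>"
  show "\<xi> \<in> K" unfolding K_def
  proof (intro CollectI ballI)
    fix x assume x: "x \<in> C"
    have "\<bar>x \<bullet> (a - \<xi>)\<bar> \<le> norm x * norm (a - \<xi>)" by (rule Cauchy_Schwarz_ineq2)
    also have "\<dots> \<le> norm x * \<rho>" using \<xi> by (intro mult_left_mono) (auto simp: dist_norm)
    finally have "x \<bullet> a - x \<bullet> \<xi> \<le> norm x * \<rho>" by (simp add: inner_diff_right)
    then show "x \<bullet> \<xi> \<ge> 0" using proper[OF x] by (simp add: inner_commute mult.commute)
  qed
qed

text \<open>Half of the exponential decay absorbs the power, the other half remains
  integrable.\<close>

lemma integrable_poly_exp:
  assumes "\<delta> > 0" shows "integrable lborel (\<lambda>\<xi>::'v. norm \<xi> ^ k * exp (- \<delta> * norm \<xi>))"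
proof (rule Bochner_Integration.integrable_bound)
  show "integrable lborel (\<lambda>\<xi>::'v. (fact k / (\<delta>/2) ^ k) * exp (- (\<delta>/2) * norm \<xi>))"
    by (intro integrable_mult_right integrable_exp_norm) (use assms in simp)
  have "norm \<xi> ^ k * exp (- \<delta> * norm \<xi>) \<le> (fact k / (\<delta>/2) ^ k) * exp (- (\<delta>/2) * norm \<xi>)" for \<xi> :: 'v
  proof -
    have "norm \<xi> ^ k * exp (- \<delta> * norm \<xi>) \<le> ((fact k / (\<delta>/2) ^ k) * exp ((\<delta>/2) * norm \<xi>)) * exp (- \<delta> * norm \<xi>)"
      using assms by (intro mult_right_mono power_le_exp) auto
    also have "\<dots> = (fact k / (\<delta>/2) ^ k) * (exp ((\<delta>/2) * norm \<xi>) * exp (- \<delta> * norm \<xi>))" by simp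
    also have "exp ((\<delta>/2) * norm \<xi>) * exp (- \<delta> * norm \<xi>) = exp (- (\<delta>/2) * norm \<xi>)"
      by (simp add: exp_add[symmetric] field_simps)
    finally show ?thesis .
  qed
  then show "AE \<xi> in lborel. norm (norm \<xi> ^ k * exp (- \<delta> * norm \<xi>)) \<le> norm ((fact k / (\<delta>/2) ^ k) * exp (- (\<delta>/2) * norm (\<xi>::'v)))"
    using assms by (intro AE_I2) (simp add: abs_mult)
qed simp

lemma \<Phi>_integrable:
  assumes x: "x \<in> C" shows "integrable lborel (\<lambda>\<xi>. indicator K \<xi> * (lin_prod vs \<xi> * exp (- (x \<bullet> \<xi>))))"
proof -
  obtain \<delta> where \<delta>: "\<delta> > 0" "\<And>\<xi>. \<xi> \<in> K \<Longrightarrow> x \<bullet> \<xi> \<ge> \<delta> * norm \<xi>" using K_lower[OF x] by metis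
  define c where "c = prod_list (map norm vs)"
  have c: "c \<ge> 0" unfolding c_def by (induction vs) auto
  show ?thesis
  proof (rule Bochner_Integration.integrable_bound)
    show "integrable lborel (\<lambda>\<xi>::'v. c * (norm \<xi> ^ length vs * exp (- \<delta> * norm \<xi>)))"
      using integrable_poly_exp[OF \<delta>(1)] by simp
    have "norm (indicator K \<xi> * (lin_prod vs \<xi> * exp (- (x \<bullet> \<xi>)))) \<le> norm (c * (norm \<xi> ^ length vs * exp (- \<delta> * norm \<xi>)))" for \<xi>
    proof (cases "\<xi> \<in> K")
      case True
      have "\<bar>lin_prod vs \<xi>\<bar> * exp (- (x \<bullet> \<xi>)) \<le> (c * norm \<xi> ^ length vs) * exp (- \<delta> * norm \<xi>)"
        unfolding c_def using \<delta>(2)[OF True] by (intro mult_mono lin_prod_bound) (auto intro!: mult_nonneg_nonneg c[unfolded c_def])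
      then show ?thesis using True c by (simp add: abs_mult mult_ac)
    qed simp
    then show "AE \<xi> in lborel. norm (indicator K \<xi> * (lin_prod vs \<xi> * exp (- (x \<bullet> \<xi>)))) \<le> norm (c * (norm \<xi> ^ length vs * exp (- \<delta> * norm \<xi>)))"
      by simp
  qed measurable
qed

lemma \<Phi>_linear:
  assumes x: "x \<in> C" shows "linear (\<lambda>v. \<Phi> (v # vs) x)"
proof (rule linearI)
  fix v w
  have "\<Phi> ((v + w) # vs) x = (\<integral>\<xi>. indicator K \<xi> * (lin_prod (v # vs) \<xi> * exp (- (x \<bullet> \<xi>))) + indicator K \<xi> * (lin_prod (w # vs) \<xi> * exp (- (x \<bullet> \<xi>))) \<partial>lborel)"
    unfolding \<Phi>_def by (simp add: inner_add_left algebra_simps)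
  also have "\<dots> = \<Phi> (v # vs) x + \<Phi> (w # vs) x"
    unfolding \<Phi>_def using \<Phi>_integrable[OF x] by (intro Bochner_Integration.integral_add)
  finally show "\<Phi> ((v + w) # vs) x = \<Phi> (v # vs) x + \<Phi> (w # vs) x" .
next
  fix r :: real and v
  have "\<Phi> ((r *\<^sub>R v) # vs) x = (\<integral>\<xi>. r * (indicator K \<xi> * (lin_prod (v # vs) \<xi> * exp (- (x \<bullet> \<xi>)))) \<partial>lborel)"
    unfolding \<Phi>_def by (simp add: mult_ac)
  also have "\<dots> = r *\<^sub>R \<Phi> (v # vs) x" unfolding \<Phi>_def by simp
  finally show "\<Phi> ((r *\<^sub>R v) # vs) x = r *\<^sub>R \<Phi> (v # vs) x" .
qed

text \<open>Differentiation under the integral sign by an explicit remainder: the second-order error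
  of the exponential, integrated, is at most a constant times the square of
  \<open>norm v\<close>.\<close>

lemma \<Phi>_derivative:
  assumes x: "x \<in> C" shows "(\<Phi> vs has_derivative (\<lambda>v. - \<Phi> (v # vs) x)) (at x)"
proof -
  obtain \<delta> where \<delta>: "\<delta> > 0" "\<And>\<xi>. \<xi> \<in> K \<Longrightarrow> x \<bullet> \<xi> \<ge> \<delta> * norm \<xi>" using K_lower[OF x] by metis
  obtain e where e: "e > 0" "ball x e \<subseteq> C" using x C_open open_contains_ball by blast
  define c where "c = prod_list (map norm vs)"
  have c: "c \<ge> 0" unfolding c_def by (induction vs) auto
  \<comment> \<open>\<open>e\<close> keeps \<open>x + v\<close> in \<open>C\<close>;
    \<open>\<delta> / 2\<close> lets the exponential of the remainder use up only half of the decay.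
    The \<open>2\<close> in \<open>k\<close> below counts the two powers of
    \<open>norm \<xi>\<close> in the quadratic remainder.\<close>
  define d where "d = min e (\<delta> / 2)"
  define k where "k = length vs + 2"
  define B where "B = (\<integral>\<xi>. c * (norm \<xi> ^ k * exp (- (\<delta>/2) * norm \<xi>)) \<partial>(lborel :: 'v measure))"
  show ?thesis
  proof (rule has_derivative_of_quadratic_bound)
    show "linear (\<lambda>v. - \<Phi> (v # vs) x)" using linear_compose_neg[OF \<Phi>_linear[OF x]] .
    show "d > 0" using e \<delta> by (simp add: d_def)
    fix v :: 'v assume v: "norm v < d"
    have xv: "x + v \<in> C" using v e by (auto simp: d_def dist_norm intro!: subsetD[OF e(2)])
    define r where "r \<xi> = indicator K \<xi> * (lin_prod vs \<xi> * exp (- ((x + v) \<bullet> \<xi>)))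
        - indicator K \<xi> * (lin_prod vs \<xi> * exp (- (x \<bullet> \<xi>))) + indicator K \<xi> * (lin_prod (v # vs) \<xi> * exp (- (x \<bullet> \<xi>)))" for \<xi>
    have ir: "integrable lborel r" unfolding r_def[abs_def]
      by (intro Bochner_Integration.integrable_add Bochner_Integration.integrable_diff \<Phi>_integrable x xv)
    have "(\<integral>\<xi>. r \<xi> \<partial>lborel) = \<Phi> vs (x + v) - \<Phi> vs x + \<Phi> (v # vs) x"
      unfolding r_def \<Phi>_def
      by (simp only: Bochner_Integration.integral_add Bochner_Integration.integral_diff Bochner_Integration.integrable_diff \<Phi>_integrable x xv)
    moreover have "\<bar>\<integral>\<xi>. r \<xi> \<partial>lborel\<bar> \<le> (\<integral>\<xi>. (norm v)\<^sup>2 * (c * (norm \<xi> ^ k * exp (- (\<delta>/2) * norm \<xi>))) \<partial>(lborel :: 'v measure))"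
    proof (rule integral_abs_bound_integral[OF ir])
      show "integrable lborel (\<lambda>\<xi>::'v. (norm v)\<^sup>2 * (c * (norm \<xi> ^ k * exp (- (\<delta>/2) * norm \<xi>))))"
        using integrable_poly_exp[of "\<delta>/2" k] \<delta> by simp
      fix \<xi> :: 'v
      show "\<bar>r \<xi>\<bar> \<le> (norm v)\<^sup>2 * (c * (norm \<xi> ^ k * exp (- (\<delta>/2) * norm \<xi>)))"
      proof (cases "\<xi> \<in> K")
        case True
        have "exp (- ((x + v) \<bullet> \<xi>)) = exp (- (x \<bullet> \<xi>)) * exp (- (v \<bullet> \<xi>))" by (simp add: inner_add_left exp_add[symmetric])
        then have r_eq: "r \<xi> = lin_prod vs \<xi> * exp (- (x \<bullet> \<xi>)) * (exp (- (v \<bullet> \<xi>)) - 1 + v \<bullet> \<xi>)"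
          using True by (simp add: r_def algebra_simps)
        have vx: "\<bar>v \<bullet> \<xi>\<bar> \<le> norm v * norm \<xi>" by (rule Cauchy_Schwarz_ineq2)
        also have "\<dots> \<le> (\<delta>/2) * norm \<xi>" using v by (intro mult_right_mono) (auto simp: d_def)
        finally have vx2: "\<bar>v \<bullet> \<xi>\<bar> \<le> (\<delta>/2) * norm \<xi>" .
        have "\<bar>exp (- (v \<bullet> \<xi>)) - 1 + v \<bullet> \<xi>\<bar> \<le> (v \<bullet> \<xi>)\<^sup>2 * exp \<bar>v \<bullet> \<xi>\<bar>" by (rule exp_quadratic_remainder)
        also have "\<dots> \<le> (norm v * norm \<xi>)\<^sup>2 * exp ((\<delta>/2) * norm \<xi>)"
          using vx vx2 by (intro mult_mono) (auto intro: power_mono simp: abs_le_square_iff[symmetric])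
        finally have rem: "\<bar>exp (- (v \<bullet> \<xi>)) - 1 + v \<bullet> \<xi>\<bar> \<le> (norm v * norm \<xi>)\<^sup>2 * exp ((\<delta>/2) * norm \<xi>)" .
        have "\<bar>r \<xi>\<bar> = (\<bar>lin_prod vs \<xi>\<bar> * exp (- (x \<bullet> \<xi>))) * \<bar>exp (- (v \<bullet> \<xi>)) - 1 + v \<bullet> \<xi>\<bar>"
          unfolding r_eq by (simp add: abs_mult)
        also have "\<dots> \<le> ((c * norm \<xi> ^ length vs) * exp (- \<delta> * norm \<xi>)) * ((norm v * norm \<xi>)\<^sup>2 * exp ((\<delta>/2) * norm \<xi>))"
          unfolding c_def using \<delta>(2)[OF True] rem
          by (intro mult_mono lin_prod_bound) (auto intro!: mult_nonneg_nonneg c[unfolded c_def])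
        also have "\<dots> = (norm v)\<^sup>2 * (c * (norm \<xi> ^ k * (exp (- \<delta> * norm \<xi>) * exp ((\<delta>/2) * norm \<xi>))))"
          by (simp add: k_def power_mult_distrib power_add power2_eq_square mult_ac)
        also have "exp (- \<delta> * norm \<xi>) * exp ((\<delta>/2) * norm \<xi>) = exp (- (\<delta>/2) * norm \<xi>)"
          by (simp add: exp_add[symmetric] field_simps)
        finally show ?thesis .
      qed (use c in \<open>simp add: r_def\<close>)
    qed
    moreover have "(\<integral>\<xi>. (norm v)\<^sup>2 * (c * (norm \<xi> ^ k * exp (- (\<delta>/2) * norm \<xi>))) \<partial>(lborel :: 'v measure)) = (norm v)\<^sup>2 * B"
      unfolding B_def by (rule integral_mult_right_zero)
    ultimately show "\<bar>\<Phi> vs (x + v) - \<Phi> vs x - - \<Phi> (v # vs) x\<bar> \<le> B * (norm v)\<^sup>2"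
      by (simp only: minus_minus diff_minus_eq_add mult.commute[of B])
  qed
qed

text \<open>If the integral vanished, \<open>f\<close> would vanish almost everywhere and the open
  set \<open>S\<close> would be a null set.\<close>

lemma integral_pos:
  assumes int: "integrable lborel f" and nn: "\<And>\<xi>. f \<xi> \<ge> 0" and S: "open S" "S \<noteq> {}" and pos: "\<And>\<xi>. \<xi> \<in> S \<Longrightarrow> f \<xi> > 0"
  shows "(\<integral>\<xi>. f \<xi> \<partial>(lborel :: 'v measure)) > (0::real)"
proof (rule ccontr)
  assume "\<not> (\<integral>\<xi>. f \<xi> \<partial>lborel) > 0"
  moreover have "(\<integral>\<xi>. f \<xi> \<partial>lborel) \<ge> 0" by (intro integral_nonneg_AE AE_I2 nn)
  ultimately have "(\<integral>\<xi>. f \<xi> \<partial>lborel) = 0" by simp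
  then have "AE \<xi> in lborel. f \<xi> = 0" using integral_nonneg_eq_0_iff_AE[OF int] nn by simp
  then have "AE \<xi> in lborel. \<xi> \<notin> S" by eventually_elim (use pos in force)
  then have "S \<in> null_sets lborel" using AE_iff_null_sets[of S lborel] S(1) by (auto intro: borel_open)
  then have "negligible S" by (simp add: negligible_iff_null_sets null_sets_completionI)
  then show False using open_not_negligible[OF S] by blast
qed

lemma \<Phi>_pos: "x \<in> C \<Longrightarrow> \<Phi> [] x > 0"
  unfolding \<Phi>_def
  by (rule integral_pos[OF \<Phi>_integrable, where S = "ball a \<rho>"])
    (use \<rho> K_ball in \<open>auto split: split_indicator\<close>)

lemma \<Phi>_square_pos:
  assumes x: "x \<in> C" and w: "w \<noteq> 0" shows "\<Phi> [w, w] x > 0"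
  unfolding \<Phi>_def
proof (rule integral_pos[OF \<Phi>_integrable[OF x], where S = "ball a \<rho> \<inter> {\<xi>. w \<bullet> \<xi> \<noteq> 0}"])
  show "open (ball a \<rho> \<inter> {\<xi>. w \<bullet> \<xi> \<noteq> 0})" by (intro open_Int open_ball open_Collect_neq continuous_intros)
  show "ball a \<rho> \<inter> {\<xi>. w \<bullet> \<xi> \<noteq> 0} \<noteq> {}"
  proof (cases "w \<bullet> a = 0")
    case True
    \<comment> \<open>The centre lies on the excluded hyperplane, so it is moved off along
      \<open>w\<close> within the ball.\<close>
    define b where "b = a + (\<rho> / (2 * norm w)) *\<^sub>R w"
    have "dist a b = \<rho> / 2" using w \<rho> by (simp add: b_def dist_norm)
    moreover have "w \<bullet> b \<noteq> 0" using True w \<rho> by (simp add: b_def inner_add_right)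
    ultimately have "b \<in> ball a \<rho> \<inter> {\<xi>. w \<bullet> \<xi> \<noteq> 0}" using \<rho> by simp
    then show ?thesis by blast
  next
    case False
    then have "a \<in> ball a \<rho> \<inter> {\<xi>. w \<bullet> \<xi> \<noteq> 0}" using \<rho> by simp
    then show ?thesis by blast
  qed
  fix \<xi>
  have "lin_prod [w, w] \<xi> = (w \<bullet> \<xi>)\<^sup>2" by (simp add: power2_eq_square)
  then show "0 \<le> indicator K \<xi> * (lin_prod [w, w] \<xi> * exp (- (x \<bullet> \<xi>)))" by (auto split: split_indicator)
  show "0 < indicator K \<xi> * (lin_prod [w, w] \<xi> * exp (- (x \<bullet> \<xi>)))" if "\<xi> \<in> ball a \<rho> \<inter> {\<xi>. w \<bullet> \<xi> \<noteq> 0}"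
    using that K_ball \<open>lin_prod [w, w] \<xi> = (w \<bullet> \<xi>)\<^sup>2\<close> by (auto split: split_indicator)
qed

end

section \<open>Locality and closure arguments for smoothness\<close>

section \<open>Smoothness from closed families of functions\<close>

lemma frechet_derivative_cong_open:
  assumes "open S" "t \<in> S" "\<And>s. s \<in> S \<Longrightarrow> f s = g s"
  shows "frechet_derivative f (at t) = frechet_derivative g (at t)"
proof -
  have "(f has_derivative D) (at t) \<longleftrightarrow> (g has_derivative D) (at t)" for D
    using has_derivative_transform_within_open[of f D t UNIV S g] has_derivative_transform_within_open[of g D t UNIV S f] assms
    by auto
  then show ?thesis by (simp add: frechet_derivative_def)
qed

lemma partial_cong_open:
  assumes "open S" "t \<in> S" "\<And>s. s \<in> S \<Longrightarrow> f s = g s" shows "partial i f t = partial i g t"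
  unfolding partial_def using frechet_derivative_cong_open[OF assms] by simp

lemma Ck_on_cong:
  assumes S: "open S" and eq: "\<And>s. s \<in> S \<Longrightarrow> f s = g s" and f: "Ck_on k S f" shows "Ck_on k S g"
  using eq f
proof (induction k arbitrary: f g)
  case 0
  then show ?case by (simp cong: continuous_on_cong)
next
  case (Suc k)
  have "g differentiable (at t)" if t: "t \<in> S" for t
  proof -
    obtain D where "(f has_derivative D) (at t)" using Suc.prems(2) t by (auto simp: differentiable_def)
    then have "(g has_derivative D) (at t)"
      using has_derivative_transform_within_open[of f D t UNIV S g] S t Suc.prems(1) by auto
    then show ?thesis by (auto simp: differentiable_def)
  qed
  moreover have "Ck_on k S (partial i g)" for i
  proof (rule Suc.IH)
    show "partial i f s = partial i g s" if "s \<in> S" for s by (rule partial_cong_open[OF S that Suc.prems(1)])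
    show "Ck_on k S (partial i f)" using Suc.prems(2) by simp
  qed
  ultimately show ?case by simp
qed

lemma smooth_on_cong:
  "open S \<Longrightarrow> (\<And>s. s \<in> S \<Longrightarrow> f s = g s) \<Longrightarrow> smooth_on S f \<Longrightarrow> smooth_on S g"
  unfolding smooth_on_def using Ck_on_cong by blast

lemma smooth_on_Un:
  assumes "open S" "open T" "smooth_on S f" "smooth_on T f" shows "smooth_on (S \<union> T) f"
proof -
  have "Ck_on k S f \<Longrightarrow> Ck_on k T f \<Longrightarrow> Ck_on k (S \<union> T) f" for k f
  proof (induction k arbitrary: f)
    case 0
    then show ?case using continuous_on_open_Un[of S T f] assms by simp
  next
    case (Suc k)
    then show ?case by simp blast
  qed
  then show ?thesis using assms by (auto simp: smooth_on_def)
qed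

text \<open>A family closed under partial derivatives, with equality of derivatives demanded on
  \<open>S\<close> only, consists of smooth functions: induction on the order for all members at
  once.\<close>

lemma smooth_on_family:
  assumes S: "open S" and f: "fam f"
    and step: "\<And>f. fam f \<Longrightarrow> \<exists>f'. \<forall>i. fam (f' i) \<and> (\<forall>t\<in>S. f differentiable (at t) \<and> partial i f t = f' i t)"
  shows "smooth_on S f"
proof -
  have "\<forall>f. fam f \<longrightarrow> Ck_on k S f" for k
  proof (induction k)
    case 0
    have "continuous_on S f" if "fam f" for f
    proof (rule continuous_at_imp_continuous_on, rule ballI)
      fix t assume "t \<in> S"
      then show "isCont f t" using step[OF that] differentiable_imp_continuous_within[of f t UNIV] by auto
    qed
    then show ?case by simp
  next
    case (Suc k)
    show ?case
    proof (intro allI impI)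
      fix f assume "fam f"
      then obtain f' where f': "\<And>i. fam (f' i)" "\<And>i t. t \<in> S \<Longrightarrow> f differentiable (at t) \<and> partial i f t = f' i t"
        using step by metis
      have "Ck_on k S (partial i f)" for i
        by (rule Ck_on_cong[OF S, of "f' i"]) (use f' Suc in auto)
      then show "Ck_on (Suc k) S f" using f'(2) by simp
    qed
  qed
  then show ?thesis using f by (simp add: smooth_on_def)
qed

lemma partial_of_has_derivative:
  assumes "(f has_derivative D) (at t)" shows "f differentiable (at t)" "partial i f t = D (axis i 1)"
  using assms frechet_derivative_at[OF assms] by (auto simp: differentiable_def partial_def)

text \<open>The linear part of \<open>hom_vec\<close>, and hence its derivative.\<close>

definition hom_dir :: "real ^ 'n \<Rightarrow> real ^ 'n::finite option" where
  "hom_dir t = (\<chi> k. case k of Some i \<Rightarrow> t $ i | None \<Rightarrow> 0)"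

lemma hom_dir_nth [simp]: "hom_dir t $ None = 0" "hom_dir t $ Some i = t $ i"
  by (simp_all add: hom_dir_def)

lemma vec_option_eq_iff: "(x :: real ^ 'n::finite option) = y \<longleftrightarrow> x $ None = y $ None \<and> (\<forall>i. x $ Some i = y $ Some i)"
  unfolding vec_eq_iff by (metis option.exhaust)

lemma hom_dir_linear: "linear hom_dir"
  by (rule linearI) (simp_all add: vec_option_eq_iff)

lemma hom_dir_axis: "hom_dir (axis i 1) = axis (Some i) 1"
  by (simp add: vec_option_eq_iff axis_def)

lemma hom_vec_has_derivative:
  fixes t :: "real ^ 'n::finite" shows "(hom_vec has_derivative hom_dir) (at t)"
proof -
  have "(\<lambda>t :: real ^ 'n. hom_dir t + axis None 1) = hom_vec" by (simp add: fun_eq_iff vec_option_eq_iff axis_def)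
  moreover have "((\<lambda>t. hom_dir t + axis None 1) has_derivative (\<lambda>h. hom_dir h + 0)) (at t)"
    by (intro has_derivative_add has_derivative_const linear_imp_has_derivative hom_dir_linear)
  ultimately show ?thesis by (simp only: add_0_right)
qed

section \<open>Invariance, homogeneity and convexity of the characteristic function\<close>

section \<open>The Koszul--Vinberg function\<close>

lemma mat_mult_vec: "mat r *v x = r *\<^sub>R (x :: real ^ 'm::finite)"
  by (simp add: vec_eq_iff matrix_vector_mult_def mat_def if_distrib[of "\<lambda>x. x * _"] cong: if_cong)

lemma det_mat: "det (mat r :: real ^ 'm ^ 'm::finite) = r ^ CARD('m)"
  by (subst det_diagonal) (auto simp: mat_def)

locale dual_cone_vec = dual_cone C a \<rho>
  for C :: "(real ^ 'm::finite) set" and a \<rho> +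
  fixes N :: real
  assumes N_eq: "N = real CARD('m)"
begin

lemma N_pos: "N > 0" by (simp add: N_eq)

lemma K_transpose:
  assumes A: "(\<lambda>x. A *v x) ` C = C" shows "transpose A *v \<xi> \<in> K \<longleftrightarrow> \<xi> \<in> K"
proof -
  have adj: "x \<bullet> (transpose A *v \<xi>) = (A *v x) \<bullet> \<xi>" for x
    by (metis dot_lmul_matrix inner_commute transpose_matrix_vector)
  have "(\<forall>x\<in>C. (A *v x) \<bullet> \<xi> \<ge> 0) \<longleftrightarrow> (\<forall>y\<in>(\<lambda>x. A *v x) ` C. y \<bullet> \<xi> \<ge> 0)" by auto
  then show ?thesis unfolding K_def mem_Collect_eq adj A .
qed

text \<open>The transpose of an automorphism of \<open>C\<close> preserves the dual cone, so it can
  serve as the change of variables.\<close>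

lemma \<Phi>_invariant:
  assumes A: "det A \<noteq> 0" "(\<lambda>x. A *v x) ` C = C" shows "\<Phi> [] (A *v x) = \<Phi> [] x / \<bar>det A\<bar>"
proof -
  define f where "f \<xi> = indicator K \<xi> * (lin_prod [] \<xi> * exp (- (x \<bullet> \<xi>)))" for \<xi>
  have adj: "x \<bullet> (transpose A *v \<xi>) = (A *v x) \<bullet> \<xi>" for \<xi>
    by (metis dot_lmul_matrix inner_commute transpose_matrix_vector)
  have fm: "f \<in> borel_measurable borel" unfolding f_def by measurable
  have "f (transpose A *v \<xi>) = indicator K \<xi> * (lin_prod [] \<xi> * exp (- ((A *v x) \<bullet> \<xi>)))" for \<xi>
    using K_transpose[OF A(2), of \<xi>] by (simp add: f_def adj indicator_def del: transpose_matrix_vector)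
  then have "\<Phi> [] (A *v x) = (\<integral>\<xi>. f (transpose A *v \<xi>) \<partial>lborel)" by (simp add: \<Phi>_def)
  also have "\<dots> = (\<integral>\<xi>. f \<xi> \<partial>lborel) / \<bar>det (transpose A)\<bar>"
    using A by (intro integral_linear_change fm) simp
  finally show ?thesis by (simp add: \<Phi>_def f_def)
qed

lemma \<Phi>_scale:
  assumes r: "r > 0" shows "\<Phi> vs (r *\<^sub>R x) = \<Phi> vs x / r ^ (CARD('m) + length vs)"
proof -
  define f where "f \<xi> = indicator K \<xi> * (lin_prod vs \<xi> * exp (- (x \<bullet> \<xi>)))" for \<xi>
  have fm: "f \<in> borel_measurable borel" unfolding f_def by measurable
  have K: "r *\<^sub>R \<xi> \<in> K \<longleftrightarrow> \<xi> \<in> K" for \<xi> using r by (simp add: K_def zero_le_mult_iff)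
  have "f (mat r *v \<xi>) = r ^ length vs * (indicator K \<xi> * (lin_prod vs \<xi> * exp (- ((r *\<^sub>R x) \<bullet> \<xi>))))" for \<xi>
    unfolding mat_mult_vec f_def using K[of \<xi>] by (simp add: lin_prod_scale indicator_def)
  then have "(\<integral>\<xi>. f (mat r *v \<xi>) \<partial>lborel) = r ^ length vs * \<Phi> vs (r *\<^sub>R x)" by (simp add: \<Phi>_def)
  moreover have "(\<integral>\<xi>. f (mat r *v \<xi>) \<partial>lborel) = (\<integral>\<xi>. f \<xi> \<partial>lborel) / \<bar>det (mat r :: real ^ 'm ^ 'm)\<bar>"
    using r by (intro integral_linear_change fm) (simp add: det_mat)
  ultimately show ?thesis using r by (simp add: det_mat \<Phi>_def f_def power_add field_simps)
qed

text \<open>Euler's relation for degree \<open>-(N + length vs)\<close>, obtained by differentiating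
  along the ray at \<open>r = 1\<close>; the sign is absorbed by
  \<open>\<Phi>_derivative\<close>.\<close>

lemma \<Phi>_Euler:
  assumes x: "x \<in> C" shows "\<Phi> (x # vs) x = (N + length vs) * \<Phi> vs x"
proof -
  define k where "k = CARD('m) + length vs"
  have k: "k > 0" by (simp add: k_def)
  have "(\<Phi> vs has_derivative (\<lambda>v. - \<Phi> (v # vs) x)) (at (1 *\<^sub>R x))" using \<Phi>_derivative[OF x] by simp
  moreover have "((\<lambda>r. r *\<^sub>R x) has_derivative (\<lambda>h. h *\<^sub>R x)) (at (1::real))" by (auto intro!: derivative_eq_intros)
  ultimately have "((\<lambda>r. \<Phi> vs (r *\<^sub>R x)) has_derivative (\<lambda>h. - \<Phi> ((h *\<^sub>R x) # vs) x)) (at 1)"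
    using diff_chain_at[of "\<lambda>r. r *\<^sub>R x" _ 1 "\<Phi> vs"] by (simp add: o_def)
  moreover have "(\<lambda>h. - \<Phi> ((h *\<^sub>R x) # vs) x) = (*) (- \<Phi> (x # vs) x)"
    using linear_scale[OF \<Phi>_linear[OF x], of _ x vs] by (simp add: fun_eq_iff)
  ultimately have 1: "((\<lambda>r. \<Phi> vs (r *\<^sub>R x)) has_real_derivative (- \<Phi> (x # vs) x)) (at 1)"
    by (simp only: has_field_derivative_def)
  have "((\<lambda>r. \<Phi> vs x / r ^ k) has_real_derivative - (real k * \<Phi> vs x)) (at 1)"
    by (auto intro!: derivative_eq_intros)
  then have "((\<lambda>r. \<Phi> vs (r *\<^sub>R x)) has_real_derivative - (real k * \<Phi> vs x)) (at 1)"
    by (rule has_field_derivative_transform_within_open[where S = "{0<..}"]) (auto simp: \<Phi>_scale k_def)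
  then have "- \<Phi> (x # vs) x = - (real k * \<Phi> vs x)" using 1 DERIV_unique by blast
  then show ?thesis by (simp add: k_def N_eq)
qed

lemma \<Phi>_swap: "\<Phi> [v, w] x = \<Phi> [w, v] x"
  by (simp add: \<Phi>_def mult_ac)

text \<open>Positivity of the second moment of \<open>v + \<alpha> x\<close>, with the optimal \<open>\<alpha>\<close>; the Euler relations
  evaluate the moments involving \<open>x\<close>.\<close>

lemma \<Phi>_reverse_Cauchy_Schwarz:
  assumes x: "x \<in> C" and v: "\<nexists>r. v = r *\<^sub>R x"
  shows "(N + 1) / N * (\<Phi> [v] x)\<^sup>2 < \<Phi> [] x * \<Phi> [v, v] x"
proof -
  note pos = \<Phi>_pos[OF x]
  define \<alpha> where "\<alpha> = - \<Phi> [v] x / (N * \<Phi> [] x)"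
  have "v + \<alpha> *\<^sub>R x \<noteq> 0"
  proof
    assume "v + \<alpha> *\<^sub>R x = 0"
    then have "v = (- \<alpha>) *\<^sub>R x" by (simp add: eq_neg_iff_add_eq_0)
    then show False using v by blast
  qed
  then have "0 < \<Phi> [v + \<alpha> *\<^sub>R x, v + \<alpha> *\<^sub>R x] x" by (rule \<Phi>_square_pos[OF x])
  also have "\<dots> = \<Phi> [v, v + \<alpha> *\<^sub>R x] x + \<alpha> * \<Phi> [x, v + \<alpha> *\<^sub>R x] x"
    using linear_add[OF \<Phi>_linear[OF x], of v "\<alpha> *\<^sub>R x"] linear_scale[OF \<Phi>_linear[OF x], of \<alpha> x] by simp
  also have "\<Phi> [v, v + \<alpha> *\<^sub>R x] x = \<Phi> [v, v] x + \<alpha> * \<Phi> [x, v] x"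
    unfolding \<Phi>_swap[of v "v + \<alpha> *\<^sub>R x"]
    using linear_add[OF \<Phi>_linear[OF x], of v "\<alpha> *\<^sub>R x"] linear_scale[OF \<Phi>_linear[OF x], of \<alpha> x] by simp
  \<comment> \<open>The factors \<open>N + 1\<close> and \<open>N\<close> are Euler's relation on
    first and zeroth moments; the choice of \<open>\<alpha>\<close> makes the bracket
    vanish.\<close>
  also have "\<Phi> [x, v + \<alpha> *\<^sub>R x] x = (N + 1) * (\<Phi> [v] x + \<alpha> * (N * \<Phi> [] x))"
    using \<Phi>_Euler[OF x, of "[v + \<alpha> *\<^sub>R x]"] \<Phi>_Euler[OF x, of "[]"]
      linear_add[OF \<Phi>_linear[OF x], of v "\<alpha> *\<^sub>R x" "[]"] linear_scale[OF \<Phi>_linear[OF x], of \<alpha> x "[]"] by simp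
  also have "\<Phi> [x, v] x = (N + 1) * \<Phi> [v] x" using \<Phi>_Euler[OF x, of "[v]"] by simp
  also have "\<alpha> * (N * \<Phi> [] x) = - \<Phi> [v] x" using pos N_pos by (simp add: \<alpha>_def)
  finally have "0 < \<Phi> [v, v] x + \<alpha> * ((N + 1) * \<Phi> [v] x)" by simp
  then have "0 < \<Phi> [] x * (\<Phi> [v, v] x + \<alpha> * ((N + 1) * \<Phi> [v] x))" using pos by simp
  also have "\<dots> = \<Phi> [] x * \<Phi> [v, v] x - (N + 1) / N * (\<Phi> [v] x)\<^sup>2"
    using pos N_pos by (simp add: \<alpha>_def power2_eq_square field_simps)
  finally show ?thesis by simp
qed

text \<open>The power turns degree \<open>-N\<close> into degree one, so that \<open>U0\<close> is
  linear along rays; the sign makes the function negative and, by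
  \<open>U0_positive_definite\<close>, its Hessian positive.\<close>

definition U0 where "U0 x = - (\<Phi> [] x powr (- 1 / N))"

lemma U0_neg: "x \<in> C \<Longrightarrow> U0 x < 0"
  using \<Phi>_pos[of x] by (simp add: U0_def)

lemma U0_scale: assumes x: "x \<in> C" and r: "r > 0" shows "U0 (r *\<^sub>R x) = r * U0 x"
proof -
  have "r ^ CARD('m) = r powr N" using r by (simp add: powr_realpow N_eq)
  then have "\<Phi> [] (r *\<^sub>R x) = \<Phi> [] x * r powr (- N)"
    using \<Phi>_scale[OF r, of "[]" x] r by (simp add: powr_minus divide_inverse)
  then have "\<Phi> [] (r *\<^sub>R x) powr (- 1 / N) = \<Phi> [] x powr (- 1 / N) * (r powr (- N)) powr (- 1 / N)"
    using \<Phi>_pos[OF x] by (simp add: powr_mult)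
  also have "(r powr (- N)) powr (- 1 / N) = r" using r N_pos by (simp add: powr_powr)
  finally show ?thesis by (simp add: U0_def)
qed

lemma U0_invariant: "\<bar>det A\<bar> = 1 \<Longrightarrow> (\<lambda>x. A *v x) ` C = C \<Longrightarrow> U0 (A *v x) = U0 x"
  using \<Phi>_invariant[of A x] by (auto simp: U0_def)

end

locale dual_cone_chart = dual_cone_vec C a \<rho> N
  for C :: "(real ^ 'n::finite option) set" and a \<rho> N +
  fixes B :: "real ^ 'n option ^ 'n option"
begin

definition y where "y t = B *v hom_vec t"

definition dir where "dir i = B *v axis (Some i) 1"

definition S where "S = {t. y t \<in> C}"

lemma S_open: "open S"
proof -
  have "continuous_on UNIV y" unfolding y_def
    by (rule continuous_on_compose2[OF matrix_vector_mult_linear_continuous_on continuous_on_hom_vec]) auto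
  then show ?thesis using C_open open_vimage[of C y] by (simp add: S_def vimage_def)
qed

lemma y_derivative: "(y has_derivative (\<lambda>h. B *v hom_dir h)) (at t)"
  unfolding y_def by (rule bounded_linear.has_derivative[OF matrix_vector_mul_bounded_linear hom_vec_has_derivative])

lemma \<Phi>_y_derivative:
  assumes t: "t \<in> S" shows "((\<lambda>t. \<Phi> vs (y t)) has_derivative (\<lambda>h. - \<Phi> ((B *v hom_dir h) # vs) (y t))) (at t)"
proof -
  have "y t \<in> C" using t by (simp add: S_def)
  then show ?thesis
    using diff_chain_at[OF y_derivative \<Phi>_derivative, of t vs] by (simp add: o_def)
qed

text \<open>Allowing all real powers of the positive function \<open>\<Phi> []\<close> closes the
  family under derivatives with only the product and chain rules.\<close>

inductive fam :: "(real ^ 'n \<Rightarrow> real) \<Rightarrow> bool" where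
  base: "fam (\<lambda>t. \<Phi> vs (y t))"
| pow: "fam (\<lambda>t. \<Phi> [] (y t) powr b)"
| const: "fam (\<lambda>t. c)"
| mult: "fam f \<Longrightarrow> fam g \<Longrightarrow> fam (\<lambda>t. f t * g t)"
| add: "fam f \<Longrightarrow> fam g \<Longrightarrow> fam (\<lambda>t. f t + g t)"

lemma powr_derivative:
  assumes t: "t \<in> S"
  shows "((\<lambda>t. \<Phi> [] (y t) powr b) has_derivative
    (\<lambda>h. - \<Phi> [B *v hom_dir h] (y t) * (b * \<Phi> [] (y t) powr (b - 1)))) (at t)"
proof -
  have "\<Phi> [] (y t) > 0" using t \<Phi>_pos by (simp add: S_def)
  then have "((\<lambda>z. z powr b) has_real_derivative b * \<Phi> [] (y t) powr (b - 1)) (at (\<Phi> [] (y t)))"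
    by (rule has_real_derivative_powr)
  then show ?thesis by (rule DERIV_compose_FDERIV[OF _ \<Phi>_y_derivative[OF t]])
qed

lemma fam_step:
  assumes "fam f" shows "\<exists>f'. \<forall>i. fam (f' i) \<and> (\<forall>t\<in>S. f differentiable (at t) \<and> partial i f t = f' i t)"
  using assms
proof induction
  case (base vs)
  have "fam (\<lambda>t. (-1) * \<Phi> (dir i # vs) (y t))" for i by (intro fam.intros)
  moreover have "(\<lambda>t. \<Phi> vs (y t)) differentiable (at t) \<and> partial i (\<lambda>t. \<Phi> vs (y t)) t = (-1) * \<Phi> (dir i # vs) (y t)"
    if "t \<in> S" for i t
    using partial_of_has_derivative[OF \<Phi>_y_derivative[OF that]] by (simp add: dir_def hom_dir_axis)
  ultimately show ?case by (intro exI[of _ "\<lambda>i t. (-1) * \<Phi> (dir i # vs) (y t)"]) simp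
next
  case (pow b)
  have "fam (\<lambda>t. ((-1) * \<Phi> [dir i] (y t)) * (b * \<Phi> [] (y t) powr (b - 1)))" for i by (intro fam.intros)
  moreover have "(\<lambda>t. \<Phi> [] (y t) powr b) differentiable (at t) \<and>
      partial i (\<lambda>t. \<Phi> [] (y t) powr b) t = ((-1) * \<Phi> [dir i] (y t)) * (b * \<Phi> [] (y t) powr (b - 1))"
    if "t \<in> S" for i t
    using partial_of_has_derivative[OF powr_derivative[OF that]] by (simp add: dir_def hom_dir_axis)
  ultimately show ?case by (intro exI[of _ "\<lambda>i t. ((-1) * \<Phi> [dir i] (y t)) * (b * \<Phi> [] (y t) powr (b - 1))"]) simp
next
  case (const c)
  have "partial i (\<lambda>t. c) t = 0" for i :: 'n and t
    using partial_of_has_derivative(2)[OF has_derivative_const[of c "at t"]] by simp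
  then show ?case using fam.const[of 0] by (intro exI[of _ "\<lambda>i t. 0"]) simp
next
  case (mult f g)
  then obtain f' g' where f': "\<And>i. fam (f' i)" "\<And>i t. t \<in> S \<Longrightarrow> f differentiable (at t) \<and> partial i f t = f' i t"
    and g': "\<And>i. fam (g' i)" "\<And>i t. t \<in> S \<Longrightarrow> g differentiable (at t) \<and> partial i g t = g' i t" by metis
  have "(\<lambda>t. f t * g t) differentiable (at t) \<and> partial i (\<lambda>t. f t * g t) t = f t * g' i t + f' i t * g t" if t: "t \<in> S" for i t
  proof -
    have "(f has_derivative frechet_derivative f (at t)) (at t)" "(g has_derivative frechet_derivative g (at t)) (at t)"
      using f'(2)[OF t] g'(2)[OF t] frechet_derivative_works by blast+
    from partial_of_has_derivative[OF has_derivative_mult[OF this]] show ?thesis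
      using f'(2)[OF t, of i] g'(2)[OF t, of i] by (simp add: partial_def)
  qed
  moreover have "fam (\<lambda>t. f t * g' i t + f' i t * g t)" for i using mult f' g' by (intro fam.intros)
  ultimately show ?case by (intro exI[of _ "\<lambda>i t. f t * g' i t + f' i t * g t"]) simp
next
  case (add f g)
  then obtain f' g' where f': "\<And>i. fam (f' i)" "\<And>i t. t \<in> S \<Longrightarrow> f differentiable (at t) \<and> partial i f t = f' i t"
    and g': "\<And>i. fam (g' i)" "\<And>i t. t \<in> S \<Longrightarrow> g differentiable (at t) \<and> partial i g t = g' i t" by metis
  have "(\<lambda>t. f t + g t) differentiable (at t) \<and> partial i (\<lambda>t. f t + g t) t = f' i t + g' i t" if t: "t \<in> S" for i t
  proof -
    have "(f has_derivative frechet_derivative f (at t)) (at t)" "(g has_derivative frechet_derivative g (at t)) (at t)"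
      using f'(2)[OF t] g'(2)[OF t] frechet_derivative_works by blast+
    from partial_of_has_derivative[OF has_derivative_add[OF this]] show ?thesis
      using f'(2)[OF t, of i] g'(2)[OF t, of i] by (simp add: partial_def)
  qed
  moreover have "fam (\<lambda>t. f' i t + g' i t)" for i using f' g' by (intro fam.intros)
  ultimately show ?case by (intro exI[of _ "\<lambda>i t. f' i t + g' i t"]) simp
qed

lemma fam_smooth: "fam f \<Longrightarrow> smooth_on S f"
  using smooth_on_family[where fam = fam, OF S_open _ fam_step] .

lemma U0_smooth: "smooth_on S (\<lambda>t. c * U0 (y t))"
proof -
  have "fam (\<lambda>t. (- c) * \<Phi> [] (y t) powr (- 1 / N))" by (intro fam.intros)
  then have "smooth_on S (\<lambda>t. (- c) * \<Phi> [] (y t) powr (- 1 / N))" by (rule fam_smooth)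
  moreover have "(\<lambda>t. (- c) * \<Phi> [] (y t) powr (- 1 / N)) = (\<lambda>t. c * U0 (y t))" by (simp add: U0_def fun_eq_iff)
  ultimately show ?thesis by simp
qed

lemma U0_hessian:
  assumes t: "t \<in> S"
  shows "hessian (\<lambda>t. U0 (y t)) t $ i $ j = (1 / N) * \<Phi> [] (y t) powr (- 1 / N - 2) *
    (\<Phi> [] (y t) * \<Phi> [dir i, dir j] (y t) - (N + 1) / N * (\<Phi> [dir i] (y t) * \<Phi> [dir j] (y t)))"
proof -
  define b where "b = - 1 / N"
  have d1: "partial j (\<lambda>t. U0 (y t)) s = (b * \<Phi> [] (y s) powr (b - 1)) * \<Phi> [dir j] (y s)" if s: "s \<in> S" for s
  proof -
    have "((\<lambda>t. U0 (y t)) has_derivative (\<lambda>h. - (- \<Phi> [B *v hom_dir h] (y s) * (b * \<Phi> [] (y s) powr (b - 1))))) (at s)"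
      unfolding U0_def b_def by (intro has_derivative_minus powr_derivative s)
    from partial_of_has_derivative(2)[OF this] show ?thesis by (simp add: dir_def hom_dir_axis)
  qed
  have "hessian (\<lambda>t. U0 (y t)) t $ i $ j = partial i (partial j (\<lambda>t. U0 (y t))) t" by (simp add: hessian_def)
  also have "\<dots> = partial i (\<lambda>s. (b * \<Phi> [] (y s) powr (b - 1)) * \<Phi> [dir j] (y s)) t"
    by (rule partial_cong_open[OF S_open t d1])
  also have "\<dots> = (b * \<Phi> [] (y t) powr (b - 1)) * - \<Phi> [dir i, dir j] (y t) +
      (b * (- \<Phi> [dir i] (y t) * ((b - 1) * \<Phi> [] (y t) powr (b - 1 - 1)))) * \<Phi> [dir j] (y t)"
    using partial_of_has_derivative(2)[OF has_derivative_mult[OF has_derivative_mult_right[OF powr_derivative[OF t, of "b - 1"], of b]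
      \<Phi>_y_derivative[OF t, of "[dir j]"]], of i]
    by (simp only: dir_def hom_dir_axis)
  \<comment> \<open>With the power \<open>b - 2\<close> as common factor, the rest is the bilinear
    form of \<open>\<Phi>_reverse_Cauchy_Schwarz\<close>.\<close>
  also have "\<Phi> [] (y t) powr (b - 1) = \<Phi> [] (y t) powr (b - 2) * \<Phi> [] (y t)"
  proof -
    have "\<Phi> [] (y t) > 0" using t \<Phi>_pos by (simp add: S_def)
    then show ?thesis by (simp add: powr_mult_base[symmetric] mult.commute[of _ "\<Phi> [] (y t)"] powr_mult_base)
  qed
  also have "b - 1 - 1 = b - 2" by simp
  also have "(b * (\<Phi> [] (y t) powr (b - 2) * \<Phi> [] (y t))) * - \<Phi> [dir i, dir j] (y t) +
      (b * (- \<Phi> [dir i] (y t) * ((b - 1) * \<Phi> [] (y t) powr (b - 2)))) * \<Phi> [dir j] (y t)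
    = (- b) * \<Phi> [] (y t) powr (b - 2) * (\<Phi> [] (y t) * \<Phi> [dir i, dir j] (y t) - (1 - b) * (\<Phi> [dir i] (y t) * \<Phi> [dir j] (y t)))"
    by (simp add: algebra_simps)
  also have "1 - b = (N + 1) / N" using N_pos by (simp add: b_def field_simps)
  also have "- b = 1 / N" by (simp add: b_def)
  finally show ?thesis by (simp add: b_def)
qed

text \<open>The quadratic form at \<open>v\<close> is the reverse Cauchy--Schwarz difference at
  \<open>w = B *v hom_dir v\<close>. This direction is not radial: in the coordinates of
  \<open>B\<close> its last entry is \<open>0\<close>, while that of \<open>y t\<close> is
  not.\<close>

lemma U0_positive_definite:
  assumes t: "t \<in> S" and B: "det B \<noteq> 0"
  shows "positive_definite (hessian (\<lambda>t. U0 (y t)) t)"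
  unfolding positive_definite_def
proof (intro conjI allI impI)
  show "transpose (hessian (\<lambda>t. U0 (y t)) t) = hessian (\<lambda>t. U0 (y t)) t"
  proof -
    have "hessian (\<lambda>t. U0 (y t)) t $ j $ i = hessian (\<lambda>t. U0 (y t)) t $ i $ j" for i j
      unfolding U0_hessian[OF t] \<Phi>_swap[of "dir j" "dir i"] by (simp only: mult.commute[of "\<Phi> [dir j] (y t)"])
    then show ?thesis by (simp add: vec_eq_iff transpose_def)
  qed
  fix v :: "real ^ 'n" assume v: "v \<noteq> 0"
  have x: "y t \<in> C" using t by (simp add: S_def)
  define w where "w = B *v hom_dir v"
  have nr: "\<nexists>r. w = r *\<^sub>R y t"
  proof
    assume "\<exists>r. w = r *\<^sub>R y t"
    then obtain r where "B *v hom_dir v = B *v (r *\<^sub>R hom_vec t)" by (auto simp: w_def y_def matrix_vector_mult_scaleR)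
    then have eq: "hom_dir v = r *\<^sub>R hom_vec t" using det_inv_matrix(4)[OF B] by metis
    have "r = 0" using arg_cong[OF eq, of "\<lambda>x. x $ None"] by simp
    then have "v $ i = 0" for i using arg_cong[OF eq, of "\<lambda>x. x $ Some i"] by simp
    then show False using v by (simp add: vec_eq_iff)
  qed
  have lin: "linear (\<lambda>v. B *v hom_dir v)"
    using linear_compose[OF hom_dir_linear matrix_vector_mul_linear[of B]] by (simp add: o_def)
  have "v = (\<Sum>i\<in>UNIV. v $ i *\<^sub>R axis i 1)" using basis_expansion[of v] by (simp add: scalar_mult_eq_scaleR)
  then have "w = B *v hom_dir (\<Sum>i\<in>UNIV. v $ i *\<^sub>R axis i 1)" by (simp add: w_def)
  also have "\<dots> = (\<Sum>i\<in>UNIV. v $ i *\<^sub>R dir i)"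
    by (simp add: linear_sum[OF lin] linear_scale[OF lin] dir_def hom_dir_axis)
  finally have w: "w = (\<Sum>i\<in>UNIV. v $ i *\<^sub>R dir i)" .
  have lw: "\<Phi> (w # vs) (y t) = (\<Sum>i\<in>UNIV. v $ i * \<Phi> (dir i # vs) (y t))" for vs
    unfolding w by (simp add: linear_sum[OF \<Phi>_linear[OF x]] linear_scale[OF \<Phi>_linear[OF x]])
  have ww: "\<Phi> [w, w] (y t) = (\<Sum>i\<in>UNIV. \<Sum>j\<in>UNIV. v $ i * (\<Phi> [dir i, dir j] (y t) * v $ j))"
  proof -
    have "\<Phi> [dir i, w] (y t) = (\<Sum>j\<in>UNIV. v $ j * \<Phi> [dir i, dir j] (y t))" for i
      unfolding \<Phi>_swap[of "dir i"] lw[of "[dir i]"] ..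
    then show ?thesis unfolding lw[of "[w]"] by (simp add: sum_distrib_left mult_ac)
  qed
  have w2: "(\<Phi> [w] (y t))\<^sup>2 = (\<Sum>i\<in>UNIV. \<Sum>j\<in>UNIV. v $ i * ((\<Phi> [dir i] (y t) * \<Phi> [dir j] (y t)) * v $ j))"
    unfolding lw[of "[]"] power2_eq_square sum_product by (simp add: mult_ac)
  define c where "c = (1 / N) * \<Phi> [] (y t) powr (- 1 / N - 2)"
  have c: "c > 0" using \<Phi>_pos[OF x] N_pos by (simp add: c_def)
  have "v \<bullet> (hessian (\<lambda>t. U0 (y t)) t *v v) = (\<Sum>i\<in>UNIV. \<Sum>j\<in>UNIV. v $ i * (hessian (\<lambda>t. U0 (y t)) t $ i $ j * v $ j))"
    by (simp add: inner_vec_def matrix_vector_mult_def sum_distrib_left)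
  also have "\<dots> = c * (\<Phi> [] (y t) * \<Phi> [w, w] (y t) - (N + 1) / N * (\<Phi> [w] (y t))\<^sup>2)"
    unfolding U0_hessian[OF t] ww w2 c_def[symmetric] sum_distrib_left sum_subtractf[symmetric]
    by (simp add: algebra_simps)
  also have "\<dots> > 0" using c \<Phi>_reverse_Cauchy_Schwarz[OF x nr] by simp
  finally show "v \<bullet> (hessian (\<lambda>t. U0 (y t)) t *v v) > 0" .
qed

end

section \<open>Pulled-back charts whose transition maps lie in the group\<close>

section \<open>Orbit spaces and their charts\<close>

lemma scaled_matrix:
  fixes A :: "real ^ 'm ^ 'm::finite"
  shows "(mat r ** A) *v x = r *\<^sub>R (A *v x)" "det (mat r ** A) = r ^ CARD('m) * det A"
  by (simp_all add: matrix_vector_mul_assoc[symmetric] mat_mult_vec det_mul det_mat)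

lemma normalize_SLpm:
  fixes A :: "real ^ 'm ^ 'm::finite"
  assumes "det A \<noteq> 0" obtains r where "r > 0" "mat r ** A \<in> SLpm"
proof -
  define r where "r = \<bar>det A\<bar> powr (- 1 / real CARD('m))"
  have r: "r > 0" using assms by (simp add: r_def)
  have "r ^ CARD('m) = r powr real CARD('m)" using r by (simp add: powr_realpow)
  also have "\<dots> = \<bar>det A\<bar> powr (-1)" by (simp add: r_def powr_powr)
  also have "\<dots> = 1 / \<bar>det A\<bar>" using assms by (simp add: powr_neg_one)
  finally have "det (mat r ** A) = det A / \<bar>det A\<bar>" by (simp add: scaled_matrix)
  then have "det (mat r ** A) = 1 \<or> det (mat r ** A) = -1" using assms by (cases "det A > 0") auto
  then show ?thesis using that r by (simp add: SLpm_def)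
qed

lemma proj_map_scaled:
  fixes A :: "real ^ 'n::finite option ^ 'n option"
  assumes "det A \<noteq> 0" "r \<noteq> 0" shows "proj_map (mat r ** A) = proj_map A"
proof -
  have "det (mat r ** A) \<noteq> 0" using assms by (simp add: scaled_matrix)
  then show ?thesis using proj_map_eq_iff[OF assms(1), of "mat r ** A"] assms(2) by (auto simp: scaled_matrix)
qed

text \<open>\<open>B\<close> is normalized to \<open>SLpm\<close> because the Hessian condition
  accepts inhomogeneous coordinates of that kind only.\<close>

locale quotient_data =
  fixes M :: "'a topology" and \<A> :: "('a, 'n::finite) atlas" and \<Gamma> :: "('n rp \<Rightarrow> 'n rp) set"
    and B :: "real ^ 'n option ^ 'n option" and D :: "(real ^ 'n) set" and \<Omega> :: "'n rp set"
    and f :: "'a \<Rightarrow> 'n rp set"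
  assumes mfdA: "proj_flat_manifold M \<A>"
    and B: "B \<in> SLpm" and D: "open D" "convex D" "bounded D" "D \<noteq> {}" and \<Omega>: "\<Omega> = affine_pt B ` D"
    and \<Gamma>: "\<Gamma> \<subseteq> PGL" "id \<in> \<Gamma>" "\<And>\<gamma> \<delta>. \<gamma> \<in> \<Gamma> \<Longrightarrow> \<delta> \<in> \<Gamma> \<Longrightarrow> \<gamma> \<circ> \<delta> \<in> \<Gamma>" "\<And>\<gamma>. \<gamma> \<in> \<Gamma> \<Longrightarrow> inv \<gamma> \<in> \<Gamma>"
    and act: "acts_properly_discontinuously \<Gamma> \<Omega>"
    and f: "homeomorphic_map M (orbit_space \<Omega> \<Gamma>) f"
    and f_proj: "\<And>c d p. c \<in> \<A> \<Longrightarrow> d \<in> orbit_atlas \<Omega> \<Gamma> \<Longrightarrow> p \<in> fst c \<Longrightarrow> f p \<in> fst d \<Longrightarrow>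
           (\<exists>\<gamma> \<in> PGL. \<exists>W. openin M W \<and> p \<in> W \<and> W \<subseteq> fst c \<and> f ` W \<subseteq> fst d \<and>
              (\<forall>q\<in>W. snd d (f q) = \<gamma> (snd c q)))"
begin

lemma detB: "det B \<noteq> 0" using B SLpm_nz by blast

lemma \<Omega>_open: "open \<Omega>" unfolding \<Omega> using detB D(1) by (rule open_affine_pt_image)

lemma \<Gamma>_image: "\<gamma> \<in> \<Gamma> \<Longrightarrow> \<gamma> ` \<Omega> = \<Omega>"
  using act unfolding acts_properly_discontinuously_def by (elim conjE) (erule bspec)

lemma \<Gamma>_free: "\<gamma> \<in> \<Gamma> \<Longrightarrow> x \<in> \<Omega> \<Longrightarrow> \<gamma> x = x \<Longrightarrow> \<gamma> = id"
proof -
  have "\<forall>\<gamma>\<in>\<Gamma>. \<forall>x\<in>\<Omega>. \<gamma> x = x \<longrightarrow> \<gamma> = id"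
    using act unfolding acts_properly_discontinuously_def by (elim conjE)
  from this[rule_format, of \<gamma> x] show "\<gamma> \<in> \<Gamma> \<Longrightarrow> x \<in> \<Omega> \<Longrightarrow> \<gamma> x = x \<Longrightarrow> \<gamma> = id" .
qed

lemma \<Gamma>_finite: "compact K \<Longrightarrow> K \<subseteq> \<Omega> \<Longrightarrow> finite {\<gamma>\<in>\<Gamma>. \<gamma> ` K \<inter> K \<noteq> {}}"
  using act unfolding acts_properly_discontinuously_def by (elim conjE) simp

lemma \<Gamma>_\<Omega>: "\<gamma> \<in> \<Gamma> \<Longrightarrow> x \<in> \<Omega> \<Longrightarrow> \<gamma> x \<in> \<Omega>" using \<Gamma>_image[of \<gamma>] by blast

lemma \<Gamma>_bij: "\<gamma> \<in> \<Gamma> \<Longrightarrow> bij \<gamma>" using \<Gamma>(1) PGL_group(4) by blast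

text \<open>A free action determines an element by its value at one point; transition elements
  between charts are therefore unique.\<close>

lemma \<Gamma>_eq:
  assumes "\<gamma> \<in> \<Gamma>" "\<delta> \<in> \<Gamma>" "x \<in> \<Omega>" "\<gamma> x = \<delta> x" shows "\<gamma> = \<delta>"
proof -
  have b: "bij \<delta>" using \<Gamma>_bij[OF assms(2)] .
  have "inv \<delta> \<circ> \<gamma> \<in> \<Gamma>" using \<Gamma>(3)[OF \<Gamma>(4)[OF assms(2)] assms(1)] .
  moreover have "(inv \<delta> \<circ> \<gamma>) x = x" using assms(4) b by (simp add: bij_is_inj inv_f_f)
  ultimately have "inv \<delta> \<circ> \<gamma> = id" by (rule \<Gamma>_free[OF _ assms(3)])
  then have "inv \<delta> (\<gamma> z) = z" for z by (metis comp_apply id_apply)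
  then have "\<gamma> z = \<delta> z" for z using bij_is_surj[OF b] by (metis surj_f_inv_f)
  then show ?thesis by (rule ext)
qed

abbreviation "orb \<equiv> orbit_map \<Gamma>"

lemma orb_eq_iff: "orb x = orb y \<longleftrightarrow> (\<exists>\<gamma>\<in>\<Gamma>. y = \<gamma> x)"
proof
  assume "orb x = orb y"
  moreover have "y \<in> orb y" using \<Gamma>(2) by (auto simp: orbit_map_def intro!: image_eqI[of _ _ id])
  ultimately show "\<exists>\<gamma>\<in>\<Gamma>. y = \<gamma> x" by (auto simp: orbit_map_def)
next
  assume "\<exists>\<gamma>\<in>\<Gamma>. y = \<gamma> x"
  then obtain \<gamma> where g: "\<gamma> \<in> \<Gamma>" "y = \<gamma> x" by blast
  have b: "bij \<gamma>" using \<Gamma>_bij[OF g(1)] .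
  show "orb x = orb y"
  proof (intro set_eqI iffI)
    fix z assume "z \<in> orb x"
    then obtain \<delta> where d: "\<delta> \<in> \<Gamma>" "z = \<delta> x" by (auto simp: orbit_map_def)
    have "z = (\<delta> \<circ> inv \<gamma>) y" using d g b by (simp add: bij_is_inj inv_f_f)
    then show "z \<in> orb y" unfolding orbit_map_def using \<Gamma>(3)[OF d(1) \<Gamma>(4)[OF g(1)]] by blast
  next
    fix z assume "z \<in> orb y"
    then obtain \<delta> where d: "\<delta> \<in> \<Gamma>" "z = \<delta> y" by (auto simp: orbit_map_def)
    then have "z = (\<delta> \<circ> \<gamma>) x" using g by simp
    then show "z \<in> orb x" unfolding orbit_map_def using \<Gamma>(3)[OF d(1) g(1)] by blast
  qed
qed

lemma orb_image_open:
  assumes "open S" "S \<subseteq> \<Omega>" shows "openin (orbit_space \<Omega> \<Gamma>) (orb ` S)"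
proof -
  have "{q \<in> \<Omega>. orb q \<in> orb ` S} = (\<Union>\<gamma>\<in>\<Gamma>. \<gamma> ` S)"
  proof (intro set_eqI iffI)
    fix q assume "q \<in> {q \<in> \<Omega>. orb q \<in> orb ` S}"
    then obtain x where "x \<in> S" "orb x = orb q" by auto
    then show "q \<in> (\<Union>\<gamma>\<in>\<Gamma>. \<gamma> ` S)" using orb_eq_iff by auto
  next
    fix q assume "q \<in> (\<Union>\<gamma>\<in>\<Gamma>. \<gamma> ` S)"
    then obtain \<gamma> x where gx: "\<gamma> \<in> \<Gamma>" "x \<in> S" "q = \<gamma> x" by auto
    then have "orb x = orb q" using orb_eq_iff by blast
    then show "q \<in> {q \<in> \<Omega>. orb q \<in> orb ` S}" using gx \<Gamma>_\<Omega> assms by auto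
  qed
  moreover have "open (\<Union>\<gamma>\<in>\<Gamma>. \<gamma> ` S)" by (intro open_UN ballI open_PGL_image(1)) (use assms \<Gamma>(1) in auto)
  ultimately show ?thesis unfolding openin_orbit_space_iff[OF \<Omega>_open] using assms by auto
qed

definition evenly :: "'n rp set \<Rightarrow> bool" where
  "evenly S \<longleftrightarrow> open S \<and> S \<subseteq> \<Omega> \<and> inj_on orb S"

text \<open>On a compact neighbourhood only finitely many elements can identify points. Each
  nontrivial one moves \<open>x\<close>, so a smaller neighbourhood is disjoint from its image, and
  finitely many such conditions can be met together.\<close>

lemma evenly_ex:
  assumes x: "x \<in> \<Omega>" obtains S where "evenly S" "x \<in> S"
proof -
  obtain t0 where t0: "t0 \<in> D" "x = affine_pt B t0" using x \<Omega> by blast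
  obtain e where e: "e > 0" "cball t0 e \<subseteq> D" using D t0 open_contains_cball by blast
  define K where "K = affine_pt B ` cball t0 e"
  have "compact K" unfolding K_def by (intro compact_continuous_image continuous_on_affine_pt detB) auto
  moreover have "K \<subseteq> \<Omega>" using e \<Omega> by (auto simp: K_def)
  ultimately have fin: "finite {\<gamma>\<in>\<Gamma>. \<gamma> ` K \<inter> K \<noteq> {}}" by (rule \<Gamma>_finite)
  define Q where "Q = {\<gamma>\<in>\<Gamma>. \<gamma> ` K \<inter> K \<noteq> {}} - {id}"
  have "\<exists>S. open S \<and> x \<in> S \<and> S \<inter> \<gamma> ` S = {}" if g: "\<gamma> \<in> Q" for \<gamma>
  proof -
    have gG: "\<gamma> \<in> \<Gamma>" "\<gamma> \<noteq> id" using g by (auto simp: Q_def)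
    then obtain t1 where t1: "t1 \<in> D" "\<gamma> x = affine_pt B t1" using \<Gamma>_\<Omega>[OF gG(1) x] \<Omega> by blast
    have "t0 \<noteq> t1" using \<Gamma>_free[OF gG(1) x] gG(2) t0 t1 by auto
    then obtain N0 N1 where N: "open N0" "open N1" "t0 \<in> N0" "t1 \<in> N1" "N0 \<inter> N1 = {}" using hausdorff[of t0 t1] by blast
    define S where "S = affine_pt B ` N0 \<inter> \<gamma> -` (affine_pt B ` N1)"
    have "open S" unfolding S_def using N detB gG \<Gamma>(1) by (intro open_Int open_affine_pt_image open_PGL_image(2)) auto
    moreover have "x \<in> S" using N t0 t1 by (auto simp: S_def)
    moreover have "affine_pt B ` N0 \<inter> affine_pt B ` N1 = {}"
      using N(5) affine_pt_inj[OF detB, of UNIV] by (auto simp: inj_on_def)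
    then have "S \<inter> \<gamma> ` S = {}" by (auto simp: S_def)
    ultimately show ?thesis by blast
  qed
  then obtain S where S: "\<And>\<gamma>. \<gamma> \<in> Q \<Longrightarrow> open (S \<gamma>) \<and> x \<in> S \<gamma> \<and> S \<gamma> \<inter> \<gamma> ` S \<gamma> = {}" by metis
  define T where "T = affine_pt B ` ball t0 e \<inter> (\<Inter>\<gamma>\<in>Q. S \<gamma>)"
  have "open T" unfolding T_def using S fin detB
    by (intro open_Int open_INT open_affine_pt_image) (auto simp: Q_def)
  moreover have TK: "T \<subseteq> K" by (auto simp: T_def K_def)
  moreover have "inj_on orb T"
  proof (rule inj_onI)
    fix y z assume yz: "y \<in> T" "z \<in> T" "orb y = orb z"
    then obtain \<gamma> where g: "\<gamma> \<in> \<Gamma>" "z = \<gamma> y" using orb_eq_iff by blast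
    show "y = z"
    proof (cases "\<gamma> = id")
      case False
      have "z \<in> \<gamma> ` K \<inter> K" using yz TK g by auto
      then have gQ: "\<gamma> \<in> Q" using g False by (auto simp: Q_def)
      then have "y \<in> S \<gamma>" "z \<in> S \<gamma>" using yz by (auto simp: T_def)
      then show ?thesis using S[OF gQ] g by blast
    qed (use g in simp)
  qed
  moreover have "x \<in> T" using S e t0 by (auto simp: T_def)
  ultimately show ?thesis using that[of T] \<open>K \<subseteq> \<Omega>\<close> by (auto simp: evenly_def)
qed

lemma f_props:
  shows "f ` topspace M = orb ` \<Omega>" "inj_on f (topspace M)"
    "openin (orbit_space \<Omega> \<Gamma>) S \<Longrightarrow> openin M {p \<in> topspace M. f p \<in> S}"
    "openin M W \<Longrightarrow> openin (orbit_space \<Omega> \<Gamma>) (f ` W)"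
proof -
  show "f ` topspace M = orb ` \<Omega>"
    using homeomorphic_imp_surjective_map[OF f] topspace_orbit_space_eq[OF \<Omega>_open] by simp
  show "inj_on f (topspace M)" using homeomorphic_imp_injective_map[OF f] .
  show "openin (orbit_space \<Omega> \<Gamma>) S \<Longrightarrow> openin M {p \<in> topspace M. f p \<in> S}"
    using homeomorphic_imp_continuous_map[OF f] openin_continuous_map_preimage by blast
  show "openin M W \<Longrightarrow> openin (orbit_space \<Omega> \<Gamma>) (f ` W)"
    using homeomorphic_imp_open_map[OF f] by (simp add: open_map_def)
qed

text \<open>Charts of \<open>M\<close> built from evenly covered sets. They are used in place of
  \<open>\<A>\<close> because their transition maps are group elements and can be lifted
  consistently.\<close>

definition pull :: "'n rp set \<Rightarrow> ('a, 'n) chart" where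
  "pull S = ({p \<in> topspace M. f p \<in> orb ` S}, \<lambda>p. inv_into S orb (f p))"

definition \<B> where "\<B> = pull ` Collect evenly"

lemma pull:
  assumes S: "evenly S"
  shows "p \<in> fst (pull S) \<longleftrightarrow> p \<in> topspace M \<and> f p \<in> orb ` S"
    "p \<in> fst (pull S) \<Longrightarrow> snd (pull S) p \<in> S" "p \<in> fst (pull S) \<Longrightarrow> orb (snd (pull S) p) = f p"
    "p \<in> topspace M \<Longrightarrow> x \<in> S \<Longrightarrow> orb x = f p \<Longrightarrow> p \<in> fst (pull S) \<and> snd (pull S) p = x"
proof -
  show "p \<in> fst (pull S) \<longleftrightarrow> p \<in> topspace M \<and> f p \<in> orb ` S" by (simp add: pull_def)
  show "p \<in> fst (pull S) \<Longrightarrow> snd (pull S) p \<in> S" by (simp add: pull_def inv_into_into)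
  show "p \<in> fst (pull S) \<Longrightarrow> orb (snd (pull S) p) = f p" by (simp add: pull_def f_inv_into_f)
  assume p: "p \<in> topspace M" "x \<in> S" "orb x = f p"
  have "inv_into S orb (orb x) = x" using S p by (intro inv_into_f_f) (auto simp: evenly_def)
  then show "p \<in> fst (pull S) \<and> snd (pull S) p = x" using p by (auto simp: pull_def)
qed

lemma pull_image: assumes S: "evenly S" shows "snd (pull S) ` fst (pull S) = S"
proof (intro equalityI subsetI)
  fix x assume x: "x \<in> S"
  then have "orb x \<in> f ` topspace M" using S f_props(1) by (auto simp: evenly_def)
  then obtain p where "p \<in> topspace M" "orb x = f p" by blast
  then show "x \<in> snd (pull S) ` fst (pull S)" using pull(4)[OF S _ x] by (metis imageI)
qed (use pull(2)[OF S] in auto)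

lemma pull_preimage_open:
  assumes S: "evenly S" and T: "open T" shows "openin M {p \<in> fst (pull S). snd (pull S) p \<in> T}"
proof -
  have "{p \<in> fst (pull S). snd (pull S) p \<in> T} = {p \<in> topspace M. f p \<in> orb ` (S \<inter> T)}"
  proof (intro set_eqI iffI)
    fix p assume "p \<in> {p \<in> fst (pull S). snd (pull S) p \<in> T}"
    then show "p \<in> {p \<in> topspace M. f p \<in> orb ` (S \<inter> T)}"
      using pull(1,2,3)[OF S, of p] by (auto intro!: image_eqI[of _ _ "snd (pull S) p"])
  next
    fix p assume "p \<in> {p \<in> topspace M. f p \<in> orb ` (S \<inter> T)}"
    then obtain x where x: "p \<in> topspace M" "x \<in> S" "x \<in> T" "orb x = f p" by auto
    then show "p \<in> {p \<in> fst (pull S). snd (pull S) p \<in> T}" using pull(4)[OF S x(1,2,4)] by simp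
  qed
  moreover have "openin (orbit_space \<Omega> \<Gamma>) (orb ` (S \<inter> T))"
    using S T by (intro orb_image_open) (auto simp: evenly_def)
  ultimately show ?thesis using f_props(3) by simp
qed

lemma pull_open: assumes S: "evenly S" shows "openin M (fst (pull S))"
  using pull_preimage_open[OF S open_UNIV] by simp

lemma pull_chart: assumes S: "evenly S" shows "proj_chart M (pull S)"
proof -
  have sub: "fst (pull S) \<subseteq> topspace M" using pull(1)[OF S] by blast
  have tsp: "topspace (subtopology M (fst (pull S))) = fst (pull S)" using sub by auto
  have oS: "open S" using S by (simp add: evenly_def)
  have "homeomorphic_map (subtopology M (fst (pull S))) (top_of_set S) (snd (pull S))"
  proof (rule bijective_open_imp_homeomorphic_map)
    show "snd (pull S) ` topspace (subtopology M (fst (pull S))) = topspace (top_of_set S)"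
      unfolding tsp using pull_image[OF S] by simp
    show "continuous_map (subtopology M (fst (pull S))) (top_of_set S) (snd (pull S))"
      unfolding continuous_map_def tsp
    proof (intro conjI allI impI)
      show "snd (pull S) \<in> fst (pull S) \<rightarrow> topspace (top_of_set S)" using pull(2)[OF S] by simp
      fix T assume "openin (top_of_set S) T"
      then have "open T" using oS openin_open_eq by blast
      then have "openin M {p \<in> fst (pull S). snd (pull S) p \<in> T}" by (rule pull_preimage_open[OF S])
      then show "openin (subtopology M (fst (pull S))) {p \<in> fst (pull S). snd (pull S) p \<in> T}"
        unfolding openin_open_subtopology[OF pull_open[OF S]] by auto
    qed
    show "open_map (subtopology M (fst (pull S))) (top_of_set S) (snd (pull S))"
      unfolding open_map_def
    proof (intro allI impI)
      fix W assume "openin (subtopology M (fst (pull S))) W"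
      then have W: "openin M W" "W \<subseteq> fst (pull S)" using openin_open_subtopology[OF pull_open[OF S]] by auto
      have "snd (pull S) ` W = S \<inter> {q \<in> \<Omega>. orb q \<in> f ` W}"
      proof (intro set_eqI iffI)
        fix x assume "x \<in> snd (pull S) ` W"
        then obtain p where p: "p \<in> W" "x = snd (pull S) p" by blast
        then have pf: "p \<in> fst (pull S)" using W by blast
        then have "x \<in> S" "orb x = f p" using pull(2,3)[OF S] p by auto
        then show "x \<in> S \<inter> {q \<in> \<Omega>. orb q \<in> f ` W}" using S p by (auto simp: evenly_def)
      next
        fix x assume "x \<in> S \<inter> {q \<in> \<Omega>. orb q \<in> f ` W}"
        then obtain p where p: "x \<in> S" "p \<in> W" "orb x = f p" by auto
        then have "p \<in> topspace M" using W sub by blast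
        then show "x \<in> snd (pull S) ` W" using pull(4)[OF S _ p(1,3)] p(2) by (metis imageI)
      qed
      moreover have "open {q \<in> \<Omega>. orb q \<in> f ` W}"
        using f_props(4)[OF W(1)] unfolding openin_orbit_space_iff[OF \<Omega>_open] by (rule conjunct2)
      ultimately show "openin (top_of_set S) (snd (pull S) ` W)" by (simp add: openin_open_Int)
    qed
    show "inj_on (snd (pull S)) (topspace (subtopology M (fst (pull S))))"
      unfolding tsp
    proof (rule inj_onI)
      fix p q assume pq: "p \<in> fst (pull S)" "q \<in> fst (pull S)" "snd (pull S) p = snd (pull S) q"
      then have "f p = f q" using pull(3)[OF S] by metis
      then show "p = q" using f_props(2) pq sub by (auto simp: inj_on_def)
    qed
  qed
  then show ?thesis unfolding proj_chart_def pull_image[OF S] using pull_open[OF S] oS by simp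
qed

text \<open>The element that matches the two chart values at \<open>p\<close> works as long as it
  keeps the first value inside \<open>S'\<close>, on which \<open>orb\<close> is injective.\<close>

lemma transition_ex:
  assumes S: "evenly S" "evenly S'" and p: "p \<in> fst (pull S)" "p \<in> fst (pull S')"
  obtains \<gamma> W where "\<gamma> \<in> \<Gamma>" "openin M W" "p \<in> W" "W \<subseteq> fst (pull S) \<inter> fst (pull S')"
    "\<And>q. q \<in> W \<Longrightarrow> snd (pull S') q = \<gamma> (snd (pull S) q)"
proof -
  have "orb (snd (pull S) p) = orb (snd (pull S') p)" using pull(3) S p by simp
  then obtain \<gamma> where g: "\<gamma> \<in> \<Gamma>" "snd (pull S') p = \<gamma> (snd (pull S) p)" using orb_eq_iff by blast
  have "open (\<gamma> -` S')" using g \<Gamma>(1) S(2) by (intro open_PGL_image(2)) (auto simp: evenly_def)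
  then have o: "openin M ({q \<in> fst (pull S). snd (pull S) q \<in> \<gamma> -` S'} \<inter> fst (pull S'))" (is "openin M ?W")
    using pull_preimage_open[OF S(1)] pull_open[OF S(2)] by (intro openin_Int)
  show ?thesis
  proof (rule that[OF g(1) o])
    show "p \<in> ?W" using p g pull(2)[OF S(2) p(2)] by simp
    fix q assume q: "q \<in> ?W"
    have "orb (snd (pull S) q) = orb (\<gamma> (snd (pull S) q))" using orb_eq_iff g by blast
    then have "orb (\<gamma> (snd (pull S) q)) = f q" using pull(3)[OF S(1)] q by simp
    moreover have "q \<in> topspace M" using q pull(1)[OF S(1)] by blast
    ultimately show "snd (pull S') q = \<gamma> (snd (pull S) q)" using pull(4)[OF S(2)] q by blast
  qed auto
qed

lemma mfd: "proj_flat_manifold M \<B>"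
  unfolding proj_flat_manifold_def
proof (intro conjI ballI)
  show "Hausdorff_space M" "second_countable M" using mfdA by (auto simp: proj_flat_manifold_def)
  show "proj_chart M c" if "c \<in> \<B>" for c using that pull_chart by (auto simp: \<B>_def)
  show "topspace M = (\<Union>c\<in>\<B>. fst c)"
  proof (intro equalityI subsetI)
    fix p assume p: "p \<in> topspace M"
    then obtain x where x: "x \<in> \<Omega>" "f p = orb x" using f_props(1) by blast
    obtain S where S: "evenly S" "x \<in> S" using evenly_ex[OF x(1)] by blast
    then have "p \<in> fst (pull S)" using pull(4)[OF S(1) p S(2)] x by simp
    then show "p \<in> (\<Union>c\<in>\<B>. fst c)" using S by (auto simp: \<B>_def)
  next
    fix p assume "p \<in> (\<Union>c\<in>\<B>. fst c)" then show "p \<in> topspace M" using pull(1) by (auto simp: \<B>_def)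
  qed
  fix c c' assume "c \<in> \<B>" "c' \<in> \<B>"
  then obtain S S' where S: "evenly S" "c = pull S" "evenly S'" "c' = pull S'" by (auto simp: \<B>_def)
  show "proj_compatible M c c'" unfolding proj_compatible_def S
  proof
    fix p assume "p \<in> fst (pull S) \<inter> fst (pull S')"
    then obtain \<gamma> W where "\<gamma> \<in> \<Gamma>" "openin M W" "p \<in> W" "W \<subseteq> fst (pull S) \<inter> fst (pull S')"
      "\<And>q. q \<in> W \<Longrightarrow> snd (pull S') q = \<gamma> (snd (pull S) q)" using transition_ex[OF S(1,3)] by blast
    then show "\<exists>\<gamma>\<in>PGL. \<exists>W. openin M W \<and> p \<in> W \<and> W \<subseteq> fst (pull S) \<inter> fst (pull S') \<and> (\<forall>q\<in>W. snd (pull S') q = \<gamma> (snd (pull S) q))"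
      by (intro bexI[of _ \<gamma>] exI[of _ W]) (use \<Gamma>(1) in auto)
  qed
qed

lemma same: "same_structure M \<A> \<B>"
  unfolding same_structure_def
proof (intro conjI mfdA mfd ballI)
  fix c c' assume c: "c \<in> \<A>" "c' \<in> \<B>"
  then obtain S where S: "evenly S" "c' = pull S" by (auto simp: \<B>_def)
  define d where "d = (orb ` S, inv_into S orb)"
  have d: "d \<in> orbit_atlas \<Omega> \<Gamma>" using S by (auto simp: d_def orbit_atlas_def evenly_def)
  show "proj_compatible M c c'" unfolding proj_compatible_def
  proof
    fix p assume p: "p \<in> fst c \<inter> fst c'"
    then have "p \<in> fst c" "f p \<in> fst d" using S pull(1)[OF S(1)] by (auto simp: d_def)
    then obtain \<gamma> W where W: "\<gamma> \<in> PGL" "openin M W" "p \<in> W" "W \<subseteq> fst c" "f ` W \<subseteq> fst d" "\<forall>q\<in>W. snd d (f q) = \<gamma> (snd c q)"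
      using f_proj[OF c(1) d] by metis
    have "W \<subseteq> fst c'"
    proof
      fix q assume "q \<in> W"
      then have "q \<in> topspace M" "f q \<in> orb ` S" using openin_subset[OF W(2)] W(5) by (auto simp: d_def)
      then show "q \<in> fst c'" unfolding S(2) pull(1)[OF S(1)] by simp
    qed
    moreover have "snd c' q = snd d (f q)" for q by (simp add: S(2) pull_def d_def)
    ultimately show "\<exists>\<gamma>\<in>PGL. \<exists>W. openin M W \<and> p \<in> W \<and> W \<subseteq> fst c \<inter> fst c' \<and> (\<forall>q\<in>W. snd c' q = \<gamma> (snd c q))"
      using W by (intro bexI[of _ \<gamma>] exI[of _ W]) auto
  qed
qed

section \<open>Canonical unimodular lifts and the cocycle\<close>

section \<open>Lifting the group to the cone\<close>

definition C where "C = pcone ((\<lambda>t. B *v hom_vec t) ` D)"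

lemma C_props: "open C" "convex C" "is_pcone C" "0 \<notin> C" "\<Omega> = proj_pt ` C"
  unfolding C_def \<Omega> affine_pt_image
  using detB D by (auto simp: open_pcone_affine convex_pcone convex_affine_image is_pcone_pcone pcone_affine_0)

lemma C_nz: "x \<in> C \<Longrightarrow> x \<noteq> 0" using C_props(4) by auto

lemma C_pos: assumes "x \<in> C" "r *\<^sub>R x \<in> C" shows "r > 0"
proof -
  have "(matrix_inv B *v x) $ None > 0" "(matrix_inv B *v (r *\<^sub>R x)) $ None > 0"
    using assms unfolding C_def pcone_affine[OF detB] by auto
  then show ?thesis by (simp add: matrix_vector_mult_scaleR zero_less_mult_iff)
qed

lemma C_line:
  assumes "x \<in> C" "y \<noteq> 0" "proj_pt y \<in> \<Omega>" shows "y \<in> C \<or> - y \<in> C"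
proof -
  obtain z where z: "z \<in> C" "proj_pt z = proj_pt y" using assms C_props(5) by auto
  then obtain r where r: "y = r *\<^sub>R z" using proj_pt_eq_iff[OF C_nz assms(2)] by blast
  show ?thesis
  proof (cases "r > 0")
    case True then show ?thesis using is_pconeD[OF C_props(3) z(1)] r by blast
  next
    case False
    have "- r > 0" using False r assms(2) by (cases "r = 0") auto
    then have "(- r) *\<^sub>R z \<in> C" using is_pconeD[OF C_props(3) z(1)] by blast
    then show ?thesis using r by simp
  qed
qed

text \<open>Lifts that map the cone to itself; this condition settles the sign left open by the
  projective map and the determinant.\<close>

definition Gh where "Gh = {A \<in> SLpm. (\<lambda>x. A *v x) ` C = C \<and> proj_map A \<in> \<Gamma>}"

lemma C_ex: obtains x where "x \<in> C"
  using D(4) subset_pcone[of "(\<lambda>t. B *v hom_vec t) ` D"] unfolding C_def by blast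

text \<open>Positive scaling normalizes the determinant up to sign. By connectedness the image of
  \<open>C\<close> lies entirely in \<open>C\<close> or entirely in its negative, and in the second
  case the matrix is negated.\<close>

lemma lift_ex:
  assumes g: "\<gamma> \<in> \<Gamma>" obtains A where "A \<in> Gh" "proj_map A = \<gamma>"
proof -
  obtain A0 where A0: "det A0 \<noteq> 0" "\<gamma> = proj_map A0" using g \<Gamma>(1) PGL_E by blast
  obtain r where r: "r > 0" "mat r ** A0 \<in> SLpm" using normalize_SLpm[OF A0(1)] by blast
  define A1 where "A1 = mat r ** A0"
  have A1: "A1 \<in> SLpm" "det A1 \<noteq> 0" "proj_map A1 = \<gamma>"
    using r A0 proj_map_scaled[OF A0(1), of r] SLpm_nz by (auto simp: A1_def)
  have im: "proj_pt (A1 *v x) \<in> \<Omega>" "A1 *v x \<noteq> 0" if "x \<in> C" for x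
  proof -
    have "proj_pt x \<in> \<Omega>" using that C_props(5) by blast
    then have "\<gamma> (proj_pt x) \<in> \<Omega>" using \<Gamma>_\<Omega>[OF g] by blast
    then show "proj_pt (A1 *v x) \<in> \<Omega>" using proj_map_pt[OF A1(2) C_nz[OF that]] A1(3) by simp
    show "A1 *v x \<noteq> 0" using A1(2) C_nz[OF that] by (simp add: det_nz_mult_zero)
  qed
  have cov: "C \<subseteq> (\<lambda>x. A1 *v x) -` C \<union> (\<lambda>x. A1 *v x) -` (uminus ` C)"
  proof
    fix x assume x: "x \<in> C"
    then have "A1 *v x \<in> C \<or> - (A1 *v x) \<in> C" using C_line[OF x im(2)[OF x] im(1)[OF x]] by blast
    then show "x \<in> (\<lambda>x. A1 *v x) -` C \<union> (\<lambda>x. A1 *v x) -` (uminus ` C)" by force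
  qed
  have oneg: "open (uminus ` C)" using C_props(1) by (rule open_negations)
  have disj: "C \<inter> uminus ` C = {}"
  proof (rule ccontr)
    assume "C \<inter> uminus ` C \<noteq> {}"
    then obtain y where "y \<in> C" "(-1) *\<^sub>R y \<in> C" by auto
    then show False using C_pos by fastforce
  qed
  \<comment> \<open>The image of the connected set \<open>C\<close> is covered by the disjoint open
    sets \<open>C\<close> and its negative, so one sign serves all of \<open>C\<close>.\<close>
  have "(\<lambda>x. A1 *v x) -` C \<inter> C = {} \<or> (\<lambda>x. A1 *v x) -` (uminus ` C) \<inter> C = {}"
    by (rule connectedD[OF convex_connected[OF C_props(2)]])
      (use linear_vimage_open[OF matrix_vector_mul_linear] C_props(1) oneg cov disj in auto)
  then obtain s :: real where s: "s = 1 \<or> s = -1" "\<And>x. x \<in> C \<Longrightarrow> s *\<^sub>R (A1 *v x) \<in> C"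
  proof
    assume "(\<lambda>x. A1 *v x) -` C \<inter> C = {}"
    then have "\<And>x. x \<in> C \<Longrightarrow> (-1) *\<^sub>R (A1 *v x) \<in> C" using cov by force
    then show ?thesis by (intro that[of "-1"]) auto
  next
    assume "(\<lambda>x. A1 *v x) -` (uminus ` C) \<inter> C = {}"
    then have "\<And>x. x \<in> C \<Longrightarrow> 1 *\<^sub>R (A1 *v x) \<in> C" using cov by force
    then show ?thesis by (intro that[of 1]) auto
  qed
  \<comment> \<open>The sign changes the determinant at most by a sign and does not affect the
    projective map.\<close>
  define A where "A = mat s ** A1"
  have Ax: "A *v x = s *\<^sub>R (A1 *v x)" for x by (simp add: A_def scaled_matrix)
  have s0: "s \<noteq> 0" using s(1) by auto
  have dA: "det A = s ^ CARD('n option) * det A1" unfolding A_def by (rule scaled_matrix)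
  have "s ^ CARD('n option) = 1 \<or> s ^ CARD('n option) = -1" using s(1) by (auto simp: minus_one_power_iff)
  then have ASL: "A \<in> SLpm" using dA A1(1) by (auto simp: SLpm_def)
  have pA: "proj_map A = \<gamma>" unfolding A_def using proj_map_scaled[OF A1(2) s0] A1(3) by simp
  have "(\<lambda>x. A *v x) ` C = C"
  proof (intro equalityI subsetI)
    fix y assume "y \<in> (\<lambda>x. A *v x) ` C" then show "y \<in> C" using s(2) Ax by auto
  next
    fix y assume y: "y \<in> C"
    then have "proj_pt y \<in> \<gamma> ` \<Omega>" using C_props(5) \<Gamma>_image[OF g] by auto
    then obtain x where x: "x \<in> C" "proj_pt y = \<gamma> (proj_pt x)" using C_props(5) by auto
    have Axn: "A *v x \<in> C" using s(2)[OF x(1)] Ax by simp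
    have "proj_pt (A *v x) = proj_pt y" using proj_map_pt[OF SLpm_nz[OF ASL] C_nz[OF x(1)]] pA x(2) by simp
    then obtain r where r: "y = r *\<^sub>R (A *v x)" using proj_pt_eq_iff[OF C_nz[OF Axn] C_nz[OF y]] by blast
    then have "r > 0" using C_pos[OF Axn] y by blast
    then have "r *\<^sub>R x \<in> C" "y = A *v (r *\<^sub>R x)" using is_pconeD[OF C_props(3) x(1)] r by (auto simp: matrix_vector_mult_scaleR)
    then show "y \<in> (\<lambda>x. A *v x) ` C" by blast
  qed
  then have "A \<in> Gh" using ASL pA g by (simp add: Gh_def)
  then show ?thesis using that pA by blast
qed

lemma Gh_nz: "A \<in> Gh \<Longrightarrow> det A \<noteq> 0" by (auto simp: Gh_def SLpm_nz)

lemma Gh_C: "A \<in> Gh \<Longrightarrow> x \<in> C \<Longrightarrow> A *v x \<in> C" by (auto simp: Gh_def)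

text \<open>Two lifts are proportional. The factor is positive because both preserve
  \<open>C\<close>, and the determinants force it to be \<open>1\<close>. Hence lifting is
  multiplicative.\<close>

lemma lift_unique:
  assumes A: "A \<in> Gh" "A' \<in> Gh" "proj_map A = proj_map A'" shows "A = A'"
proof -
  obtain c where c: "c \<noteq> 0" "\<And>v. A' *v v = c *\<^sub>R (A *v v)"
    using proj_map_eq_iff[OF Gh_nz[OF A(1)] Gh_nz[OF A(2)]] A(3) by auto
  obtain x where x: "x \<in> C" using C_ex by blast
  have "c > 0" using C_pos[OF Gh_C[OF A(1) x], of c] Gh_C[OF A(2) x] c(2)[of x] by simp
  have "A' = mat c ** A" by (subst matrix_eq) (simp add: scaled_matrix c(2))
  then have "det A' = c ^ CARD('n option) * det A" by (simp add: scaled_matrix)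
  moreover have "\<bar>det A\<bar> = 1" "\<bar>det A'\<bar> = 1" using A by (auto simp: Gh_def SLpm_def)
  ultimately have "c ^ CARD('n option) = 1" using \<open>c > 0\<close> by (simp add: abs_mult)
  then have "c = 1" using \<open>c > 0\<close> power_eq_iff_eq_base[of "CARD('n option)" c 1] by auto
  then have "A' *v v = A *v v" for v using c(2) by simp
  then show ?thesis by (metis matrix_eq)
qed

lemma Gh_mult: assumes A: "A \<in> Gh" "A' \<in> Gh" shows "A ** A' \<in> Gh"
proof -
  have "(\<lambda>x. (A ** A') *v x) ` C = (\<lambda>x. A *v x) ` (\<lambda>x. A' *v x) ` C"
    by (simp add: image_image matrix_vector_mul_assoc)
  then have 1: "(\<lambda>x. (A ** A') *v x) ` C = C" using A by (simp add: Gh_def)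
  have "proj_map (A ** A') = proj_map A \<circ> proj_map A'"
    using proj_map_comp[OF Gh_nz[OF A(1)] Gh_nz[OF A(2)]] by (simp add: fun_eq_iff)
  then have 2: "proj_map (A ** A') \<in> \<Gamma>" using A \<Gamma>(3) by (simp add: Gh_def)
  have "A ** A' \<in> SLpm" using A by (auto simp: Gh_def SLpm_def det_mul)
  then show ?thesis using 1 2 by (simp add: Gh_def)
qed

definition lft where "lft \<gamma> = (SOME A. A \<in> Gh \<and> proj_map A = \<gamma>)"

lemma lft: assumes "\<gamma> \<in> \<Gamma>" shows "lft \<gamma> \<in> Gh" "proj_map (lft \<gamma>) = \<gamma>"
proof -
  have "\<exists>A. A \<in> Gh \<and> proj_map A = \<gamma>" using lift_ex[OF assms] by blast
  then have "lft \<gamma> \<in> Gh \<and> proj_map (lft \<gamma>) = \<gamma>" unfolding lft_def by (rule someI_ex)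
  then show "lft \<gamma> \<in> Gh" "proj_map (lft \<gamma>) = \<gamma>" by auto
qed

lemma lft_comp: assumes "\<gamma> \<in> \<Gamma>" "\<delta> \<in> \<Gamma>" shows "lft \<gamma> ** lft \<delta> = lft (\<gamma> \<circ> \<delta>)"
proof (rule lift_unique)
  show "lft \<gamma> ** lft \<delta> \<in> Gh" using Gh_mult lft assms by blast
  show "lft (\<gamma> \<circ> \<delta>) \<in> Gh" using lft \<Gamma>(3) assms by blast
  show "proj_map (lft \<gamma> ** lft \<delta>) = proj_map (lft (\<gamma> \<circ> \<delta>))"
    using proj_map_comp[OF Gh_nz[OF lft(1)[OF assms(1)]] Gh_nz[OF lft(1)[OF assms(2)]]] lft(2) assms \<Gamma>(3)
    by (simp add: fun_eq_iff)
qed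

text \<open>By freeness the choice is unique, so it is locally constant and composes along triple
  overlaps.\<close>

definition tr where "tr c c' p = (SOME \<gamma>. \<gamma> \<in> \<Gamma> \<and> snd c' p = \<gamma> (snd c p))"

definition g :: "('a, 'n) lift" where "g c c' p = lft (tr c c' p)"

lemma chart_\<Omega>: "c \<in> \<B> \<Longrightarrow> p \<in> fst c \<Longrightarrow> snd c p \<in> \<Omega>"
proof -
  assume c: "c \<in> \<B>" "p \<in> fst c"
  then obtain S where S: "evenly S" "c = pull S" by (auto simp: \<B>_def)
  then have "snd c p \<in> S" using pull(2)[OF S(1)] c(2) by simp
  then show "snd c p \<in> \<Omega>" using S(1) by (auto simp: evenly_def)
qed

lemma tr:
  assumes "c \<in> \<B>" "c' \<in> \<B>" "p \<in> fst c" "p \<in> fst c'"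
  shows "tr c c' p \<in> \<Gamma>" "snd c' p = tr c c' p (snd c p)"
    "\<gamma> \<in> \<Gamma> \<Longrightarrow> snd c' p = \<gamma> (snd c p) \<Longrightarrow> tr c c' p = \<gamma>"
proof -
  obtain S S' where S: "evenly S" "c = pull S" "evenly S'" "c' = pull S'" using assms by (auto simp: \<B>_def)
  obtain \<gamma> W where "\<gamma> \<in> \<Gamma>" "p \<in> W" "\<And>q. q \<in> W \<Longrightarrow> snd (pull S') q = \<gamma> (snd (pull S) q)"
    using transition_ex[OF S(1,3), of p] assms S by metis
  then have "\<exists>\<gamma>. \<gamma> \<in> \<Gamma> \<and> snd c' p = \<gamma> (snd c p)" using S by blast
  then have "tr c c' p \<in> \<Gamma> \<and> snd c' p = tr c c' p (snd c p)" unfolding tr_def by (rule someI_ex)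
  then show *: "tr c c' p \<in> \<Gamma>" "snd c' p = tr c c' p (snd c p)" by auto
  show "tr c c' p = \<gamma>" if "\<gamma> \<in> \<Gamma>" "snd c' p = \<gamma> (snd c p)" for \<gamma>
    using \<Gamma>_eq[OF *(1) that(1) chart_\<Omega>[OF assms(1,3)]] * that by simp
qed

lemma lift: "transition_lift M \<B> g"
  unfolding transition_lift_def
proof (intro conjI ballI)
  fix c c' p assume c: "c \<in> \<B>" "c' \<in> \<B>" "p \<in> fst c \<inter> fst c'"
  then obtain S S' where S: "evenly S" "c = pull S" "evenly S'" "c' = pull S'" by (auto simp: \<B>_def)
  have t: "tr c c' p \<in> \<Gamma>" using tr(1) c by simp
  then show "g c c' p \<in> SLpm" using lft(1) by (simp add: g_def Gh_def)
  obtain \<gamma> W where W: "\<gamma> \<in> \<Gamma>" "openin M W" "p \<in> W" "W \<subseteq> fst c \<inter> fst c'" "\<And>q. q \<in> W \<Longrightarrow> snd c' q = \<gamma> (snd c q)"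
    using transition_ex[OF S(1,3), of p] c S by auto
  have tg: "tr c c' q = \<gamma>" if "q \<in> W" for q using tr(3)[OF c(1,2) _ _ W(1) W(5)[OF that]] that W(4) by blast
  show "\<exists>W. openin M W \<and> p \<in> W \<and> W \<subseteq> fst c \<inter> fst c' \<and>
           (\<forall>q\<in>W. g c c' q = g c c' p \<and> snd c' q = proj_map (g c c' p) (snd c q))"
    using W tg lft(2)[OF W(1)] by (intro exI[of _ W]) (auto simp: g_def)
next
  fix c c' c'' p assume c: "c \<in> \<B>" "c' \<in> \<B>" "c'' \<in> \<B>" "p \<in> fst c \<inter> fst c' \<inter> fst c''"
  have t: "tr c c' p \<in> \<Gamma>" "tr c' c'' p \<in> \<Gamma>" using tr(1) c by auto
  have "snd c'' p = (tr c' c'' p \<circ> tr c c' p) (snd c p)" using tr(2)[of c c' p] tr(2)[of c' c'' p] c by simp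
  then have "tr c c'' p = tr c' c'' p \<circ> tr c c' p" using tr(3)[of c c'' p] c \<Gamma>(3)[OF t(2,1)] by simp
  then show "g c' c'' p ** g c c' p = g c c'' p" using lft_comp[OF t(2,1)] by (simp add: g_def)
qed

sublocale lifted_atlas M \<B> g
  by unfold_locales (fact mfd, fact lift)

lemma g_Gh: "c \<in> \<B> \<Longrightarrow> c' \<in> \<B> \<Longrightarrow> p \<in> fst c \<Longrightarrow> p \<in> fst c' \<Longrightarrow> g c c' p \<in> Gh"
  unfolding g_def using lft(1) tr(1) by blast

section \<open>Orientation, and the section induced by the characteristic function\<close>

section \<open>The invariant section\<close>

text \<open>One chart may decide positivity for all, since the lifts preserve \<open>C\<close>; see
  \<open>P_iff\<close>.\<close>

definition P where "P p = {w \<in> fibre p. \<exists>c\<in>\<B>. p \<in> fst c \<and> w c \<in> C}"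

lemma P_iff:
  assumes w: "w \<in> fibre p" and c: "c \<in> \<B>" "p \<in> fst c" shows "w \<in> P p \<longleftrightarrow> w c \<in> C"
proof
  assume "w \<in> P p"
  then obtain d where d: "d \<in> \<B>" "p \<in> fst d" "w d \<in> C" by (auto simp: P_def)
  then show "w c \<in> C" using fibreD(2)[OF w d(1) c(1) d(2) c(2)] Gh_C[OF g_Gh[OF d(1) c(1) d(2) c(2)] d(3)] by simp
qed (use w c in \<open>auto simp: P_def\<close>)

lemma C_rep: assumes "q \<in> \<Omega>" obtains x where "x \<in> C" "proj_pt x = q"
  using assms C_props(5) by auto

text \<open>The slice \<open>D\<close> of the cone gives a continuous representative in
  \<open>C\<close> of each point of the domain.\<close>

lemma coords:
  obtains X where "\<And>q. q \<in> \<Omega> \<Longrightarrow> X q \<in> C" "\<And>q. q \<in> \<Omega> \<Longrightarrow> proj_pt (X q) = q" "continuous_on \<Omega> X"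
proof -
  obtain k where k: "homeomorphism D \<Omega> (affine_pt B) k"
    using affine_pt_homeomorphism[OF detB D(1)] \<Omega> by metis
  have kD: "k q \<in> D" "affine_pt B (k q) = q" if "q \<in> \<Omega>" for q using k that by (auto simp: homeomorphism_def)
  show ?thesis
  proof (rule that[of "\<lambda>q. B *v hom_vec (k q)"])
    show "B *v hom_vec (k q) \<in> C" if "q \<in> \<Omega>" for q
      unfolding C_def using kD(1)[OF that] subset_pcone[of "(\<lambda>t. B *v hom_vec t) ` D"] by blast
    show "proj_pt (B *v hom_vec (k q)) = q" if "q \<in> \<Omega>" for q using kD(2)[OF that] by (simp add: affine_pt_def)
    show "continuous_on \<Omega> (\<lambda>q. B *v hom_vec (k q))"
      using k by (intro continuous_on_compose2[OF matrix_vector_mult_linear_continuous_on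
        continuous_on_compose2[OF continuous_on_hom_vec[of UNIV]]]) (auto simp: homeomorphism_def)
  qed
qed

lemma mem_own_line: "x \<noteq> 0 \<Longrightarrow> x \<in> line_of (proj_pt (x :: real ^ 'n option))"
  by (subst mem_line_proj_pt) (auto intro: exI[of _ 1])

text \<open>The continuous representative \<open>X\<close>, read in one chart \<open>c\<close>, is a
  positive section over all of \<open>fst c\<close>.\<close>

lemma orientation: "taut_orientation M \<B> g P"
  unfolding taut_orientation_def
proof (intro ballI conjI)
  fix p assume p: "p \<in> topspace M"
  then obtain c where c: "c \<in> \<B>" "p \<in> fst c" using topspace_charts by blast
  obtain X where X: "\<And>q. q \<in> \<Omega> \<Longrightarrow> X q \<in> C" "\<And>q. q \<in> \<Omega> \<Longrightarrow> proj_pt (X q) = q" "continuous_on \<Omega> X"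
    using coords by blast
  define s where "s q = elem q c (X (snd c q))" for q
  have s: "s q \<in> fibre q" "s q c = X (snd c q)" "s q \<in> P q" "X (snd c q) \<in> C" if q: "q \<in> fst c" for q
  proof -
    have qO: "snd c q \<in> \<Omega>" using chart_\<Omega> c(1) q by blast
    have "X (snd c q) \<in> line_of (snd c q)" using mem_own_line[OF C_nz[OF X(1)[OF qO]]] X(2)[OF qO] by simp
    then show 1: "s q \<in> fibre q" unfolding s_def by (rule elem_fibre[OF c(1) q])
    show 2: "s q c = X (snd c q)" unfolding s_def by (rule elem_self[OF c(1) q])
    show "X (snd c q) \<in> C" using X(1)[OF qO] .
    then show "s q \<in> P q" using P_iff[OF 1 c(1) q] 2 by simp
  qed
  show "\<exists>w\<in>fibre p. w \<noteq> (\<lambda>c. 0) \<and> P p = {\<lambda>c. r *\<^sub>R w c |r. 0 < r}"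
  proof (intro bexI[of _ "s p"] conjI)
    show "s p \<in> fibre p" using s c by blast
    show "s p \<noteq> (\<lambda>c. 0)" using s(2)[OF c(2)] C_nz[OF s(4)[OF c(2)]] by auto
    show "P p = {\<lambda>c. r *\<^sub>R s p c |r. 0 < r}"
    proof (intro set_eqI iffI)
      fix w assume w: "w \<in> P p"
      then have wf: "w \<in> fibre p" by (simp add: P_def)
      have wC: "w c \<in> C" using P_iff[OF wf c] w by simp
      have "w c \<in> line_of (snd c p)" using fibreD(1)[OF wf c] .
      then have "w c \<in> line_of (proj_pt (X (snd c p)))" using X(2) chart_\<Omega>[OF c] by simp
      then obtain r where r: "w c = r *\<^sub>R X (snd c p)" using mem_line_proj_pt[OF C_nz[OF s(4)[OF c(2)]]] by blast
      then have "r > 0" using C_pos[OF s(4)[OF c(2)]] wC by simp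
      moreover have "w = (\<lambda>d. r *\<^sub>R s p d)" using fibre_elem[OF wf c] r by (simp add: s_def elem_scale)
      ultimately show "w \<in> {\<lambda>c. r *\<^sub>R s p c |r. 0 < r}" by blast
    next
      fix w assume "w \<in> {\<lambda>c. r *\<^sub>R s p c |r. 0 < r}"
      then obtain r where r: "r > 0" "w = (\<lambda>d. r *\<^sub>R s p d)" by blast
      have "w \<in> fibre p" using r fibre_scale s(1)[OF c(2)] by blast
      moreover have "w c \<in> C" using r is_pconeD[OF C_props(3) s(4)[OF c(2)]] s(2)[OF c(2)] by simp
      ultimately show "w \<in> P p" using P_iff c by blast
    qed
  qed
  show "\<exists>W \<sigma>. openin M W \<and> p \<in> W \<and> (\<forall>q\<in>W. \<sigma> q \<in> P q) \<and>
       (\<forall>c\<in>\<B>. continuous_map (subtopology M (W \<inter> fst c)) euclidean (\<lambda>q. \<sigma> q c))"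
  proof (intro exI[of _ "fst c"] exI[of _ s] conjI ballI)
    show "openin M (fst c)" "p \<in> fst c" using chart(1)[OF c(1)] c by auto
    show "s q \<in> P q" if "q \<in> fst c" for q using s that by blast
    fix d assume d: "d \<in> \<B>"
    define Z where "Z = fst c \<inter> fst d"
    have oZ: "openin M Z" unfolding Z_def using chart(1)[OF c(1)] chart(1)[OF d] by (rule openin_Int)
    have Zt: "topspace (subtopology M Z) = Z" using openin_subset[OF oZ] by auto
    have "continuous_map (subtopology M Z) euclidean (\<lambda>q. s q d)"
      unfolding continuous_map_def Zt
    proof (intro conjI allI impI)
      show "(\<lambda>q. s q d) \<in> Z \<rightarrow> topspace euclidean" by simp
      fix T :: "(real ^ 'n option) set" assume "openin euclidean T"
      then have T: "open T" by simp
      have "openin M {q \<in> Z. s q d \<in> T}"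
      proof (subst openin_subopen, intro ballI)
        fix q assume q: "q \<in> {q \<in> Z. s q d \<in> T}"
        then have qcd: "q \<in> fst c" "q \<in> fst d" by (auto simp: Z_def)
        \<comment> \<open>In another chart \<open>d\<close> the section is multiplied by the lifted
          transition, which is constant on \<open>W\<close>.\<close>
        obtain W where W: "openin M W" "q \<in> W" "W \<subseteq> fst c \<inter> fst d" "\<And>r. r \<in> W \<Longrightarrow> g c d r = g c d q"
          using g_local[OF c(1) d qcd] by metis
        define T' where "T' = {x \<in> \<Omega>. g c d q *v X x \<in> T}"
        have "continuous_on \<Omega> (\<lambda>x. g c d q *v X x)"
          by (rule continuous_on_compose2[OF matrix_vector_mult_linear_continuous_on X(3)]) auto
        then have "open (\<Omega> \<inter> (\<lambda>x. g c d q *v X x) -` T)" using \<Omega>_open T by (rule continuous_open_preimage)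
        then have "open T'" by (simp add: T'_def vimage_def Int_def)
        then have "openin M {r \<in> fst c. snd c r \<in> T'}" by (rule chart_preimage[OF c(1)])
        then have "openin M (W \<inter> {r \<in> fst c. snd c r \<in> T'})" using W(1) by (intro openin_Int)
        moreover have sd: "s r d = g c d q *v X (snd c r)" if "r \<in> W" for r
          using W(3) W(4)[OF that] that d by (auto simp: s_def taut_elem_def)
        then have "q \<in> W \<inter> {r \<in> fst c. snd c r \<in> T'}" using W(2) q qcd chart_\<Omega>[OF c(1) qcd(1)] sd[OF W(2)] by (simp add: T'_def)
        moreover have "W \<inter> {r \<in> fst c. snd c r \<in> T'} \<subseteq> {q \<in> Z. s q d \<in> T}"
          using W(3) sd by (auto simp: T'_def Z_def)
        ultimately show "\<exists>S. openin M S \<and> q \<in> S \<and> S \<subseteq> {q \<in> Z. s q d \<in> T}" by blast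
      qed
      then show "openin (subtopology M Z) {q \<in> Z. s q d \<in> T}"
        unfolding openin_open_subtopology[OF oZ] by auto
    qed
    then show "continuous_map (subtopology M (fst c \<inter> fst d)) euclidean (\<lambda>q. s q d)" by (simp add: Z_def)
  qed
qed

text \<open>\<open>a\<close> reads off the height over the slice. As \<open>D\<close> is bounded,
  the norm of a vector in \<open>C\<close> is at most a constant times its height.\<close>

lemma dual_bound:
  obtains a \<rho> where "\<rho> > 0" "\<And>x. x \<in> C \<Longrightarrow> a \<bullet> x \<ge> \<rho> * norm x"
proof -
  have "compact (closure D)" using D(3) by (simp add: compact_closure)
  then have "compact ((\<lambda>t. B *v hom_vec t) ` closure D)"
    by (intro compact_continuous_image continuous_on_compose2[OF matrix_vector_mult_linear_continuous_on continuous_on_hom_vec]) auto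
  then have "bounded ((\<lambda>t. B *v hom_vec t) ` closure D)" by (rule compact_imp_bounded)
  then obtain R where R: "R > 0" "\<And>x. x \<in> (\<lambda>t. B *v hom_vec t) ` closure D \<Longrightarrow> norm x \<le> R"
    using bounded_pos by metis
  define a where "a = transpose (matrix_inv B) *v (axis None 1 :: real ^ 'n option)"
  have a: "a \<bullet> x = (matrix_inv B *v x) $ None" for x
  proof -
    have "a \<bullet> x = axis None 1 \<bullet> (matrix_inv B *v x)" unfolding a_def by (simp add: dot_lmul_matrix)
    then show ?thesis by (simp add: inner_axis')
  qed
  have "a \<bullet> x \<ge> (1 / R) * norm x" if x: "x \<in> C" for x
  proof -
    obtain s t where st: "s > 0" "t \<in> D" "x = s *\<^sub>R (B *v hom_vec t)" using x by (auto simp: C_def pcone_def)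
    have "norm (B *v hom_vec t) \<le> R" using R(2) st closure_subset by blast
    then have "norm x \<le> s * R" using st by (simp add: mult_left_mono)
    moreover have "a \<bullet> x = s" unfolding a st(3) matrix_vector_mult_scaleR det_inv_matrix(4)[OF detB] by simp
    ultimately show ?thesis using R(1) by (simp add: field_simps)
  qed
  then show ?thesis using that[of "1 / R" a] R(1) by simp
qed

end

locale quotient_cone = quotient_data M \<A> \<Gamma> B D \<Omega> f
  for M :: "'a topology" and \<A> :: "('a, 'n::finite) atlas" and \<Gamma> B D \<Omega> f +
  fixes a :: "real ^ 'n option" and \<rho> :: real
  assumes \<rho>_pos: "\<rho> > 0" and a_bound: "\<And>x. x \<in> C \<Longrightarrow> a \<bullet> x \<ge> \<rho> * norm x"
begin

sublocale dual_cone_vec C a \<rho> "real CARD('n option)"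
  by unfold_locales (fact C_props(1), fact C_props(3), fact \<rho>_pos, fact a_bound, rule refl)

text \<open>The odd extension to the negative cone and the origin: a section of the dual bundle must
  be linear on whole lines, not just on half-lines.\<close>

definition U1 where "U1 x = (if x \<in> C then U0 x else if - x \<in> C then - U0 (- x) else 0)"

lemma U1_scale: assumes x: "x \<in> C" shows "U1 (r *\<^sub>R x) = r * U0 x"
proof -
  consider "r > 0" | "r = 0" | "r < 0" by linarith
  then show ?thesis
  proof cases
    case 1
    then show ?thesis using is_pconeD[OF C_props(3) x 1] U0_scale[OF x 1] by (simp add: U1_def)
  next
    case 2
    then show ?thesis using C_props(4) by (simp add: U1_def)
  next
    case 3
    have "r *\<^sub>R x \<notin> C" using C_pos[OF x, of r] 3 by auto
    moreover have "(- r) *\<^sub>R x \<in> C" using 3 by (intro is_pconeD[OF C_props(3) x]) simp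
    moreover have "U0 ((- r) *\<^sub>R x) = (- r) * U0 x" using 3 by (intro U0_scale[OF x]) simp
    ultimately show ?thesis unfolding U1_def by simp
  qed
qed

text \<open>Evaluated in an arbitrary chart; \<open>u_eval\<close> removes the choice, since the
  lifts are unimodular automorphisms of \<open>C\<close>.\<close>

definition u where "u p w = U1 (w (SOME c. c \<in> \<B> \<and> p \<in> fst c))"

lemma chart_line:
  assumes c: "c \<in> \<B>" "p \<in> fst c" obtains x where "x \<in> C" "snd c p = proj_pt x"
    "\<And>y. y \<in> line_of (snd c p) \<Longrightarrow> \<exists>r. y = r *\<^sub>R x"
proof -
  obtain x where x: "x \<in> C" "proj_pt x = snd c p" using C_rep[OF chart_\<Omega>[OF c]] by blast
  then show ?thesis using that[of x] mem_line_proj_pt[OF C_nz[OF x(1)]] by simp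
qed

lemma u_eval:
  assumes w: "w \<in> fibre p" and c: "c \<in> \<B>" "p \<in> fst c" shows "u p w = U1 (w c)"
proof -
  define d where "d = (SOME c. c \<in> \<B> \<and> p \<in> fst c)"
  have "d \<in> \<B> \<and> p \<in> fst d" unfolding d_def by (rule someI[of _ c]) (use c in simp)
  then have d: "d \<in> \<B>" "p \<in> fst d" by auto
  have A: "g c d p \<in> Gh" using g_Gh c d by blast
  obtain x where x: "x \<in> C" "\<And>y. y \<in> line_of (snd c p) \<Longrightarrow> \<exists>r. y = r *\<^sub>R x" using chart_line[OF c] by metis
  obtain r where r: "w c = r *\<^sub>R x" using x(2)[OF fibreD(1)[OF w c]] by blast
  have "w d = r *\<^sub>R (g c d p *v x)" using fibreD(2)[OF w c(1) d(1) c(2) d(2)] r by (simp add: matrix_vector_mult_scaleR)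
  then have "U1 (w d) = r * U0 (g c d p *v x)" using U1_scale[OF Gh_C[OF A x(1)]] by simp
  also have "U0 (g c d p *v x) = U0 x" using A by (intro U0_invariant) (auto simp: Gh_def SLpm_def)
  finally show ?thesis using U1_scale[OF x(1)] r by (simp add: u_def d_def)
qed

lemma fibre_comb:
  assumes "w \<in> fibre p" "w' \<in> fibre p" shows "(\<lambda>c. r *\<^sub>R w c + s *\<^sub>R w' c) \<in> fibre p"
  unfolding taut_fibre_def
proof (intro CollectI conjI ballI impI allI)
  fix c assume "c \<in> \<B>" "p \<in> fst c"
  then show "r *\<^sub>R w c + s *\<^sub>R w' c \<in> line_of (snd c p)"
    by (intro subspace_add subspace_scale line_of_subspace(1) fibreD(1)[OF assms(1)] fibreD(1)[OF assms(2)])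
next
  fix c c' assume c: "c \<in> \<B>" "c' \<in> \<B>" "p \<in> fst c \<inter> fst c'"
  then show "r *\<^sub>R w c' + s *\<^sub>R w' c' = g c c' p *v (r *\<^sub>R w c + s *\<^sub>R w' c)"
    using fibreD(2)[OF assms(1), of c c'] fibreD(2)[OF assms(2), of c c']
    by (simp add: matrix_vector_mult_scaleR matrix_vector_right_distrib)
next
  fix c assume "c \<notin> \<B> \<or> p \<notin> fst c"
  then show "r *\<^sub>R w c + s *\<^sub>R w' c = 0" using fibreD(3)[OF assms(1), of c] fibreD(3)[OF assms(2), of c] by simp
qed

lemma coord_dom_open: "c \<in> \<B> \<Longrightarrow> det B' \<noteq> 0 \<Longrightarrow> open (coord_dom c B')"
  using open_vimage[OF chart(2), of c "affine_pt B'"] continuous_on_affine_pt[of B' UNIV]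
  by (simp add: coord_dom_def vimage_def)

lemma coord_vec:
  assumes c: "c \<in> \<B>" and B': "det B' \<noteq> 0" and t: "t \<in> coord_dom c B'"
  shows "coord_pt c B' t \<in> fst c" "snd c (coord_pt c B' t) = proj_pt (B' *v hom_vec t)"
    "coord_frame \<B> g c B' t \<in> fibre (coord_pt c B' t)" "coord_frame \<B> g c B' t c = B' *v hom_vec t"
    "local_rep \<B> g u c B' t = U1 (B' *v hom_vec t)" "B' *v hom_vec t \<in> C \<or> - (B' *v hom_vec t) \<in> C"
proof -
  define x where "x = B' *v hom_vec t"
  have x0: "x \<noteq> 0" unfolding x_def by (rule B_hom_vec_nz[OF B'])
  have xd: "x \<in> dom c" using t x0 by (simp add: dom_def coord_dom_def affine_pt_def x_def)
  have cp: "coord_pt c B' t = pt c x" by (simp add: coord_pt_def pt_def affine_pt_def x_def)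
  show 1: "coord_pt c B' t \<in> fst c" "snd c (coord_pt c B' t) = proj_pt (B' *v hom_vec t)"
    using pt_in[OF xd] cp by (simp_all add: x_def)
  have "x \<in> line_of (snd c (coord_pt c B' t))" using mem_own_line[OF x0] 1(2) by (simp add: x_def)
  then show 2: "coord_frame \<B> g c B' t \<in> fibre (coord_pt c B' t)"
    unfolding coord_frame_def x_def[symmetric] by (rule elem_fibre[OF c 1(1)])
  show 3: "coord_frame \<B> g c B' t c = B' *v hom_vec t"
    unfolding coord_frame_def by (rule elem_self[OF c 1(1)])
  show "local_rep \<B> g u c B' t = U1 (B' *v hom_vec t)"
    unfolding local_rep_def using u_eval[OF 2 c 1(1)] 3 by simp
  obtain z where "z \<in> C" using C_ex by blast
  then show "B' *v hom_vec t \<in> C \<or> - (B' *v hom_vec t) \<in> C"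
    using C_line[of z x] x0 chart_\<Omega>[OF c 1(1)] 1(2) by (simp add: x_def)
qed

text \<open>Smoothness is demanded in all unimodular coordinates, where the frame
  \<open>(t, 1)\<close> may point into \<open>C\<close> or into its negative. These two open regions
  cover the coordinate domain and are treated separately.\<close>

lemma section_smooth:
  assumes c: "c \<in> \<B>" and B': "B' \<in> SLpm" shows "smooth_on (coord_dom c B') (local_rep \<B> g u c B')"
proof -
  note nz = SLpm_nz[OF B']
  interpret plus: dual_cone_chart C a \<rho> "real CARD('n option)" B' by unfold_locales
  \<comment> \<open>Negating the matrix moves the frame of the second region into \<open>C\<close>,
    where \<open>U0\<close> is known to be smooth.\<close>
  interpret minus: dual_cone_chart C a \<rho> "real CARD('n option)" "mat (-1) ** B'" by unfold_locales
  have my: "minus.y t = - (B' *v hom_vec t)" for t by (simp add: minus.y_def scaled_matrix)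
  note op = coord_dom_open[OF c nz] plus.S_open minus.S_open
  have "smooth_on (coord_dom c B' \<inter> plus.S) (\<lambda>t. 1 * U0 (plus.y t))"
    using plus.U0_smooth[of 1] by (rule smooth_on_subset) auto
  then have 1: "smooth_on (coord_dom c B' \<inter> plus.S) (local_rep \<B> g u c B')"
    by (rule smooth_on_cong[rotated 2])
      (use op coord_vec(5)[OF c nz] in \<open>auto simp: plus.S_def plus.y_def U1_def\<close>)
  have "smooth_on (coord_dom c B' \<inter> minus.S) (\<lambda>t. (-1) * U0 (minus.y t))"
    using minus.U0_smooth[of "-1"] by (rule smooth_on_subset) auto
  then have 2: "smooth_on (coord_dom c B' \<inter> minus.S) (local_rep \<B> g u c B')"
  proof (rule smooth_on_cong[rotated 2])
    fix t assume t: "t \<in> coord_dom c B' \<inter> minus.S"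
    then have m: "- (B' *v hom_vec t) \<in> C" by (simp add: minus.S_def my)
    then have "U1 (B' *v hom_vec t) = (-1) * U0 (- (B' *v hom_vec t))" using U1_scale[OF m, of "-1"] by simp
    then show "(-1) * U0 (minus.y t) = local_rep \<B> g u c B' t" using coord_vec(5)[OF c nz] t my by simp
  qed (use op in auto)
  have "coord_dom c B' = (coord_dom c B' \<inter> plus.S) \<union> (coord_dom c B' \<inter> minus.S)"
    using coord_vec(6)[OF c nz] by (auto simp: plus.S_def plus.y_def minus.S_def my)
  then show ?thesis using smooth_on_Un[OF _ _ 1 2] op by (metis open_Int)
qed

lemma section_dual: "dual_section M \<B> g u"
  unfolding dual_section_def
proof (intro conjI ballI allI section_smooth)
  fix p w w' and r s :: real assume p: "p \<in> topspace M" and w: "w \<in> fibre p" "w' \<in> fibre p"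
  obtain c where c: "c \<in> \<B>" "p \<in> fst c" using topspace_charts[OF p] by blast
  obtain x where x: "x \<in> C" "\<And>y. y \<in> line_of (snd c p) \<Longrightarrow> \<exists>r. y = r *\<^sub>R x" using chart_line[OF c] by metis
  obtain \<alpha> \<beta> where ab: "w c = \<alpha> *\<^sub>R x" "w' c = \<beta> *\<^sub>R x"
    using x(2)[OF fibreD(1)[OF w(1) c]] x(2)[OF fibreD(1)[OF w(2) c]] by blast
  have "u p (\<lambda>c. r *\<^sub>R w c + s *\<^sub>R w' c) = U1 ((r * \<alpha> + s * \<beta>) *\<^sub>R x)"
    using u_eval[OF fibre_comb[OF w] c] ab by (simp add: scaleR_add_left)
  then show "u p (\<lambda>c. r *\<^sub>R w c + s *\<^sub>R w' c) = r * u p w + s * u p w'"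
    unfolding u_eval[OF w(1) c] u_eval[OF w(2) c] ab U1_scale[OF x(1)] by (simp only: distrib_right mult.assoc)
qed

lemma section_negative: "negative_section M P u"
  unfolding negative_section_def
proof (intro ballI)
  fix p w assume "p \<in> topspace M" "w \<in> P p"
  then obtain c where c: "c \<in> \<B>" "p \<in> fst c" "w c \<in> C" "w \<in> fibre p" by (auto simp: P_def)
  then show "u p w < 0" using u_eval[OF c(4,1,2)] U0_neg[OF c(3)] by (simp add: U1_def)
qed

text \<open>The coordinates of the slice itself are used: there the frame lies in \<open>C\<close>
  and the local representative is \<open>U0\<close> along the slice.\<close>

lemma section_hessian: "hessian_positive M \<B> g P u"
  unfolding hessian_positive_def
proof
  fix p assume p: "p \<in> topspace M"
  obtain c where c: "c \<in> \<B>" "p \<in> fst c" using topspace_charts[OF p] by blast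
  interpret std: dual_cone_chart C a \<rho> "real CARD('n option)" B by unfold_locales
  define T where "T = coord_dom c B \<inter> std.S"
  have oT: "open T" unfolding T_def using coord_dom_open[OF c(1) detB] std.S_open by auto
  obtain t0 where t0: "t0 \<in> D" "snd c p = affine_pt B t0" using chart_\<Omega>[OF c] \<Omega> by auto
  have "B *v hom_vec t0 \<in> C" unfolding C_def using t0(1) subset_pcone[of "(\<lambda>t. B *v hom_vec t) ` D"] by blast
  moreover have "t0 \<in> coord_dom c B" using t0(2) c(2) unfolding coord_dom_def by (metis (mono_tags) imageI mem_Collect_eq)
  ultimately have "t0 \<in> T" by (simp add: T_def std.S_def std.y_def)
  moreover have "coord_pt c B t0 = p"
    unfolding coord_pt_def t0(2)[symmetric] using chart_inj[OF c(1)] c(2) by (rule inv_into_f_f)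
  ultimately have pT: "p \<in> coord_pt c B ` T" by blast
  have fr: "coord_frame \<B> g c B t \<in> P (coord_pt c B t)" if t: "t \<in> T" for t
  proof -
    have td: "t \<in> coord_dom c B" "B *v hom_vec t \<in> C" using t by (auto simp: T_def std.S_def std.y_def)
    note cv = coord_vec[OF c(1) detB td(1)]
    show ?thesis using P_iff[OF cv(3) c(1) cv(1)] cv(4) td(2) by simp
  qed
  have loc: "local_rep \<B> g u c B t = U0 (std.y t)" if t: "t \<in> T" for t
    using coord_vec(5)[OF c(1) detB, of t] t by (simp add: T_def std.S_def std.y_def U1_def)
  have pd: "positive_definite (hessian (local_rep \<B> g u c B) t)" if t: "t \<in> T" for t
  proof -
    have "partial j (local_rep \<B> g u c B) s = partial j (\<lambda>t. U0 (std.y t)) s" if "s \<in> T" for j s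
      by (rule partial_cong_open[OF oT that loc])
    then have "partial i (partial j (local_rep \<B> g u c B)) t = partial i (partial j (\<lambda>t. U0 (std.y t))) t" for i j
      by (intro partial_cong_open[OF oT t])
    then have "hessian (local_rep \<B> g u c B) t = hessian (\<lambda>t. U0 (std.y t)) t" by (simp add: hessian_def)
    then show ?thesis using std.U0_positive_definite[of t] t detB by (simp add: T_def)
  qed
  show "\<exists>c\<in>\<B>. \<exists>B\<in>SLpm. \<exists>T. open T \<and> T \<subseteq> coord_dom c B \<and> p \<in> coord_pt c B ` T \<and>
        (\<forall>t\<in>T. coord_frame \<B> g c B t \<in> P (coord_pt c B t) \<and> positive_definite (hessian (local_rep \<B> g u c B) t))"
    using c(1) B oT pT fr pd by (intro bexI[of _ c] bexI[of _ B] exI[of _ T]) (auto simp: T_def)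
qed

end

theorem section_of_convex_quotient:
  fixes M :: "'a topology" and \<A> :: "('a, 'n::finite) atlas"
  assumes M: "proj_flat_manifold M \<A>" and \<Omega>: "bounded_convex_domain \<Omega>" and \<Gamma>: "discrete_subgroup_PGL \<Gamma>"
    and act: "acts_properly_discontinuously \<Gamma> \<Omega>" and eq: "proj_equivalent M \<A> (orbit_space \<Omega> \<Gamma>) (orbit_atlas \<Omega> \<Gamma>)"
  shows "\<exists>\<B> g P u. same_structure M \<A> \<B> \<and> transition_lift M \<B> g \<and> taut_orientation M \<B> g P \<and>
        dual_section M \<B> g u \<and> negative_section M P u \<and> hessian_positive M \<B> g P u"
proof -
  obtain B0 D where B0: "det B0 \<noteq> 0" "open D" "convex D" "bounded D" "D \<noteq> {}" "\<Omega> = affine_pt B0 ` D"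
    using \<Omega> unfolding bounded_convex_domain_def by blast
  obtain r where r: "r > 0" "mat r ** B0 \<in> SLpm" using normalize_SLpm[OF B0(1)] by blast
  \<comment> \<open>Rescaling the matrix does not move the affine coordinates, so it can be
    normalized to \<open>SLpm\<close> for the same \<open>D\<close>.\<close>
  have "affine_pt (mat r ** B0) t = affine_pt B0 t" for t
    using r(1) by (simp add: affine_pt_def scaled_matrix proj_pt_scale)
  then have \<Omega>B: "\<Omega> = affine_pt (mat r ** B0) ` D" using B0(6) by simp
  obtain f where f: "homeomorphic_map M (orbit_space \<Omega> \<Gamma>) f"
    "\<forall>c\<in>\<A>. \<forall>d\<in>orbit_atlas \<Omega> \<Gamma>. \<forall>p \<in> fst c. f p \<in> fst d \<longrightarrow>
           (\<exists>\<gamma> \<in> PGL. \<exists>W. openin M W \<and> p \<in> W \<and> W \<subseteq> fst c \<and> f ` W \<subseteq> fst d \<and>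
              (\<forall>q\<in>W. snd d (f q) = \<gamma> (snd c q)))"
    using eq unfolding proj_equivalent_def by blast
  interpret qd: quotient_data M \<A> \<Gamma> "mat r ** B0" D \<Omega> f
  proof
    show "\<Gamma> \<subseteq> PGL" "id \<in> \<Gamma>" "\<And>\<gamma> \<delta>. \<gamma> \<in> \<Gamma> \<Longrightarrow> \<delta> \<in> \<Gamma> \<Longrightarrow> \<gamma> \<circ> \<delta> \<in> \<Gamma>" "\<And>\<gamma>. \<gamma> \<in> \<Gamma> \<Longrightarrow> inv \<gamma> \<in> \<Gamma>"
      using \<Gamma> unfolding discrete_subgroup_PGL_def by blast+
  qed (fact M r(2) B0(2) B0(3) B0(4) B0(5) \<Omega>B act f(1) | use f(2) in blast)+
  obtain a \<rho> where a: "\<rho> > 0" "\<And>x. x \<in> qd.C \<Longrightarrow> a \<bullet> x \<ge> \<rho> * norm x" using qd.dual_bound by blast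
  interpret qc: quotient_cone M \<A> \<Gamma> "mat r ** B0" D \<Omega> f a \<rho>
    by unfold_locales (fact a)+
  show ?thesis
    using qd.same qd.lift qd.orientation qc.section_dual qc.section_negative qc.section_hessian by blast
qed

theorem theorem1:
  fixes M :: "'a topology" and \<A> :: "('a, 'n::finite) atlas"
  assumes "proj_flat_manifold M \<A>"
    and "compact_space M" and "connected_space M" and "topspace M \<noteq> {}"
  shows
    "(\<exists>\<B> g P u. same_structure M \<A> \<B> \<and> transition_lift M \<B> g \<and> taut_orientation M \<B> g P \<and>
        dual_section M \<B> g u \<and> negative_section M P u \<and> hessian_positive M \<B> g P u)
     \<longleftrightarrow>
     (\<exists>(\<Omega> :: 'n rp set) \<Gamma>. bounded_convex_domain \<Omega> \<and> discrete_subgroup_PGL \<Gamma> \<and>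
        acts_properly_discontinuously \<Gamma> \<Omega> \<and>
        proj_equivalent M \<A> (orbit_space \<Omega> \<Gamma>) (orbit_atlas \<Omega> \<Gamma>))"
  using convex_quotient_of_section[OF _ _ _ _ _ _ assms(2-4)] section_of_convex_quotient[OF assms(1)] by blast

end
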